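(* Let $\tilde P$ be a generalized gamma NRMI with parameters $\gamma\in(0,1)$, $\tau>0$ and finite non-atomic measure $\alpha$ on $\mathbb{X}$; put $a=\alpha(\mathbb{X})>0$, $P_0=\alpha/a$ and $\beta=a\tau^\gamma>0$. Let $g:\mathbb{X}\to\mathbb{R}$ be measurable with $\int_{\mathbb{X}}(\tau+t|g(x)|)^\gamma\alpha(dx)<\infty$ for any $t>0$. Let $\mathbf{X}=(X_1,\dots,X_n)$, $n\ge1$, be conditionally i.i.d. from $\tilde P$ given $\tilde P$, with distinct values $X^*_1,\dots,X^*_{n(\boldsymbol\pi)}$ of multiplicities $n_1,\dots,n_{n(\boldsymbol\pi)}$. Then the posterior density function of $\tilde P(g)=\int g\,d\tilde P$, given $\mathbf{X}$, is of the form $$\rho^{\mathbf{X}}(\sigma;g)=\begin{cases}\displaystyle\int_0^\infty \mathrm{Re}\{\chi_g(t,\sigma)\}\,dt, & n=1,\\[2mm] \displaystyle(-1)^{p+1}\int_{-\infty}^\sigma\int_0^\infty [(\sigma-z)t]^{n-1}\,\mathrm{Im}\{\chi_g(t,z)\}\,dt\,dz, & n=2p,\\[2mm] \displaystyle(-1)^{p}\int_{-\infty}^\sigma\int_0^\infty [(\sigma-z)t]^{n-1}\,\mathrm{Re}\{\chi_g(t,z)\}\,dt\,dz, & n=2p+1,\end{cases}$$ where $p\ge1$ is an integer and $$\chi_g(t,z)=\frac{\gamma\beta^{n(\boldsymbol\pi)}\,e^{-\beta\int_{\mathbb{X}}(1-it(g(x)-z))^\gamma P_0(dx)}\prod_{j=1}^{n(\boldsymbol\pi)}[1-it(g(X_j^*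 )-z)]^{\gamma-n_j}}{\pi\sum_{j=0}^{n-1}\binom{n-1}{j}(-1)^j\beta^{j/\gamma}\,\Gamma(n(\boldsymbol\pi)-j/\gamma;\beta)}.$$ Moreover, the posterior cumulative distribution function of $\tilde P(g)$, given $\mathbf{X}$, can be written as $$\mathbb{F}^{\mathbf{X}}(\sigma;g)=\frac12-\frac{\int_0^\infty\int_0^\infty t^{-1}u^{n-1}\,\mathrm{Im}\Big\{e^{-\beta\int_{\mathbb{X}}(1+u-it(g(x)-\sigma))^\gamma P_0(dx)}\prod_{j=1}^{n(\boldsymbol\pi)}[1+u-it(g(X_j^* )-\sigma)]^{\gamma-n_j}\Big\}\,du\,dt}{\pi\,(\gamma\beta^{n(\boldsymbol\pi)})^{-1}\sum_{j=0}^{n-1}\binom{n-1}{j}(-1)^j\beta^{j/\gamma}\,\Gamma(n(\boldsymbol\pi)-j/\gamma;\beta)}.$$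
   Context: $\mathbb{X}$ is a Polish space with its Borel $\sigma$-field. The generalized gamma completely random measure $\tilde\mu$ on $\mathbb{X}$ is the random measure with independent values on disjoint measurable sets and Laplace functional $\mathbb{E}[e^{-\int f\,d\tilde\mu}]=\exp\{-\int_{\mathbb{R}^+\times\mathbb{X}}(1-e^{-vf(x)})\,\nu(dv,dx)\}$ for $f\ge0$ with finite exponent, with intensity $\nu(dv,dx)=\frac{\gamma}{\Gamma(1-\gamma)}\frac{e^{-\tau v}}{v^{1+\gamma}}\,dv\,\alpha(dx)$ on $(0,\infty)\times\mathbb{X}$. The generalized gamma NRMI (normalized random measure with independent increments) is $\tilde P=\tilde\mu/\tilde\mu(\mathbb{X})$. The condition on $g$ is equivalent to $\tilde P(|g|)<\infty$ a.s. $\Gamma(c;x)=\int_x^\infty w^{c-1}e^{-w}\,dw$ ($x>0$, $c\in\mathbb{R}$) is the (upper) incomplete gamma function. Complex powers use the principal branch. "Posterior" refers to a regular conditional distribution given $\mathbf{X}$.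
   Formalization: For n≥2 the displayed double integral is the posterior CDF, and is proved as such; the density has (n-1)(σ-z)^{n-2}t^{n-1} in place of [(σ-z)t]^{n-1}. The density claim excludes g α-a.e. constant (no density exists); the CDF formula excludes σ with g=σ α-a.e. (it gives 1/2, not 1). *)

theory Defs
  imports "HOL-Probability.Probability"
begin

definition random_measure :: "'w measure \<Rightarrow> ('w \<Rightarrow> 'x::topological_space measure) \<Rightarrow> bool" where
  "random_measure M \<mu> \<longleftrightarrow>
     (\<forall>\<omega>\<in>space M. sets (\<mu> \<omega>) = sets borel) \<and>
     (\<forall>A\<in>sets borel. (\<lambda>\<omega>. emeasure (\<mu> \<omega>) A) \<in> borel_measurable M)"

definition exp_neg :: "ennreal \<Rightarrow> real" where
  "exp_neg y = (if y = \<infinity> then 0 else exp (- enn2real y))"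

definition laplace_exponent :: "(real \<times> 'x) measure \<Rightarrow> ('x \<Rightarrow> real) \<Rightarrow> ennreal" where
  "laplace_exponent \<nu> f = (\<integral>\<^sup>+(v, x). ennreal (1 - exp (- (v * f x))) \<partial>\<nu>)"

definition completely_random_measure ::
  "'w measure \<Rightarrow> ('w \<Rightarrow> 'x::topological_space measure) \<Rightarrow> (real \<times> 'x) measure \<Rightarrow> bool" where
  "completely_random_measure M \<mu> \<nu> \<longleftrightarrow>
     random_measure M \<mu> \<and>
     (\<forall>\<A>. finite \<A> \<longrightarrow> \<A> \<subseteq> sets borel \<longrightarrow> disjoint \<A> \<longrightarrow>
        prob_space.indep_vars M (\<lambda>_. borel) (\<lambda>A \<omega>. emeasure (\<mu> \<omega>) A) \<A>) \<and>
     (\<forall>f\<in>borel_measurable borel. (\<forall>x. 0 \<le> f x) \<longrightarrow> laplace_exponent \<nu> f < \<infinity> \<longrightarrow>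
        (\<integral>\<omega>. exp_neg (\<integral>\<^sup>+x. ennreal (f x) \<partial>\<mu> \<omega>) \<partial>M) = exp_neg (laplace_exponent \<nu> f))"

definition gg_intensity :: "real \<Rightarrow> real \<Rightarrow> 'x measure \<Rightarrow> (real \<times> 'x) measure" where
  "gg_intensity \<gamma> \<tau> \<alpha> =
     density (lborel \<Otimes>\<^sub>M \<alpha>)
       (\<lambda>(v, x). if 0 < v
          then ennreal (\<gamma> / Gamma (1 - \<gamma>) * (exp (- \<tau> * v) / v powr (1 + \<gamma>))) else 0)"

text \<open>If the total mass is \<open>0\<close> or \<open>\<infinity>\<close> (null events for the random
  measures considered), the result is the null measure; it is therefore always a subprobability measure.\<close>

definition normalize_measure :: "'x measure \<Rightarrow> 'x measure" where
  "normalize_measure m = scale_measure (inverse (emeasure m (space m))) m"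

definition nrmi :: "('w \<Rightarrow> 'x measure) \<Rightarrow> 'w \<Rightarrow> 'x measure" where
  "nrmi \<mu> \<omega> = normalize_measure (\<mu> \<omega>)"

definition cond_iid ::
  "'w measure \<Rightarrow> nat \<Rightarrow> (nat \<Rightarrow> 'w \<Rightarrow> 'x::topological_space) \<Rightarrow> ('w \<Rightarrow> 'x measure) \<Rightarrow> bool" where
  "cond_iid M n X P \<longleftrightarrow>
     (\<forall>i<n. X i \<in> borel_measurable M) \<and>
     (\<forall>A. (\<forall>i<n. A i \<in> sets borel) \<longrightarrow>
        (AE \<omega> in M.
           real_cond_exp M (vimage_algebra (space M) P (subprob_algebra borel))
             (indicator {\<omega>\<in>space M. \<forall>i<n. X i \<omega> \<in> A i}) \<omega>
           = (\<Prod>i<n. measure (P \<omega>) (A i))))"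

definition regular_cond_distr ::
  "'w measure \<Rightarrow> ('w \<Rightarrow> 'a) \<Rightarrow> 'a measure \<Rightarrow> ('w \<Rightarrow> 'b) \<Rightarrow> 'b measure \<Rightarrow> ('a \<Rightarrow> 'b measure) \<Rightarrow> bool"
where
  "regular_cond_distr M X S Y T \<kappa> \<longleftrightarrow>
     \<kappa> \<in> S \<rightarrow>\<^sub>M prob_algebra T \<and>
     (\<forall>B\<in>sets T. AE \<omega> in M.
        real_cond_exp M (vimage_algebra (space M) X S) (indicator {\<omega>\<in>space M. Y \<omega> \<in> B}) \<omega>
        = measure (\<kappa> (X \<omega>)) B)"

text \<open>Upper incomplete gamma function \<open>\<Gamma>(c; x)\<close>, for \<open>x > 0\<close> and real \<open>c\<close>.\<close>

definition upper_Gamma :: "real \<Rightarrow> real \<Rightarrow> real" where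
  "upper_Gamma c x = (LBINT w:{x<..}. w powr (c - 1) * exp (- w))"

text \<open>A sample \<open>(x\<^sub>1,\<dots>,x\<^sub>n)\<close> is a function on \<open>{..<n}\<close>.  Products over the distinct values
  \<open>x\<^sup>*\<^sub>j\<close> are taken over the set of values, so that no enumeration has to be chosen.\<close>

definition distinct_values :: "nat \<Rightarrow> (nat \<Rightarrow> 'x) \<Rightarrow> 'x set" where
  "distinct_values n xs = xs ` {..<n}"

definition n_distinct :: "nat \<Rightarrow> (nat \<Rightarrow> 'x) \<Rightarrow> nat" where
  "n_distinct n xs = card (distinct_values n xs)"

definition frequency :: "nat \<Rightarrow> (nat \<Rightarrow> 'x) \<Rightarrow> 'x \<Rightarrow> nat" where
  "frequency n xs y = card {i. i < n \<and> xs i = y}"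

definition gg_norm_sum :: "real \<Rightarrow> real \<Rightarrow> nat \<Rightarrow> nat \<Rightarrow> real" where
  "gg_norm_sum \<gamma> \<beta> n k =
     (\<Sum>j=0..n-1. real ((n - 1) choose j) * (- 1) ^ j * \<beta> powr (real j / \<gamma>) *
        upper_Gamma (real k - real j / \<gamma>) \<beta>)"

text \<open>\<open>gg_kernel \<dots> u t z\<close> is
  \<open>e\<^bsup>-\<beta>\<integral>(1+u-it(g-z))\<^sup>\<gamma> dP\<^sub>0\<^esup> \<Prod>\<^sub>j [1+u-it(g(x\<^sup>*\<^sub>j)-z)]\<^bsup>\<gamma>-n\<^sub>j\<^esup>\<close>.\<close>

definition gg_kernel ::
  "real \<Rightarrow> real \<Rightarrow> 'x measure \<Rightarrow> ('x \<Rightarrow> real) \<Rightarrow> nat \<Rightarrow> (nat \<Rightarrow> 'x) \<Rightarrow> real \<Rightarrow> real \<Rightarrow> real \<Rightarrow> complex"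
where
  "gg_kernel \<gamma> \<beta> P0 g n xs u t z =
     exp (- of_real \<beta> * (\<integral>x. (1 + of_real u - \<i> * of_real (t * (g x - z))) powr of_real \<gamma> \<partial>P0)) *
     (\<Prod>y\<in>distinct_values n xs.
        (1 + of_real u - \<i> * of_real (t * (g y - z))) powr of_real (\<gamma> - real (frequency n xs y)))"

definition gg_chi ::
  "real \<Rightarrow> real \<Rightarrow> 'x measure \<Rightarrow> ('x \<Rightarrow> real) \<Rightarrow> nat \<Rightarrow> (nat \<Rightarrow> 'x) \<Rightarrow> real \<Rightarrow> real \<Rightarrow> complex"
where
  "gg_chi \<gamma> \<beta> P0 g n xs t z =
     of_real (\<gamma> * \<beta> ^ n_distinct n xs) * gg_kernel \<gamma> \<beta> P0 g n xs 0 t z /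
     of_real (pi * gg_norm_sum \<gamma> \<beta> n (n_distinct n xs))"

text \<open>For \<open>n \<ge> 2\<close> the double integral
  \<open>\<plusminus> \<integral>\<^bsub>-\<infinity>\<^esub>\<^bsup>\<sigma>\<^esup> \<integral>\<^sub>0\<^bsup>\<infinity>\<^esup> [(\<sigma>-z)t]\<^bsup>n-1\<^esup> Im/Re \<chi>(t,z) dt dz\<close>
  with kernel exponent \<open>n - 1\<close> in both factors is the cumulative distribution function, not the
  density: under \<open>g \<mapsto> c g\<close>, \<open>\<sigma> \<mapsto> c \<sigma>\<close> with \<open>c > 0\<close> it is invariant, whereas a density is multiplied
  by \<open>1/c\<close>.  The inner integral of \<open>t\<^bsup>n-1\<^esup> Im/Re \<chi>(t,z)\<close> is, up to sign, \<open>1/(n-1)!\<close> times the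
  \<open>(n-1)\<close>-st derivative of the posterior density at \<open>z\<close>, so the density is obtained by
  differentiating the double integral once in \<open>\<sigma>\<close>, i.e. by replacing \<open>(\<sigma>-z)\<^bsup>n-1\<^esup>\<close> by
  \<open>(n-1)(\<sigma>-z)\<^bsup>n-2\<^esup>\<close>.  Both functions are defined here.\<close>

definition gg_double_integral ::
  "real \<Rightarrow> real \<Rightarrow> 'x measure \<Rightarrow> ('x \<Rightarrow> real) \<Rightarrow> nat \<Rightarrow> (nat \<Rightarrow> 'x) \<Rightarrow> real \<Rightarrow> real"
where
  "gg_double_integral \<gamma> \<beta> P0 g n xs \<sigma> =
     (let p = n div 2 in
      if even n then
        (- 1) ^ (p + 1) * (LBINT z:{..\<sigma>}. LBINT t:{0<..}.
          ((\<sigma> - z) * t) ^ (n - 1) * Im (gg_chi \<gamma> \<beta> P0 g n xs t z))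
      else
        (- 1) ^ p * (LBINT z:{..\<sigma>}. LBINT t:{0<..}.
          ((\<sigma> - z) * t) ^ (n - 1) * Re (gg_chi \<gamma> \<beta> P0 g n xs t z)))"

definition gg_post_density ::
  "real \<Rightarrow> real \<Rightarrow> 'x measure \<Rightarrow> ('x \<Rightarrow> real) \<Rightarrow> nat \<Rightarrow> (nat \<Rightarrow> 'x) \<Rightarrow> real \<Rightarrow> real"
where
  "gg_post_density \<gamma> \<beta> P0 g n xs \<sigma> =
     (let p = n div 2 in
      if n = 1 then
        (LBINT t:{0<..}. Re (gg_chi \<gamma> \<beta> P0 g n xs t \<sigma>))
      else if even n then
        (- 1) ^ (p + 1) * (LBINT z:{..\<sigma>}. LBINT t:{0<..}.
          real (n - 1) * (\<sigma> - z) ^ (n - 2) * t ^ (n - 1) * Im (gg_chi \<gamma> \<beta> P0 g n xs t z))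
      else
        (- 1) ^ p * (LBINT z:{..\<sigma>}. LBINT t:{0<..}.
          real (n - 1) * (\<sigma> - z) ^ (n - 2) * t ^ (n - 1) * Re (gg_chi \<gamma> \<beta> P0 g n xs t z)))"

definition gg_post_cdf ::
  "real \<Rightarrow> real \<Rightarrow> 'x measure \<Rightarrow> ('x \<Rightarrow> real) \<Rightarrow> nat \<Rightarrow> (nat \<Rightarrow> 'x) \<Rightarrow> real \<Rightarrow> real"
where
  "gg_post_cdf \<gamma> \<beta> P0 g n xs \<sigma> =
     1 / 2 -
     (LBINT t:{0<..}. LBINT u:{0<..}. inverse t * u ^ (n - 1) * Im (gg_kernel \<gamma> \<beta> P0 g n xs u t \<sigma>)) /
     (pi * inverse (\<gamma> * \<beta> ^ n_distinct n xs) * gg_norm_sum \<gamma> \<beta> n (n_distinct n xs))"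

end

theory Submission
  imports Defs "HOL-Complex_Analysis.Complex_Analysis"
begin

text \<open>Write \<open>S\<close> for \<open>\<tau>\<close> times the total mass. For \<open>f \<ge> 0\<close> the Laplace functional reads
  \<open>E exp (- S * P(f)) = exp (- \<beta> * P0((1 + f)\<^sup>\<gamma> - 1))\<close>. It extends to complex \<open>f\<close> with \<open>Re f \<ge> 0\<close> by analytic
  continuation, and differentiating it in the directions \<open>1\<^sub>A\<close> gives a Palm formula: it expresses
  \<open>E (S\<^sup>n * P(A\<^sub>1) \<dots> P(A\<^sub>n) * exp (- S * P(f)))\<close> as an integral over samples with respect to a Polya urn
  measure. Integrating against \<open>u\<^bsup>n-1\<^esup>\<close> for \<open>f = u - i * t * (g - z)\<close> removes the factor \<open>S\<^sup>n\<close> and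
  yields the conditional characteristic function of \<open>Y = S * P(g - z)\<close> given the sample. Since
  \<open>P(g) \<le> z\<close> if and only if \<open>Y \<le> 0\<close>, inversion at the single point \<open>0\<close> (by means of the sine integral) is the
  formula for the distribution function. Its derivative in \<open>z\<close> is the density. For \<open>n \<ge> 2\<close> that derivative
  still contains an integral over \<open>u\<close>, which a quarter turn of the path of integration transforms
  into the integral over \<open>z \<le> \<sigma>\<close>.\<close>

section \<open>Differentiation under the integral sign and complex powers\<close>

text \<open>Only the moment of order \<open>\<gamma> < 1\<close> of \<open>g\<close> is finite, so
  no first-order expansion in \<open>t\<close> exists and every estimate is of Hoelder order
  \<open>\<gamma>\<close>. For small \<open>t\<close> the imaginary part of the kernel is of order
  \<open>t powr \<gamma>\<close>, because the kernel is real at \<open>t = 0\<close>; this makes the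
  factor \<open>1 / t\<close> of the inversion harmless. For large \<open>t\<close> the kernel is
  dominated by \<open>exp (- b * t powr \<gamma> * D z)\<close>, where \<open>D z\<close> is the
  integral of \<open>\<bar>g x - z\<bar> powr \<gamma>\<close>. Hence everything hinges on
  \<open>D z > 0\<close>, that is, on \<open>g\<close> not being almost everywhere equal to
  \<open>z\<close>. At an exceptional \<open>z\<close> the law of \<open>P(g)\<close> is a point
  mass at \<open>z\<close>, and for almost every sample the inversion formula would return
  \<open>1 / 2\<close>, the middle of the jump, instead of the value \<open>1\<close> of the
  distribution function; this is why such points are excluded. The regular conditional distribution
  is not postulated: for non-constant \<open>g\<close> it is built from the inversion formula
  itself, whose monotonicity and limits are known only for almost every sample.\<close>

lemma has_field_derivative_integral:
  fixes f :: "'k::{real_normed_field,banach,second_countable_topology} \<Rightarrow> 'a \<Rightarrow> 'k"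
  assumes r: "r > 0"
    and deriv: "\<And>z x. z \<in> ball z0 r \<Longrightarrow> x \<in> space M \<Longrightarrow> ((\<lambda>z. f z x) has_field_derivative f' z x) (at z)"
    and int: "\<And>z. z \<in> ball z0 r \<Longrightarrow> integrable M (f z)"
    and meas: "f' z0 \<in> borel_measurable M"
    and bound: "\<And>z x. z \<in> ball z0 r \<Longrightarrow> x \<in> space M \<Longrightarrow> norm (f' z x) \<le> B x"
    and B: "integrable M B"
  shows "((\<lambda>z. \<integral>x. f z x \<partial>M) has_field_derivative (\<integral>x. f' z0 x \<partial>M)) (at z0)"
proof -
  have z0: "z0 \<in> ball z0 r" using r by simp
  \<comment> \<open>By the mean value inequality on the ball, \<open>B\<close> dominates the
    difference quotients and not only the derivative, which is what dominated convergence asks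
    for.\<close>
  have lip: "norm (f z x - f z0 x) \<le> B x * norm (z - z0)"
    if "z \<in> ball z0 r" "x \<in> space M" for z x
    using that z0 deriv bound
    by (intro field_differentiable_bound[of "ball z0 r" "\<lambda>z. f z x" "\<lambda>z. f' z x"])
       (auto intro: has_field_derivative_at_within)
  show ?thesis
    unfolding has_field_derivative_iff
  proof (subst tendsto_at_iff_sequentially, intro allI impI)
    fix X :: "nat \<Rightarrow> 'k"
    assume X: "\<forall>i. X i \<in> UNIV - {z0}" and lim: "X \<longlonglongrightarrow> z0"
    have ev: "\<forall>\<^sub>F i in sequentially. X i \<in> ball z0 r"
      using topological_tendstoD[OF lim, of "ball z0 r"] z0 by auto
    then obtain N where N: "\<And>i. i \<ge> N \<Longrightarrow> X i \<in> ball z0 r"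
      by (auto simp: eventually_sequentially)
    \<comment> \<open>Dropping the first \<open>N\<close> terms puts the whole sequence into the
      ball without changing the limit.\<close>
    define Y where "Y i = X (i + N)" for i
    have Y: "Y i \<in> ball z0 r" "Y i \<noteq> z0" for i using N X by (auto simp: Y_def)
    have Ylim: "Y \<longlonglongrightarrow> z0" unfolding Y_def using lim by (rule LIMSEQ_ignore_initial_segment)
    have "(\<lambda>i. \<integral>x. (f (Y i) x - f z0 x) / (Y i - z0) \<partial>M) \<longlonglongrightarrow> (\<integral>x. f' z0 x \<partial>M)"
    proof (rule integral_dominated_convergence[where w = B])
      show "f' z0 \<in> borel_measurable M" by (rule meas)
      show "(\<lambda>x. (f (Y i) x - f z0 x) / (Y i - z0)) \<in> borel_measurable M" for i
        using int[OF Y(1)] int[OF z0]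
        by (intro borel_measurable_divide borel_measurable_diff) auto
      show "integrable M B" by (rule B)
      show "AE x in M. (\<lambda>i. (f (Y i) x - f z0 x) / (Y i - z0)) \<longlonglongrightarrow> f' z0 x"
      proof (rule AE_I2)
        fix x assume x: "x \<in> space M"
        have "((\<lambda>z. (f z x - f z0 x) / (z - z0)) \<longlongrightarrow> f' z0 x) (at z0)"
          using deriv[OF z0 x] by (simp add: has_field_derivative_iff)
        then show "(\<lambda>i. (f (Y i) x - f z0 x) / (Y i - z0)) \<longlonglongrightarrow> f' z0 x"
          using Y(2) Ylim unfolding tendsto_at_iff_sequentially comp_def by auto
      qed
      show "AE x in M. norm ((f (Y i) x - f z0 x) / (Y i - z0)) \<le> B x" for i
      proof (rule AE_I2)
        fix x assume x: "x \<in> space M"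
        show "norm ((f (Y i) x - f z0 x) / (Y i - z0)) \<le> B x"
          using lip[OF Y(1)[of i] x] Y(2)[of i] by (simp add: norm_divide field_simps)
      qed
    qed
    moreover have "(\<integral>x. (f (Y i) x - f z0 x) / (Y i - z0) \<partial>M)
        = ((\<integral>x. f (Y i) x \<partial>M) - (\<integral>x. f z0 x \<partial>M)) / (Y i - z0)" for i
      by (subst integral_divide_zero, subst Bochner_Integration.integral_diff[OF int[OF Y(1)] int[OF z0]], rule refl)
    ultimately have "(\<lambda>i. ((\<integral>x. f (Y i) x \<partial>M) - (\<integral>x. f z0 x \<partial>M)) / (Y i - z0)) \<longlonglongrightarrow> (\<integral>x. f' z0 x \<partial>M)"
      by (simp only:)
    then show "((\<lambda>y. ((\<integral>x. f y x \<partial>M) - (\<integral>x. f z0 x \<partial>M)) / (y - z0)) \<circ> X) \<longlonglongrightarrow> (\<integral>x. f' z0 x \<partial>M)"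
      unfolding Y_def comp_def by (rule LIMSEQ_offset)
  qed
qed

lemma integrable_deriv_bound:
  fixes f :: "'a \<Rightarrow> 'b::{banach,second_countable_topology}"
  assumes "integrable M B" "f \<in> borel_measurable M" "\<And>x. x \<in> space M \<Longrightarrow> norm (f x) \<le> B x"
  shows "integrable M f"
  by (rule Bochner_Integration.integrable_bound[OF assms(1,2)]) (use assms(3) in \<open>force intro: order_trans[OF _ abs_ge_self]\<close>)

section \<open>Powers with real exponent in the right half-plane\<close>

lemma norm_powr_of_real:
  fixes z :: complex
  shows "norm (z powr of_real r) = norm z powr r"
  by (simp add: powr_def)

text \<open>The argument of \<open>z\<close> is less than \<open>pi / 2\<close> in modulus, so that
  of the power is less than \<open>\<gamma> * pi / 2\<close>, where the cosine stays positive
  because \<open>\<gamma> < 1\<close>. All exponential decay of the kernels comes from this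
  inequality; its constant is later called \<open>cg\<close>.\<close>

lemma Re_powr_ge:
  fixes z :: complex
  assumes "Re z > 0" "0 < \<gamma>" "\<gamma> < 1"
  shows "Re (z powr of_real \<gamma>) \<ge> cos (\<gamma> * pi / 2) * norm z powr \<gamma>"
proof -
  have z: "z \<noteq> 0" using assms by auto
  have "Re (z powr of_real \<gamma>) = norm z powr \<gamma> * cos (\<gamma> * Im (Ln z))"
    using z by (simp add: powr_def Re_exp)
  moreover have "\<bar>\<gamma> * Im (Ln z)\<bar> \<le> \<gamma> * pi / 2"
  proof -
    have "\<bar>Im (Ln z)\<bar> < pi / 2" using assms z Re_Ln_pos_lt by blast
    then show ?thesis using assms by (simp add: abs_mult)
  qed
  then have "cos (\<gamma> * pi / 2) \<le> cos \<bar>\<gamma> * Im (Ln z)\<bar>"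
    using assms by (intro cos_monotone_0_pi_le) (auto simp: field_simps)
  ultimately show ?thesis by (metis abs_norm_cancel cos_abs_real mult.commute mult_left_mono powr_ge_zero)
qed

lemma norm_exp_diff_le:
  fixes a b :: complex
  assumes "Re a \<le> m" "Re b \<le> m"
  shows "norm (exp a - exp b) \<le> exp m * norm (a - b)"
proof -
  have "convex {z. Re z \<le> m}" by (rule convex_halfspace_Re_le)
  then show ?thesis
    by (rule field_differentiable_bound[where f' = exp])
       (use assms in \<open>auto intro!: derivative_eq_intros\<close>)
qed

text \<open>If \<open>a - b\<close> is comparable in size to the larger of the two points, the
  triangle inequality suffices. Otherwise the segment between them keeps at least the distance
  \<open>norm (a - b)\<close> from the branch point, and integrating the derivative along it gives
  the same order.\<close>

lemma norm_powr_diff_le: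
  fixes a b :: complex
  assumes "Re a > 0" "Re b > 0" "0 < \<gamma>" "\<gamma> < 1"
  shows "norm (a powr of_real \<gamma> - b powr of_real \<gamma>) \<le> 4 * norm (a - b) powr \<gamma>"
proof -
  have main: "norm (a powr of_real \<gamma> - b powr of_real \<gamma>) \<le> 4 * norm (a - b) powr \<gamma>"
    if a: "Re a > 0" and b: "Re b > 0" and le: "norm b \<le> norm a" for a b :: complex
  proof (cases "norm a \<le> 2 * norm (a - b)")
    case True
    have 0: "a \<noteq> 0" "b \<noteq> 0" using a b by auto
    have "norm (a powr of_real \<gamma> - b powr of_real \<gamma>) \<le> norm a powr \<gamma> + norm b powr \<gamma>"
      using norm_triangle_ineq4[of "a powr of_real \<gamma>" "b powr of_real \<gamma>"] 0
      by (simp add: norm_powr_of_real)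
    also have "\<dots> \<le> 2 * (2 * norm (a - b)) powr \<gamma>"
      using powr_mono2[of \<gamma> "norm a" "2 * norm (a - b)"] powr_mono2[of \<gamma> "norm b" "2 * norm (a - b)"]
        True le assms by simp
    also have "\<dots> = 2 * 2 powr \<gamma> * norm (a - b) powr \<gamma>" by (simp add: powr_mult)
    also have "\<dots> \<le> 4 * norm (a - b) powr \<gamma>"
      using powr_mono[of \<gamma> 1 2] assms by (intro mult_right_mono) auto
    finally show ?thesis .
  next
    case False
    define d where "d = norm (a - b)"
    show ?thesis
    proof (cases "d = 0")
      case True then show ?thesis by (simp add: d_def)
    next
      case d0: False
      then have d: "d > 0" by (simp add: d_def)
      have seg: "Re z > 0 \<and> norm z \<ge> d" if "z \<in> closed_segment a b" for z
      proof
        have "closed_segment a b \<subseteq> {z. Re z > 0}"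
          using a b by (intro closed_segment_subset convex_halfspace_Re_gt) auto
        with that show "Re z > 0" by auto
        have "norm (a - z) \<le> d" using that unfolding d_def
          using dist_in_closed_segment[of z a b] by (simp add: dist_norm norm_minus_commute)
        then show "norm z \<ge> d" using False norm_triangle_ineq3[of a z] by (simp add: d_def)
      qed
      have "norm (a powr of_real \<gamma> - b powr of_real \<gamma>) \<le> (\<gamma> * d powr (\<gamma> - 1)) * norm (a - b)"
      proof (rule field_differentiable_bound[of "closed_segment a b" _ "\<lambda>z. of_real \<gamma> * z powr (of_real \<gamma> - 1)"])
        fix z assume z: "z \<in> closed_segment a b"
        have z': "z \<notin> \<real>\<^sub>\<le>\<^sub>0" "z \<noteq> 0" using seg[OF z] by (auto simp: complex_nonpos_Reals_iff)
        show "((\<lambda>z. z powr of_real \<gamma>) has_field_derivative of_real \<gamma> * z powr (of_real \<gamma> - 1)) (at z within closed_segment a b)"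
          using z' by (auto intro: has_field_derivative_at_within[OF has_field_derivative_powr])
        have "norm (z powr of_real (\<gamma> - 1)) = norm z powr (\<gamma> - 1)"
          using z' norm_powr_of_real by blast
        also have "\<dots> \<le> d powr (\<gamma> - 1)"
          using seg[OF z] d assms by (intro powr_mono2') auto
        finally show "norm (of_real \<gamma> * z powr (of_real \<gamma> - 1)) \<le> \<gamma> * d powr (\<gamma> - 1)"
          using assms by (simp add: norm_mult)
      qed auto
      also have "\<dots> = \<gamma> * d powr \<gamma>"
        using d by (simp add: d_def[symmetric] powr_diff)
      also have "\<dots> \<le> 4 * d powr \<gamma>" using assms by (intro mult_right_mono) auto
      finally show ?thesis by (simp add: d_def)
    qed
  qed
  show ?thesis
    using main[of a b] main[of b a] assms by (cases "norm b \<le> norm a") (auto simp: norm_minus_commute)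
qed

text \<open>On this half-plane the function is bounded and Lipschitz. Both facts are weakened to
  order \<open>\<gamma>\<close>, so that the estimate has the same shape as
  \<open>norm_powr_diff_le\<close> and the two can be added in \<open>ker_diff_le\<close>.\<close>

lemma norm_powr_neg_diff_le:
  fixes a b :: complex
  assumes "Re a \<ge> 1" "Re b \<ge> 1" "e \<le> 0" "0 < \<gamma>" "\<gamma> < 1"
  shows "norm (a powr of_real e - b powr of_real e) \<le> (2 + \<bar>e\<bar>) * norm (a - b) powr \<gamma>"
proof -
  have n1: "norm z \<ge> 1" if "Re z \<ge> 1" for z :: complex
    using that complex_Re_le_cmod[of z] by linarith
  have le1: "norm (z powr of_real e') \<le> 1" if "Re z \<ge> 1" "e' \<le> 0" for z and e' :: real
  proof -
    have "norm (z powr of_real e') = norm z powr e'"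
      by (rule norm_powr_of_real)
    also have "\<dots> \<le> norm z powr 0" using n1[of z] that by (intro powr_mono) auto
    finally show ?thesis using n1[of z] that by (auto split: if_splits)
  qed
  show ?thesis
  proof (cases "norm (a - b) \<le> 1")
    case True
    have "norm (a powr of_real e - b powr of_real e) \<le> \<bar>e\<bar> * norm (a - b)"
    proof (rule field_differentiable_bound[of "{z. Re z \<ge> 1}" _ "\<lambda>z. of_real e * z powr (of_real e - 1)"])
      fix z :: complex assume z: "z \<in> {z. Re z \<ge> 1}"
      then have z': "z \<notin> \<real>\<^sub>\<le>\<^sub>0" by (auto simp: complex_nonpos_Reals_iff)
      show "((\<lambda>z. z powr of_real e) has_field_derivative of_real e * z powr (of_real e - 1)) (at z within {z. Re z \<ge> 1})"
        using z' by (auto intro: has_field_derivative_at_within[OF has_field_derivative_powr])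
      show "norm (of_real e * z powr (of_real e - 1)) \<le> \<bar>e\<bar>"
        using le1[of z "e - 1"] z assms mult_left_le[of "norm (z powr (of_real e - 1))" "\<bar>e\<bar>"] by (simp add: norm_mult)
    qed (use assms in \<open>auto intro: convex_halfspace_Re_ge\<close>)
    also have "norm (a - b) \<le> norm (a - b) powr \<gamma>"
      using powr_mono'[of \<gamma> 1 "norm (a - b)"] True assms by (cases "a = b") auto
    then have "\<bar>e\<bar> * norm (a - b) \<le> \<bar>e\<bar> * norm (a - b) powr \<gamma>" by (intro mult_left_mono) auto
    also have "\<dots> \<le> (2 + \<bar>e\<bar>) * norm (a - b) powr \<gamma>" by (intro mult_right_mono) auto
    finally show ?thesis .
  next
    case False
    have "norm (a powr of_real e - b powr of_real e) \<le> 2"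
      using norm_triangle_ineq4[of "a powr of_real e" "b powr of_real e"] le1[of a e] le1[of b e] assms
      by simp
    also have "\<dots> \<le> (2 + \<bar>e\<bar>) * 1" by simp
    also have "\<dots> \<le> (2 + \<bar>e\<bar>) * norm (a - b) powr \<gamma>"
      using False assms by (intro mult_left_mono ge_one_powr_ge_zero) auto
    finally show ?thesis .
  qed
qed

text \<open>The sum is at most twice the larger term, and \<open>2 powr \<gamma> \<le> 2\<close>.
  This is the substitute for the triangle inequality that makes \<open>gint\<close> stable under
  sums.\<close>

lemma powr_add_le:
  fixes x y :: real
  assumes "0 \<le> x" "0 \<le> y" "0 < \<gamma>" "\<gamma> < 1"
  shows "(x + y) powr \<gamma> \<le> 2 * (x powr \<gamma> + y powr \<gamma>)"
proof -
  have *: "(x + y) powr \<gamma> \<le> 2 * (x powr \<gamma> + y powr \<gamma>)" if "0 \<le> x" "x \<le> y" for x y :: real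
  proof -
    have "(x + y) powr \<gamma> \<le> (2 * y) powr \<gamma>" using that assms by (intro powr_mono2) auto
    also have "\<dots> = 2 powr \<gamma> * y powr \<gamma>" by (simp add: powr_mult)
    also have "\<dots> \<le> 2 * y powr \<gamma>" using powr_mono[of \<gamma> 1 2] assms by (intro mult_right_mono) auto
    finally have "(x + y) powr \<gamma> \<le> 2 * y powr \<gamma>" .
    moreover have "0 \<le> x powr \<gamma>" by simp
    ultimately show ?thesis unfolding distrib_left by linarith
  qed
  show ?thesis using *[of x y] *[of y x] assms by (cases "x \<le> y") (auto simp: add.commute)
qed

section \<open>The Laplace functional at complex arguments\<close>

locale gg_base = prob_space P0
  for P0 :: "'x::polish_space measure" +
  fixes \<gamma> \<beta> :: real
  assumes sets_P0 [measurable_cong, simp]: "sets P0 = sets borel"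
    and gam: "0 < \<gamma>" "\<gamma> < 1"
    and beta: "0 < \<beta>"
    and nonatomic: "\<And>x. emeasure P0 {x} = 0"
begin

lemma space_P0 [simp]: "space P0 = UNIV"
  using sets_eq_imp_space_eq[OF sets_P0] by simp

lemma prob_UNIV [simp]: "prob UNIV = 1"
  using prob_space by simp

lemma borel_P0: "borel_measurable P0 = borel_measurable borel"
  by (rule measurable_cong_sets) auto

text \<open>For \<open>\<gamma> < 1\<close> this is a vector space of functions without a norm. It
  is the natural class here: its members are almost surely integrable with respect to the random
  \<open>P\<close> (\<open>X_integrable\<close>), and their Laplace exponent is finite.\<close>

definition gint :: "('x \<Rightarrow> complex) \<Rightarrow> bool" where
  "gint f \<longleftrightarrow> f \<in> borel_measurable borel \<and> integrable P0 (\<lambda>x. norm (f x) powr \<gamma>)"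

lemma gint_measurable: "gint f \<Longrightarrow> f \<in> borel_measurable borel"
  by (simp add: gint_def)

lemma gint_bound:
  assumes "f \<in> borel_measurable borel" "integrable P0 B" "\<And>x. norm (f x) powr \<gamma> \<le> B x"
  shows "gint f"
proof -
  have "integrable P0 (\<lambda>x. norm (f x) powr \<gamma>)"
    by (rule integrable_deriv_bound[OF assms(2)]) (use assms in \<open>auto simp: borel_P0\<close>)
  with assms show ?thesis by (simp add: gint_def)
qed

lemma gint_add: assumes "gint f" "gint g" shows "gint (\<lambda>x. f x + g x)"
proof (rule gint_bound)
  show "(\<lambda>x. f x + g x) \<in> borel_measurable borel"
    using assms by (auto simp: gint_def)
  show "integrable P0 (\<lambda>x. 2 * (norm (f x) powr \<gamma> + norm (g x) powr \<gamma>))"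
    using assms by (auto simp: gint_def)
  fix x
  have "norm (f x + g x) powr \<gamma> \<le> (norm (f x) + norm (g x)) powr \<gamma>"
    using gam by (intro powr_mono2 norm_triangle_ineq) auto
  also have "\<dots> \<le> 2 * (norm (f x) powr \<gamma> + norm (g x) powr \<gamma>)"
    using gam by (intro powr_add_le) auto
  finally show "norm (f x + g x) powr \<gamma> \<le> 2 * (norm (f x) powr \<gamma> + norm (g x) powr \<gamma>)" .
qed

lemma gint_cmult: assumes "gint f" shows "gint (\<lambda>x. c * f x)"
  using assms unfolding gint_def by (auto simp: norm_mult powr_mult)

lemma gint_bounded:
  assumes "f \<in> borel_measurable borel" "\<And>x. norm (f x) \<le> K"
  shows "gint f"
proof (rule gint_bound[OF assms(1)])
  show "norm (f x) powr \<gamma> \<le> K powr \<gamma>" for x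
    using assms(2)[of x] gam by (intro powr_mono2) auto
qed auto

lemma gint_const: "gint (\<lambda>_. c)"
  by (rule gint_bounded) auto

lemma gint_le:
  assumes "f \<in> borel_measurable borel" "gint g" "\<And>x. norm (f x) \<le> norm (g x)"
  shows "gint f"
  using assms gam by (intro gint_bound[of f "\<lambda>x. norm (g x) powr \<gamma>"] powr_mono2) (auto simp: gint_def)

lemma integrable_powr:
  assumes "gint f"
  shows "integrable P0 (\<lambda>x. f x powr of_real \<gamma>)"
  by (rule integrable_deriv_bound[of P0 "\<lambda>x. norm (f x) powr \<gamma>"])
     (use assms in \<open>auto simp: gint_def norm_powr_of_real borel_P0\<close>)

text \<open>The dominating function is left to the caller because \<open>q\<close> may be unbounded:
  in \<open>lap_step\<close> the decay of the power in the direction of \<open>q\<close> compensates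
  the growth of \<open>q\<close>, whereas for indicators and constants the version for bounded
  \<open>q\<close> is enough.\<close>

lemma powr_integral_deriv:
  assumes c: "gint c" and q: "gint q" and r: "r > 0"
    and pos: "\<And>z x. z \<in> ball z0 r \<Longrightarrow> Re (c x + z * q x) > 0"
    and bound: "\<And>z x. z \<in> ball z0 r \<Longrightarrow> norm (q x) * norm (c x + z * q x) powr (\<gamma> - 1) \<le> B x"
    and B: "integrable P0 B"
  shows "((\<lambda>z. \<integral>x. (c x + z * q x) powr of_real \<gamma> \<partial>P0) has_field_derivative
          (\<integral>x. of_real \<gamma> * q x * (c x + z0 * q x) powr of_real (\<gamma> - 1) \<partial>P0)) (at z0)"
proof (rule has_field_derivative_integral[OF r, where B = "\<lambda>x. \<gamma> * B x" and
    f' = "\<lambda>z x. of_real \<gamma> * q x * (c x + z * q x) powr of_real (\<gamma> - 1)"])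
  fix z x assume z: "z \<in> ball z0 r"
  have "c x + z * q x \<notin> \<real>\<^sub>\<le>\<^sub>0" using pos[OF z, of x] by (auto simp: complex_nonpos_Reals_iff)
  then show "((\<lambda>z. (c x + z * q x) powr of_real \<gamma>) has_field_derivative
      of_real \<gamma> * q x * (c x + z * q x) powr of_real (\<gamma> - 1)) (at z)"
    by (auto intro!: derivative_eq_intros)
  show "norm (of_real \<gamma> * q x * (c x + z * q x) powr of_real (\<gamma> - 1)) \<le> \<gamma> * B x"
    using bound[OF z, of x] gam unfolding norm_mult norm_powr_of_real by simp
next
  show "integrable P0 (\<lambda>x. (c x + z * q x) powr of_real \<gamma>)" for z
    by (intro integrable_powr gint_add gint_cmult c q)
  show "(\<lambda>x. of_real \<gamma> * q x * (c x + z0 * q x) powr of_real (\<gamma> - 1)) \<in> borel_measurable P0"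
    using gint_measurable[OF c] gint_measurable[OF q] unfolding borel_P0 by measurable
qed (use B in auto)

lemma powr_integral_deriv_bounded:
  assumes c: "gint c" and q: "gint q" and qb: "\<And>x. norm (q x) \<le> K" and \<delta>: "\<delta> > 0" and r: "r > 0"
    and pos: "\<And>z x. z \<in> ball z0 r \<Longrightarrow> Re (c x + z * q x) \<ge> \<delta>"
  shows "((\<lambda>z. \<integral>x. (c x + z * q x) powr of_real \<gamma> \<partial>P0) has_field_derivative
          (\<integral>x. of_real \<gamma> * q x * (c x + z0 * q x) powr of_real (\<gamma> - 1) \<partial>P0)) (at z0)"
proof (rule powr_integral_deriv[OF c q r, where B = "\<lambda>_. K * \<delta> powr (\<gamma> - 1)"])
  fix z x assume z: "z \<in> ball z0 r"
  show "Re (c x + z * q x) > 0" using pos[OF z, of x] \<delta> by linarith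
  have "norm (c x + z * q x) \<ge> \<delta>" using pos[OF z, of x] complex_Re_le_cmod[of "c x + z * q x"] by linarith
  then have "norm (c x + z * q x) powr (\<gamma> - 1) \<le> \<delta> powr (\<gamma> - 1)"
    using \<delta> gam by (intro powr_mono2') auto
  then show "norm (q x) * norm (c x + z * q x) powr (\<gamma> - 1) \<le> K * \<delta> powr (\<gamma> - 1)"
    using qb[of x] by (intro mult_mono) (auto intro: order_trans[OF norm_ge_zero])
qed auto

end

text \<open>\<open>S\<close> stands for \<open>\<tau>\<close> times the total mass of the random measure and \<open>P\<close> for its
  normalization; in this scaling only \<open>\<gamma>\<close> and \<open>\<beta>\<close> remain of the parameters.\<close>

locale gg_rand = gg_base P0 \<gamma> \<beta> + M: prob_space M
  for P0 :: "'x::polish_space measure" and \<gamma> \<beta> and M :: "'w measure" +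
  fixes S :: "'w \<Rightarrow> real" and P :: "'w \<Rightarrow> 'x measure"
  assumes S_meas [measurable]: "S \<in> borel_measurable M"
    and S_nonneg: "\<And>\<omega>. S \<omega> \<ge> 0"
    and S_pos: "AE \<omega> in M. S \<omega> > 0"
    and P_meas [measurable]: "P \<in> M \<rightarrow>\<^sub>M subprob_algebra borel"
    and P_prob: "AE \<omega> in M. prob_space (P \<omega>)"
    and real_integrable: "\<And>f. f \<in> borel_measurable borel \<Longrightarrow> (\<And>x. 0 \<le> f x) \<Longrightarrow> integrable P0 (\<lambda>x. f x powr \<gamma>) \<Longrightarrow>
          (AE \<omega> in M. integrable (P \<omega>) f)"
    and real_laplace: "\<And>f. f \<in> borel_measurable borel \<Longrightarrow> (\<And>x. 0 \<le> f x) \<Longrightarrow> integrable P0 (\<lambda>x. f x powr \<gamma>) \<Longrightarrow>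
          (\<integral>\<omega>. exp (- (S \<omega> * (\<integral>x. f x \<partial>P \<omega>))) \<partial>M) = exp (- \<beta> * (\<integral>x. (1 + f x) powr \<gamma> - 1 \<partial>P0))"
begin

lemma sets_P: "\<omega> \<in> space M \<Longrightarrow> sets (P \<omega>) = sets borel"
  by (metis P_meas sets_kernel)

lemma space_P: "\<omega> \<in> space M \<Longrightarrow> space (P \<omega>) = UNIV"
  using sets_eq_imp_space_eq[OF sets_P, of \<omega>] by simp

definition X :: "('x \<Rightarrow> complex) \<Rightarrow> 'w \<Rightarrow> complex" where
  "X f \<omega> = of_real (S \<omega>) * (\<integral>x. f x \<partial>P \<omega>)"

lemma integral_P_meas [measurable]:
  fixes f :: "'x \<Rightarrow> 'b::{banach,second_countable_topology}"
  shows "f \<in> borel_measurable borel \<Longrightarrow> (\<lambda>\<omega>. \<integral>x. f x \<partial>P \<omega>) \<in> borel_measurable M"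
  by (rule measurable_compose[OF P_meas integral_measurable_subprob_algebra])

lemma X_meas [measurable]: "f \<in> borel_measurable borel \<Longrightarrow> X f \<in> borel_measurable M"
  unfolding X_def by measurable

lemma X_integrable:
  assumes "gint f" shows "AE \<omega> in M. integrable (P \<omega>) f"
proof -
  have f [measurable]: "f \<in> borel_measurable borel" using assms by (rule gint_measurable)
  have "AE \<omega> in M. integrable (P \<omega>) (\<lambda>x. norm (f x))"
    using assms by (intro real_integrable) (auto simp: gint_def)
  then show ?thesis
  proof (rule AE_mp, intro AE_I2 impI)
    fix \<omega> assume "\<omega> \<in> space M" "integrable (P \<omega>) (\<lambda>x. norm (f x))"
    then show "integrable (P \<omega>) f"
      using measurable_cong_sets[OF sets_P[of \<omega>] refl] f
      by (subst (asm) integrable_norm_iff) auto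
  qed
qed

text \<open>This holds at every point and not only almost everywhere: where \<open>f\<close> is not
  integrable with respect to \<open>P \<omega>\<close>, the integral has the default value
  \<open>0\<close>.\<close>

lemma Re_X_nonneg:
  assumes "\<And>x. Re (f x) \<ge> 0"
  shows "Re (X f \<omega>) \<ge> 0"
proof (cases "integrable (P \<omega>) f")
  case True
  then have "Re (\<integral>x. f x \<partial>P \<omega>) = (\<integral>x. Re (f x) \<partial>P \<omega>)" by simp
  also have "\<dots> \<ge> 0" using assms by (intro Bochner_Integration.integral_nonneg) auto
  finally show ?thesis using S_nonneg by (simp add: X_def)
qed (simp add: X_def not_integrable_integral_eq)

lemma X_add: "gint f \<Longrightarrow> gint g \<Longrightarrow> AE \<omega> in M. X (\<lambda>x. f x + c * g x) \<omega> = X f \<omega> + c * X g \<omega>"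
  using X_integrable[of f] X_integrable[of g]
  by (auto simp: X_def algebra_simps)

lemma X_of_real: "X (\<lambda>x. of_real (f x)) \<omega> = of_real (S \<omega> * (\<integral>x. f x \<partial>P \<omega>))"
  unfolding X_def by simp

definition lap_ok :: "('x \<Rightarrow> complex) \<Rightarrow> bool" where
  "lap_ok f \<longleftrightarrow> (\<integral>\<omega>. exp (- X f \<omega>) \<partial>M) = exp (- of_real \<beta> * (\<integral>x. (1 + f x) powr of_real \<gamma> - 1 \<partial>P0))"

lemma lap_ok_real:
  assumes "f \<in> borel_measurable borel" "\<And>x. 0 \<le> f x" "integrable P0 (\<lambda>x. f x powr \<gamma>)"
  shows "lap_ok (\<lambda>x. of_real (f x))"
proof -
  have "(\<integral>\<omega>. exp (- X (\<lambda>x. of_real (f x)) \<omega>) \<partial>M) = (\<integral>\<omega>. of_real (exp (- (S \<omega> * (\<integral>x. f x \<partial>P \<omega>)))) \<partial>M)"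
    by (intro Bochner_Integration.integral_cong) (auto simp: X_of_real exp_of_real[symmetric])
  also have "\<dots> = of_real (exp (- \<beta> * (\<integral>x. (1 + f x) powr \<gamma> - 1 \<partial>P0)))"
    using real_laplace[OF assms] by simp
  also have "\<dots> = exp (- of_real \<beta> * (\<integral>x. of_real ((1 + f x) powr \<gamma> - 1) \<partial>P0))"
    by (subst integral_complex_of_real) (simp add: exp_of_real[symmetric])
  also have "(\<lambda>x. complex_of_real ((1 + f x) powr \<gamma> - 1)) = (\<lambda>x. (1 + of_real (f x)) powr of_real \<gamma> - 1)"
  proof
    fix x
    show "complex_of_real ((1 + f x) powr \<gamma> - 1) = (1 + of_real (f x)) powr of_real \<gamma> - 1"
      using assms(2)[of x] powr_of_real[of "1 + f x" \<gamma>] by simp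
  qed
  finally show ?thesis unfolding lap_ok_def .
qed

lemma X_nonneg_mult_exp:
  fixes x d :: real assumes "x \<ge> 0" "d > 0" shows "x * exp (- d * x) \<le> 1 / d"
proof -
  have "d * x \<le> exp (d * x)" using exp_ge_add_one_self[of "d * x"] by linarith
  then show ?thesis using assms by (simp add: exp_minus field_simps)
qed

lemma lap_rhs_diff:
  assumes "gint f"
  shows "(\<integral>x. (1 + f x) powr of_real \<gamma> - 1 \<partial>P0) = (\<integral>x. (1 + f x) powr of_real \<gamma> \<partial>P0) - 1"
  using integrable_powr[OF gint_add[OF gint_const[of 1] assms]]
  by (simp add: prob_space)

text \<open>Both sides are holomorphic in \<open>z\<close> on the open right half-plane and agree on
  the positive reals, hence everywhere by the identity theorem. Approaching from the right then
  extends the identity to the imaginary axis, which is where it is needed. One application makes one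
  coefficient complex.\<close>

lemma lap_step:
  assumes c: "gint c" "\<And>x. Re (c x) \<ge> 0"
    and q: "gint (\<lambda>x. of_real (q x))" "\<And>x. q x \<ge> (0::real)"
    and ok: "\<And>z. z > 0 \<Longrightarrow> lap_ok (\<lambda>x. c x + of_real z * of_real (q x))"
    and z: "Re z \<ge> 0"
  shows "lap_ok (\<lambda>x. c x + z * of_real (q x))"
proof -
  define Q where "Q \<omega> = S \<omega> * (\<integral>x. q x \<partial>P \<omega>)" for \<omega>
  have [measurable]: "c \<in> borel_measurable borel" using c(1) by (rule gint_measurable)
  have [measurable]: "q \<in> borel_measurable borel"
    using measurable_compose[OF gint_measurable[OF q(1)] borel_measurable_Re] by simp
  have [measurable]: "Q \<in> borel_measurable M" unfolding Q_def by measurable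
  have Q0: "Q \<omega> \<ge> 0" for \<omega>
    unfolding Q_def using q S_nonneg by (intro mult_nonneg_nonneg Bochner_Integration.integral_nonneg) auto
  have C0: "Re (X c \<omega>) \<ge> 0" for \<omega> using c Re_X_nonneg by blast
  have XQ: "X (\<lambda>x. of_real (q x)) \<omega> = of_real (Q \<omega>)" for \<omega> unfolding X_of_real Q_def ..
  let ?E = "\<lambda>z \<omega>. exp (- (X c \<omega> + z * of_real (Q \<omega>)))"
  define L where "L z = (\<integral>\<omega>. ?E z \<omega> \<partial>M)" for z
  define I where "I z = (\<integral>x. ((1 + c x) + z * of_real (q x)) powr of_real \<gamma> \<partial>P0)" for z
  define R where "R z = exp (- of_real \<beta> * (I z - 1))" for z
  have c1: "gint (\<lambda>x. 1 + c x)" by (intro gint_add gint_const c)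
  have iff: "lap_ok (\<lambda>x. c x + z * of_real (q x)) \<longleftrightarrow> L z = R z" for z
  proof -
    have "AE \<omega> in M. X (\<lambda>x. c x + z * of_real (q x)) \<omega> = X c \<omega> + z * of_real (Q \<omega>)"
      using X_add[OF c(1) q(1), of z] unfolding XQ .
    then have "(\<integral>\<omega>. exp (- X (\<lambda>x. c x + z * of_real (q x)) \<omega>) \<partial>M) = L z"
      unfolding L_def by (intro integral_cong_AE) auto
    then show ?thesis
      unfolding lap_ok_def R_def I_def lap_rhs_diff[OF gint_add[OF c(1) gint_cmult[OF q(1)]]]
      by (simp add: add.assoc)
  qed
  have bd: "norm (?E z \<omega>) \<le> exp (- Re z * Q \<omega>)" for z \<omega>
    using C0[of \<omega>] by simp
  have intL: "integrable M (\<lambda>\<omega>. ?E z \<omega>)" if "Re z \<ge> 0" for z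
  proof (rule M.integrable_const_bound[where B = 1])
    show "AE \<omega> in M. norm (?E z \<omega>) \<le> 1"
      using bd[of _ z] Q0 that by (intro AE_I2 order_trans[OF bd]) auto
  qed measurable
  have dL: "(L has_field_derivative (\<integral>\<omega>. - of_real (Q \<omega>) * ?E z \<omega> \<partial>M)) (at z)"
    if z: "Re z > 0" for z
    unfolding L_def
  proof (rule has_field_derivative_integral[where r = "Re z / 2" and B = "\<lambda>_. 2 / Re z" and
      f' = "\<lambda>z \<omega>. - of_real (Q \<omega>) * ?E z \<omega>"])
    show "Re z / 2 > 0" using z by simp
    fix w assume w: "w \<in> ball z (Re z / 2)"
    have "\<bar>Re (z - w)\<bar> \<le> norm (z - w)" by (rule abs_Re_le_cmod)
    with w have w': "Re w \<ge> Re z / 2" by (simp add: dist_norm)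
    show "integrable M (\<lambda>\<omega>. ?E w \<omega>)"
      using w' z by (intro intL) auto
    fix \<omega>
    show "((\<lambda>z. ?E z \<omega>) has_field_derivative
        - of_real (Q \<omega>) * ?E w \<omega>) (at w)"
      by (auto intro!: derivative_eq_intros)
    have "norm (- of_real (Q \<omega>) * ?E w \<omega>) \<le> Q \<omega> * exp (- Re w * Q \<omega>)"
      unfolding norm_mult using Q0[of \<omega>] by (intro mult_mono bd) auto
    also have "\<dots> \<le> Q \<omega> * exp (- (Re z / 2) * Q \<omega>)"
      using mult_right_mono[OF w' Q0[of \<omega>]] Q0[of \<omega>] by (intro mult_left_mono) auto
    also have "\<dots> \<le> 1 / (Re z / 2)" by (rule X_nonneg_mult_exp) (use Q0 z in auto)
    finally show "norm (- of_real (Q \<omega>) * ?E w \<omega>) \<le> 2 / Re z" by simp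
  qed auto
  have dI: "(I has_field_derivative (\<integral>x. of_real \<gamma> * of_real (q x) * ((1 + c x) + z * of_real (q x)) powr of_real (\<gamma> - 1) \<partial>P0)) (at z)"
    if z: "Re z > 0" for z
    unfolding I_def
  proof (rule powr_integral_deriv[OF c1 q(1), where r = "Re z / 2" and
        B = "\<lambda>x. (2 / Re z) * norm (1 + of_real (Re z / 2) * of_real (q x) :: complex) powr \<gamma>"])
    define d where "d = Re z / 2"
    have d: "d > 0" using z by (simp add: d_def)
    show "Re z / 2 > 0" using z by simp
    fix w x assume w: "w \<in> ball z (Re z / 2)"
    have "\<bar>Re (z - w)\<bar> \<le> norm (z - w)" by (rule abs_Re_le_cmod)
    with w have w': "Re w \<ge> d" by (simp add: dist_norm d_def)
    then have wq: "Re w * q x \<ge> d * q x" using q(2) by (intro mult_right_mono) auto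
    have qx: "q x \<ge> 0" "d * q x \<ge> 0" using q(2) d by auto
    show "0 < Re (1 + c x + w * of_real (q x))"
      using c(2)[of x] wq qx by simp
    have "1 + d * q x \<le> Re (1 + c x + w * of_real (q x))" using c(2)[of x] wq by simp
    also have "\<dots> \<le> norm (1 + c x + w * of_real (q x))" by (rule complex_Re_le_cmod)
    finally have "norm (1 + c x + w * of_real (q x)) powr (\<gamma> - 1) \<le> (1 + d * q x) powr (\<gamma> - 1)"
      using gam qx by (intro powr_mono2') auto
    then have "norm (complex_of_real (q x)) * norm (1 + c x + w * of_real (q x)) powr (\<gamma> - 1)
        \<le> q x * (1 + d * q x) powr (\<gamma> - 1)"
      using qx by (simp add: mult_left_mono)
    \<comment> \<open>The unbounded factor \<open>q x\<close> is absorbed by one full power of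
      \<open>1 + d * q x\<close>; the remaining power has exponent \<open>\<gamma>\<close> and is
      integrable.\<close>
    also have "\<dots> = q x * (1 + d * q x) powr \<gamma> / (1 + d * q x)" using qx by (simp add: powr_diff)
    also have "\<dots> = (q x / (1 + d * q x)) * (1 + d * q x) powr \<gamma>" by simp
    also have "\<dots> \<le> (1 / d) * (1 + d * q x) powr \<gamma>"
    proof (rule mult_right_mono)
      have "0 < 1 + d * q x" using qx by linarith
      then show "q x / (1 + d * q x) \<le> 1 / d" using d by (simp add: field_simps)
    qed simp
    also have "1 + d * q x = norm (1 + of_real d * of_real (q x) :: complex)"
    proof -
      have "norm (of_real (1 + d * q x) :: complex) = 1 + d * q x" using qx by (subst norm_of_real) auto
      then show ?thesis by simp
    qed
    finally show "norm (complex_of_real (q x)) * norm (1 + c x + w * of_real (q x)) powr (\<gamma> - 1)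
        \<le> (2 / Re z) * norm (1 + of_real (Re z / 2) * of_real (q x) :: complex) powr \<gamma>"
      by (simp add: d_def)
  next
    have "gint (\<lambda>x. 1 + of_real (Re z / 2) * of_real (q x))"
      by (intro gint_add gint_const gint_cmult q)
    then show "integrable P0 (\<lambda>x. (2 / Re z) * norm (1 + of_real (Re z / 2) * of_real (q x) :: complex) powr \<gamma>)"
      unfolding gint_def by auto
  qed
  have holL: "L holomorphic_on {z. Re z > 0}"
    using dL by (auto simp: holomorphic_on_open open_halfspace_Re_gt)
  have holI: "I holomorphic_on {z. Re z > 0}"
    using dI by (auto simp: holomorphic_on_open open_halfspace_Re_gt)
  have holR: "R holomorphic_on {z. Re z > 0}"
    unfolding R_def by (intro holomorphic_intros holI)
  have pos: "L z = R z" if "Re z > 0" for z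
  proof -
    have "L z - R z = 0"
    proof (rule analytic_continuation[of "\<lambda>z. L z - R z" "{z. Re z > 0}" "of_real ` {0<..}" 1])
      show "(\<lambda>z. L z - R z) holomorphic_on {z. Re z > 0}" by (intro holomorphic_intros holL holR)
      show "(1::complex) islimpt of_real ` {0<..}"
      proof (rule islimptI)
        fix T assume T: "(1::complex) \<in> T" "open T"
        then obtain e where e: "e > 0" "ball 1 e \<subseteq> T" by (auto simp: open_contains_ball)
        have "complex_of_real (1 + e / 2) \<in> ball 1 e"
          using e by (simp add: dist_norm norm_minus_commute)
        moreover have "complex_of_real (1 + e / 2) \<noteq> 1" using e by simp
        moreover have "complex_of_real (1 + e / 2) \<in> of_real ` {0<..}" using e by (intro imageI) auto
        ultimately show "\<exists>y\<in>of_real ` {0<..}. y \<in> T \<and> y \<noteq> 1" using e by blast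
      qed
      show "\<And>z. z \<in> of_real ` {0<..} \<Longrightarrow> L z - R z = 0"
        using ok iff by (auto simp del: of_real_mult)
    qed (use that in \<open>auto simp: open_halfspace_Re_gt convex_halfspace_Re_gt convex_connected\<close>)
    then show ?thesis by simp
  qed
  have "L z = R z"
  proof (rule LIMSEQ_unique)
    \<comment> \<open>These points have positive real part even if \<open>Re z = 0\<close>, so the
      identity already proved applies to them.\<close>
    define w where "w i = z + of_real (inverse (real (Suc i)))" for i
    have w: "Re (w i) > 0" for i using z by (simp add: w_def add_nonneg_pos)
    have wlim: "w \<longlonglongrightarrow> z"
      unfolding w_def using tendsto_add[OF tendsto_const tendsto_of_real[OF LIMSEQ_inverse_real_of_nat], of z]
      by simp
    show "(\<lambda>i. L (w i)) \<longlonglongrightarrow> L z"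
      unfolding L_def
    proof (rule integral_dominated_convergence[where w = "\<lambda>_. 1"])
      show "AE \<omega> in M. (\<lambda>i. ?E (w i) \<omega>) \<longlonglongrightarrow> ?E z \<omega>"
        by (intro AE_I2 tendsto_intros wlim)
      show "AE \<omega> in M. norm (?E (w i) \<omega>) \<le> 1" for i
        using Q0 w[of i] by (intro AE_I2 order_trans[OF bd]) auto
    qed auto
    have "(\<lambda>i. I (w i)) \<longlonglongrightarrow> I z"
      unfolding I_def
    proof (rule integral_dominated_convergence[where w = "\<lambda>x. (norm (1 + c x) + (norm z + 1) * q x) powr \<gamma>"])
      show "AE x in P0. (\<lambda>i. (1 + c x + w i * of_real (q x)) powr of_real \<gamma>) \<longlonglongrightarrow> (1 + c x + z * of_real (q x)) powr of_real \<gamma>"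
      proof (intro AE_I2)
        fix x have "Re (1 + c x + z * of_real (q x)) > 0"
          using c(2)[of x] q(2)[of x] z by (simp add: add_pos_nonneg)
        then have "1 + c x + z * of_real (q x) \<notin> \<real>\<^sub>\<le>\<^sub>0" by (auto simp: complex_nonpos_Reals_iff)
        moreover have "(\<lambda>i. 1 + c x + w i * of_real (q x)) \<longlonglongrightarrow> 1 + c x + z * of_real (q x)"
          by (intro tendsto_intros wlim)
        ultimately show "(\<lambda>i. (1 + c x + w i * of_real (q x)) powr of_real \<gamma>) \<longlonglongrightarrow> (1 + c x + z * of_real (q x)) powr of_real \<gamma>"
          by (intro tendsto_powr_complex tendsto_const)
      qed
      show "AE x in P0. norm ((1 + c x + w i * of_real (q x)) powr of_real \<gamma>) \<le> (norm (1 + c x) + (norm z + 1) * q x) powr \<gamma>" for i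
      proof (intro AE_I2)
        fix x
        have "norm (complex_of_real (inverse (real (Suc i)))) \<le> 1"
          unfolding norm_of_real by (simp add: divide_simps)
        then have "norm (w i) \<le> norm z + 1"
          unfolding w_def by (intro norm_triangle_le add_mono) auto
        then have "norm (1 + c x + w i * of_real (q x)) \<le> norm (1 + c x) + (norm z + 1) * q x"
          using norm_triangle_ineq[of "1 + c x" "w i * of_real (q x)"] mult_right_mono[of "norm (w i)" "norm z + 1" "q x"] q(2)[of x]
          by (simp add: norm_mult)
        then show "norm ((1 + c x + w i * of_real (q x)) powr of_real \<gamma>) \<le> (norm (1 + c x) + (norm z + 1) * q x) powr \<gamma>"
          unfolding norm_powr_of_real using gam by (intro powr_mono2) auto
      qed
      have "gint (\<lambda>x. of_real (norm (1 + c x)) + of_real (norm z + 1) * of_real (q x))"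
        using c1 by (intro gint_add gint_cmult q) (auto simp: gint_def)
      moreover have "norm (complex_of_real (norm (1 + c x)) + complex_of_real (norm z + 1) * complex_of_real (q x))
          = norm (1 + c x) + (norm z + 1) * q x" for x
        unfolding of_real_mult[symmetric] of_real_add[symmetric] norm_of_real using q(2)[of x] by simp
      ultimately show "integrable P0 (\<lambda>x. (norm (1 + c x) + (norm z + 1) * q x) powr \<gamma>)"
        unfolding gint_def by simp
    qed (auto simp: borel_P0)
    then have "(\<lambda>i. R (w i)) \<longlonglongrightarrow> R z" unfolding R_def by (intro tendsto_intros)
    then show "(\<lambda>i. L (w i)) \<longlonglongrightarrow> R z" using pos[OF w] by simp
  qed
  then show ?thesis using iff by blast
qed

theorem laplace_complex:
  assumes f: "gint f" "\<And>x. Re (f x) \<ge> 0"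
  shows "(\<integral>\<omega>. exp (- X f \<omega>) \<partial>M) = exp (- of_real \<beta> * (\<integral>x. (1 + f x) powr of_real \<gamma> - 1 \<partial>P0))"
proof -
  \<comment> \<open>\<open>lap_step\<close> handles a nonnegative direction only, so the imaginary
    part is split into its positive part \<open>a\<close> and negative part \<open>b\<close>. The
    coefficient of \<open>a\<close> is moved to \<open>\<i>\<close> while that of \<open>b\<close>
    stays real and positive; then that of \<open>b\<close> is moved to
    \<open>- \<i>\<close>.\<close>
  define p a b where "p x = Re (f x)" and "a x = max 0 (Im (f x))" and "b x = max 0 (- Im (f x))" for x
  have m [measurable]: "f \<in> borel_measurable borel" using f by (simp add: gint_def)
  have [measurable]: "p \<in> borel_measurable borel" "a \<in> borel_measurable borel" "b \<in> borel_measurable borel"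
    unfolding p_def a_def b_def by measurable
  have g: "gint (\<lambda>x. of_real (p x))" "gint (\<lambda>x. of_real (a x))" "gint (\<lambda>x. of_real (b x))"
  proof -
    have "\<bar>p x\<bar> \<le> norm (f x)" "\<bar>a x\<bar> \<le> norm (f x)" "\<bar>b x\<bar> \<le> norm (f x)" for x
      using abs_Re_le_cmod[of "f x"] abs_Im_le_cmod[of "f x"] by (auto simp: p_def a_def b_def max_def)
    then show "gint (\<lambda>x. of_real (p x))" "gint (\<lambda>x. of_real (a x))" "gint (\<lambda>x. of_real (b x))"
      by (auto intro!: gint_le[OF _ f(1)])
  qed
  have pos: "p x \<ge> 0" "a x \<ge> 0" "b x \<ge> 0" for x using f(2)[of x] by (auto simp: p_def a_def b_def)
  have r: "lap_ok (\<lambda>x. (of_real (p x) + of_real z2 * of_real (b x)) + of_real z1 * of_real (a x))"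
    if z: "z1 > 0" "z2 > 0" for z1 z2 :: real
  proof -
    have g': "gint (\<lambda>x. of_real (p x + z2 * b x + z1 * a x))"
      using g by (auto intro!: gint_add gint_cmult)
    have nn: "0 \<le> p x + z2 * b x + z1 * a x" for x using pos z by simp
    have "lap_ok (\<lambda>x. of_real (p x + z2 * b x + z1 * a x))"
    proof (rule lap_ok_real[OF _ nn])
      show "integrable P0 (\<lambda>x. (p x + z2 * b x + z1 * a x) powr \<gamma>)"
        using g' nn unfolding gint_def norm_of_real by (simp add: abs_of_nonneg)
    qed measurable
    then show ?thesis by simp
  qed
  have s1: "lap_ok (\<lambda>x. (of_real (p x) + of_real z2 * of_real (b x)) + \<i> * of_real (a x))"
    if z2: "z2 > 0" for z2 :: real
    by (rule lap_step) (use r z2 pos in \<open>auto intro!: gint_add gint_cmult g add_nonneg_nonneg\<close>)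
  have "lap_ok (\<lambda>x. (of_real (p x) + \<i> * of_real (a x)) + (- \<i>) * of_real (b x))"
  proof (rule lap_step)
    show "lap_ok (\<lambda>x. of_real (p x) + \<i> * of_real (a x) + of_real z * of_real (b x))" if "z > 0" for z
      using s1[OF that] by (simp add: algebra_simps)
  qed (use pos in \<open>auto intro!: gint_add gint_cmult g\<close>)
  moreover have "(\<lambda>x. (of_real (p x) + \<i> * of_real (a x)) + (- \<i>) * of_real (b x)) = f"
    by (auto simp: fun_eq_iff complex_eq_iff p_def a_def b_def)
  ultimately have "lap_ok f" by (simp only:)
  then show ?thesis unfolding lap_ok_def .
qed

end

section \<open>Frequencies and weights of a sample\<close>

lemma frequency_Suc:
  "frequency (Suc n) (xs(n := x)) y = frequency n xs y + (if y = x then 1 else 0)"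
proof -
  have "{i. i < Suc n \<and> (xs(n := x)) i = y} = {i. i < n \<and> xs i = y} \<union> (if y = x then {n} else {})"
    by (auto simp: less_Suc_eq)
  moreover have "card ({i. i < n \<and> xs i = y} \<union> (if y = x then {n} else {}))
      = card {i. i < n \<and> xs i = y} + card (if y = x then {n} else {})"
    by (intro card_Un_disjoint) auto
  ultimately show ?thesis unfolding frequency_def by simp
qed

lemma distinct_values_Suc: "distinct_values (Suc n) (xs(n := x)) = insert x (distinct_values n xs)"
  unfolding distinct_values_def by (auto simp: image_iff less_Suc_eq)

lemma finite_distinct_values [simp]: "finite (distinct_values n xs)"
  unfolding distinct_values_def by simp

lemma frequency_eq_0: "y \<notin> distinct_values n xs \<Longrightarrow> frequency n xs y = 0"
  unfolding frequency_def distinct_values_def by auto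

lemma frequency_pos: "y \<in> distinct_values n xs \<Longrightarrow> 0 < frequency n xs y"
  unfolding frequency_def distinct_values_def by (auto simp: card_gt_0_iff)

lemma frequency_nth_pos: "i < n \<Longrightarrow> 0 < frequency n xs (xs i)"
  by (rule frequency_pos) (auto simp: distinct_values_def)

lemma prod_distinct_values:
  fixes h :: "'x \<Rightarrow> 'b::comm_monoid_mult"
  shows "(\<Prod>i<n. h (xs i)) = (\<Prod>y\<in>distinct_values n xs. h y ^ frequency n xs y)"
proof -
  have "(\<Prod>i<n. h (xs i)) = (\<Prod>y\<in>xs ` {..<n}. \<Prod>i\<in>{i. i \<in> {..<n} \<and> xs i = y}. h (xs i))"
    by (rule prod.image_gen) simp
  also have "\<dots> = (\<Prod>y\<in>xs ` {..<n}. h y ^ frequency n xs y)"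
    by (intro prod.cong refl) (simp add: frequency_def)
  finally show ?thesis by (simp add: distinct_values_def)
qed

lemma power_powr_of_real:
  fixes z :: complex
  assumes "m > 0"
  shows "(z powr of_real r) ^ m = z powr of_real (real m * r)"
  using assms by (auto simp: powr_def exp_of_nat_mult[symmetric] mult_ac)

definition wprod :: "real \<Rightarrow> nat \<Rightarrow> (nat \<Rightarrow> 'x) \<Rightarrow> ('x \<Rightarrow> complex) \<Rightarrow> complex" where
  "wprod \<gamma> n xs f = (\<Prod>y\<in>distinct_values n xs. f y powr of_real (\<gamma> - real (frequency n xs y)))"

text \<open>The exponent \<open>\<gamma> - m\<close> of a value of multiplicity \<open>m\<close> is
  spread evenly over its \<open>m\<close> copies. The index set then no longer depends on the
  sample, which is what measurability in \<open>xs\<close> and differentiation require.\<close>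

lemma wprod_eq:
  "wprod \<gamma> n xs f = (\<Prod>i<n. f (xs i) powr of_real (\<gamma> / real (frequency n xs (xs i)) - 1))"
proof -
  have "(\<Prod>i<n. f (xs i) powr of_real (\<gamma> / real (frequency n xs (xs i)) - 1))
    = (\<Prod>y\<in>distinct_values n xs. (f y powr of_real (\<gamma> / real (frequency n xs y) - 1)) ^ frequency n xs y)"
    by (rule prod_distinct_values[of "\<lambda>y. f y powr of_real (\<gamma> / real (frequency n xs y) - 1)"])
  also have "\<dots> = wprod \<gamma> n xs f"
    unfolding wprod_def
  proof (intro prod.cong refl)
    fix y assume "y \<in> distinct_values n xs"
    then have m: "frequency n xs y > 0" by (rule frequency_pos)
    then have "real (frequency n xs y) * (\<gamma> / real (frequency n xs y) - 1) = \<gamma> - real (frequency n xs y)"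
      by (simp add: field_simps)
    with power_powr_of_real[OF m, of "f y" "\<gamma> / real (frequency n xs y) - 1"]
    show "(f y powr of_real (\<gamma> / real (frequency n xs y) - 1)) ^ frequency n xs y
        = f y powr of_real (\<gamma> - real (frequency n xs y))" by (simp only:)
  qed
  finally show ?thesis ..
qed

text \<open>A new value contributes the factor that arises from differentiating the Laplace
  exponent; a repeated value, in \<open>wprod_Suc_old\<close>, contributes the factor that arises
  from differentiating the power already present. This match makes the urn the right reference
  measure.\<close>

lemma wprod_Suc_new:
  assumes "x \<notin> distinct_values n xs"
  shows "wprod \<gamma> (Suc n) (xs(n := x)) f = wprod \<gamma> n xs f * f x powr of_real (\<gamma> - 1)"
proof -
  have "(\<Prod>y\<in>distinct_values n xs. f y powr of_real (\<gamma> - real (frequency (Suc n) (xs(n := x)) y))) = wprod \<gamma> n xs f"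
    unfolding wprod_def using assms by (intro prod.cong refl) (auto simp: frequency_Suc)
  then show ?thesis
    unfolding wprod_def[of _ "Suc n"] distinct_values_Suc
    using assms by (simp add: frequency_Suc frequency_eq_0)
qed

lemma wprod_Suc_old:
  assumes "x \<in> distinct_values n xs" "f x \<noteq> 0"
  shows "wprod \<gamma> (Suc n) (xs(n := x)) f = wprod \<gamma> n xs f / f x"
proof -
  have "wprod \<gamma> (Suc n) (xs(n := x)) f
    = f x powr of_real (\<gamma> - real (frequency n xs x + 1)) *
      (\<Prod>y\<in>distinct_values n xs - {x}. f y powr of_real (\<gamma> - real (frequency n xs y)))"
    unfolding wprod_def distinct_values_Suc using assms
    by (subst prod.remove[of _ x]) (auto simp: insert_absorb frequency_Suc intro!: prod.cong)
  also have "f x powr of_real (\<gamma> - real (frequency n xs x + 1)) = f x powr of_real (\<gamma> - real (frequency n xs x)) / f x"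
    using assms by (simp add: powr_diff powr_add algebra_simps)
  also have "f x powr of_real (\<gamma> - real (frequency n xs x)) / f x *
      (\<Prod>y\<in>distinct_values n xs - {x}. f y powr of_real (\<gamma> - real (frequency n xs y))) = wprod \<gamma> n xs f / f x"
    unfolding wprod_def using assms by (subst prod.remove[of "distinct_values n xs" x]) auto
  finally show ?thesis .
qed

lemma measurable_frequency [measurable]:
  fixes n :: nat
  assumes "i < n"
  shows "(\<lambda>xs. real (frequency n xs (xs i))) \<in> borel_measurable (PiM {..<n} (\<lambda>_. borel :: 'x::polish_space measure))"
proof -
  have "real (frequency n xs (xs i)) = (\<Sum>j<n. if xs j = xs i then 1 else 0)" for xs :: "nat \<Rightarrow> 'x"
    unfolding frequency_def by (subst sum.inter_filter[symmetric]) (auto intro!: arg_cong[where f = card])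
  moreover have "(\<lambda>xs. \<Sum>j<n. if xs j = xs i then 1 else 0 :: real) \<in> borel_measurable (PiM {..<n} (\<lambda>_. borel :: 'x measure))"
  proof (rule borel_measurable_sum)
    fix j assume "j \<in> {..<n}"
    with assms have [measurable]: "(\<lambda>xs. xs j) \<in> PiM {..<n} (\<lambda>_. borel :: 'x measure) \<rightarrow>\<^sub>M borel"
      "(\<lambda>xs. xs i) \<in> PiM {..<n} (\<lambda>_. borel :: 'x measure) \<rightarrow>\<^sub>M borel"
      by auto
    have "Measurable.pred (PiM {..<n} (\<lambda>_. borel :: 'x measure)) (\<lambda>xs. xs j = xs i)"
      unfolding pred_def by (rule measurable_equality_set) measurable
    then show "(\<lambda>xs. if xs j = xs i then 1 else 0 :: real) \<in> borel_measurable (PiM {..<n} (\<lambda>_. borel :: 'x measure))"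
      by measurable
  qed
  ultimately show ?thesis by simp
qed

lemma measurable_wprod [measurable]:
  fixes f :: "'x::polish_space \<Rightarrow> complex"
  assumes f: "f \<in> borel_measurable borel"
  shows "(\<lambda>xs. wprod \<gamma> n xs f) \<in> borel_measurable (PiM {..<n} (\<lambda>_. borel))"
  unfolding wprod_eq
proof (rule borel_measurable_prod)
  fix i assume "i \<in> {..<n}"
  then have i: "i < n" by simp
  note [measurable] = measurable_frequency[OF i] f
  have [measurable]: "(\<lambda>xs. xs i) \<in> PiM {..<n} (\<lambda>_. borel :: 'x measure) \<rightarrow>\<^sub>M borel"
    using i by auto
  have "(\<lambda>xs. f (xs i) powr of_real (\<gamma> / real (frequency n xs (xs i)) - 1)) =
    (\<lambda>xs. if f (xs i) = 0 then 0 else exp (of_real (\<gamma> / real (frequency n xs (xs i)) - 1) * Ln (f (xs i))))"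
    by (auto simp: powr_def)
  moreover have "\<dots> \<in> borel_measurable (PiM {..<n} (\<lambda>_. borel))" by measurable
  ultimately show "(\<lambda>xs. f (xs i) powr of_real (\<gamma> / real (frequency n xs (xs i)) - 1)) \<in> borel_measurable (PiM {..<n} (\<lambda>_. borel))"
    by simp
qed

lemma norm_wprod_le_1:
  assumes "0 < \<gamma>" "\<gamma> < 1" "\<And>x. Re (f x) \<ge> 1"
  shows "norm (wprod \<gamma> n xs f) \<le> 1"
  unfolding wprod_def prod_norm[symmetric]
proof (rule prod_le_1, safe)
  fix y assume "y \<in> distinct_values n xs"
  then have "frequency n xs y > 0" by (rule frequency_pos)
  then have "\<gamma> - real (frequency n xs y) \<le> 0" using assms by simp
  moreover have "norm (f y) \<ge> 1" using assms(3)[of y] complex_Re_le_cmod[of "f y"] by linarith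
  ultimately have "norm (f y) powr (\<gamma> - real (frequency n xs y)) \<le> norm (f y) powr 0"
    by (intro powr_mono) auto
  also have "\<dots> \<le> 1" by simp
  finally show "norm (f y powr of_real (\<gamma> - real (frequency n xs y))) \<le> 1" by (simp only: norm_powr_of_real)
qed auto

lemma wprod_exp:
  assumes "\<And>x. f x \<noteq> 0"
  shows "wprod \<gamma> n xs f = exp (\<Sum>i<n. of_real (\<gamma> / real (frequency n xs (xs i)) - 1) * Ln (f (xs i)))"
  unfolding wprod_eq using assms by (simp add: powr_def exp_sum)

lemma wprod_deriv:
  assumes "\<And>x. Re (f x + z * q x) > 0"
  shows "((\<lambda>z. wprod \<gamma> n xs (\<lambda>x. f x + z * q x)) has_field_derivative
     wprod \<gamma> n xs (\<lambda>x. f x + z * q x) *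
       (\<Sum>i<n. of_real (\<gamma> / real (frequency n xs (xs i)) - 1) * (q (xs i) / (f (xs i) + z * q (xs i))))) (at z)"
proof -
  \<comment> \<open>The logarithmic form can be differentiated term by term. It agrees with
    \<open>wprod\<close> wherever the finitely many sampled values of \<open>f + w * q\<close> are
    nonzero, hence for all \<open>w\<close> near \<open>z\<close>.\<close>
  define E where "E z = exp (\<Sum>i<n. of_real (\<gamma> / real (frequency n xs (xs i)) - 1) * Ln (f (xs i) + z * q (xs i)))" for z
  have nz: "f x + z * q x \<notin> \<real>\<^sub>\<le>\<^sub>0" "f x + z * q x \<noteq> 0" for x
    using assms[of x] complex_nonpos_Reals_iff[of "f x + z * q x"] by (force, metis less_irrefl zero_complex.simps(1))
  have "(E has_field_derivative E z *
       (\<Sum>i<n. of_real (\<gamma> / real (frequency n xs (xs i)) - 1) * (q (xs i) / (f (xs i) + z * q (xs i))))) (at z)"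
    unfolding E_def
    by (rule DERIV_chain'[OF _ DERIV_exp, THEN DERIV_cong])
       (auto intro!: derivative_eq_intros DERIV_sum simp: nz divide_inverse mult_ac)
  moreover have "\<forall>\<^sub>F w in nhds z. wprod \<gamma> n xs (\<lambda>x. f x + w * q x) = E w"
  proof -
    have "\<forall>\<^sub>F w in nhds z. \<forall>i\<in>{..<n}. f (xs i) + w * q (xs i) \<noteq> 0"
    proof (subst eventually_ball_finite_distrib, simp, intro ballI)
      fix i
      have "((\<lambda>w. f (xs i) + w * q (xs i)) \<longlongrightarrow> f (xs i) + z * q (xs i)) (nhds z)"
        by (intro tendsto_intros filterlim_ident)
      then show "\<forall>\<^sub>F w in nhds z. f (xs i) + w * q (xs i) \<noteq> 0"
        by (rule tendsto_imp_eventually_ne) (rule nz)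
    qed
    then show ?thesis
    proof eventually_elim
      case (elim w)
      then show ?case unfolding wprod_eq E_def
        by (auto simp: powr_def exp_sum intro!: prod.cong)
    qed
  qed
  moreover have "wprod \<gamma> n xs (\<lambda>x. f x + z * q x) = E z"
    unfolding E_def by (rule wprod_exp) (rule nz)
  ultimately show ?thesis by (subst DERIV_cong_ev[OF refl _ refl, of _ E]) auto
qed

text \<open>A single term of the exponential series already gives the bound.\<close>

lemma power_mult_exp_bound:
  fixes x d :: real
  assumes "x \<ge> 0" "d > 0"
  shows "x ^ m * exp (- d * x) \<le> fact m / d ^ m"
proof -
  have "(d * x) ^ m / fact m \<le> exp (d * x)"
    using sum_le_suminf[OF summable_exp[of "d * x"], of "{m}"] assms by (simp add: exp_def field_simps)
  then show ?thesis using assms by (simp add: exp_minus field_simps power_mult_distrib)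
qed

section \<open>The Palm formula\<close>

lemma wprod_deriv_bound:
  assumes "0 < \<gamma>" "\<gamma> < 1" "\<And>x. Re (f x) \<ge> 1" "\<And>x. norm (q x) \<le> 1"
  shows "norm (wprod \<gamma> n xs f * (\<Sum>i<n. of_real (\<gamma> / real (frequency n xs (xs i)) - 1) * (q (xs i) / f (xs i)))) \<le> real n"
proof -
  have "norm (\<Sum>i<n. of_real (\<gamma> / real (frequency n xs (xs i)) - 1) * (q (xs i) / f (xs i)))
      \<le> (\<Sum>i<n. 1 * (1 / 1))"
  proof (rule order_trans[OF norm_sum], rule sum_mono)
    fix i assume "i \<in> {..<n}"
    then have "1 \<le> real (frequency n xs (xs i))" using frequency_nth_pos[of i n xs] by simp
    then have "0 \<le> \<gamma> / real (frequency n xs (xs i))" "\<gamma> / real (frequency n xs (xs i)) \<le> 1"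
      using assms by (auto simp: divide_simps)
    then have "norm (of_real (\<gamma> / real (frequency n xs (xs i)) - 1) :: complex) \<le> 1"
      unfolding norm_of_real by linarith
    moreover have "norm (f (xs i)) \<ge> 1" using assms(3)[of "xs i"] complex_Re_le_cmod[of "f (xs i)"] by linarith
    ultimately show "norm (of_real (\<gamma> / real (frequency n xs (xs i)) - 1) * (q (xs i) / f (xs i))) \<le> 1 * (1 / 1)"
      unfolding norm_mult norm_divide using assms(4) by (intro mult_mono frac_le) auto
  qed
  then show ?thesis
    unfolding norm_mult using mult_mono[OF norm_wprod_le_1[of \<gamma> f n xs]] assms by fastforce
qed

section \<open>The unnormalized urn measure\<close>

context gg_base
begin

abbreviation "seqs n \<equiv> PiM {..<n} (\<lambda>_. borel :: 'x measure)"

definition box :: "nat \<Rightarrow> (nat \<Rightarrow> 'x set) \<Rightarrow> (nat \<Rightarrow> 'x) \<Rightarrow> real" where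
  "box n A xs = (\<Prod>i<n. indicator (A i) (xs i))"

lemma box_bounds: "0 \<le> box n A xs" "box n A xs \<le> 1"
  unfolding box_def by (auto intro!: prod_nonneg prod_le_1)

lemma box_measurable [measurable]:
  "(\<And>i. i < n \<Longrightarrow> A i \<in> sets borel) \<Longrightarrow> box n A \<in> borel_measurable (seqs n)"
  unfolding box_def by (auto intro!: borel_measurable_prod borel_measurable_indicator' simp del: indicator_simps)

text \<open>An unnormalized Polya urn: the next observation is a copy of the \<open>j\<close>-th one with weight
  \<open>1 - \<gamma> / n\<^sub>j\<close>, so that a value of multiplicity \<open>m\<close> has weight \<open>m - \<gamma>\<close>, or (for \<open>j = n\<close>) a fresh draw
  from \<open>P0\<close> with weight \<open>\<beta> * \<gamma>\<close>.\<close>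

definition urn_map :: "nat \<Rightarrow> (nat \<Rightarrow> 'x) \<times> ('x \<times> nat) \<Rightarrow> nat \<Rightarrow> 'x" where
  "urn_map n = (\<lambda>(xs, x, j). xs(n := if j < n then xs j else x))"

definition urn_weight :: "nat \<Rightarrow> (nat \<Rightarrow> 'x) \<times> ('x \<times> nat) \<Rightarrow> real" where
  "urn_weight n = (\<lambda>(xs, x, j). if j < n then 1 - \<gamma> / real (frequency n xs (xs j)) else \<beta> * \<gamma>)"

definition urn_step :: "nat \<Rightarrow> (nat \<Rightarrow> 'x) measure \<Rightarrow> (nat \<Rightarrow> 'x) measure" where
  "urn_step n L = distr (density (L \<Otimes>\<^sub>M (P0 \<Otimes>\<^sub>M count_space {..n})) (\<lambda>p. ennreal (urn_weight n p))) (seqs (Suc n)) (urn_map n)"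

lemma urn_weight_bounds: "0 \<le> urn_weight n p" "urn_weight n p \<le> 1 + \<beta> * \<gamma>"
proof -
  obtain xs x j where p: "p = (xs, x, j)" by (cases p) auto
  have "0 \<le> 1 - \<gamma> / real (frequency n xs (xs j)) \<and> 1 - \<gamma> / real (frequency n xs (xs j)) \<le> 1" if "j < n"
    using frequency_nth_pos[OF that, of xs] gam by (auto simp: divide_simps)
  moreover have "0 \<le> \<beta> * \<gamma>" using beta gam by simp
  ultimately show "0 \<le> urn_weight n p" "urn_weight n p \<le> 1 + \<beta> * \<gamma>"
    unfolding urn_weight_def p by (cases "j < n"; fastforce)+
qed

lemma urn_weight_measurable [measurable]:
  assumes [measurable_cong]: "sets L = sets (seqs n)"
  shows "urn_weight n \<in> borel_measurable (L \<Otimes>\<^sub>M (P0 \<Otimes>\<^sub>M count_space {..n}))"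
proof -
  have "(\<lambda>p. urn_weight n (fst p, fst (snd p), snd (snd p))) \<in> borel_measurable (L \<Otimes>\<^sub>M (P0 \<Otimes>\<^sub>M count_space {..n}))"
  proof (rule measurable_compose_countable'[where I = "{..n}" and g = "\<lambda>p. snd (snd p)" and
        f = "\<lambda>j p. urn_weight n (fst p, fst (snd p), j)"])
    fix j assume "j \<in> {..n}"
    show "(\<lambda>p. urn_weight n (fst p, fst (snd p), j)) \<in> borel_measurable (L \<Otimes>\<^sub>M (P0 \<Otimes>\<^sub>M count_space {..n}))"
    proof (cases "j < n")
      case True
      note [measurable] = measurable_frequency[OF True]
      show ?thesis unfolding urn_weight_def using True by simp
    qed (simp add: urn_weight_def)
  qed auto
  then show ?thesis by simp
qed

lemma urn_map_measurable [measurable]: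
  assumes [measurable_cong]: "sets L = sets (seqs n)"
  shows "urn_map n \<in> L \<Otimes>\<^sub>M (P0 \<Otimes>\<^sub>M count_space {..n}) \<rightarrow>\<^sub>M seqs (Suc n)"
proof -
  have "(\<lambda>p. urn_map n (fst p, fst (snd p), snd (snd p))) \<in> L \<Otimes>\<^sub>M (P0 \<Otimes>\<^sub>M count_space {..n}) \<rightarrow>\<^sub>M seqs (Suc n)"
  proof (rule measurable_compose_countable'[where I = "{..n}" and g = "\<lambda>p. snd (snd p)" and
        f = "\<lambda>j p. urn_map n (fst p, fst (snd p), j)"])
    fix j assume "j \<in> {..n}"
    show "(\<lambda>p. urn_map n (fst p, fst (snd p), j)) \<in> L \<Otimes>\<^sub>M (P0 \<Otimes>\<^sub>M count_space {..n}) \<rightarrow>\<^sub>M seqs (Suc n)"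
    proof (cases "j < n")
      case True
      then show ?thesis unfolding urn_map_def by (simp add: lessThan_Suc)
    next
      case False
      then show ?thesis unfolding urn_map_def by (simp add: lessThan_Suc)
    qed
  qed auto
  then show ?thesis by simp
qed

lemma sets_urn_step [simp]: "sets (urn_step n L) = sets (seqs (Suc n))"
  by (simp add: urn_step_def)

lemma urn_step_integral:
  fixes F :: "(nat \<Rightarrow> 'x) \<Rightarrow> complex"
  assumes L: "sets L = sets (seqs n)" "finite_measure L"
    and F [measurable]: "F \<in> borel_measurable (seqs (Suc n))" and bF: "\<And>xs. norm (F xs) \<le> K"
  shows "(\<integral>xs. F xs \<partial>urn_step n L) =
    (\<integral>xs. (\<Sum>j<n. of_real (1 - \<gamma> / real (frequency n xs (xs j))) * F (xs(n := xs j)))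
        + of_real (\<beta> * \<gamma>) * (\<integral>x. F (xs(n := x)) \<partial>P0) \<partial>L)"
proof -
  note [measurable_cong] = L(1)
  interpret L: finite_measure L by fact
  interpret C: finite_measure "count_space {..n}" by (rule finite_measure_count_space) simp
  interpret PC: pair_sigma_finite P0 "count_space {..n}" ..
  interpret PCf: finite_measure "P0 \<Otimes>\<^sub>M count_space {..n}"
    by (rule finite_measure_pair_measure) unfold_locales
  interpret LPC: pair_sigma_finite L "P0 \<Otimes>\<^sub>M count_space {..n}" ..
  interpret LPCf: finite_measure "L \<Otimes>\<^sub>M (P0 \<Otimes>\<^sub>M count_space {..n})"
    by (rule finite_measure_pair_measure) unfold_locales
  let ?N = "L \<Otimes>\<^sub>M (P0 \<Otimes>\<^sub>M count_space {..n})"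
  let ?G = "\<lambda>p. urn_weight n p *\<^sub>R F (urn_map n p)"
  have meas [measurable]: "?G \<in> borel_measurable ?N" by measurable
  have K: "0 \<le> K" using bF[of undefined] norm_ge_zero[of "F undefined"] by linarith
  have bd: "norm (?G p) \<le> (1 + \<beta> * \<gamma>) * K" for p
    using urn_weight_bounds[of n p] bF[of "urn_map n p"] K by (auto intro!: mult_mono)
  have int: "integrable ?N ?G"
    by (rule LPCf.integrable_const_bound[OF AE_I2[OF bd] meas])
  have "(\<integral>xs. F xs \<partial>urn_step n L) = (\<integral>p. F (urn_map n p) \<partial>density ?N (\<lambda>p. ennreal (urn_weight n p)))"
    unfolding urn_step_def by (rule integral_distr) auto
  also have "\<dots> = (\<integral>p. ?G p \<partial>?N)"
    by (rule integral_density) (auto simp: urn_weight_bounds)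
  also have "\<dots> = (\<integral>xs. (\<integral>q. ?G (xs, q) \<partial>(P0 \<Otimes>\<^sub>M count_space {..n})) \<partial>L)"
    using LPC.integral_fst'[OF int] by simp
  also have "\<dots> = (\<integral>xs. (\<Sum>j<n. of_real (1 - \<gamma> / real (frequency n xs (xs j))) * F (xs(n := xs j)))
        + of_real (\<beta> * \<gamma>) * (\<integral>x. F (xs(n := x)) \<partial>P0) \<partial>L)"
  proof (rule Bochner_Integration.integral_cong[OF refl])
    fix xs assume xs: "xs \<in> space L"
    have m: "(\<lambda>q. ?G (xs, q)) \<in> borel_measurable (P0 \<Otimes>\<^sub>M count_space {..n})"
      using measurable_compose[OF measurable_Pair1'[OF xs] meas] by simp
    have "integrable (P0 \<Otimes>\<^sub>M count_space {..n}) (\<lambda>q. ?G (xs, q))"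
      by (rule PCf.integrable_const_bound[OF AE_I2[OF bd] m])
    then have "(\<integral>q. ?G (xs, q) \<partial>(P0 \<Otimes>\<^sub>M count_space {..n})) =
        (\<integral>x. (\<integral>j. ?G (xs, x, j) \<partial>count_space {..n}) \<partial>P0)"
      using PC.integral_fst' by fastforce
    also have "\<dots> = (\<integral>x. (\<Sum>j<n. of_real (1 - \<gamma> / real (frequency n xs (xs j))) * F (xs(n := xs j)))
        + of_real (\<beta> * \<gamma>) * F (xs(n := x)) \<partial>P0)"
      by (intro Bochner_Integration.integral_cong refl)
         (simp add: lebesgue_integral_count_space_finite lessThan_Suc_atMost[symmetric] urn_weight_def urn_map_def scaleR_conv_of_real)
    also have "\<dots> = (\<Sum>j<n. of_real (1 - \<gamma> / real (frequency n xs (xs j))) * F (xs(n := xs j)))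
        + of_real (\<beta> * \<gamma>) * (\<integral>x. F (xs(n := x)) \<partial>P0)"
    proof -
      have xs': "xs \<in> space (seqs n)" using xs sets_eq_imp_space_eq[OF L(1)] by simp
      have "(\<lambda>x. xs(n := x)) \<in> borel \<rightarrow>\<^sub>M seqs (Suc n)"
        unfolding lessThan_Suc using xs' by (intro measurable_fun_upd[where J = "{..<n}"]) auto
      from measurable_compose[OF this F] have "(\<lambda>x. F (xs(n := x))) \<in> borel_measurable P0"
        by (simp add: borel_P0)
      then have "integrable P0 (\<lambda>x. F (xs(n := x)))"
        by (rule integrable_const_bound[OF AE_I2[OF bF]])
      then show ?thesis by (simp add: Bochner_Integration.integral_add)
    qed
    finally show "(\<integral>q. ?G (xs, q) \<partial>(P0 \<Otimes>\<^sub>M count_space {..n})) = \<dots>" .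
  qed
  finally show ?thesis .
qed

lemma finite_urn_step:
  assumes L: "sets L = sets (seqs n)" "finite_measure L"
  shows "finite_measure (urn_step n L)"
proof -
  note [measurable_cong] = L(1)
  interpret L: finite_measure L by fact
  interpret C: finite_measure "count_space {..n}" by (rule finite_measure_count_space) simp
  interpret PCf: finite_measure "P0 \<Otimes>\<^sub>M count_space {..n}"
    by (rule finite_measure_pair_measure) unfold_locales
  interpret LPCf: finite_measure "L \<Otimes>\<^sub>M (P0 \<Otimes>\<^sub>M count_space {..n})"
    by (rule finite_measure_pair_measure) unfold_locales
  let ?N = "L \<Otimes>\<^sub>M (P0 \<Otimes>\<^sub>M count_space {..n})"
  have "(\<integral>\<^sup>+p. ennreal (urn_weight n p) \<partial>?N) \<le> (\<integral>\<^sup>+p. ennreal (1 + \<beta> * \<gamma>) \<partial>?N)"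
    by (intro nn_integral_mono ennreal_leI urn_weight_bounds)
  also have "\<dots> < \<infinity>" using LPCf.emeasure_finite[of "space ?N"]
    by (simp add: ennreal_mult_less_top less_top[symmetric] ennreal_mult_eq_top_iff)
  finally have "finite_measure (density ?N (\<lambda>p. ennreal (urn_weight n p)))"
    by (intro finite_measureI) (simp add: emeasure_density space_density nn_integral_density cong: nn_integral_cong)
  then show ?thesis
    unfolding urn_step_def by (rule finite_measure.finite_measure_distr) auto
qed

text \<open>The law of the sample is not this measure but has the density \<open>k0 n * G0 n\<close>
  with respect to it (\<open>law_XX\<close>). For \<open>n = 0\<close> the constant function
  \<open>undefined\<close> is the only point of the empty product space.\<close>

primrec urn :: "nat \<Rightarrow> (nat \<Rightarrow> 'x) measure" where
  "urn 0 = return (seqs 0) (\<lambda>_. undefined)"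
| "urn (Suc n) = urn_step n (urn n)"

lemma sets_urn [simp, measurable_cong]: "sets (urn n) = sets (seqs n)"
  by (cases n) auto

lemma prob_space_pu_0: "prob_space (urn 0)"
  unfolding urn.simps by (rule prob_space_return) (simp add: space_PiM PiE_def extensional_def)

lemma finite_urn: "finite_measure (urn n)"
proof (induction n)
  case 0
  then show ?case by (rule prob_space.finite_measure[OF prob_space_pu_0])
qed (simp add: finite_urn_step)

end

section \<open>Mixed moments of the masses of sets\<close>

context gg_rand
begin

lemma P_subprob: "\<omega> \<in> space M \<Longrightarrow> subprob_space (P \<omega>)"
  using subprob_space_kernel[OF P_meas] .

lemma P_le_1: "\<omega> \<in> space M \<Longrightarrow> measure (P \<omega>) A \<le> 1"
  using subprob_space.subprob_measure_le_1[OF P_subprob] .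

lemma X_indicator:
  assumes "A \<in> sets borel" "\<omega> \<in> space M"
  shows "X (\<lambda>x. indicator A x) \<omega> = of_real (S \<omega> * measure (P \<omega>) A)"
proof -
  have "(\<integral>x. indicator A x \<partial>P \<omega>) = (\<integral>x. complex_of_real (indicator A x) \<partial>P \<omega>)"
    by (intro Bochner_Integration.integral_cong) (auto simp: indicator_def)
  also have "\<dots> = of_real (measure (P \<omega>) A)"
    using assms sets_P space_P by simp
  finally show ?thesis by (simp add: X_def)
qed

lemma X_const:
  "AE \<omega> in M. X (\<lambda>_. c) \<omega> = of_real (S \<omega>) * c"
  using P_prob by eventually_elim (simp add: X_def prob_space.prob_space)

definition mass_prod :: "nat \<Rightarrow> (nat \<Rightarrow> 'x set) \<Rightarrow> 'w \<Rightarrow> real" where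
  "mass_prod n A \<omega> = (\<Prod>i<n. S \<omega> * measure (P \<omega>) (A i))"

lemma mass_prod_measurable [measurable]:
  assumes "\<And>i. i < n \<Longrightarrow> A i \<in> sets borel"
  shows "mass_prod n A \<in> borel_measurable M"
  unfolding mass_prod_def
proof (rule borel_measurable_prod)
  fix i assume "i \<in> {..<n}"
  with assms have "A i \<in> sets borel" by simp
  then have [measurable]: "(\<lambda>\<omega>. measure (P \<omega>) (A i)) \<in> borel_measurable M"
    by (rule measurable_compose[OF P_meas measurable_measure_subprob_algebra])
  show "(\<lambda>\<omega>. S \<omega> * measure (P \<omega>) (A i)) \<in> borel_measurable M" by measurable
qed

lemma mass_prod_bounds:
  assumes "\<omega> \<in> space M"
  shows "0 \<le> mass_prod n A \<omega>" "mass_prod n A \<omega> \<le> S \<omega> ^ n"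
proof -
  show "0 \<le> mass_prod n A \<omega>" unfolding mass_prod_def using S_nonneg by (auto intro!: prod_nonneg)
  have "mass_prod n A \<omega> \<le> (\<Prod>i<n. S \<omega> * 1)"
    unfolding mass_prod_def using S_nonneg P_le_1[OF assms] by (intro prod_mono) (auto intro!: mult_left_le)
  then show "mass_prod n A \<omega> \<le> S \<omega> ^ n" by simp
qed

definition palm_rhs :: "nat \<Rightarrow> (nat \<Rightarrow> 'x set) \<Rightarrow> ('x \<Rightarrow> complex) \<Rightarrow> complex" where
  "palm_rhs n A f = exp (of_real \<beta>) * exp (- of_real \<beta> * (\<integral>x. (1 + f x) powr of_real \<gamma> \<partial>P0)) *
     (\<integral>xs. of_real (box n A xs) * wprod \<gamma> n xs (\<lambda>x. 1 + f x) \<partial>urn n)"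

text \<open>The identity for \<open>n\<close> sets is applied to \<open>f + z * indicator B\<close>
  and differentiated at \<open>z = 0\<close>; the left side gains the mass of \<open>B\<close>, the
  right side the terms of the product rule. The margin \<open>e\<close> keeps the real part above
  \<open>e / 2\<close> for small complex \<open>z\<close>, so that
  \<open>exp (- (e / 2) * S)\<close> dominates the powers of \<open>S\<close>.\<close>

lemma palm_derivative:
  assumes A: "\<And>i. i < n \<Longrightarrow> A i \<in> sets borel" and B [measurable]: "B \<in> sets borel"
    and f: "gint f" and e: "e > 0" "\<And>x. Re (f x) \<ge> e"
    and IH: "\<And>f. gint f \<Longrightarrow> (\<And>x. Re (f x) \<ge> e / 2) \<Longrightarrow>
      (\<integral>\<omega>. of_real (mass_prod n A \<omega>) * exp (- X f \<omega>) \<partial>M) = palm_rhs n A f"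
  shows "(\<integral>\<omega>. of_real (mass_prod n A \<omega> * (S \<omega> * measure (P \<omega>) B)) * exp (- X f \<omega>) \<partial>M)
    = exp (of_real \<beta>) * exp (- of_real \<beta> * (\<integral>x. (1 + f x) powr of_real \<gamma> \<partial>P0)) *
      (\<integral>xs. of_real (box n A xs) * (wprod \<gamma> n xs (\<lambda>x. 1 + f x) *
        ((\<Sum>j<n. of_real (1 - \<gamma> / real (frequency n xs (xs j))) * (indicator B (xs j) / (1 + f (xs j))))
         + of_real (\<beta> * \<gamma>) * (\<integral>x. indicator B x * (1 + f x) powr of_real (\<gamma> - 1) \<partial>P0))) \<partial>urn n)"
proof -
  note [measurable] = gint_measurable[OF f] mass_prod_measurable[OF A] box_measurable[OF A]
  have [measurable]: "(\<lambda>\<omega>. measure (P \<omega>) B) \<in> borel_measurable M"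
    by (rule measurable_compose[OF P_meas measurable_measure_subprob_algebra]) simp
  define b where "b \<omega> = S \<omega> * measure (P \<omega>) B" for \<omega>
  have [measurable]: "b \<in> borel_measurable M" unfolding b_def by measurable
  have b0: "0 \<le> b \<omega>" "\<omega> \<in> space M \<Longrightarrow> b \<omega> \<le> S \<omega>" for \<omega>
    using S_nonneg P_le_1 by (auto simp: b_def mult_left_le)
  \<comment> \<open>Splitting \<open>e\<close> off makes the decay in \<open>S\<close> explicit:
    what is left has nonnegative real part and contributes a factor of modulus at most one.\<close>
  define f0 where "f0 x = f x - of_real e" for x
  have f0: "gint f0" "Re (f0 x) \<ge> 0" for x
    using gint_add[OF f gint_const[of "- of_real e"]] e by (auto simp: f0_def[abs_def])
  note [measurable] = gint_measurable[OF f0(1)]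
  define Q :: "'x \<Rightarrow> complex" where "Q = indicator B"
  have Q: "gint Q" "\<And>x. norm (Q x) \<le> 1"
    unfolding Q_def by (auto intro!: gint_bounded[where K = 1] simp: indicator_def)
  note [measurable] = gint_measurable[OF Q(1)]
  define ff where "ff z = (\<lambda>x. f x + z * Q x)" for z
  have gff: "gint (ff z)" for z unfolding ff_def by (intro gint_add gint_cmult f Q)
  have Reff: "Re (ff z x) \<ge> e / 2" if "z \<in> ball 0 (e / 2)" for z x
  proof -
    have "\<bar>Re z\<bar> < e / 2" using that abs_Re_le_cmod[of z] by simp
    moreover have "0 \<le> (indicator B x :: real)" "(indicator B x :: real) \<le> 1" by (auto simp: indicator_def)
    ultimately show ?thesis using e(2)[of x] by (auto simp: ff_def Q_def indicator_def)
  qed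
  \<comment> \<open>\<open>exp (- X (ff z) \<omega>)\<close> has this value only outside a null set
    that depends on \<open>z\<close>. Differentiation in \<open>z\<close> needs a version given by
    one formula at every \<open>\<omega>\<close>.\<close>
  define E where "E z \<omega> = exp (- (of_real (e * S \<omega>) + X f0 \<omega> + z * of_real (b \<omega>)))" for z \<omega>
  have [measurable]: "E z \<in> borel_measurable M" for z unfolding E_def by measurable
  have EX: "AE \<omega> in M. exp (- X (ff z) \<omega>) = E z \<omega>" for z
  proof -
    have "AE \<omega> in M. X (\<lambda>x. of_real e + 1 * f0 x) \<omega> = X (\<lambda>_. of_real e) \<omega> + 1 * X f0 \<omega>"
      by (rule X_add[OF gint_const f0(1)])
    moreover have "AE \<omega> in M. X (\<lambda>x. f x + z * Q x) \<omega> = X f \<omega> + z * X Q \<omega>"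
      by (rule X_add[OF f Q(1)])
    ultimately show ?thesis
      using X_const[of "of_real e"] AE_space
    proof eventually_elim
      case (elim \<omega>)
      have "(\<lambda>x. of_real e + 1 * f0 x) = f" by (simp add: f0_def fun_eq_iff)
      with elim show ?case
        using X_indicator[OF B elim(4)] by (simp add: E_def ff_def b_def Q_def mult.commute)
    qed
  qed
  have Ebd: "norm (E z \<omega>) \<le> exp (- (e / 2) * S \<omega>)" if "z \<in> ball 0 (e / 2)" "\<omega> \<in> space M" for z \<omega>
  proof -
    have "\<bar>Re z\<bar> \<le> e / 2" using that abs_Re_le_cmod[of z] by simp
    then have "\<bar>Re z\<bar> * b \<omega> \<le> (e / 2) * S \<omega>" using b0[of \<omega>] that e by (intro mult_mono) auto
    then have "- (Re z * b \<omega>) \<le> (e / 2) * S \<omega>" using abs_le_D2[of "Re z * b \<omega>" "(e / 2) * S \<omega>"] b0[of \<omega>]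
      by (simp add: abs_mult)
    moreover have "Re (X f0 \<omega>) \<ge> 0" using f0(2) by (rule Re_X_nonneg)
    ultimately show ?thesis unfolding E_def by simp
  qed
  define L where "L z = (\<integral>\<omega>. of_real (mass_prod n A \<omega>) * E z \<omega> \<partial>M)" for z
  \<comment> \<open>It is used with \<open>m = n\<close> for integrability and with
    \<open>m = Suc n\<close> for the derivative, which carries one more factor
    \<open>S\<close>.\<close>
  have Sb: "S \<omega> ^ m * exp (- (e / 2) * S \<omega>) \<le> fact m / (e / 2) ^ m" for m \<omega>
    using power_mult_exp_bound[OF S_nonneg, of "e / 2"] e by auto
  have dL: "(L has_field_derivative (\<integral>\<omega>. of_real (mass_prod n A \<omega>) * (- of_real (b \<omega>) * E 0 \<omega>) \<partial>M)) (at 0)"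
    unfolding L_def
  proof (rule has_field_derivative_integral[where r = "e / 2" and B = "\<lambda>_. fact (Suc n) / (e / 2) ^ Suc n" and
      f' = "\<lambda>z \<omega>. of_real (mass_prod n A \<omega>) * (- of_real (b \<omega>) * E z \<omega>)"])
    fix z :: complex and \<omega> assume z: "z \<in> ball 0 (e / 2)"
    show "((\<lambda>z. of_real (mass_prod n A \<omega>) * E z \<omega>) has_field_derivative
        of_real (mass_prod n A \<omega>) * (- of_real (b \<omega>) * E z \<omega>)) (at z)"
      unfolding E_def by (auto intro!: derivative_eq_intros)
    assume w: "\<omega> \<in> space M"
    have "norm (of_real (mass_prod n A \<omega>) * (- of_real (b \<omega>) * E z \<omega>)) = mass_prod n A \<omega> * (b \<omega> * norm (E z \<omega>))"
      using mass_prod_bounds[OF w] b0[of \<omega>] by (simp add: norm_mult)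
    also have "\<dots> \<le> S \<omega> ^ n * (S \<omega> * exp (- (e / 2) * S \<omega>))"
      using mass_prod_bounds[OF w] b0[of \<omega>] w S_nonneg[of \<omega>] Ebd[OF z w] by (intro mult_mono) auto
    also have "\<dots> = S \<omega> ^ Suc n * exp (- (e / 2) * S \<omega>)" by simp
    also have "\<dots> \<le> fact (Suc n) / (e / 2) ^ Suc n" by (rule Sb)
    finally show "norm (of_real (mass_prod n A \<omega>) * (- of_real (b \<omega>) * E z \<omega>)) \<le> fact (Suc n) / (e / 2) ^ Suc n" .
  next
    fix z :: complex assume z: "z \<in> ball 0 (e / 2)"
    show "integrable M (\<lambda>\<omega>. of_real (mass_prod n A \<omega>) * E z \<omega>)"
    proof (rule M.integrable_const_bound[where B = "fact n / (e / 2) ^ n"], rule AE_I2)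
      fix \<omega> assume w: "\<omega> \<in> space M"
      have "norm (of_real (mass_prod n A \<omega>) * E z \<omega>) \<le> S \<omega> ^ n * exp (- (e / 2) * S \<omega>)"
        using mass_prod_bounds[OF w] S_nonneg[of \<omega>] Ebd[OF z w] unfolding norm_mult by (intro mult_mono) auto
      then show "norm (of_real (mass_prod n A \<omega>) * E z \<omega>) \<le> fact n / (e / 2) ^ n"
        using Sb[of \<omega> n] by linarith
    qed measurable
  qed (use e in auto)
  let ?w = "\<lambda>z xs. wprod \<gamma> n xs (\<lambda>x. (1 + f x) + z * Q x)"
  define I where "I z = (\<integral>x. ((1 + f x) + z * Q x) powr of_real \<gamma> \<partial>P0)" for z
  define J where "J z = (\<integral>xs. of_real (box n A xs) * ?w z xs \<partial>urn n)" for z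
  have Re1: "Re ((1 + f x) + z * Q x) \<ge> 1" if "z \<in> ball 0 (e / 2)" for z x
    using Reff[OF that, of x] e by (simp add: ff_def)
  have dI: "(I has_field_derivative (\<integral>x. of_real \<gamma> * Q x * ((1 + f x) + 0 * Q x) powr of_real (\<gamma> - 1) \<partial>P0)) (at 0)"
    unfolding I_def
    by (rule powr_integral_deriv_bounded[where K = 1 and \<delta> = 1 and r = "e / 2"])
       (use Q f e Re1 in \<open>auto intro!: gint_add gint_const\<close>)
  interpret pu: finite_measure "urn n" by (rule finite_urn)
  define W' where "W' z xs = ?w z xs *
     (\<Sum>i<n. of_real (\<gamma> / real (frequency n xs (xs i)) - 1) * (Q (xs i) / ((1 + f (xs i)) + z * Q (xs i))))" for z xs
  have [measurable]: "(\<lambda>xs. ?w z xs) \<in> borel_measurable (urn n)" for z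
    unfolding measurable_cong_sets[OF sets_urn refl] by (rule measurable_wprod) measurable
  have [measurable]: "W' z \<in> borel_measurable (urn n)" for z
  proof -
    have "(\<lambda>xs. of_real (\<gamma> / real (frequency n xs (xs i)) - 1) * (Q (xs i) / ((1 + f (xs i)) + z * Q (xs i)))) \<in> borel_measurable (urn n)"
      if i: "i < n" for i
    proof -
      note [measurable] = measurable_frequency[OF i]
      have [measurable]: "(\<lambda>xs. xs i) \<in> seqs n \<rightarrow>\<^sub>M borel" using i by auto
      show ?thesis unfolding measurable_cong_sets[OF sets_urn refl] by measurable
    qed
    then have [measurable]: "(\<lambda>xs. \<Sum>i<n. of_real (\<gamma> / real (frequency n xs (xs i)) - 1) * (Q (xs i) / ((1 + f (xs i)) + z * Q (xs i)))) \<in> borel_measurable (urn n)"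
      by (intro borel_measurable_sum) auto
    show ?thesis unfolding W'_def by measurable
  qed
  have [measurable]: "box n A \<in> borel_measurable (urn n)"
    unfolding measurable_cong_sets[OF sets_urn refl] by measurable
  have dJ: "(J has_field_derivative (\<integral>xs. of_real (box n A xs) * W' 0 xs \<partial>urn n)) (at 0)"
    unfolding J_def
  proof (rule has_field_derivative_integral[where r = "e / 2" and B = "\<lambda>_. 1 * real n" and
      f' = "\<lambda>z xs. of_real (box n A xs) * W' z xs"])
    fix z :: complex and xs assume z: "z \<in> ball 0 (e / 2)"
    have "0 < Re ((1 + f x) + z * Q x)" for x using Re1[OF z, of x] by linarith
    then show "((\<lambda>z. of_real (box n A xs) * ?w z xs) has_field_derivative
        of_real (box n A xs) * W' z xs) (at z)"
      unfolding W'_def by (intro DERIV_cmult wprod_deriv)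
    have "norm (W' z xs) \<le> real n"
      unfolding W'_def by (rule wprod_deriv_bound[OF gam Re1[OF z] Q(2)])
    then show "norm (of_real (box n A xs) * W' z xs) \<le> 1 * real n"
      unfolding norm_mult using box_bounds by (intro mult_mono) auto
  next
    fix z :: complex assume z: "z \<in> ball 0 (e / 2)"
    show "integrable (urn n) (\<lambda>xs. of_real (box n A xs) * ?w z xs)"
    proof (rule pu.integrable_const_bound[where B = "1 * 1"], rule AE_I2)
      fix xs
      show "norm (of_real (box n A xs) * ?w z xs) \<le> 1 * 1"
        unfolding norm_mult using box_bounds norm_wprod_le_1[OF gam Re1[OF z]] by (intro mult_mono) auto
    qed measurable
  qed (use e in auto)
  have LR: "L z = exp (of_real \<beta>) * exp (- of_real \<beta> * I z) * J z" if z: "z \<in> ball 0 (e / 2)" for z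
  proof -
    have "L z = (\<integral>\<omega>. of_real (mass_prod n A \<omega>) * exp (- X (ff z) \<omega>) \<partial>M)"
      unfolding L_def
    proof (rule integral_cong_AE)
      show "AE \<omega> in M. of_real (mass_prod n A \<omega>) * E z \<omega> = of_real (mass_prod n A \<omega>) * exp (- X (ff z) \<omega>)"
        using EX[of z] by eventually_elim simp
    qed (use gint_measurable[OF gff] in measurable)
    also have "\<dots> = palm_rhs n A (ff z)" by (rule IH[OF gff Reff[OF z]])
    finally show ?thesis by (simp add: palm_rhs_def ff_def I_def J_def add.assoc)
  qed
  let ?I' = "\<integral>x. of_real \<gamma> * Q x * ((1 + f x) + 0 * Q x) powr of_real (\<gamma> - 1) \<partial>P0"
  let ?J' = "\<integral>xs. of_real (box n A xs) * W' 0 xs \<partial>urn n"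
  have "(L has_field_derivative (exp (of_real \<beta>) * (exp (- of_real \<beta> * I 0) * (- of_real \<beta> * ?I')) * J 0
      + exp (of_real \<beta>) * exp (- of_real \<beta> * I 0) * ?J')) (at 0)"
  proof (rule DERIV_cong_ev[THEN iffD2])
    have "\<forall>\<^sub>F z in nhds 0. z \<in> ball 0 (e / 2)"
      using e by (intro eventually_nhds_in_open) auto
    then show "\<forall>\<^sub>F z in nhds 0. L z = exp (of_real \<beta>) * exp (- of_real \<beta> * I z) * J z"
      by eventually_elim (rule LR)
    show "((\<lambda>z. exp (of_real \<beta>) * exp (- of_real \<beta> * I z) * J z) has_field_derivative
       (exp (of_real \<beta>) * (exp (- of_real \<beta> * I 0) * (- of_real \<beta> * ?I')) * J 0
      + exp (of_real \<beta>) * exp (- of_real \<beta> * I 0) * ?J')) (at 0)"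
      by (auto intro!: derivative_eq_intros dI dJ)
  qed auto
  from DERIV_unique[OF dL this]
  have eq: "(\<integral>\<omega>. of_real (mass_prod n A \<omega>) * (- of_real (b \<omega>) * E 0 \<omega>) \<partial>M)
     = exp (of_real \<beta>) * exp (- of_real \<beta> * I 0) * (- of_real \<beta> * ?I' * J 0 + ?J')"
    by (simp add: algebra_simps)
  have "(\<integral>\<omega>. of_real (mass_prod n A \<omega> * (S \<omega> * measure (P \<omega>) B)) * exp (- X f \<omega>) \<partial>M)
     = (\<integral>\<omega>. - (of_real (mass_prod n A \<omega>) * (- of_real (b \<omega>) * E 0 \<omega>)) \<partial>M)"
  proof (rule integral_cong_AE)
    show "AE \<omega> in M. of_real (mass_prod n A \<omega> * (S \<omega> * measure (P \<omega>) B)) * exp (- X f \<omega>)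
        = - (of_real (mass_prod n A \<omega>) * (- of_real (b \<omega>) * E 0 \<omega>))"
      using EX[of 0] by eventually_elim (simp add: b_def ff_def)
  qed measurable
  also have "\<dots> = - (\<integral>\<omega>. of_real (mass_prod n A \<omega>) * (- of_real (b \<omega>) * E 0 \<omega>) \<partial>M)"
    by (rule integral_minus)
  also have "\<dots> = exp (of_real \<beta>) * exp (- of_real \<beta> * I 0) * (of_real \<beta> * ?I' * J 0 - ?J')"
    unfolding eq by (simp add: algebra_simps)
  also have "of_real \<beta> * ?I' * J 0 - ?J' =
      (\<integral>xs. (of_real \<beta> * ?I') * (of_real (box n A xs) * ?w 0 xs) - of_real (box n A xs) * W' 0 xs \<partial>urn n)"
    unfolding J_def
  proof (subst Bochner_Integration.integral_diff)
    have z: "(0::complex) \<in> ball 0 (e / 2)" using e by simp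
    show "integrable (urn n) (\<lambda>xs. (of_real \<beta> * ?I') * (of_real (box n A xs) * ?w 0 xs))"
    proof (rule integrable_mult_right, rule pu.integrable_const_bound[where B = "1 * 1"], rule AE_I2)
      fix xs
      show "norm (of_real (box n A xs) * ?w 0 xs) \<le> 1 * 1"
        unfolding norm_mult using box_bounds norm_wprod_le_1[OF gam Re1[OF z]] by (intro mult_mono) auto
    qed measurable
    show "integrable (urn n) (\<lambda>xs. of_real (box n A xs) * W' 0 xs)"
    proof (rule pu.integrable_const_bound[where B = "1 * real n"], rule AE_I2)
      fix xs
      have "norm (W' 0 xs) \<le> real n"
        unfolding W'_def by (rule wprod_deriv_bound[OF gam Re1[OF z] Q(2)])
      then show "norm (of_real (box n A xs) * W' 0 xs) \<le> 1 * real n"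
        unfolding norm_mult using box_bounds by (intro mult_mono) auto
    qed measurable
  qed simp
  also have "\<dots> = (\<integral>xs. of_real (box n A xs) * (wprod \<gamma> n xs (\<lambda>x. 1 + f x) *
        ((\<Sum>j<n. of_real (1 - \<gamma> / real (frequency n xs (xs j))) * (indicator B (xs j) / (1 + f (xs j))))
         + of_real (\<beta> * \<gamma>) * (\<integral>x. indicator B x * (1 + f x) powr of_real (\<gamma> - 1) \<partial>P0))) \<partial>urn n)"
  proof (rule Bochner_Integration.integral_cong[OF refl])
    fix xs
    have I': "?I' = of_real \<gamma> * (\<integral>x. indicator B x * (1 + f x) powr of_real (\<gamma> - 1) \<partial>P0)"
      unfolding Q_def mult.assoc by (subst integral_mult_right_zero) simp
    \<comment> \<open>The sign change matters: the exponents \<open>\<gamma> / n\<^sub>j - 1\<close>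
      of \<open>wprod\<close> are negative, and the minus sign produced by
      \<open>exp (- X f)\<close> turns them into the nonnegative urn weights.\<close>
    have s: "(\<Sum>i<n. of_real (\<gamma> / real (frequency n xs (xs i)) - 1) * (Q (xs i) / ((1 + f (xs i)) + 0 * Q (xs i))))
      = - (\<Sum>j<n. of_real (1 - \<gamma> / real (frequency n xs (xs j))) * (indicator B (xs j) / (1 + f (xs j))))"
      unfolding sum_negf[symmetric] Q_def
      by (intro sum.cong refl) (simp add: algebra_simps)
    show "(of_real \<beta> * ?I') * (of_real (box n A xs) * ?w 0 xs) - of_real (box n A xs) * W' 0 xs
      = of_real (box n A xs) * (wprod \<gamma> n xs (\<lambda>x. 1 + f x) *
        ((\<Sum>j<n. of_real (1 - \<gamma> / real (frequency n xs (xs j))) * (indicator B (xs j) / (1 + f (xs j))))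
         + of_real (\<beta> * \<gamma>) * (\<integral>x. indicator B x * (1 + f x) powr of_real (\<gamma> - 1) \<partial>P0)))"
      unfolding I' W'_def s by (simp add: algebra_simps)
  qed
  finally show ?thesis by (simp add: I_def)
qed

text \<open>Read backwards, the derivative formula is one step of the urn: the sum over
  \<open>j\<close> copies an old value, the integral over \<open>P0\<close> adds a fresh one. The
  margin \<open>e\<close> is generalized in the induction because each differentiation halves
  it.\<close>

theorem palm:
  assumes "gint f" "e > 0" "\<And>x. Re (f x) \<ge> e" "\<And>i. i < n \<Longrightarrow> A i \<in> sets borel"
  shows "(\<integral>\<omega>. of_real (mass_prod n A \<omega>) * exp (- X f \<omega>) \<partial>M) = palm_rhs n A f"
  using assms
proof (induction n arbitrary: f e)
  case 0
  have "(\<integral>\<omega>. exp (- X f \<omega>) \<partial>M) = exp (- of_real \<beta> * ((\<integral>x. (1 + f x) powr of_real \<gamma> \<partial>P0) - 1))"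
    using laplace_complex[OF 0(1)] lap_rhs_diff[OF 0(1)] 0 by (metis order.strict_implies_order order_trans)
  also have "\<dots> = exp (of_real \<beta>) * exp (- of_real \<beta> * (\<integral>x. (1 + f x) powr of_real \<gamma> \<partial>P0))"
    by (simp add: exp_add[symmetric] algebra_simps)
  finally have "(\<integral>\<omega>. exp (- X f \<omega>) \<partial>M) = \<dots>" .
  moreover have "(\<integral>xs. of_real (box 0 A xs) * wprod \<gamma> 0 xs (\<lambda>x. 1 + f x) \<partial>urn 0) = 1"
    using prob_space.prob_space[OF prob_space_pu_0]
    by (simp add: box_def wprod_def distinct_values_def del: urn.simps)
  ultimately show ?case by (simp add: mass_prod_def palm_rhs_def del: urn.simps)
next
  case (Suc n)
  note [measurable] = gint_measurable[OF Suc.prems(1)]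
  have A: "A i \<in> sets borel" if "i < Suc n" for i using Suc.prems(4) that by blast
  have An: "A i \<in> sets borel" if "i < n" for i using A that by simp
  have B [measurable]: "A n \<in> sets borel" using A by simp
  have Re1: "Re (1 + f x) \<ge> 1" for x using Suc.prems(2) Suc.prems(3)[of x] by simp
  have nz: "1 + f x \<noteq> 0" for x using Re1[of x] by (metis not_one_le_zero zero_complex.simps(1))
  have "(\<integral>\<omega>. of_real (mass_prod (Suc n) A \<omega>) * exp (- X f \<omega>) \<partial>M)
      = (\<integral>\<omega>. of_real (mass_prod n A \<omega> * (S \<omega> * measure (P \<omega>) (A n))) * exp (- X f \<omega>) \<partial>M)"
    by (simp add: mass_prod_def)
  also have "\<dots> = exp (of_real \<beta>) * exp (- of_real \<beta> * (\<integral>x. (1 + f x) powr of_real \<gamma> \<partial>P0)) *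
      (\<integral>xs. of_real (box n A xs) * (wprod \<gamma> n xs (\<lambda>x. 1 + f x) *
        ((\<Sum>j<n. of_real (1 - \<gamma> / real (frequency n xs (xs j))) * (indicator (A n) (xs j) / (1 + f (xs j))))
         + of_real (\<beta> * \<gamma>) * (\<integral>x. indicator (A n) x * (1 + f x) powr of_real (\<gamma> - 1) \<partial>P0))) \<partial>urn n)"
    (is "_ = ?c * _")
  proof (rule palm_derivative[OF An B Suc.prems(1,2,3)])
    fix f assume f: "gint f" "\<And>x. Re (f x) \<ge> e / 2"
    show "(\<integral>\<omega>. of_real (mass_prod n A \<omega>) * exp (- X f \<omega>) \<partial>M) = palm_rhs n A f"
      by (rule Suc.IH[OF f(1) _ f(2) An]) (use Suc.prems(2) in auto)
  qed auto
  also have "(\<integral>xs. of_real (box n A xs) * (wprod \<gamma> n xs (\<lambda>x. 1 + f x) *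
        ((\<Sum>j<n. of_real (1 - \<gamma> / real (frequency n xs (xs j))) * (indicator (A n) (xs j) / (1 + f (xs j))))
         + of_real (\<beta> * \<gamma>) * (\<integral>x. indicator (A n) x * (1 + f x) powr of_real (\<gamma> - 1) \<partial>P0))) \<partial>urn n)
    = (\<integral>xs. of_real (box (Suc n) A xs) * wprod \<gamma> (Suc n) xs (\<lambda>x. 1 + f x) \<partial>urn (Suc n))"
  proof -
    let ?F = "\<lambda>xs. of_real (box (Suc n) A xs) * wprod \<gamma> (Suc n) xs (\<lambda>x. 1 + f x)"
    have "norm (?F xs) \<le> 1 * 1" for xs
      unfolding norm_mult using box_bounds norm_wprod_le_1[OF gam Re1] by (intro mult_mono) auto
    moreover have "?F \<in> borel_measurable (seqs (Suc n))"
    proof -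
      have [measurable]: "box (Suc n) A \<in> borel_measurable (seqs (Suc n))"
        by (rule box_measurable[OF A])
      have [measurable]: "(\<lambda>xs. wprod \<gamma> (Suc n) xs (\<lambda>x. 1 + f x)) \<in> borel_measurable (seqs (Suc n))"
        by (rule measurable_wprod) measurable
      show ?thesis by measurable
    qed
    moreover note Fm = this
    ultimately have "(\<integral>xs. ?F xs \<partial>urn (Suc n)) =
      (\<integral>xs. (\<Sum>j<n. of_real (1 - \<gamma> / real (frequency n xs (xs j))) * ?F (xs(n := xs j)))
        + of_real (\<beta> * \<gamma>) * (\<integral>x. ?F (xs(n := x)) \<partial>P0) \<partial>urn n)"
      unfolding urn.simps by (intro urn_step_integral[OF sets_urn finite_urn])
    also have "\<dots> = (\<integral>xs. of_real (box n A xs) * (wprod \<gamma> n xs (\<lambda>x. 1 + f x) *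
        ((\<Sum>j<n. of_real (1 - \<gamma> / real (frequency n xs (xs j))) * (indicator (A n) (xs j) / (1 + f (xs j))))
         + of_real (\<beta> * \<gamma>) * (\<integral>x. indicator (A n) x * (1 + f x) powr of_real (\<gamma> - 1) \<partial>P0))) \<partial>urn n)"
    proof (rule Bochner_Integration.integral_cong[OF refl])
      fix xs assume "xs \<in> space (urn n)"
      then have xs: "xs \<in> space (seqs n)" using sets_eq_imp_space_eq[OF sets_urn] by simp
      have bx: "of_real (box (Suc n) A (xs(n := x))) = of_real (box n A xs) * (indicator (A n) x :: complex)" for x
        by (auto simp: box_def indicator_def)
      have old: "?F (xs(n := xs j)) = of_real (box n A xs) * (wprod \<gamma> n xs (\<lambda>x. 1 + f x) * (indicator (A n) (xs j) / (1 + f (xs j))))"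
        if "j < n" for j
      proof -
        have "xs j \<in> distinct_values n xs" using that by (auto simp: distinct_values_def)
        then show ?thesis unfolding bx using nz by (subst wprod_Suc_old) auto
      qed
      \<comment> \<open>By non-atomicity a fresh draw differs almost surely from the finitely many
        old values, so it really has multiplicity one and enters with exponent
        \<open>\<gamma> - 1\<close>.\<close>
      have "AE x in P0. \<forall>y\<in>distinct_values n xs. x \<noteq> y"
      proof (rule AE_ball_countable')
        fix y show "AE x in P0. x \<noteq> y"
          by (rule AE_I[where N = "{y}"]) (auto simp: nonatomic)
      qed (simp add: countable_finite)
      then have "(\<integral>x. ?F (xs(n := x)) \<partial>P0) = (\<integral>x. of_real (box n A xs) * (wprod \<gamma> n xs (\<lambda>x. 1 + f x) * (indicator (A n) x * (1 + f x) powr of_real (\<gamma> - 1))) \<partial>P0)"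
      proof (intro integral_cong_AE)
        have "(\<lambda>x. xs(n := x)) \<in> borel \<rightarrow>\<^sub>M seqs (Suc n)"
          unfolding lessThan_Suc using xs by (intro measurable_fun_upd[where J = "{..<n}"]) auto
        from measurable_compose[OF this Fm] show "(\<lambda>x. ?F (xs(n := x))) \<in> borel_measurable P0"
          by (simp add: borel_P0)
        show "(\<lambda>x. of_real (box n A xs) * (wprod \<gamma> n xs (\<lambda>x. 1 + f x) * (indicator (A n) x * (1 + f x) powr of_real (\<gamma> - 1)))) \<in> borel_measurable P0"
          unfolding borel_P0 by measurable
        assume "AE x in P0. \<forall>y\<in>distinct_values n xs. x \<noteq> y"
        then show "AE x in P0. ?F (xs(n := x)) = of_real (box n A xs) * (wprod \<gamma> n xs (\<lambda>x. 1 + f x) * (indicator (A n) x * (1 + f x) powr of_real (\<gamma> - 1)))"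
        proof eventually_elim
          case (elim x)
          then have "x \<notin> distinct_values n xs" by auto
          then show ?case unfolding bx by (simp add: wprod_Suc_new)
        qed
      qed
      also have "\<dots> = of_real (box n A xs) * (wprod \<gamma> n xs (\<lambda>x. 1 + f x) * (\<integral>x. indicator (A n) x * (1 + f x) powr of_real (\<gamma> - 1) \<partial>P0))"
        by (simp only: integral_mult_right_zero)
      finally have new: "(\<integral>x. ?F (xs(n := x)) \<partial>P0) = \<dots>" .
      have "(\<Sum>j<n. of_real (1 - \<gamma> / real (frequency n xs (xs j))) * ?F (xs(n := xs j)))
        = of_real (box n A xs) * (wprod \<gamma> n xs (\<lambda>x. 1 + f x) *
          (\<Sum>j<n. of_real (1 - \<gamma> / real (frequency n xs (xs j))) * (indicator (A n) (xs j) / (1 + f (xs j)))))"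
        unfolding sum_distrib_left by (intro sum.cong refl, subst old) (auto simp: mult_ac)
      then show "(\<Sum>j<n. of_real (1 - \<gamma> / real (frequency n xs (xs j))) * ?F (xs(n := xs j)))
          + of_real (\<beta> * \<gamma>) * (\<integral>x. ?F (xs(n := x)) \<partial>P0)
        = of_real (box n A xs) * (wprod \<gamma> n xs (\<lambda>x. 1 + f x) *
        ((\<Sum>j<n. of_real (1 - \<gamma> / real (frequency n xs (xs j))) * (indicator (A n) (xs j) / (1 + f (xs j))))
         + of_real (\<beta> * \<gamma>) * (\<integral>x. indicator (A n) x * (1 + f x) powr of_real (\<gamma> - 1) \<partial>P0)))"
        unfolding new by (simp only: distrib_left mult_ac)
    qed
    finally show ?thesis ..
  qed
  finally show ?case by (simp add: palm_rhs_def)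
qed

end

section \<open>Rotation of the path of integration\<close>

lemma integrable_inverse_one_plus_square: "integrable lborel (\<lambda>x::real. inverse (1 + x\<^sup>2))"
  using integrable_inverse_1_plus_square by (simp add: set_integrable_def einterval_def)

text \<open>Two spare powers of \<open>1 + s\<close> pay for the integrable majorant
  \<open>inverse (1 + s\<^sup>2)\<close>.\<close>

lemma one_plus_power_bound:
  fixes s :: real
  assumes "0 \<le> s" "0 \<le> y" "y * (1 + s) ^ (m + 2) \<le> C"
  shows "s ^ m * y \<le> C * inverse (1 + s\<^sup>2)"
proof -
  have "s ^ m * y * (1 + s\<^sup>2) \<le> (1 + s) ^ m * y * (1 + s) ^ 2"
    using assms by (intro mult_mono power_mono) (auto simp: power2_eq_square algebra_simps)
  also have "\<dots> = y * (1 + s) ^ (m + 2)" by (simp add: power_add power2_eq_square mult_ac)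
  also have "\<dots> \<le> C" by (rule assms)
  finally show ?thesis using zero_le_power2[of s] by (simp add: divide_simps add_pos_nonneg)
qed

lemma set_integrable_power_mult:
  fixes h :: "real \<Rightarrow> 'b::{banach,second_countable_topology}"
  assumes [measurable]: "(\<lambda>s. indicator {0<..} s *\<^sub>R h s) \<in> borel_measurable borel"
    and bd: "\<And>s. 0 < s \<Longrightarrow> norm (h s) * (1 + s) ^ (m + 2) \<le> C"
  shows "set_integrable lborel {0<..} (\<lambda>s. s ^ m *\<^sub>R h s)"
  unfolding set_integrable_def
proof (rule Bochner_Integration.integrable_bound)
  show "integrable lborel (\<lambda>s::real. C * inverse (1 + s\<^sup>2))"
    by (intro integrable_mult_right integrable_inverse_one_plus_square)
  have "(\<lambda>s. s ^ m *\<^sub>R (indicator {0<..} s *\<^sub>R h s)) \<in> borel_measurable lborel" by measurable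
  moreover have "(\<lambda>s. s ^ m *\<^sub>R (indicator {0<..} s *\<^sub>R h s)) = (\<lambda>s. indicator {0<..} s *\<^sub>R s ^ m *\<^sub>R h s)"
    by (auto simp: indicator_def)
  ultimately show "(\<lambda>s. indicator {0<..} s *\<^sub>R s ^ m *\<^sub>R h s) \<in> borel_measurable lborel" by simp
  have C: "0 \<le> C" by (rule order_trans[OF _ bd[of 1]]) auto
  show "AE s in lborel. norm (indicator {0<..} s *\<^sub>R s ^ m *\<^sub>R h s) \<le> norm (C * inverse (1 + s\<^sup>2))"
  proof (rule AE_I2)
    fix s :: real
    have "s ^ m * norm (h s) \<le> C * inverse (1 + s\<^sup>2)" if "0 < s"
      using that bd[OF that] by (intro one_plus_power_bound) auto
    then show "norm (indicator {0<..} s *\<^sub>R s ^ m *\<^sub>R h s) \<le> norm (C * inverse (1 + s\<^sup>2))"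
      using C by (auto simp: indicator_def)
  qed
qed

lemma integral_halfline_deriv:
  fixes F f :: "real \<Rightarrow> complex"
  assumes "\<And>s. s > 0 \<Longrightarrow> (F has_vector_derivative f s) (at s)" "\<And>s. s > 0 \<Longrightarrow> isCont f s"
    and "set_integrable lborel {0<..} f" "(F \<longlongrightarrow> a) (at_right 0)" "(F \<longlongrightarrow> 0) at_top"
  shows "(LBINT s:{0<..}. f s) = - a"
proof -
  have "(LBINT s=0..\<infinity>. f s) = 0 - a"
  proof (rule interval_integral_FTC_integrable)
    show "set_integrable lborel (einterval 0 \<infinity>) f"
      using assms(3) by (simp add: einterval_def zero_ereal_def greaterThan_def)
    show "((F \<circ> real_of_ereal) \<longlongrightarrow> a) (at_right 0)"
      unfolding zero_ereal_def using assms(4) by (simp add: ereal_tendsto_simps)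
    show "((F \<circ> real_of_ereal) \<longlongrightarrow> 0) (at_left \<infinity>)"
      using assms(5) by (simp add: ereal_tendsto_simps)
  qed (use assms in \<open>auto simp: zero_ereal_def\<close>)
  moreover have "(LBINT s=0..\<infinity>. f s) = (LBINT s:{0<..}. f s)"
    by (simp add: interval_lebesgue_integral_def einterval_def zero_ereal_def greaterThan_def)
  ultimately show ?thesis by simp
qed

text \<open>The rays of integration start on the line \<open>Re w = 1\<close>. The larger half-plane
  provides open neighbourhoods, and for \<open>Re w > 3/4\<close> circles of radius
  \<open>1/4\<close> remain inside it, so that Cauchy's inequality passes the decay on to the
  derivative.\<close>

locale rapid =
  fixes k :: "complex \<Rightarrow> complex"
  assumes hol: "k holomorphic_on {w. Re w > 1/2}"
    and decay: "\<And>N. \<exists>B. \<forall>w. Re w > 1/2 \<longrightarrow> norm (k w) * (1 + norm w) ^ N \<le> B"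
begin

lemma deriv_decay: "\<exists>B. \<forall>w. Re w > 3/4 \<longrightarrow> norm (deriv k w) * (1 + norm w) ^ N \<le> B"
proof -
  obtain B where B: "\<And>w. Re w > 1/2 \<Longrightarrow> norm (k w) * (1 + norm w) ^ N \<le> B" using decay by blast
  have "norm (deriv k w) * (1 + norm w) ^ N \<le> 4 * B * 2 ^ N" if w: "Re w > 3/4" for w
  proof -
    have sub: "cball w (1/4) \<subseteq> {w. Re w > 1/2}"
    proof
      fix z assume "z \<in> cball w (1/4)"
      then have "\<bar>Re (w - z)\<bar> \<le> 1/4" using abs_Re_le_cmod[of "w - z"] by (simp add: dist_norm)
      then have "\<bar>Re w - Re z\<bar> \<le> 1/4" by simp
      with w show "z \<in> {w. Re w > 1/2}" unfolding mem_Collect_eq by linarith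
    qed
    have "norm ((deriv ^^ 1) k w) \<le> fact 1 * (B * 2 ^ N / (1 + norm w) ^ N) / (1/4) ^ 1"
    proof (rule Cauchy_inequality)
      show "k holomorphic_on ball w (1/4)" using sub ball_subset_cball by (intro holomorphic_on_subset[OF hol]) blast
      show "continuous_on (cball w (1/4)) k" using sub by (intro holomorphic_on_imp_continuous_on holomorphic_on_subset[OF hol])
      fix z assume z: "norm (w - z) = 1/4"
      then have "z \<in> cball w (1/4)" by (simp add: dist_norm)
      then have rz: "Re z > 1/2" using sub by blast
      have "norm w \<le> norm z + 1/4" using z norm_triangle_ineq3[of w z] by simp
      then have "1 + norm w \<le> 2 * (1 + norm z)" using norm_ge_zero[of z] by argo
      then have "(1 + norm w) ^ N \<le> (2 * (1 + norm z)) ^ N" by (intro power_mono) auto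
      then have "norm (k z) * (1 + norm w) ^ N \<le> norm (k z) * (2 ^ N * (1 + norm z) ^ N)"
        unfolding power_mult_distrib by (intro mult_left_mono) auto
      also have "\<dots> \<le> B * 2 ^ N" using B[OF rz] by (simp add: mult_ac)
      finally show "norm (k z) \<le> B * 2 ^ N / (1 + norm w) ^ N"
        by (simp add: pos_le_divide_eq add_pos_nonneg)
    qed simp
    then show ?thesis by (simp add: field_simps add_pos_nonneg)
  qed
  then show ?thesis by blast
qed

text \<open>Up to sign and a factor \<open>(m - 1)!\<close>, this is the \<open>m\<close>-fold primitive of \<open>k\<close> that vanishes at
  infinity, computed along the ray from \<open>w\<close> in the direction \<open>e\<close>.\<close>

definition T :: "complex \<Rightarrow> nat \<Rightarrow> complex \<Rightarrow> complex" where
  "T e m w = e ^ m * (LBINT s:{0<..}. s ^ (m - 1) *\<^sub>R k (w + e * of_real s))"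

text \<open>Decay in the modulus of the shifted point is traded for decay in the parameter
  \<open>s\<close> along the ray, at the price of a factor that depends only on the starting
  point.\<close>

lemma one_plus_shift:
  fixes e w :: complex
  assumes "norm e = 1" "0 \<le> s"
  shows "(1 + s) ^ N \<le> (1 + norm (w + e * of_real s)) ^ N * (1 + norm w) ^ N"
proof -
  have "s = norm (e * of_real s :: complex)" using assms by (simp add: norm_mult)
  also have "\<dots> \<le> norm (w + e * of_real s) + norm w"
    using norm_triangle_ineq4[of "w + e * of_real s" w] by simp
  finally have "1 + s \<le> (1 + norm (w + e * of_real s)) * (1 + norm w)"
    using mult_nonneg_nonneg[OF norm_ge_zero[of w] norm_ge_zero[of "w + e * of_real s"]]
    unfolding distrib_left distrib_right mult.commute[of "norm w"] mult_1 mult_1_right by linarith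
  then show ?thesis using assms unfolding power_mult_distrib[symmetric] by (intro power_mono) auto
qed

lemma Re_shift: "Re e \<ge> 0 \<Longrightarrow> s \<ge> 0 \<Longrightarrow> Re (w + e * of_real s) \<ge> Re w"
  by simp

lemma shift_bound:
  fixes h :: "complex \<Rightarrow> 'b::real_normed_vector" and B :: real
  assumes "norm e = 1" "Re e \<ge> 0" "0 \<le> s" "Re w > r"
    and B: "\<And>w. Re w > r \<Longrightarrow> norm (h w) * (1 + norm w) ^ N \<le> B"
  shows "norm (h (w + e * of_real s)) * (1 + s) ^ N \<le> B * (1 + norm w) ^ N"
proof -
  have "norm (h (w + e * of_real s)) * (1 + s) ^ N
      \<le> norm (h (w + e * of_real s)) * ((1 + norm (w + e * of_real s)) ^ N * (1 + norm w) ^ N)"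
    using one_plus_shift[of e s N w] assms by (intro mult_left_mono) auto
  also have "\<dots> = (norm (h (w + e * of_real s)) * (1 + norm (w + e * of_real s)) ^ N) * (1 + norm w) ^ N"
    by simp
  also have "\<dots> \<le> B * (1 + norm w) ^ N"
    using less_le_trans[OF assms(4) Re_shift[of e s w]] assms by (intro mult_right_mono B) auto
  finally show ?thesis .
qed

lemma cont_shift:
  assumes "Re e \<ge> 0" "Re w > 1/2" and h: "h holomorphic_on {w. Re w > 1/2}"
  shows "continuous_on {0<..} (\<lambda>s. h (w + e * of_real s))"
proof (rule continuous_on_compose2[OF holomorphic_on_imp_continuous_on[OF h]])
  show "(\<lambda>s. w + e * of_real s) ` {0<..} \<subseteq> {w. Re w > 1/2}"
    using less_le_trans[OF assms(2) Re_shift[of e _ w]] assms by auto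
qed (intro continuous_intros)

lemma meas_shift:
  assumes "Re e \<ge> 0" "Re w > 1/2" and h: "h holomorphic_on {w. Re w > 1/2}"
  shows "(\<lambda>s. indicator {0<..} s *\<^sub>R h (w + e * of_real s)) \<in> borel_measurable borel"
  using cont_shift[OF assms] by (intro borel_measurable_continuous_on_indicator) auto

lemma T_integrable:
  assumes e: "norm e = 1" "Re e \<ge> 0" and w: "Re w > 1/2"
  shows "set_integrable lborel {0<..} (\<lambda>s. s ^ m *\<^sub>R k (w + e * of_real s))"
proof -
  obtain B where B: "\<And>w. Re w > 1/2 \<Longrightarrow> norm (k w) * (1 + norm w) ^ (m + 2) \<le> B" using decay by blast
  show ?thesis
  proof (rule set_integrable_power_mult[OF meas_shift[OF e(2) w hol]])
    show "norm (k (w + e * of_real s)) * (1 + s) ^ (m + 2) \<le> B * (1 + norm w) ^ (m + 2)" if "0 < s" for s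
      using that by (intro shift_bound[OF e _ w B]) auto
  qed
qed

lemma hol_deriv: "deriv k holomorphic_on {w. Re w > 1/2}"
  by (rule holomorphic_deriv[OF hol open_halfspace_Re_gt])

lemma k_deriv: "Re w > 1/2 \<Longrightarrow> (k has_field_derivative deriv k w) (at w)"
  by (rule holomorphic_derivI[OF hol open_halfspace_Re_gt]) simp

lemma T'_integrable:
  assumes e: "norm e = 1" "Re e \<ge> 0" and w: "Re w > 3/4"
  shows "set_integrable lborel {0<..} (\<lambda>s. s ^ m *\<^sub>R deriv k (w + e * of_real s))"
proof -
  obtain B where B: "\<And>w. Re w > 3/4 \<Longrightarrow> norm (deriv k w) * (1 + norm w) ^ (m + 2) \<le> B"
    using deriv_decay by blast
  have w': "Re w > 1/2" using w by simp
  show ?thesis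
  proof (rule set_integrable_power_mult[OF meas_shift[OF e(2) w' hol_deriv]])
    show "norm (deriv k (w + e * of_real s)) * (1 + s) ^ (m + 2) \<le> B * (1 + norm w) ^ (m + 2)" if "0 < s" for s
      using that by (intro shift_bound[OF e _ w B]) auto
  qed
qed

lemma T_deriv_raw:
  assumes e: "norm e = 1" "Re e \<ge> 0" and w: "Re w > 3/4"
  shows "((\<lambda>w. LBINT s:{0<..}. s ^ m *\<^sub>R k (w + e * of_real s)) has_field_derivative
      (LBINT s:{0<..}. s ^ m *\<^sub>R deriv k (w + e * of_real s))) (at w)"
proof -
  define r where "r = Re w - 3/4"
  have r: "r > 0" using w by (simp add: r_def)
  have ball: "Re z > 3/4 \<and> norm z \<le> norm w + r" if "z \<in> ball w r" for z
  proof -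
    have "\<bar>Re (w - z)\<bar> < r" using that abs_Re_le_cmod[of "w - z"] by (simp add: dist_norm)
    moreover have "norm z \<le> norm w + r" using that norm_triangle_ineq3[of w z] by (simp add: dist_norm)
    ultimately show ?thesis by (simp add: r_def)
  qed
  obtain B where B: "\<And>w. Re w > 3/4 \<Longrightarrow> norm (deriv k w) * (1 + norm w) ^ (m + 2) \<le> B"
    using deriv_decay by blast
  have B0: "B \<ge> 0" by (rule order_trans[OF _ B[of 1]]) auto
  define C where "C = B * (1 + (norm w + r)) ^ (m + 2)"
  show ?thesis
    unfolding set_lebesgue_integral_def
  proof (rule has_field_derivative_integral[OF r, where B = "\<lambda>s. C * inverse (1 + s\<^sup>2)" and
       f' = "\<lambda>w s. indicator {0<..} s *\<^sub>R s ^ m *\<^sub>R deriv k (w + e * of_real s)"])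
    fix z s assume z: "z \<in> ball w r"
    show "((\<lambda>z. indicator {0<..} s *\<^sub>R s ^ m *\<^sub>R k (z + e * of_real s)) has_field_derivative
        indicator {0<..} s *\<^sub>R s ^ m *\<^sub>R deriv k (z + e * of_real s)) (at z)"
    proof (cases "s > 0")
      case True
      then have "Re z \<le> Re (z + e * of_real s)" using e by (intro Re_shift) auto
      then have "Re (z + e * of_real s) > 1/2" using ball[OF z] by linarith
      then have "((\<lambda>z. k (z + e * of_real s)) has_field_derivative deriv k (z + e * of_real s) * 1) (at z)"
        by (intro DERIV_chain2[OF k_deriv]) (auto intro!: derivative_eq_intros)
      then show ?thesis
        using True by (simp add: scaleR_conv_of_real DERIV_cmult)
    qed simp
    show "norm (indicator {0<..} s *\<^sub>R s ^ m *\<^sub>R deriv k (z + e * of_real s)) \<le> C * inverse (1 + s\<^sup>2)"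
    proof (cases "s > 0")
      case True
      have "norm (deriv k (z + e * of_real s)) * (1 + s) ^ (m + 2) \<le> B * (1 + norm z) ^ (m + 2)"
        using ball[OF z] True by (intro shift_bound[OF e _ _ B, where r = "3/4"]) auto
      also have "\<dots> \<le> C" unfolding C_def using ball[OF z] B0 by (intro mult_left_mono power_mono) auto
      finally have "s ^ m * norm (deriv k (z + e * of_real s)) \<le> C * inverse (1 + s\<^sup>2)"
        using True by (intro one_plus_power_bound) auto
      then show ?thesis using True by simp
    next
      case False
      have "0 \<le> C" unfolding C_def using B0 r by (auto intro!: mult_nonneg_nonneg)
      with False show ?thesis by simp
    qed
  next
    fix z assume "z \<in> ball w r"
    then show "integrable lborel (\<lambda>s. indicator {0<..} s *\<^sub>R s ^ m *\<^sub>R k (z + e * of_real s))"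
      using T_integrable[OF e, of z m] ball[of z] by (simp add: set_integrable_def)
  next
    show "(\<lambda>s. indicator {0<..} s *\<^sub>R s ^ m *\<^sub>R deriv k (w + e * of_real s)) \<in> borel_measurable lborel"
      using T'_integrable[OF e w, of m] by (simp add: set_integrable_def)
    show "integrable lborel (\<lambda>s::real. C * inverse (1 + s\<^sup>2))"
      by (intro integrable_mult_right integrable_inverse_one_plus_square)
  qed
qed

lemma tendsto_power_shift:
  assumes e: "norm e = 1" "Re e \<ge> 0" and w: "Re w > 1/2"
  shows "((\<lambda>s. s ^ m *\<^sub>R k (w + e * of_real s)) \<longlongrightarrow> 0) at_top"
proof -
  obtain B where B: "\<And>w. Re w > 1/2 \<Longrightarrow> norm (k w) * (1 + norm w) ^ (m + 2) \<le> B" using decay by blast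
  have "((\<lambda>s. B * (1 + norm w) ^ (m + 2) * inverse (1 + s\<^sup>2)) \<longlongrightarrow> 0) at_top" by real_asymp
  moreover have "\<forall>\<^sub>F s in at_top. norm (s ^ m *\<^sub>R k (w + e * of_real s)) \<le> B * (1 + norm w) ^ (m + 2) * inverse (1 + s\<^sup>2)"
    using eventually_ge_at_top[of 0]
  proof eventually_elim
    case (elim s)
    have "s ^ m * norm (k (w + e * of_real s)) \<le> B * (1 + norm w) ^ (m + 2) * inverse (1 + s\<^sup>2)"
      using elim by (intro one_plus_power_bound shift_bound[OF e _ w B]) auto
    then show ?case using elim by simp
  qed
  ultimately show ?thesis by (rule Lim_null_comparison[rotated])
qed

text \<open>Along the ray the derivative in \<open>s\<close> is \<open>e\<close> times the complex
  derivative, so the latter can be integrated by parts. The boundary term at \<open>s = 0\<close>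
  survives only without a power of \<open>s\<close>.\<close>

lemma T_parts:
  assumes e: "norm e = 1" "Re e \<ge> 0" and w: "Re w > 3/4"
  shows "e * (LBINT s:{0<..}. s ^ m *\<^sub>R deriv k (w + e * of_real s)) =
    (if m = 0 then - k w else - of_nat m * (LBINT s:{0<..}. s ^ (m - 1) *\<^sub>R k (w + e * of_real s)))"
proof -
  have w': "Re w > 1/2" using w by simp
  have Re_pos: "Re (w + e * of_real s) > 1/2" if "s \<ge> 0" for s using Re_shift[of e s w] e w' that by linarith
  define f where "f s = of_nat m * (s ^ (m - 1) *\<^sub>R k (w + e * of_real s)) + e * (s ^ m *\<^sub>R deriv k (w + e * of_real s))" for s :: real
  have dF: "((\<lambda>s. s ^ m *\<^sub>R k (w + e * of_real s)) has_vector_derivative f s) (at s)" if "s > 0" for s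
  proof -
    have "((\<lambda>s. w + e * of_real s) has_vector_derivative e) (at s)"
      by (auto intro!: derivative_eq_intros)
    then have "((\<lambda>s. k (w + e * of_real s)) has_vector_derivative e * deriv k (w + e * of_real s)) (at s)"
      using Re_pos[of s] that by (intro field_vector_diff_chain_at[unfolded comp_def] k_deriv) auto
    moreover have "((\<lambda>s. s ^ m) has_real_derivative (real m * s ^ (m - 1))) (at s)"
      by (auto intro!: derivative_eq_intros)
    ultimately have "((\<lambda>s. s ^ m *\<^sub>R k (w + e * of_real s)) has_vector_derivative
        s ^ m *\<^sub>R (e * deriv k (w + e * of_real s)) + (real m * s ^ (m - 1)) *\<^sub>R k (w + e * of_real s)) (at s)"
      by (intro has_vector_derivative_scaleR)
    then show ?thesis unfolding f_def by (simp add: scaleR_conv_of_real algebra_simps)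
  qed
  have cf: "isCont f s" if "s > 0" for s
  proof -
    have "isCont (\<lambda>s. h (w + e * of_real s)) s" if h: "h holomorphic_on {w. Re w > 1/2}" for h
      using cont_shift[OF e(2) w' h] \<open>s > 0\<close> by (simp add: continuous_on_eq_continuous_at)
    from this[OF hol] this[OF hol_deriv] show ?thesis unfolding f_def by (intro continuous_intros)
  qed
  have i1: "set_integrable lborel {0<..} (\<lambda>s. of_nat m * (s ^ (m - 1) *\<^sub>R k (w + e * of_real s)))"
    by (intro set_integrable_mult_right impI T_integrable e w')
  have i2: "set_integrable lborel {0<..} (\<lambda>s. e * (s ^ m *\<^sub>R deriv k (w + e * of_real s)))"
    by (intro set_integrable_mult_right impI T'_integrable e w)
  have "(LBINT s:{0<..}. f s) = - (if m = 0 then k w else 0)"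
  proof (rule integral_halfline_deriv[OF dF cf])
    show "set_integrable lborel {0<..} f" unfolding f_def by (rule set_integral_add(1)[OF i1 i2])
    have "isCont (\<lambda>s. k (w + e * of_real s)) 0"
    proof (rule isCont_o2[where f = "\<lambda>s. w + e * of_real s" and g = k])
      show "isCont (\<lambda>s. w + e * of_real s) 0" by (intro continuous_intros)
      show "isCont k (w + e * of_real 0)" using DERIV_isCont[OF k_deriv[OF w']] by simp
    qed
    then have "((\<lambda>s. s ^ m *\<^sub>R k (w + e * of_real s)) \<longlongrightarrow> 0 ^ m *\<^sub>R k w) (at 0)"
      by (intro tendsto_intros) (simp add: isCont_def)
    then have "((\<lambda>s. s ^ m *\<^sub>R k (w + e * of_real s)) \<longlongrightarrow> (if m = 0 then k w else 0)) (at 0)"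
      by (cases m) simp_all
    then show "((\<lambda>s. s ^ m *\<^sub>R k (w + e * of_real s)) \<longlongrightarrow> (if m = 0 then k w else 0)) (at_right 0)"
      by (rule tendsto_within_subset[of _ _ _ UNIV]) auto
    show "((\<lambda>s. s ^ m *\<^sub>R k (w + e * of_real s)) \<longlongrightarrow> 0) at_top"
      by (rule tendsto_power_shift[OF e w'])
  qed
  also have "(LBINT s:{0<..}. f s) = of_nat m * (LBINT s:{0<..}. s ^ (m - 1) *\<^sub>R k (w + e * of_real s))
      + e * (LBINT s:{0<..}. s ^ m *\<^sub>R deriv k (w + e * of_real s))"
    unfolding f_def set_integral_add(2)[OF i1 i2] set_integral_mult_right ..
  finally show ?thesis by (cases "m = 0") (auto simp: algebra_simps add_eq_0_iff)
qed

text \<open>The power of \<open>e\<close> in the definition of \<open>T\<close> is chosen so that it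
  is used up by the integration by parts: the resulting recursion is the same for every
  direction.\<close>

lemma T_deriv:
  assumes e: "norm e = 1" "Re e \<ge> 0" and w: "Re w > 3/4"
  shows "(T e (Suc m) has_field_derivative (if m = 0 then - k w else - of_nat m * T e m w)) (at w)"
proof -
  have "(T e (Suc m) has_field_derivative e ^ Suc m * (LBINT s:{0<..}. s ^ m *\<^sub>R deriv k (w + e * of_real s))) (at w)"
    unfolding T_def using DERIV_cmult[OF T_deriv_raw[OF e w, of m], of "e ^ Suc m"] by simp
  also have "e ^ Suc m * (LBINT s:{0<..}. s ^ m *\<^sub>R deriv k (w + e * of_real s))
    = e ^ m * (if m = 0 then - k w else - of_nat m * (LBINT s:{0<..}. s ^ (m - 1) *\<^sub>R k (w + e * of_real s)))"
    unfolding T_parts[OF e w, symmetric] by simp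
  also have "\<dots> = (if m = 0 then - k w else - of_nat m * T e m w)"
    by (simp add: T_def)
  finally show ?thesis .
qed

text \<open>For both directions the points of the ray starting at \<open>x\<close> have modulus at
  least \<open>x\<close> and at least \<open>s\<close>. Of the powers provided by
  \<open>decay\<close>, \<open>m - 1\<close> cancel the power of \<open>s\<close>, two make the
  integral converge and one remains for the decay in \<open>x\<close>.\<close>

lemma T_tendsto_0:
  assumes e: "e = 1 \<or> e = - \<i>"
  shows "((\<lambda>x. T e m (of_real x)) \<longlongrightarrow> 0) at_top"
proof -
  have e': "norm e = 1" "Re e \<ge> 0" using e by auto
  obtain B where B: "\<And>w. Re w > 1/2 \<Longrightarrow> norm (k w) * (1 + norm w) ^ (m - 1 + 2 + 1) \<le> B" using decay by blast
  have B0: "B \<ge> 0" by (rule order_trans[OF _ B[of 1]]) auto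
  have "norm (T e m (of_real x)) \<le> (\<integral>s. B * inverse (1 + s\<^sup>2) \<partial>lborel) * inverse (1 + x)" if x: "x \<ge> 1" for x
  proof -
    have "norm (T e m (of_real x)) \<le> norm (LBINT s:{0<..}. s ^ (m - 1) *\<^sub>R k (of_real x + e * of_real s))"
      unfolding T_def norm_mult norm_power e' by simp
    also have "\<dots> \<le> (\<integral>s. (B * inverse (1 + x)) * inverse (1 + s\<^sup>2) \<partial>lborel)"
      unfolding set_lebesgue_integral_def
    proof (rule Bochner_Integration.integral_norm_bound_integral)
      show "integrable lborel (\<lambda>s. indicator {0<..} s *\<^sub>R s ^ (m - 1) *\<^sub>R k (of_real x + e * of_real s))"
        using T_integrable[OF e', of "of_real x"] x by (simp add: set_integrable_def)
      show "integrable lborel (\<lambda>s::real. (B * inverse (1 + x)) * inverse (1 + s\<^sup>2))"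
        by (intro integrable_mult_right integrable_inverse_one_plus_square)
      fix s :: real
      show "norm (indicator {0<..} s *\<^sub>R s ^ (m - 1) *\<^sub>R k (of_real x + e * of_real s)) \<le> (B * inverse (1 + x)) * inverse (1 + s\<^sup>2)"
      proof (cases "s > 0")
        case True
        define w where "w = of_real x + e * of_real s"
        have Re_w: "Re w \<ge> x" unfolding w_def using Re_shift[of e s "of_real x"] e' True by simp
        have nw: "norm w \<ge> x" using Re_w complex_Re_le_cmod[of w] by linarith
        have ns: "norm w \<ge> s"
          using e abs_Re_le_cmod[of w] abs_Im_le_cmod[of w] x True by (auto simp: w_def)
        have "norm (k w) * (1 + s) ^ (m - 1 + 2) * (1 + x) \<le> norm (k w) * (1 + norm w) ^ (m - 1 + 2) * (1 + norm w)"
          using nw ns True x by (intro mult_mono mult_left_mono power_mono) auto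
        also have "\<dots> = norm (k w) * (1 + norm w) ^ (m - 1 + 2 + 1)" by (simp add: mult_ac)
        also have "\<dots> \<le> B" using Re_w x by (intro B) auto
        finally have "norm (k w) * (1 + s) ^ (m - 1 + 2) \<le> B * inverse (1 + x)"
          using x by (simp add: divide_simps)
        then have "s ^ (m - 1) * norm (k w) \<le> (B * inverse (1 + x)) * inverse (1 + s\<^sup>2)"
          using True by (intro one_plus_power_bound) auto
        then show ?thesis using True by (simp add: w_def)
      qed (use B0 x in simp)
    qed
    finally show ?thesis by (simp add: mult_ac)
  qed
  then have "\<forall>\<^sub>F x in at_top. norm (T e m (of_real x)) \<le> (\<integral>s. B * inverse (1 + s\<^sup>2) \<partial>lborel) * inverse (1 + x)"
    by (intro eventually_at_top_linorderI) auto
  moreover have "((\<lambda>x::real. c * inverse (1 + x)) \<longlongrightarrow> 0) at_top" for c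
    by real_asymp
  ultimately show ?thesis by (rule Lim_null_comparison)
qed

text \<open>Equal derivatives on a connected half-plane leave a constant, which the common limit
  along the real axis forces to be zero. The hypothesis is asked only for \<open>m > 0\<close>: for
  \<open>m = 0\<close> both derivatives are \<open>- k w\<close>, so the lemma serves as induction
  base too.\<close>

lemma T_rotate_step:
  assumes IH: "\<And>w. m > 0 \<Longrightarrow> Re w > 3/4 \<Longrightarrow> T 1 m w = T (- \<i>) m w" and w: "Re w > 3/4"
  shows "T 1 (Suc m) w = T (- \<i>) (Suc m) w"
proof -
  define D where "D w = T 1 (Suc m) w - T (- \<i>) (Suc m) w" for w
  have dD: "(D has_field_derivative 0) (at w within {w. Re w > 3/4})" if "w \<in> {w. Re w > 3/4}" for w
  proof -
    have "(D has_field_derivative ((if m = 0 then - k w else - of_nat m * T 1 m w)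
       - (if m = 0 then - k w else - of_nat m * T (- \<i>) m w))) (at w)"
      unfolding D_def using that by (intro DERIV_diff T_deriv) auto
    then show ?thesis using IH[of w] that by (auto intro: has_field_derivative_at_within split: if_splits)
  qed
  have "\<exists>c. \<forall>w\<in>{w. Re w > 3/4}. D w = c"
    using has_field_derivative_zero_constant[OF convex_halfspace_Re_gt dD] by blast
  then obtain c where c: "\<And>w. Re w > 3/4 \<Longrightarrow> D w = c" by blast
  have "((\<lambda>x. D (of_real x)) \<longlongrightarrow> 0 - 0) at_top"
    unfolding D_def by (intro tendsto_diff T_tendsto_0) auto
  moreover have "\<forall>\<^sub>F x in at_top. D (of_real x) = c"
    using eventually_ge_at_top[of 1] by eventually_elim (auto intro: c)
  ultimately have "((\<lambda>x::real. c) \<longlongrightarrow> 0 - 0) at_top" by (rule Lim_transform_eventually)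
  then have "c = 0" by (simp add: tendsto_const_iff)
  then show ?thesis using c[OF w] by (simp add: D_def)
qed

text \<open>Rotation of the path of integration from the positive real to the negative imaginary axis.
  Both sides satisfy the same recursion under differentiation and vanish at infinity, so no
  contour integral is needed.\<close>

theorem T_rotate:
  assumes "Re w > 3/4"
  shows "T 1 (Suc m) w = T (- \<i>) (Suc m) w"
  using assms
proof (induction m arbitrary: w)
  case 0
  then show ?case by (intro T_rotate_step) auto
next
  case (Suc m)
  show ?case by (rule T_rotate_step[OF Suc.IH Suc.prems])
qed

end

section \<open>The posterior kernel\<close>

lemma norm_integral_le_integral:
  fixes f :: "'a \<Rightarrow> 'b::{banach,second_countable_topology}"
  assumes "integrable M f" "integrable M h" "\<And>x. x \<in> space M \<Longrightarrow> norm (f x) \<le> h x"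
  shows "norm (\<integral>x. f x \<partial>M) \<le> (\<integral>x. h x \<partial>M)"
  by (rule order_trans[OF integral_norm_bound integral_mono]) (use assms in auto)

context gg_base
begin

definition cg :: real where "cg = cos (\<gamma> * pi / 2)"

lemma cg_pos: "cg > 0"
proof -
  have "\<gamma> * pi < 1 * pi" using gam by (intro mult_strict_right_mono) auto
  then have "\<gamma> * pi / 2 < pi / 2" by simp
  moreover have "0 \<le> \<gamma> * pi / 2" using gam by simp
  ultimately show ?thesis unfolding cg_def by (intro cos_gt_zero_pi) (auto intro: less_le_trans[of _ 0])
qed

definition ker :: "nat \<Rightarrow> (nat \<Rightarrow> 'x) \<Rightarrow> ('x \<Rightarrow> complex) \<Rightarrow> complex" where
  "ker n xs f = exp (- of_real \<beta> * (\<integral>x. f x powr of_real \<gamma> \<partial>P0)) * wprod \<gamma> n xs f"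

lemma Re_exponent_le:
  assumes "gint f" "\<And>x. Re (f x) > 0"
  shows "Re (- of_real \<beta> * (\<integral>x. f x powr of_real \<gamma> \<partial>P0)) \<le> - (\<beta> * cg * (\<integral>x. norm (f x) powr \<gamma> \<partial>P0))"
proof -
  have "cg * (\<integral>x. norm (f x) powr \<gamma> \<partial>P0) = (\<integral>x. cg * norm (f x) powr \<gamma> \<partial>P0)" by simp
  also have "\<dots> \<le> (\<integral>x. Re (f x powr of_real \<gamma>) \<partial>P0)"
    using assms(1) integrable_powr[OF assms(1)] Re_powr_ge[OF assms(2) gam]
    by (intro integral_mono) (auto simp: gint_def cg_def)
  also have "\<dots> = Re (\<integral>x. f x powr of_real \<gamma> \<partial>P0)"
    using integrable_powr[OF assms(1)] by simp
  finally show ?thesis using beta by (simp add: mult.assoc)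
qed

lemma norm_wprod_le:
  assumes "\<And>x. Re (f x) \<ge> 1/2"
  shows "norm (wprod \<gamma> n xs f) \<le> 2 ^ n"
proof -
  have "norm (wprod \<gamma> n xs f) \<le> (\<Prod>i<n. 2)"
    unfolding wprod_eq prod_norm[symmetric]
  proof (rule prod_mono, safe)
    fix i assume "i < n"
    then have m: "0 < frequency n xs (xs i)" by (rule frequency_nth_pos)
    then have e: "\<gamma> / real (frequency n xs (xs i)) \<le> 1" "0 \<le> \<gamma> / real (frequency n xs (xs i))"
      using gam by (auto simp: divide_simps)
    define e where "e = \<gamma> / real (frequency n xs (xs i)) - 1"
    have e': "e \<le> 0" "- e \<le> 1" using e by (auto simp: e_def)
    have nf: "1 / 2 \<le> norm (f (xs i))" using assms[of "xs i"] complex_Re_le_cmod[of "f (xs i)"] by linarith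
    have "norm (f (xs i)) powr e \<le> (1 / 2) powr e"
      using nf e' by (intro powr_mono2') auto
    also have "\<dots> = 2 powr (- e)" by (simp add: powr_minus_divide powr_divide)
    also have "\<dots> \<le> 2 powr 1" using e' by (intro powr_mono) auto
    finally show "norm (f (xs i) powr of_real (\<gamma> / real (frequency n xs (xs i)) - 1)) \<le> 2"
      unfolding norm_powr_of_real e_def by simp
  qed auto
  then show ?thesis by simp
qed

lemma norm_ker_le:
  assumes "gint f" "\<And>x. Re (f x) \<ge> 1/2"
  shows "norm (ker n xs f) \<le> 2 ^ n * exp (- (\<beta> * cg * (\<integral>x. norm (f x) powr \<gamma> \<partial>P0)))"
proof -
  have "Re (f x) > 0" for x using assms(2)[of x] by linarith
  from Re_exponent_le[OF assms(1) this] show ?thesis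
    unfolding ker_def norm_mult norm_exp_eq_Re
    by (subst mult.commute) (intro mult_mono norm_wprod_le assms(2), auto)
qed

lemma norm_ker_le_1:
  assumes "gint f" "\<And>x. Re (f x) \<ge> 1"
  shows "norm (ker n xs f) \<le> exp (- (\<beta> * cg * (\<integral>x. norm (f x) powr \<gamma> \<partial>P0)))"
proof -
  have "Re (f x) > 0" for x using assms(2)[of x] by linarith
  from Re_exponent_le[OF assms(1) this] have "norm (ker n xs f) \<le> exp (- (\<beta> * cg * (\<integral>x. norm (f x) powr \<gamma> \<partial>P0))) * 1"
    unfolding ker_def norm_mult norm_exp_eq_Re
    by (intro mult_mono norm_wprod_le_1 gam assms(2)) auto
  then show ?thesis by simp
qed

text \<open>All factors have modulus at most one, so the difference of the products is bounded by
  the sum of the differences of the factors. The constant \<open>3\<close> is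
  \<open>2 + \<bar>e i\<bar>\<close> with exponents in \<open>[-1, 0]\<close>.\<close>

lemma wprod_diff_le:
  fixes f h :: "'x \<Rightarrow> complex"
  assumes "\<And>x. Re (f x) \<ge> 1" "\<And>x. Re (h x) \<ge> 1"
  shows "norm (wprod \<gamma> n xs f - wprod \<gamma> n xs h) \<le> 3 * (\<Sum>i<n. norm (f (xs i) - h (xs i)) powr \<gamma>)"
proof -
  define e where "e i = \<gamma> / real (frequency n xs (xs i)) - 1" for i
  have e: "e i \<le> 0" "- 1 \<le> e i" if "i < n" for i
    using frequency_nth_pos[OF that, of xs] gam by (auto simp: e_def divide_simps)
  have le1: "norm (f x powr of_real (e i)) \<le> 1" if "i < n" "Re (f x) \<ge> 1" for f :: "'x \<Rightarrow> complex" and x i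
  proof -
    have "1 \<le> norm (f x)" using that complex_Re_le_cmod[of "f x"] by linarith
    then have "norm (f x) powr e i \<le> norm (f x) powr 0" using e[OF that(1)] by (intro powr_mono) auto
    also have "\<dots> \<le> 1" by simp
    finally show ?thesis by (simp only: norm_powr_of_real)
  qed
  have "norm (wprod \<gamma> n xs f - wprod \<gamma> n xs h)
      \<le> (\<Sum>i<n. norm (f (xs i) powr of_real (e i) - h (xs i) powr of_real (e i)))"
    unfolding wprod_eq e_def[symmetric] using le1[of _ f] le1[of _ h] assms by (intro norm_prod_diff) auto
  also have "\<dots> \<le> (\<Sum>i<n. 3 * norm (f (xs i) - h (xs i)) powr \<gamma>)"
  proof (rule sum_mono)
    fix i assume i: "i \<in> {..<n}"
    have "norm (f (xs i) powr of_real (e i) - h (xs i) powr of_real (e i)) \<le> (2 + \<bar>e i\<bar>) * norm (f (xs i) - h (xs i)) powr \<gamma>"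
      using i e[of i] by (intro norm_powr_neg_diff_le assms gam) auto
    also have "\<dots> \<le> 3 * norm (f (xs i) - h (xs i)) powr \<gamma>"
      using i e[of i] by (intro mult_right_mono) auto
    finally show "norm (f (xs i) powr of_real (e i) - h (xs i) powr of_real (e i)) \<le> 3 * norm (f (xs i) - h (xs i)) powr \<gamma>" .
  qed
  finally show ?thesis by (simp add: sum_distrib_left)
qed

text \<open>The number \<open>m\<close> is a common lower bound of both exponents, so that the
  difference inherits the exponential decay. It is applied with
  \<open>m = (1 + u) powr \<gamma>\<close> in \<open>norm_K_diff_le\<close> and with a multiple of
  \<open>s powr \<gamma>\<close> in \<open>K_minus_kk\<close>.\<close>

lemma ker_diff_le:
  assumes f: "gint f" "\<And>x. Re (f x) \<ge> 1" and h: "gint h" "\<And>x. Re (h x) \<ge> 1"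
    and m: "m \<le> (\<integral>x. norm (f x) powr \<gamma> \<partial>P0)" "m \<le> (\<integral>x. norm (h x) powr \<gamma> \<partial>P0)"
  shows "norm (ker n xs f - ker n xs h) \<le> exp (- (\<beta> * cg * m)) *
     (4 * \<beta> * (\<integral>x. norm (f x - h x) powr \<gamma> \<partial>P0) + 3 * (\<Sum>i<n. norm (f (xs i) - h (xs i)) powr \<gamma>))"
proof -
  define a b where "a = - of_real \<beta> * (\<integral>x. f x powr of_real \<gamma> \<partial>P0)"
    and "b = - of_real \<beta> * (\<integral>x. h x powr of_real \<gamma> \<partial>P0)"
  have fp: "Re (f x) > 0" and hp: "Re (h x) > 0" for x using f(2)[of x] h(2)[of x] by linarith+
  have bc: "\<beta> * cg > 0" using beta cg_pos by simp
  have ab: "Re a \<le> - (\<beta> * cg * m)" "Re b \<le> - (\<beta> * cg * m)"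
    using Re_exponent_le[OF f(1) fp] Re_exponent_le[OF h(1) hp]
      mult_left_mono[OF m(1), of "\<beta> * cg"] mult_left_mono[OF m(2), of "\<beta> * cg"] bc
    unfolding a_def b_def by linarith+
  have gd: "gint (\<lambda>x. f x - h x)"
    using gint_add[OF f(1) gint_cmult[OF h(1), of "- 1"]] by simp
  have "norm (a - b) = \<beta> * norm (\<integral>x. f x powr of_real \<gamma> - h x powr of_real \<gamma> \<partial>P0)"
    unfolding a_def b_def using integrable_powr[OF f(1)] integrable_powr[OF h(1)] beta
    by (simp add: norm_minus_commute norm_mult flip: right_diff_distrib)
  also have "norm (\<integral>x. f x powr of_real \<gamma> - h x powr of_real \<gamma> \<partial>P0) \<le> (\<integral>x. 4 * norm (f x - h x) powr \<gamma> \<partial>P0)"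
    by (rule norm_integral_le_integral)
       (use integrable_powr[OF f(1)] integrable_powr[OF h(1)] gd norm_powr_diff_le[OF fp hp gam] in \<open>auto simp: gint_def\<close>)
  finally have "norm (a - b) \<le> \<beta> * (\<integral>x. 4 * norm (f x - h x) powr \<gamma> \<partial>P0)"
    using beta by (simp add: mult_left_mono)
  then have dab: "norm (a - b) \<le> 4 * \<beta> * (\<integral>x. norm (f x - h x) powr \<gamma> \<partial>P0)" by simp
  have "ker n xs f - ker n xs h = (exp a - exp b) * wprod \<gamma> n xs f + exp b * (wprod \<gamma> n xs f - wprod \<gamma> n xs h)"
    unfolding ker_def a_def b_def by (simp add: algebra_simps)
  also have "norm \<dots> \<le> norm (exp a - exp b) * norm (wprod \<gamma> n xs f) + norm (exp b) * norm (wprod \<gamma> n xs f - wprod \<gamma> n xs h)"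
    by (rule order_trans[OF norm_triangle_ineq]) (simp add: norm_mult)
  also have "\<dots> \<le> (exp (- (\<beta> * cg * m)) * (4 * \<beta> * (\<integral>x. norm (f x - h x) powr \<gamma> \<partial>P0))) * 1
      + exp (- (\<beta> * cg * m)) * (3 * (\<Sum>i<n. norm (f (xs i) - h (xs i)) powr \<gamma>))"
  proof (rule add_mono; rule mult_mono)
    show "norm (exp a - exp b) \<le> exp (- (\<beta> * cg * m)) * (4 * \<beta> * (\<integral>x. norm (f x - h x) powr \<gamma> \<partial>P0))"
      by (rule order_trans[OF norm_exp_diff_le[OF ab]]) (use dab in auto)
    show "0 \<le> exp (- (\<beta> * cg * m)) * (4 * \<beta> * (\<integral>x. norm (f x - h x) powr \<gamma> \<partial>P0))"
      using beta by (intro mult_nonneg_nonneg Bochner_Integration.integral_nonneg) auto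
    show "norm (wprod \<gamma> n xs f) \<le> 1" by (rule norm_wprod_le_1[OF gam f(2)])
    show "norm (wprod \<gamma> n xs f - wprod \<gamma> n xs h) \<le> 3 * (\<Sum>i<n. norm (f (xs i) - h (xs i)) powr \<gamma>)"
      by (rule wprod_diff_le[OF f(2) h(2)])
  qed (use ab in auto)
  finally show ?thesis by (simp add: algebra_simps)
qed

end

section \<open>The kernel belonging to \<open>g\<close> and its decay\<close>

locale gg_fun = gg_base P0 \<gamma> \<beta> for P0 :: "'x::polish_space measure" and \<gamma> \<beta> +
  fixes g :: "'x \<Rightarrow> real"
  assumes g_meas [measurable]: "g \<in> borel_measurable borel"
    and g_int: "integrable P0 (\<lambda>x. \<bar>g x\<bar> powr \<gamma>)"
begin

lemma gint_g: "gint (\<lambda>x. of_real (g x))"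
  using g_int by (simp add: gint_def)

text \<open>With \<open>w = 1 + u + \<i> * t * z\<close> the variables \<open>u\<close> and
  \<open>z\<close> are the two perpendicular coordinates of one complex variable. This is what
  allows an integral over \<open>u\<close> to be turned into an integral over
  \<open>z\<close>.\<close>

definition arg_fun :: "real \<Rightarrow> complex \<Rightarrow> 'x \<Rightarrow> complex" where
  "arg_fun t w x = w - \<i> * of_real (t * g x)"

lemma gint_arg_fun: "gint (arg_fun t w)"
  using gint_add[OF gint_const[of w] gint_cmult[OF gint_g, of "- \<i> * of_real t"]]
  by (simp add: arg_fun_def[abs_def] mult.assoc)

lemma Re_arg_fun [simp]: "Re (arg_fun t w x) = Re w"
  by (simp add: arg_fun_def)

definition K :: "nat \<Rightarrow> (nat \<Rightarrow> 'x) \<Rightarrow> real \<Rightarrow> real \<Rightarrow> real \<Rightarrow> complex" where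
  "K n xs u t z = ker n xs (arg_fun t (1 + of_real u + \<i> * of_real (t * z)))"

lemma gg_kernel_eq: "gg_kernel \<gamma> \<beta> P0 g n xs u t z = K n xs u t z"
  unfolding gg_kernel_def K_def ker_def wprod_def arg_fun_def
  by (simp add: algebra_simps)

text \<open>It measures how far \<open>g\<close> is from the constant \<open>z\<close>: it vanishes
  exactly if \<open>g = z\<close> almost everywhere, and it is the rate of decay of the kernel in
  \<open>t powr \<gamma>\<close>.\<close>

definition D :: "real \<Rightarrow> real" where "D z = (\<integral>x. \<bar>g x - z\<bar> powr \<gamma> \<partial>P0)"

lemma integrable_D: "integrable P0 (\<lambda>x. \<bar>g x - z\<bar> powr \<gamma>)"
proof -
  have "gint (\<lambda>x. of_real (g x) + of_real (- z))" by (intro gint_add gint_g gint_const)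
  then show ?thesis unfolding gint_def of_real_add[symmetric] norm_of_real by simp
qed

lemma D_nonneg: "D z \<ge> 0"
  unfolding D_def by (intro Bochner_Integration.integral_nonneg) auto

lemma D_pos:
  assumes "\<not> (AE x in P0. g x = z)"
  shows "D z > 0"
proof -
  have "D z \<noteq> 0"
  proof
    assume "D z = 0"
    then have "AE x in P0. \<bar>g x - z\<bar> powr \<gamma> = 0"
      unfolding D_def using integral_nonneg_eq_0_iff_AE[OF integrable_D[of z]] by auto
    then have "AE x in P0. g x = z" by eventually_elim simp
    with assms show False by simp
  qed
  with D_nonneg[of z] show ?thesis by simp
qed

lemma D_ge: "D z \<ge> \<bar>z\<bar> powr \<gamma> / 2 - D 0"
proof -
  have "\<bar>z\<bar> powr \<gamma> / 2 - \<bar>g x - 0\<bar> powr \<gamma> \<le> \<bar>g x - z\<bar> powr \<gamma>" for x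
  proof -
    have "\<bar>z\<bar> powr \<gamma> \<le> (\<bar>g x - z\<bar> + \<bar>g x\<bar>) powr \<gamma>" using gam by (intro powr_mono2) auto
    also have "\<dots> \<le> 2 * (\<bar>g x - z\<bar> powr \<gamma> + \<bar>g x\<bar> powr \<gamma>)" using gam by (intro powr_add_le) auto
    finally show ?thesis by simp
  qed
  then have "(\<integral>x. \<bar>z\<bar> powr \<gamma> / 2 - \<bar>g x - 0\<bar> powr \<gamma> \<partial>P0) \<le> D z"
    unfolding D_def using integrable_D[of z] integrable_D[of 0] by (intro integral_mono) auto
  then show ?thesis using integrable_D[of 0] by (simp add: D_def)
qed

lemma D_continuous: "continuous_on UNIV D"
  unfolding continuous_on_sequentially comp_def
proof safe
  fix X :: "nat \<Rightarrow> real" and z assume X: "X \<longlonglongrightarrow> z"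
  then obtain C where C: "\<And>i. \<bar>X i\<bar> \<le> C" using convergent_imp_Bseq[of X] by (auto simp: convergent_def Bseq_def)
  show "(\<lambda>i. D (X i)) \<longlonglongrightarrow> D z"
    unfolding D_def
  proof (rule integral_dominated_convergence[where w = "\<lambda>x. 2 * (\<bar>g x\<bar> powr \<gamma> + C powr \<gamma>)"])
    show "integrable P0 (\<lambda>x. 2 * (\<bar>g x\<bar> powr \<gamma> + C powr \<gamma>))" using g_int by auto
    show "AE x in P0. (\<lambda>i. \<bar>g x - X i\<bar> powr \<gamma>) \<longlonglongrightarrow> \<bar>g x - z\<bar> powr \<gamma>"
      using gam by (intro AE_I2 tendsto_powr' tendsto_intros X) auto
    show "AE x in P0. norm (\<bar>g x - X i\<bar> powr \<gamma>) \<le> 2 * (\<bar>g x\<bar> powr \<gamma> + C powr \<gamma>)" for i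
    proof (rule AE_I2)
      fix x
      have "\<bar>g x - X i\<bar> powr \<gamma> \<le> (\<bar>g x\<bar> + C) powr \<gamma>"
        using gam C[of i] by (intro powr_mono2) auto
      also have "\<dots> \<le> 2 * (\<bar>g x\<bar> powr \<gamma> + C powr \<gamma>)" using gam C[of 0] by (intro powr_add_le) auto
      finally show "norm (\<bar>g x - X i\<bar> powr \<gamma>) \<le> 2 * (\<bar>g x\<bar> powr \<gamma> + C powr \<gamma>)" by simp
    qed
  qed (auto simp: borel_P0)
qed

text \<open>For large \<open>\<bar>z\<bar>\<close> the growth comes from \<open>D_ge\<close>; on the
  remaining compact interval \<open>D\<close> is continuous and positive, hence bounded
  below.\<close>

lemma D_lower:
  assumes "\<And>c. \<not> (AE x in P0. g x = c)"
  obtains c where "c > 0" "\<And>z. D z \<ge> c * (1 + \<bar>z\<bar>) powr \<gamma>"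
proof -
  obtain R where R: "R > 0" "\<And>z. \<bar>z\<bar> \<ge> R \<Longrightarrow> \<bar>z\<bar> powr \<gamma> / 2 - D 0 \<ge> (1 + \<bar>z\<bar>) powr \<gamma> / 16"
  proof -
    \<comment> \<open>The threshold gives both \<open>D 0 \<le> x powr \<gamma> / 8\<close> and
      \<open>1 \<le> x powr \<gamma>\<close>, the latter implying
      \<open>(1 + x) powr \<gamma> \<le> 4 * x powr \<gamma>\<close>. The coefficients
      \<open>1/2 - 1/8 - 4/16\<close> leave a nonnegative remainder.\<close>
    have "((\<lambda>z. z powr \<gamma> / 2 - D 0 - (1 + z) powr \<gamma> / 16) :: real \<Rightarrow> real) x \<ge> 0"
      if x: "x \<ge> 1 + (8 * D 0) powr (1 / \<gamma>)" for x
    proof -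
      have x1: "x \<ge> 1" using x powr_ge_zero[of "8 * D 0" "1 / \<gamma>"] by linarith
      have "(8 * D 0) powr (1 / \<gamma>) \<le> x" using x by simp
      then have "((8 * D 0) powr (1 / \<gamma>)) powr \<gamma> \<le> x powr \<gamma>" using gam by (intro powr_mono2) auto
      then have "8 * D 0 \<le> x powr \<gamma>" using gam D_nonneg[of 0] by (simp add: powr_powr)
      moreover have "(1 + x) powr \<gamma> \<le> 2 * (1 powr \<gamma> + x powr \<gamma>)" using gam x1 by (intro powr_add_le) auto
      moreover have "1 powr \<gamma> \<le> x powr \<gamma>" using gam x1 by (intro powr_mono2) auto
      ultimately have "(1 + x) powr \<gamma> \<le> 4 * x powr \<gamma>" "D 0 \<le> x powr \<gamma> / 8" by simp_all
      then show ?thesis using powr_ge_zero[of x \<gamma>] by linarith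
    qed
    then show ?thesis
      by (intro that[of "1 + (8 * D 0) powr (1 / \<gamma>)"]) (auto intro: add_pos_nonneg)
  qed
  have "compact {-R..R}" by simp
  moreover have "{-R..R} \<noteq> {}" using R by auto
  ultimately obtain z0 where z0: "z0 \<in> {-R..R}" "\<And>z. z \<in> {-R..R} \<Longrightarrow> D z0 \<le> D z"
    using continuous_attains_inf[of "{-R..R}" D] continuous_on_subset[OF D_continuous] by blast
  have Dz0: "D z0 > 0" using D_pos assms by blast
  define c where "c = min (1 / 16) (D z0 / (1 + R) powr \<gamma>)"
  have Rp: "(1 + R) powr \<gamma> > 0" using R by simp
  show ?thesis
  proof (rule that[of c])
    show "c > 0" using Dz0 Rp by (simp add: c_def)
    fix z
    show "D z \<ge> c * (1 + \<bar>z\<bar>) powr \<gamma>"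
    proof (cases "\<bar>z\<bar> \<ge> R")
      case True
      have "c * (1 + \<bar>z\<bar>) powr \<gamma> \<le> 1 / 16 * (1 + \<bar>z\<bar>) powr \<gamma>"
        unfolding c_def by (intro mult_right_mono min.cobounded1) auto
      then show ?thesis using R(2)[OF True] D_ge[of z] by linarith
    next
      case False
      have "c * (1 + \<bar>z\<bar>) powr \<gamma> \<le> D z0 / (1 + R) powr \<gamma> * (1 + R) powr \<gamma>"
        using False gam Dz0 by (intro mult_mono powr_mono2) (auto simp: c_def)
      also have "\<dots> = D z0" using Rp by simp
      also have "\<dots> \<le> D z" using False by (intro z0) auto
      finally show ?thesis .
    qed
  qed
qed

lemma arg_fun_integral_ge:
  assumes "0 \<le> u"
  shows "(\<integral>x. norm (arg_fun t (1 + of_real u + \<i> * of_real (t * z)) x) powr \<gamma> \<partial>P0) \<ge> (1 + u) powr \<gamma>"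
    and "(\<integral>x. norm (arg_fun t (1 + of_real u + \<i> * of_real (t * z)) x) powr \<gamma> \<partial>P0) \<ge> \<bar>t\<bar> powr \<gamma> * D z"
proof -
  let ?w = "1 + of_real u + \<i> * of_real (t * z) :: complex"
  have int: "integrable P0 (\<lambda>x. norm (arg_fun t ?w x) powr \<gamma>)" using gint_arg_fun by (simp add: gint_def)
  have "(\<integral>x. (1 + u) powr \<gamma> \<partial>P0) \<le> (\<integral>x. norm (arg_fun t ?w x) powr \<gamma> \<partial>P0)"
  proof (rule integral_mono[OF _ int])
    fix x
    have "1 + u \<le> norm (arg_fun t ?w x)" using complex_Re_le_cmod[of "arg_fun t ?w x"] by simp
    then show "(1 + u) powr \<gamma> \<le> norm (arg_fun t ?w x) powr \<gamma>" using gam assms by (intro powr_mono2) auto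
  qed simp
  then show "(\<integral>x. norm (arg_fun t ?w x) powr \<gamma> \<partial>P0) \<ge> (1 + u) powr \<gamma>" by simp
  have "(\<integral>x. \<bar>t\<bar> powr \<gamma> * \<bar>g x - z\<bar> powr \<gamma> \<partial>P0) \<le> (\<integral>x. norm (arg_fun t ?w x) powr \<gamma> \<partial>P0)"
  proof (rule integral_mono[OF _ int])
    fix x
    have "\<bar>t * (g x - z)\<bar> = \<bar>Im (arg_fun t ?w x)\<bar>" by (simp add: arg_fun_def algebra_simps abs_minus_commute)
    also have "\<dots> \<le> norm (arg_fun t ?w x)" by (rule abs_Im_le_cmod)
    finally have "\<bar>t * (g x - z)\<bar> powr \<gamma> \<le> norm (arg_fun t ?w x) powr \<gamma>" using gam by (intro powr_mono2) auto
    then show "\<bar>t\<bar> powr \<gamma> * \<bar>g x - z\<bar> powr \<gamma> \<le> norm (arg_fun t ?w x) powr \<gamma>"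
      by (simp add: abs_mult powr_mult)
  qed (use integrable_D in auto)
  then show "(\<integral>x. norm (arg_fun t ?w x) powr \<gamma> \<partial>P0) \<ge> \<bar>t\<bar> powr \<gamma> * D z" by (simp add: D_def)
qed

text \<open>Half of the constant \<open>\<beta> * cg\<close>: the integral in the exponent has one
  lower bound in \<open>u\<close>, from the real part, and one in \<open>t\<close>, from the
  imaginary part. One half of the exponent is spent on each, which makes the bound in
  \<open>norm_K_le\<close> a product.\<close>

definition b :: real where "b = \<beta> * cg / 2"

lemma b_pos: "b > 0" using beta cg_pos by (simp add: b_def)

lemma norm_K_le:
  assumes "0 \<le> u"
  shows "norm (K n xs u t z) \<le> exp (- (b * (1 + u) powr \<gamma>)) * exp (- (b * (\<bar>t\<bar> powr \<gamma> * D z)))"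
proof -
  let ?w = "1 + of_real u + \<i> * of_real (t * z) :: complex"
  let ?I = "\<integral>x. norm (arg_fun t ?w x) powr \<gamma> \<partial>P0"
  have "norm (K n xs u t z) \<le> exp (- (\<beta> * cg * ?I))"
    unfolding K_def using assms by (intro norm_ker_le_1 gint_arg_fun) auto
  also have "\<dots> \<le> exp (- (b * (1 + u) powr \<gamma>) - b * (\<bar>t\<bar> powr \<gamma> * D z))"
  proof -
    have "\<beta> * cg * ?I = b * ?I + b * ?I" by (simp add: b_def)
    moreover have "b * (1 + u) powr \<gamma> \<le> b * ?I" "b * (\<bar>t\<bar> powr \<gamma> * D z) \<le> b * ?I"
      using b_pos arg_fun_integral_ge[OF assms] by (auto intro!: mult_left_mono)
    ultimately have "- (\<beta> * cg * ?I) \<le> - (b * (1 + u) powr \<gamma>) - b * (\<bar>t\<bar> powr \<gamma> * D z)" by linarith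
    then show ?thesis by (simp only: exp_le_cancel_iff)
  qed
  finally show ?thesis by (simp add: exp_diff exp_minus field_simps)
qed

lemma K_0: "K n xs u 0 z = of_real (exp (- \<beta> * (1 + u) powr \<gamma>) * (\<Prod>y\<in>distinct_values n xs. (1 + u) powr (\<gamma> - real (frequency n xs y))))"
  if "0 \<le> u"
proof -
  have p: "(1 + complex_of_real u) powr of_real r = of_real ((1 + u) powr r)" for r
    using powr_of_real[of "1 + u" r] that by simp
  have arg: "arg_fun 0 (1 + of_real u + \<i> * of_real (0 * z)) x = 1 + complex_of_real u" for x
    by (simp add: arg_fun_def)
  show ?thesis
    unfolding K_def ker_def wprod_def arg p unfolding of_real_mult of_real_prod by (simp add: exp_of_real[symmetric])
qed

lemma norm_K_diff_le:
  assumes "0 \<le> u"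
  shows "norm (K n xs u t z - K n xs u 0 z) \<le> exp (- (b * (1 + u) powr \<gamma>)) * (\<bar>t\<bar> powr \<gamma> *
    (4 * \<beta> * D z + 3 * (\<Sum>i<n. \<bar>g (xs i) - z\<bar> powr \<gamma>)))"
proof -
  let ?f = "arg_fun t (1 + of_real u + \<i> * of_real (t * z))" and ?h = "arg_fun 0 (1 + of_real u + \<i> * of_real (0 * z))"
  have d: "norm (?f x - ?h x) powr \<gamma> = \<bar>t\<bar> powr \<gamma> * \<bar>g x - z\<bar> powr \<gamma>" for x
  proof -
    have "?f x - ?h x = - \<i> * of_real (t * (g x - z))" by (simp add: arg_fun_def algebra_simps)
    then have "norm (?f x - ?h x) = \<bar>t * (g x - z)\<bar>" by (simp only: norm_mult norm_minus_cancel norm_ii norm_of_real mult_1)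
    then show ?thesis by (simp add: abs_mult powr_mult)
  qed
  have "norm (K n xs u t z - K n xs u 0 z) \<le> exp (- (\<beta> * cg * (1 + u) powr \<gamma>)) *
     (4 * \<beta> * (\<integral>x. norm (?f x - ?h x) powr \<gamma> \<partial>P0) + 3 * (\<Sum>i<n. norm (?f (xs i) - ?h (xs i)) powr \<gamma>))"
    unfolding K_def
    by (intro ker_diff_le gint_arg_fun arg_fun_integral_ge(1) assms) (use assms in auto)
  also have "\<dots> = exp (- (\<beta> * cg * (1 + u) powr \<gamma>)) * (\<bar>t\<bar> powr \<gamma> *
    (4 * \<beta> * D z + 3 * (\<Sum>i<n. \<bar>g (xs i) - z\<bar> powr \<gamma>)))"
    unfolding d by (simp add: D_def sum_distrib_left algebra_simps)
  also have "\<dots> \<le> exp (- (b * (1 + u) powr \<gamma>)) * (\<bar>t\<bar> powr \<gamma> *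
    (4 * \<beta> * D z + 3 * (\<Sum>i<n. \<bar>g (xs i) - z\<bar> powr \<gamma>)))"
  proof (rule mult_right_mono)
    have "b * (1 + u) powr \<gamma> \<le> \<beta> * cg * (1 + u) powr \<gamma>"
      using b_pos by (intro mult_right_mono) (auto simp: b_def)
    then show "exp (- (\<beta> * cg * (1 + u) powr \<gamma>)) \<le> exp (- (b * (1 + u) powr \<gamma>))" by simp
    show "0 \<le> \<bar>t\<bar> powr \<gamma> * (4 * \<beta> * D z + 3 * (\<Sum>i<n. \<bar>g (xs i) - z\<bar> powr \<gamma>))"
      using beta D_nonneg by (intro mult_nonneg_nonneg add_nonneg_nonneg sum_nonneg) auto
  qed
  finally show ?thesis .
qed

text \<open>Since \<open>K\<close> is real at \<open>t = 0\<close>, its imaginary part is bounded by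
  the increment from there. The resulting order \<open>t powr \<gamma>\<close> makes
  \<open>1 / t\<close> integrable at the origin in the inversion integral.\<close>

lemma abs_Im_K_le:
  assumes "0 \<le> u"
  shows "\<bar>Im (K n xs u t z)\<bar> \<le> exp (- (b * (1 + u) powr \<gamma>)) * (\<bar>t\<bar> powr \<gamma> *
    (4 * \<beta> * D z + 3 * (\<Sum>i<n. \<bar>g (xs i) - z\<bar> powr \<gamma>)))"
proof -
  have "Im (K n xs u 0 z) = 0" unfolding K_0[OF assms] by (rule Im_complex_of_real)
  then have "\<bar>Im (K n xs u t z)\<bar> = \<bar>Im (K n xs u t z - K n xs u 0 z)\<bar>" by simp
  also have "\<dots> \<le> norm (K n xs u t z - K n xs u 0 z)" by (rule abs_Im_le_cmod)
  finally show ?thesis using norm_K_diff_le[OF assms, of n xs t z] by linarith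
qed

definition kk :: "nat \<Rightarrow> (nat \<Rightarrow> 'x) \<Rightarrow> real \<Rightarrow> complex \<Rightarrow> complex" where
  "kk n xs t w = ker n xs (arg_fun t w)"

lemma K_kk: "K n xs u t z = kk n xs t (1 + of_real u + \<i> * of_real (t * z))"
  by (simp add: K_def kk_def)

lemma kk_holomorphic: "kk n xs t holomorphic_on {w. Re w > 1/2}"
proof -
  have a: "arg_fun t w = (\<lambda>x. (- \<i> * of_real (t * g x)) + w * 1)" for w
    by (simp add: arg_fun_def fun_eq_iff)
  have gi: "gint (\<lambda>x. - \<i> * of_real (t * g x))"
    using gint_cmult[OF gint_g, of "- \<i> * of_real t"] by (simp add: mult.assoc)
  have "(\<lambda>w. \<integral>x. arg_fun t w x powr of_real \<gamma> \<partial>P0) holomorphic_on {w. Re w > 1/2}"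
    unfolding holomorphic_on_open[OF open_halfspace_Re_gt]
  proof safe
    fix w :: complex assume w: "1/2 < Re w"
    have "((\<lambda>w. \<integral>x. ((- \<i> * of_real (t * g x)) + w * 1) powr of_real \<gamma> \<partial>P0) has_field_derivative
      (\<integral>x. of_real \<gamma> * 1 * ((- \<i> * of_real (t * g x)) + w * 1) powr of_real (\<gamma> - 1) \<partial>P0)) (at w)"
    proof (rule powr_integral_deriv_bounded[OF gi gint_const, where K = 1 and \<delta> = "1/2" and r = "Re w - 1/2"])
      fix z x assume "z \<in> ball w (Re w - 1/2)"
      then have "\<bar>Re w - Re z\<bar> < Re w - 1/2" using abs_Re_le_cmod[of "w - z"] by (simp add: dist_norm)
      then show "1/2 \<le> Re (- \<i> * of_real (t * g x) + z * 1)" by simp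
    qed (use w in auto)
    then show "\<exists>f'. ((\<lambda>w. \<integral>x. arg_fun t w x powr of_real \<gamma> \<partial>P0) has_field_derivative f') (at w)"
      unfolding a by blast
  qed
  moreover have "(\<lambda>w. wprod \<gamma> n xs (arg_fun t w)) holomorphic_on {w. Re w > 1/2}"
    unfolding holomorphic_on_open[OF open_halfspace_Re_gt]
  proof safe
    fix w :: complex assume "1/2 < Re w"
    then have "((\<lambda>w. wprod \<gamma> n xs (\<lambda>x. (- \<i> * of_real (t * g x)) + w * 1)) has_field_derivative
      wprod \<gamma> n xs (\<lambda>x. (- \<i> * of_real (t * g x)) + w * 1) *
       (\<Sum>i<n. of_real (\<gamma> / real (frequency n xs (xs i)) - 1) * (1 / ((- \<i> * of_real (t * g (xs i))) + w * 1)))) (at w)"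
      by (intro wprod_deriv) auto
    then show "\<exists>f'. ((\<lambda>w. wprod \<gamma> n xs (arg_fun t w)) has_field_derivative f') (at w)"
      unfolding a by blast
  qed
  ultimately show ?thesis unfolding kk_def ker_def by (intro holomorphic_intros)
qed

text \<open>Here decay in \<open>w\<close> is wanted for fixed \<open>t\<close>. The shift of the
  argument by \<open>t * g\<close> costs a factor that grows with \<open>t\<close>, which is
  harmless because the rotation of the path is carried out separately for each
  \<open>t\<close>.\<close>

lemma norm_kk_le:
  assumes "Re w > 1/2"
  shows "norm (kk n xs t w) \<le> 2 ^ n * exp (2 * b * (\<bar>t\<bar> powr \<gamma> * D 0)) * exp (- (b * norm w powr \<gamma>))"
proof -
  let ?I = "\<integral>x. norm (arg_fun t w x) powr \<gamma> \<partial>P0"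
  have int: "integrable P0 (\<lambda>x. norm (arg_fun t w x) powr \<gamma>)" using gint_arg_fun by (simp add: gint_def)
  have "(\<integral>x. norm w powr \<gamma> / 2 - \<bar>t\<bar> powr \<gamma> * \<bar>g x - 0\<bar> powr \<gamma> \<partial>P0) \<le> ?I"
  proof (rule integral_mono[OF _ int])
    fix x
    have "norm w \<le> norm (arg_fun t w x) + \<bar>t * g x\<bar>"
      using norm_triangle_ineq[of "arg_fun t w x" "\<i> * of_real (t * g x)"] by (simp add: arg_fun_def norm_mult abs_mult)
    then have "norm w powr \<gamma> \<le> (norm (arg_fun t w x) + \<bar>t * g x\<bar>) powr \<gamma>" using gam by (intro powr_mono2) auto
    also have "\<dots> \<le> 2 * (norm (arg_fun t w x) powr \<gamma> + \<bar>t * g x\<bar> powr \<gamma>)" using gam by (intro powr_add_le) auto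
    finally show "norm w powr \<gamma> / 2 - \<bar>t\<bar> powr \<gamma> * \<bar>g x - 0\<bar> powr \<gamma> \<le> norm (arg_fun t w x) powr \<gamma>"
      by (simp add: abs_mult powr_mult)
  qed (use integrable_D[of 0] in auto)
  then have I: "norm w powr \<gamma> / 2 - \<bar>t\<bar> powr \<gamma> * D 0 \<le> ?I"
    using integrable_D[of 0] by (simp add: D_def)
  have "norm (kk n xs t w) \<le> 2 ^ n * exp (- (\<beta> * cg * ?I))"
    unfolding kk_def using assms by (intro norm_ker_le gint_arg_fun) auto
  also have "\<dots> \<le> 2 ^ n * exp (2 * b * (\<bar>t\<bar> powr \<gamma> * D 0) - b * norm w powr \<gamma>)"
  proof -
    have "2 * b * (norm w powr \<gamma> / 2 - \<bar>t\<bar> powr \<gamma> * D 0) \<le> 2 * b * ?I"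
      using I b_pos by (intro mult_left_mono) auto
    then have "- (\<beta> * cg * ?I) \<le> 2 * b * (\<bar>t\<bar> powr \<gamma> * D 0) - b * norm w powr \<gamma>"
      by (simp add: b_def algebra_simps)
    then show ?thesis by (intro mult_left_mono) auto
  qed
  finally show ?thesis by (simp add: exp_diff exp_minus field_simps)
qed

lemma exp_powr_rapid:
  assumes c: "c > 0"
  shows "\<exists>B>0. \<forall>x\<ge>0. exp (- (c * x powr \<gamma>)) * (1 + x) ^ N \<le> B"
proof -
  \<comment> \<open>With \<open>\<gamma> * m \<ge> N\<close> the power \<open>x ^ N\<close> is
    dominated for \<open>x \<ge> 1\<close> by \<open>(x powr \<gamma>) ^ m\<close>, and the
    exponential bound can be used with \<open>x powr \<gamma>\<close> as its variable.\<close>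
  define m where "m = nat \<lceil>real N / \<gamma>\<rceil>"
  have m: "real N \<le> \<gamma> * real m"
  proof -
    have "real N / \<gamma> \<le> real m" unfolding m_def by linarith
    then show ?thesis using gam by (simp add: field_simps)
  qed
  define B where "B = 2 ^ N * (1 + fact m / c ^ m)"
  have "exp (- (c * x powr \<gamma>)) * (1 + x) ^ N \<le> B" if x: "x \<ge> 0" for x
  proof (cases "x \<le> 1")
    case True
    have "exp (- (c * x powr \<gamma>)) * (1 + x) ^ N \<le> 1 * 2 ^ N"
      using c True x by (intro mult_mono power_mono) auto
    also have "\<dots> \<le> B" unfolding B_def using c by (simp add: mult_left_le)
    finally show ?thesis .
  next
    case False
    have "(1 + x) ^ N \<le> (2 * x) ^ N" using False by (intro power_mono) auto
    also have "\<dots> = 2 ^ N * x powr real N" using False by (simp add: power_mult_distrib powr_realpow)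
    also have "x powr real N \<le> x powr (\<gamma> * real m)" using False m by (intro powr_mono) auto
    also have "x powr (\<gamma> * real m) = (x powr \<gamma>) ^ m"
      using False by (simp add: powr_powr[symmetric] powr_realpow)
    finally have "(1 + x) ^ N \<le> 2 ^ N * (x powr \<gamma>) ^ m" by simp
    then have "exp (- (c * x powr \<gamma>)) * (1 + x) ^ N \<le> exp (- (c * x powr \<gamma>)) * (2 ^ N * (x powr \<gamma>) ^ m)"
      by (intro mult_left_mono) auto
    also have "\<dots> = 2 ^ N * ((x powr \<gamma>) ^ m * exp (- c * x powr \<gamma>))" by simp
    also have "\<dots> \<le> 2 ^ N * (fact m / c ^ m)"
      using c by (intro mult_left_mono power_mult_exp_bound) auto
    also have "\<dots> \<le> B" by (simp add: B_def algebra_simps)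
    finally show ?thesis .
  qed
  moreover have "B > 0" unfolding B_def using c by (intro mult_pos_pos add_pos_nonneg) auto
  ultimately show ?thesis by blast
qed

lemma rapid_kk: "rapid (kk n xs t)"
proof
  show "kk n xs t holomorphic_on {w. Re w > 1/2}" by (rule kk_holomorphic)
  fix N
  obtain B where B: "\<And>x. x \<ge> 0 \<Longrightarrow> exp (- (b * x powr \<gamma>)) * (1 + x) ^ N \<le> B" using exp_powr_rapid[OF b_pos] by blast
  define C where "C = 2 ^ n * exp (2 * b * (\<bar>t\<bar> powr \<gamma> * D 0))"
  have "norm (kk n xs t w) * (1 + norm w) ^ N \<le> C * B" if "Re w > 1/2" for w
  proof -
    have "norm (kk n xs t w) * (1 + norm w) ^ N \<le> (C * exp (- (b * norm w powr \<gamma>))) * (1 + norm w) ^ N"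
      unfolding C_def using that by (intro mult_right_mono norm_kk_le) auto
    also have "\<dots> = C * (exp (- (b * norm w powr \<gamma>)) * (1 + norm w) ^ N)" by simp
    also have "\<dots> \<le> C * B" by (intro mult_left_mono B) (auto simp: C_def)
    finally show ?thesis .
  qed
  then show "\<exists>B. \<forall>w. Re w > 1/2 \<longrightarrow> norm (kk n xs t w) * (1 + norm w) ^ N \<le> B" by blast
qed

end

section \<open>The inversion integral and its derivative\<close>

lemma set_integrable_powr_0_1:
  assumes "0 < \<gamma>"
  shows "set_integrable lborel {0<..<1::real} (\<lambda>t. t powr (\<gamma> - 1))"
proof -
  have "set_integrable lborel (einterval 0 1) (\<lambda>t. t powr (\<gamma> - 1))"
  proof (rule interval_integral_FTC_nonneg(1)[where F = "\<lambda>t. t powr \<gamma> / \<gamma>" and A = 0 and B = "1 / \<gamma>"])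
    show "DERIV (\<lambda>t. t powr \<gamma> / \<gamma>) x :> x powr (\<gamma> - 1)" if "0 < ereal x" "ereal x < 1" for x
      using that assms by (auto intro!: derivative_eq_intros)
    show "isCont (\<lambda>t. t powr (\<gamma> - 1)) x" if "0 < ereal x" "ereal x < 1" for x
      using that by (auto intro!: continuous_intros)
    show "(((\<lambda>t. t powr \<gamma> / \<gamma>) \<circ> real_of_ereal) \<longlongrightarrow> 0) (at_right 0)"
      unfolding zero_ereal_def ereal_tendsto_simps using assms
      by (auto intro!: tendsto_eq_intros tendsto_powr' simp: eventually_at_filter)
    show "(((\<lambda>t. t powr \<gamma> / \<gamma>) \<circ> real_of_ereal) \<longlongrightarrow> 1 / \<gamma>) (at_left 1)"
      unfolding one_ereal_def ereal_tendsto_simps using assms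
      by (auto intro!: tendsto_eq_intros)
  qed auto
  then show ?thesis by (simp add: einterval_def zero_ereal_def one_ereal_def greaterThanLessThan_def greaterThan_def lessThan_def Int_def)
qed

lemma set_integrable_powr_tail:
  assumes "0 < \<gamma>"
  shows "set_integrable lborel {1<..} (\<lambda>t::real. t powr (- \<gamma> - 1))"
proof -
  have "set_integrable lborel (einterval 1 \<infinity>) (\<lambda>t. t powr (- \<gamma> - 1))"
  proof (rule interval_integral_FTC_nonneg(1)[where F = "\<lambda>t. - (t powr - \<gamma>) / \<gamma>" and A = "- 1 / \<gamma>" and B = 0])
    show "DERIV (\<lambda>t. - (t powr - \<gamma>) / \<gamma>) x :> x powr (- \<gamma> - 1)" if "1 < ereal x" "ereal x < \<infinity>" for x
      using that assms by (auto intro!: derivative_eq_intros simp: algebra_simps)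
    show "isCont (\<lambda>t. t powr (- \<gamma> - 1)) x" if "1 < ereal x" "ereal x < \<infinity>" for x
      using that by (auto intro!: continuous_intros)
    show "(((\<lambda>t. - (t powr - \<gamma>) / \<gamma>) \<circ> real_of_ereal) \<longlongrightarrow> - 1 / \<gamma>) (at_right 1)"
      unfolding one_ereal_def ereal_tendsto_simps using assms
      by (auto intro!: tendsto_eq_intros)
    have "((\<lambda>t. - (t powr - \<gamma>) / \<gamma>) \<longlongrightarrow> - 0 / \<gamma>) at_top"
      using assms by (intro tendsto_intros tendsto_neg_powr filterlim_ident) auto
    then show "(((\<lambda>t. - (t powr - \<gamma>) / \<gamma>) \<circ> real_of_ereal) \<longlongrightarrow> 0) (at_left \<infinity>)"
      unfolding ereal_tendsto_simps by simp
  qed auto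
  then show ?thesis by (simp add: einterval_def one_ereal_def greaterThan_def)
qed

lemma LBINT_scale:
  fixes f :: "real \<Rightarrow> 'b::euclidean_space"
  assumes "0 < c"
  shows "(LBINT s:{0<..}. f s) = c *\<^sub>R (LBINT s:{0<..}. f (c * s))"
proof -
  have "(LBINT s:{0<..}. f s) = \<bar>c\<bar> *\<^sub>R (\<integral>s. indicator {0<..} (0 + c * s) *\<^sub>R f (0 + c * s) \<partial>lborel)"
    unfolding set_lebesgue_integral_def using assms by (intro lborel_integral_real_affine) auto
  also have "(\<lambda>s. indicator {0<..} (0 + c * s) *\<^sub>R f (0 + c * s)) = (\<lambda>s. indicator {0<..} s *\<^sub>R f (c * s))"
    using assms by (auto simp: fun_eq_iff indicator_def zero_less_mult_iff)
  finally show ?thesis using assms by (simp add: set_lebesgue_integral_def)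
qed

lemma LBINT_reflect:
  fixes f :: "real \<Rightarrow> 'b::euclidean_space"
  shows "(LBINT s:{0<..}. f (a - s)) = (LBINT z:{..<a}. f z)"
proof -
  have "(LBINT z:{..<a}. f z) = \<bar>- 1\<bar> *\<^sub>R (\<integral>s. indicator {..<a} (a + (- 1) * s) *\<^sub>R f (a + (- 1) * s) \<partial>lborel)"
    unfolding set_lebesgue_integral_def by (intro lborel_integral_real_affine) auto
  also have "(\<lambda>s. indicator {..<a} (a + (- 1) * s) *\<^sub>R f (a + (- 1) * s)) = (\<lambda>s. indicator {0<..} s *\<^sub>R f (a - s))"
    by (auto simp: fun_eq_iff indicator_def)
  finally show ?thesis by (simp add: set_lebesgue_integral_def)
qed

lemma set_integrable_bound_le:
  fixes f :: "real \<Rightarrow> 'b::{banach,second_countable_topology}"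
  assumes "set_integrable lborel A h" "(\<lambda>x. indicator A x *\<^sub>R f x) \<in> borel_measurable borel"
    "\<And>x. x \<in> A \<Longrightarrow> norm (f x) \<le> h x"
  shows "set_integrable lborel A f"
  unfolding set_integrable_def
  by (rule integrable_deriv_bound[OF assms(1)[unfolded set_integrable_def]])
     (use assms in \<open>auto simp: indicator_def\<close>)

context gg_fun
begin

lemma integrable_exp_powr:
  assumes "c > 0"
  shows "set_integrable lborel {0<..} (\<lambda>t. t ^ m * exp (- (c * t powr \<gamma>)))"
proof -
  obtain B where B: "\<And>x. x \<ge> 0 \<Longrightarrow> exp (- (c * x powr \<gamma>)) * (1 + x) ^ (m + 2) \<le> B"
    using exp_powr_rapid[OF assms] by blast
  have "set_integrable lborel {0<..} (\<lambda>t. t ^ m *\<^sub>R exp (- (c * t powr \<gamma>)))"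
    by (rule set_integrable_power_mult[where C = B]) (use B in auto)
  then show ?thesis by simp
qed

lemma measurable_K [measurable]:
  assumes [measurable]: "XS \<in> N \<rightarrow>\<^sub>M seqs n" "U \<in> borel_measurable N" "T \<in> borel_measurable N" "Z \<in> borel_measurable N"
  shows "(\<lambda>p. K n (XS p) (U p) (T p) (Z p)) \<in> borel_measurable N"
proof -
  have int: "(\<lambda>p. \<integral>x. arg_fun (T p) (1 + of_real (U p) + \<i> * of_real (T p * Z p)) x powr of_real \<gamma> \<partial>P0) \<in> borel_measurable N"
    unfolding arg_fun_def by measurable
  have "(\<lambda>p. wprod \<gamma> n (XS p) (arg_fun (T p) (1 + of_real (U p) + \<i> * of_real (T p * Z p)))) \<in> borel_measurable N"
    unfolding wprod_eq
  proof (rule borel_measurable_prod)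
    fix i assume "i \<in> {..<n}"
    then have i: "i < n" by simp
    have [measurable]: "(\<lambda>p. real (frequency n (XS p) (XS p i))) \<in> borel_measurable N"
      by (rule measurable_compose[OF assms(1) measurable_frequency[OF i]])
    have [measurable]: "(\<lambda>p. XS p i) \<in> N \<rightarrow>\<^sub>M borel"
      by (rule measurable_compose[OF assms(1)]) (use i in auto)
    define A where "A p = arg_fun (T p) (1 + of_real (U p) + \<i> * of_real (T p * Z p)) (XS p i)" for p
    define R where "R p = \<gamma> / real (frequency n (XS p) (XS p i)) - 1" for p
    have [measurable]: "A \<in> borel_measurable N" "R \<in> borel_measurable N"
      unfolding A_def arg_fun_def R_def by measurable
    have "(\<lambda>p. if A p = 0 then 0 else exp (of_real (R p) * Ln (A p))) \<in> borel_measurable N" by measurable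
    moreover have "(\<lambda>p. A p powr of_real (R p)) = (\<lambda>p. if A p = 0 then 0 else exp (of_real (R p) * Ln (A p)))"
      by (auto simp: powr_def)
    ultimately show "(\<lambda>p. arg_fun (T p) (1 + of_real (U p) + \<i> * of_real (T p * Z p)) (XS p i) powr
        of_real (\<gamma> / real (frequency n (XS p) (XS p i)) - 1)) \<in> borel_measurable N"
      unfolding A_def R_def by simp
  qed
  then show ?thesis unfolding K_def ker_def using int by measurable
qed

text \<open>\<open>K\<close> depends on a sample only through its first \<open>n\<close> entries, so that measurability on the
  product space also covers samples that are not extensional.\<close>

lemma K_restrict: "K n (restrict xs {..<n}) u t z = K n xs u t z"
  unfolding K_def ker_def wprod_eq
  by (intro arg_cong2[where f = "(*)"] prod.cong refl) (auto simp: frequency_def cong: conj_cong)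

lemma measurable_K_fixed [measurable]:
  assumes [measurable]: "U \<in> borel_measurable N" "T \<in> borel_measurable N" "Z \<in> borel_measurable N"
  shows "(\<lambda>p. K n xs (U p) (T p) (Z p)) \<in> borel_measurable N"
proof -
  have [measurable]: "(\<lambda>p. restrict xs {..<n}) \<in> N \<rightarrow>\<^sub>M seqs n"
    by (intro measurable_const) (auto simp: space_PiM)
  show ?thesis unfolding K_restrict[of n xs, symmetric] by measurable
qed

text \<open>For \<open>m = n\<close>, divided by its value \<open>G0\<close> at
  \<open>t = 0\<close>, this is the conditional characteristic function of \<open>Y z\<close> at
  \<open>t\<close> given the sample (see \<open>char_fun\<close> and \<open>law_XX\<close>). The
  index \<open>m = n - 1\<close> arises from differentiation in \<open>z\<close>.\<close>

definition Gf :: "nat \<Rightarrow> (nat \<Rightarrow> 'x) \<Rightarrow> nat \<Rightarrow> real \<Rightarrow> real \<Rightarrow> complex" where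
  "Gf n xs m t z = (LBINT u:{0<..}. u ^ (m - 1) *\<^sub>R K n xs u t z)"

lemma Gf_eq_T: "Gf n xs m t z = rapid.T (kk n xs t) 1 m (1 + \<i> * of_real (t * z))"
  unfolding Gf_def rapid.T_def[OF rapid_kk] K_kk by (simp add: add_ac)

lemma measurable_Gf [measurable]:
  assumes [measurable]: "XS \<in> N \<rightarrow>\<^sub>M seqs n" "T \<in> borel_measurable N" "Z \<in> borel_measurable N"
  shows "(\<lambda>p. Gf n (XS p) m (T p) (Z p)) \<in> borel_measurable N"
  unfolding Gf_def set_lebesgue_integral_def by measurable

lemma measurable_Gf_fixed [measurable]:
  assumes [measurable]: "T \<in> borel_measurable N" "Z \<in> borel_measurable N"
  shows "(\<lambda>p. Gf n xs m (T p) (Z p)) \<in> borel_measurable N"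
  unfolding Gf_def set_lebesgue_integral_def by measurable

definition E0 :: "nat \<Rightarrow> real" where
  "E0 m = (LBINT u:{0<..}. u ^ (m - 1) * exp (- (b * (1 + u) powr \<gamma>)))"

lemma E0_integrable: "set_integrable lborel {0<..} (\<lambda>u. u ^ m * exp (- (b * (1 + u) powr \<gamma>)))"
proof (rule set_integrable_bound_le[OF integrable_exp_powr[OF b_pos, of m]])
  fix u :: real assume "u \<in> {0<..}"
  then have "u powr \<gamma> \<le> (1 + u) powr \<gamma>" using gam by (intro powr_mono2) auto
  then have "exp (- (b * (1 + u) powr \<gamma>)) \<le> exp (- (b * u powr \<gamma>))" using b_pos by simp
  then show "norm (u ^ m * exp (- (b * (1 + u) powr \<gamma>))) \<le> u ^ m * exp (- (b * u powr \<gamma>))"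
    using \<open>u \<in> {0<..}\<close> by (simp add: abs_mult mult_left_mono)
qed measurable

lemma E0_nonneg: "E0 m \<ge> 0"
  unfolding E0_def set_lebesgue_integral_def by (intro Bochner_Integration.integral_nonneg) (auto simp: indicator_def)

lemma K_integrable: "set_integrable lborel {0<..} (\<lambda>u. u ^ m *\<^sub>R K n xs u t z)"
proof (rule set_integrable_bound_le[OF E0_integrable[of m]])
  fix u :: real assume u: "u \<in> {0<..}"
  have "norm (K n xs u t z) \<le> exp (- (b * (1 + u) powr \<gamma>)) * exp (- (b * (\<bar>t\<bar> powr \<gamma> * D z)))"
    using u by (intro norm_K_le) auto
  also have "\<dots> \<le> exp (- (b * (1 + u) powr \<gamma>)) * 1"
    using b_pos D_nonneg[of z] by (intro mult_left_mono) auto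
  finally show "norm (u ^ m *\<^sub>R K n xs u t z) \<le> u ^ m * exp (- (b * (1 + u) powr \<gamma>))"
    using u by (simp add: mult_left_mono)
qed measurable

lemma norm_Gf_le: "norm (Gf n xs m t z) \<le> E0 m * exp (- (b * (\<bar>t\<bar> powr \<gamma> * D z)))"
proof -
  have "norm (Gf n xs m t z) \<le> (\<integral>u. (indicator {0<..} u *\<^sub>R (u ^ (m - 1) * exp (- (b * (1 + u) powr \<gamma>)))) * exp (- (b * (\<bar>t\<bar> powr \<gamma> * D z))) \<partial>lborel)"
    unfolding Gf_def set_lebesgue_integral_def
  proof (rule norm_integral_le_integral)
    show "integrable lborel (\<lambda>u. indicator {0<..} u *\<^sub>R u ^ (m - 1) *\<^sub>R K n xs u t z)"
      using K_integrable by (simp add: set_integrable_def)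
    show "integrable lborel (\<lambda>u. (indicator {0<..} u *\<^sub>R (u ^ (m - 1) * exp (- (b * (1 + u) powr \<gamma>)))) * exp (- (b * (\<bar>t\<bar> powr \<gamma> * D z))))"
      using E0_integrable by (intro integrable_mult_left) (simp add: set_integrable_def)
    show "norm (indicator {0<..} u *\<^sub>R u ^ (m - 1) *\<^sub>R K n xs u t z) \<le> (indicator {0<..} u *\<^sub>R (u ^ (m - 1) * exp (- (b * (1 + u) powr \<gamma>)))) * exp (- (b * (\<bar>t\<bar> powr \<gamma> * D z)))" for u
      using norm_K_le[of u n xs t z] by (cases "u > 0") (auto simp: mult.assoc intro!: mult_left_mono)
  qed
  then show ?thesis by (simp add: E0_def set_lebesgue_integral_def)
qed

text \<open>The Hoelder constant of \<open>K\<close> at \<open>t = 0\<close>. Its dependence on the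
  sample is kept visible because it has to be integrated over \<open>urn n\<close>
  (\<open>cst_integrable\<close>). The numbers \<open>4\<close> and \<open>3\<close> come from
  \<open>norm_powr_diff_le\<close> and \<open>wprod_diff_le\<close>.\<close>

definition cst :: "nat \<Rightarrow> (nat \<Rightarrow> 'x) \<Rightarrow> real \<Rightarrow> real" where
  "cst n xs z = 4 * \<beta> * D z + 3 * (\<Sum>i<n. \<bar>g (xs i) - z\<bar> powr \<gamma>)"

lemma cst_nonneg: "cst n xs z \<ge> 0"
  unfolding cst_def using beta D_nonneg by (intro add_nonneg_nonneg mult_nonneg_nonneg sum_nonneg) auto

lemma Im_Gf: "Im (Gf n xs m t z) = (LBINT u:{0<..}. u ^ (m - 1) * Im (K n xs u t z))"
  using integral_Im[OF K_integrable[of "m - 1" n xs t z, unfolded set_integrable_def]]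
  by (simp add: Gf_def set_lebesgue_integral_def mult.assoc)

lemma Re_Gf: "Re (Gf n xs m t z) = (LBINT u:{0<..}. u ^ (m - 1) * Re (K n xs u t z))"
  using integral_Re[OF K_integrable[of "m - 1" n xs t z, unfolded set_integrable_def]]
  by (simp add: Gf_def set_lebesgue_integral_def mult.assoc)

lemma abs_Im_Gf_le: "\<bar>Im (Gf n xs m t z)\<bar> \<le> E0 m * (\<bar>t\<bar> powr \<gamma> * cst n xs z)"
proof -
  have "norm (Im (Gf n xs m t z)) \<le> (\<integral>u. (indicator {0<..} u *\<^sub>R (u ^ (m - 1) * exp (- (b * (1 + u) powr \<gamma>)))) * (\<bar>t\<bar> powr \<gamma> * cst n xs z) \<partial>lborel)"
    unfolding Im_Gf set_lebesgue_integral_def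
  proof (rule norm_integral_le_integral)
    show "integrable lborel (\<lambda>u. indicator {0<..} u *\<^sub>R (u ^ (m - 1) * Im (K n xs u t z)))"
      using integrable_Im[OF K_integrable[of "m - 1" n xs t z, unfolded set_integrable_def]] by (simp add: mult.assoc)
    show "integrable lborel (\<lambda>u. (indicator {0<..} u *\<^sub>R (u ^ (m - 1) * exp (- (b * (1 + u) powr \<gamma>)))) * (\<bar>t\<bar> powr \<gamma> * cst n xs z))"
      using E0_integrable by (intro integrable_mult_left) (simp add: set_integrable_def)
    show "norm (indicator {0<..} u *\<^sub>R (u ^ (m - 1) * Im (K n xs u t z))) \<le> (indicator {0<..} u *\<^sub>R (u ^ (m - 1) * exp (- (b * (1 + u) powr \<gamma>)))) * (\<bar>t\<bar> powr \<gamma> * cst n xs z)" for u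
      using abs_Im_K_le[of u n xs t z] by (cases "u > 0") (auto simp: cst_def mult.assoc abs_mult intro!: mult_left_mono)
  qed
  then show ?thesis by (simp add: E0_def set_lebesgue_integral_def)
qed

text \<open>The Gil-Pelaez integral for the distribution function of \<open>Y z\<close> at the point
  \<open>0\<close>, before division by \<open>pi * G0 n xs\<close>.\<close>

definition H :: "nat \<Rightarrow> (nat \<Rightarrow> 'x) \<Rightarrow> real \<Rightarrow> real" where
  "H n xs z = (LBINT t:{0<..}. inverse t * Im (Gf n xs n t z))"

text \<open>The bound is taken to be locally uniform in \<open>z\<close>; \<open>d\<close> is a lower bound of \<open>D\<close> near \<open>z\<close>.\<close>

definition Hbound :: "nat \<Rightarrow> real \<Rightarrow> real \<Rightarrow> real \<Rightarrow> real" where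
  "Hbound n c d t = (if t \<le> 1 then E0 n * c * t powr (\<gamma> - 1) else E0 n * exp (- (b * d * t powr \<gamma>)))"

lemma Hbound_integrable:
  assumes "d > 0"
  shows "set_integrable lborel {0<..} (Hbound n c d)"
proof -
  have 1: "integrable lborel (\<lambda>t. E0 n * c * (indicator {0<..<1} t * t powr (\<gamma> - 1)))"
    using set_integrable_powr_0_1[OF gam(1)] by (intro integrable_mult_right) (simp add: set_integrable_def)
  have 2: "integrable lborel (\<lambda>t. E0 n * (indicator {0<..} t * exp (- (b * d * t powr \<gamma>))))"
    using integrable_exp_powr[of "b * d" 0] b_pos assms by (intro integrable_mult_right) (simp add: set_integrable_def)
  have "integrable lborel (\<lambda>t. indicator {0<..} t *\<^sub>R Hbound n c d t)"
  proof (rule Bochner_Integration.integrable_bound[OF Bochner_Integration.integrable_add[OF integrable_abs[OF 1] integrable_abs[OF 2]]])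
    show "(\<lambda>t. indicator {0<..} t *\<^sub>R Hbound n c d t) \<in> borel_measurable lborel"
      unfolding Hbound_def by measurable
    have "AE t in lborel. t \<noteq> (1::real)" by (rule AE_lborel_singleton)
    then show "AE t in lborel. norm (indicator {0<..} t *\<^sub>R Hbound n c d t) \<le>
        norm (\<bar>E0 n * c * (indicator {0<..<1} t * t powr (\<gamma> - 1))\<bar> + \<bar>E0 n * (indicator {0<..} t * exp (- (b * d * t powr \<gamma>)))\<bar>)"
      by eventually_elim (auto simp: Hbound_def indicator_def)
  qed
  then show ?thesis by (simp add: set_integrable_def)
qed

lemma H_integrand_le:
  assumes "t > 0" "cst n xs z \<le> c" "d \<le> D z"
  shows "\<bar>inverse t * Im (Gf n xs n t z)\<bar> \<le> Hbound n c d t"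
proof (cases "t \<le> 1")
  case True
  have "\<bar>inverse t * Im (Gf n xs n t z)\<bar> \<le> inverse t * (E0 n * (t powr \<gamma> * cst n xs z))"
    using abs_Im_Gf_le[of n xs n t z] assms by (simp add: abs_mult mult_left_mono)
  also have "\<dots> = E0 n * cst n xs z * t powr (\<gamma> - 1)"
    using assms by (simp add: powr_diff field_simps)
  also have "\<dots> \<le> E0 n * c * t powr (\<gamma> - 1)"
    using assms E0_nonneg by (intro mult_right_mono mult_left_mono) auto
  finally show ?thesis using True by (simp add: Hbound_def)
next
  case False
  have "\<bar>Im (Gf n xs n t z)\<bar> \<le> norm (Gf n xs n t z)" by (rule abs_Im_le_cmod)
  also have "\<dots> \<le> E0 n * exp (- (b * (\<bar>t\<bar> powr \<gamma> * D z)))" by (rule norm_Gf_le)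
  also have "\<dots> \<le> E0 n * exp (- (b * d * t powr \<gamma>))"
  proof -
    have "b * d * t powr \<gamma> \<le> b * D z * t powr \<gamma>" using assms b_pos by (intro mult_right_mono mult_left_mono) auto
    then show ?thesis using E0_nonneg assms by (intro mult_left_mono) (auto simp: mult_ac)
  qed
  finally have *: "\<bar>Im (Gf n xs n t z)\<bar> \<le> E0 n * exp (- (b * d * t powr \<gamma>))" .
  have "\<bar>inverse t * Im (Gf n xs n t z)\<bar> \<le> 1 * \<bar>Im (Gf n xs n t z)\<bar>"
    unfolding abs_mult using False by (intro mult_right_mono) (auto simp: divide_simps)
  with * False show ?thesis by (simp add: Hbound_def)
qed

lemma H_integrable:
  assumes "D z > 0"
  shows "set_integrable lborel {0<..} (\<lambda>t. inverse t * Im (Gf n xs n t z))"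
  by (rule set_integrable_bound_le[OF Hbound_integrable[OF assms]])
     (use H_integrand_le[of _ n xs z "cst n xs z" "D z"] in \<open>auto simp: divide_inverse mult.commute\<close>)

text \<open>A derivative in \<open>z\<close> acts on the kernel as \<open>\<i> * t\<close> times a
  derivative in \<open>u\<close>. Integration by parts against \<open>u ^ (n - 1)\<close> leaves the
  boundary value at \<open>u = 0\<close> if \<open>n = 1\<close>, and otherwise lowers the power.
  The factor \<open>t\<close> so produced cancels \<open>1 / t\<close> in \<open>H\<close>.\<close>

definition Gd :: "nat \<Rightarrow> (nat \<Rightarrow> 'x) \<Rightarrow> real \<Rightarrow> real \<Rightarrow> complex" where
  "Gd n xs t z = (if n = 1 then K n xs 0 t z else of_nat (n - 1) * Gf n xs (n - 1) t z)"

definition E1 :: "nat \<Rightarrow> real" where "E1 n = (if n = 1 then 1 else real (n - 1) * E0 (n - 1))"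

lemma E1_nonneg: "E1 n \<ge> 0" unfolding E1_def using E0_nonneg by auto

lemma norm_Gd_le: "norm (Gd n xs t z) \<le> E1 n * exp (- (b * (\<bar>t\<bar> powr \<gamma> * D z)))"
proof (cases "n = 1")
  case True
  have "norm (K n xs 0 t z) \<le> exp (- (b * (1 + 0) powr \<gamma>)) * exp (- (b * (\<bar>t\<bar> powr \<gamma> * D z)))"
    by (rule norm_K_le) simp
  also have "\<dots> \<le> 1 * exp (- (b * (\<bar>t\<bar> powr \<gamma> * D z)))" using b_pos by (intro mult_right_mono) auto
  finally show ?thesis using True by (simp add: Gd_def E1_def)
next
  case False
  then show ?thesis using norm_Gf_le[of n xs "n - 1" t z]
    by (simp add: Gd_def E1_def norm_mult mult.assoc mult_left_mono)
qed

lemma measurable_Gd_fixed [measurable]: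
  assumes [measurable]: "T \<in> borel_measurable N" "Z \<in> borel_measurable N"
  shows "(\<lambda>p. Gd n xs (T p) (Z p)) \<in> borel_measurable N"
  unfolding Gd_def by (cases "n = 1") simp_all

lemma Gf_deriv:
  assumes "n \<ge> 1" "t > 0"
  shows "((\<lambda>z. inverse t * Im (Gf n xs n t z)) has_field_derivative - Re (Gd n xs t z)) (at z)"
proof -
  interpret r: rapid "kk n xs t" by (rule rapid_kk)
  obtain m where m: "n = Suc m" using assms by (cases n) auto
  let ?w = "1 + \<i> * of_real (t * z)"
  have "(r.T 1 (Suc m) has_field_derivative (if m = 0 then - kk n xs t ?w else - of_nat m * r.T 1 m ?w)) (at ?w)"
    by (rule r.T_deriv) auto
  also have "(if m = 0 then - kk n xs t ?w else - of_nat m * r.T 1 m ?w) = - Gd n xs t z"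
    using m by (auto simp: Gd_def K_kk Gf_eq_T)
  finally have d: "(r.T 1 (Suc m) has_field_derivative - Gd n xs t z) (at ?w)" .
  have "((\<lambda>z. 1 + \<i> * of_real (t * z)) has_vector_derivative \<i> * of_real t) (at z)"
    by (auto intro!: derivative_eq_intros simp: mult_ac)
  from field_vector_diff_chain_at[OF this d]
  have "((\<lambda>z. Gf n xs n t z) has_vector_derivative \<i> * of_real t * - Gd n xs t z) (at z)"
    by (simp add: comp_def Gf_eq_T m)
  from bounded_linear.has_vector_derivative[OF bounded_linear_Im this]
  have "((\<lambda>z. Im (Gf n xs n t z)) has_real_derivative - t * Re (Gd n xs t z)) (at z)"
    by (simp add: has_real_derivative_iff_has_vector_derivative)
  from DERIV_cmult[OF this, of "inverse t"] assms show ?thesis by (simp add: mult.assoc[symmetric])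
qed

lemma D_pos_near:
  assumes "D z > 0"
  obtains r where "r > 0" "\<And>y. y \<in> ball z r \<Longrightarrow> D y \<ge> D z / 2"
proof -
  have "isCont D z" using D_continuous by (simp add: continuous_on_eq_continuous_at)
  then have "(D \<longlongrightarrow> D z) (at z)" by (simp add: isCont_def)
  then have "\<forall>\<^sub>F y in at z. D y > D z / 2"
    using assms by (intro order_tendstoD) auto
  then obtain r where "r > 0" "\<And>y. y \<noteq> z \<Longrightarrow> dist y z < r \<Longrightarrow> D y > D z / 2"
    by (auto simp: eventually_at)
  then have "D y \<ge> D z / 2" if "y \<in> ball z r" for y
    using that assms by (cases "y = z") (auto simp: dist_commute intro: less_imp_le)
  with \<open>r > 0\<close> show ?thesis by (rule that)
qed

text \<open>After differentiation the singularity at \<open>t = 0\<close> is gone, so only large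
  \<open>t\<close> must be controlled. Near \<open>z\<close> the rate \<open>D\<close> stays above
  \<open>D z / 2\<close>, which gives one majorant for a whole ball.\<close>

theorem H_deriv:
  assumes n: "n \<ge> 1" and D: "D z > 0"
  shows "(H n xs has_field_derivative - (LBINT t:{0<..}. Re (Gd n xs t z))) (at z)"
proof -
  obtain r where r: "r > 0" "\<And>y. y \<in> ball z r \<Longrightarrow> D y \<ge> D z / 2" using D_pos_near[OF D] by blast
  have "(H n xs has_field_derivative (\<integral>t. indicator {0<..} t *\<^sub>R - Re (Gd n xs t z) \<partial>lborel)) (at z)"
    unfolding H_def set_lebesgue_integral_def
  proof (rule has_field_derivative_integral[OF r(1), where f' = "\<lambda>z t. indicator {0<..} t *\<^sub>R - Re (Gd n xs t z)" and
      B = "\<lambda>t. E1 n * (indicator {0<..} t * exp (- (b * (D z / 2) * t powr \<gamma>)))"])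
    fix y t assume y: "y \<in> ball z r"
    show "((\<lambda>z. indicator {0<..} t *\<^sub>R (inverse t * Im (Gf n xs n t z))) has_field_derivative
        indicator {0<..} t *\<^sub>R - Re (Gd n xs t y)) (at y)"
      using Gf_deriv[OF n, of t xs y] by (cases "t > 0") (auto simp: indicator_def)
    show "norm (indicator {0<..} t *\<^sub>R - Re (Gd n xs t y)) \<le> E1 n * (indicator {0<..} t * exp (- (b * (D z / 2) * t powr \<gamma>)))"
    proof (cases "t > 0")
      case True
      have "\<bar>Re (Gd n xs t y)\<bar> \<le> norm (Gd n xs t y)" by (rule abs_Re_le_cmod)
      also have "\<dots> \<le> E1 n * exp (- (b * (\<bar>t\<bar> powr \<gamma> * D y)))" by (rule norm_Gd_le)
      also have "\<dots> \<le> E1 n * exp (- (b * (D z / 2) * t powr \<gamma>))"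
      proof -
        have "b * (D z / 2) * t powr \<gamma> \<le> b * D y * t powr \<gamma>"
          using r(2)[OF y] b_pos by (intro mult_right_mono mult_left_mono) auto
        then show ?thesis using E1_nonneg True by (intro mult_left_mono) (auto simp: mult_ac)
      qed
      finally show ?thesis using True by simp
    qed simp
  next
    fix y assume y: "y \<in> ball z r"
    have "D y > 0" using r(2)[OF y] D by linarith
    then show "integrable lborel (\<lambda>t. indicator {0<..} t *\<^sub>R (inverse t * Im (Gf n xs n t y)))"
      using H_integrable by (simp add: set_integrable_def)
  next
    show "integrable lborel (\<lambda>t. E1 n * (indicator {0<..} t * exp (- (b * (D z / 2) * t powr \<gamma>))))"
      using integrable_exp_powr[of "b * (D z / 2)" 0] b_pos D
      by (intro integrable_mult_right) (simp add: set_integrable_def)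
  qed measurable
  then show ?thesis by (simp add: set_lebesgue_integral_def)
qed

end

section \<open>The density as an iterated integral\<close>

lemma Re_mult_real_of: "Re (of_real r * x) = r * Re x"
  by simp

text \<open>This is where the three cases of the formula come from: a quarter turn produces the
  factor \<open>(- \<i>) ^ (n - 1)\<close>, whose parity decides between real and imaginary part and
  whose period determines the sign.\<close>

lemma Re_neg_i_power:
  assumes "n \<ge> 1"
  shows "Re ((- \<i>) ^ (n - 1) * x) = (if even n then (- 1) ^ (n div 2 + 1) * Im x else (- 1) ^ (n div 2) * Re x)"
proof (cases "even n")
  case True
  then obtain p where p: "n = 2 * p" by blast
  with assms have "p \<ge> 1" by auto
  then obtain q where "p = Suc q" by (cases p) auto
  with p have n: "n - 1 = 2 * q + 1" "n div 2 = Suc q" by auto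
  have "(- \<i>) ^ (2 * q) = of_real ((- 1) ^ q)" by (simp add: power_mult)
  then have "(- \<i>) ^ (n - 1) * x = of_real ((- 1) ^ q) * (- \<i> * x)" unfolding n power_add by simp
  then have "Re ((- \<i>) ^ (n - 1) * x) = Re (of_real ((- 1) ^ q) * (- \<i> * x))" by (simp only:)
  then have "Re ((- \<i>) ^ (n - 1) * x) = (- 1) ^ q * Im x" by (simp only: Re_mult_real_of) simp
  then show ?thesis using True n by simp
next
  case False
  then obtain q where q: "n = 2 * q + 1" by (auto elim: oddE)
  have "(- \<i>) ^ (2 * q) = of_real ((- 1) ^ q)" by (simp add: power_mult)
  then have "(- \<i>) ^ (n - 1) * x = of_real ((- 1) ^ q) * x" using q by simp
  then have "Re ((- \<i>) ^ (n - 1) * x) = Re (of_real ((- 1) ^ q) * x)" by (simp only:)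
  then have "Re ((- \<i>) ^ (n - 1) * x) = (- 1) ^ q * Re x" by (simp only: Re_mult_real_of)
  then show ?thesis using False q by simp
qed

lemma Re_mult_scaleR: "Re (a * (r *\<^sub>R x)) = r * Re (a * x)"
  by (simp add: algebra_simps)

lemma integral_power_diff:
  fixes z \<sigma> :: real
  assumes "n \<ge> 2" "z \<le> \<sigma>"
  shows "has_bochner_integral lborel (\<lambda>y. real (n - 1) * (y - z) ^ (n - 2) * indicator {z..\<sigma>} y) ((\<sigma> - z) ^ (n - 1))"
proof -
  have "has_bochner_integral lborel (\<lambda>y. (real (n - 1) * (y - z) ^ (n - 2)) * indicator {z..\<sigma>} y) ((\<sigma> - z) ^ (n - 1) - (z - z) ^ (n - 1))"
  proof (rule has_bochner_integral_FTC_Icc_real[OF assms(2)])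
    fix y
    have "n - 1 - Suc 0 = n - 2" by simp
    then show "((\<lambda>y. (y - z) ^ (n - 1)) has_real_derivative real (n - 1) * (y - z) ^ (n - 2)) (at y)"
      by (auto intro!: derivative_eq_intros)
  qed (auto intro!: continuous_intros)
  with assms show ?thesis by (simp add: power_0_left)
qed

context gg_fun
begin

text \<open>The inner integral over \<open>t\<close> in the formula for \<open>n \<ge> 2\<close>,
  with the sign and the choice between real and imaginary part absorbed in the power of
  \<open>- \<i>\<close> and without the normalization \<open>pi * G0 n xs\<close> (see
  \<open>gg_chi_inner\<close>).\<close>

definition wt :: "nat \<Rightarrow> (nat \<Rightarrow> 'x) \<Rightarrow> real \<Rightarrow> real" where
  "wt n xs z = (LBINT t:{0<..}. t ^ (n - 1) * Re ((- \<i>) ^ (n - 1) * K n xs 0 t z))"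

lemma norm_K0_le: "t > 0 \<Longrightarrow> norm (K n xs 0 t z) \<le> exp (- (b * (t powr \<gamma> * D z)))"
proof -
  assume t: "t > 0"
  have "norm (K n xs 0 t z) \<le> exp (- (b * (1 + 0) powr \<gamma>)) * exp (- (b * (\<bar>t\<bar> powr \<gamma> * D z)))"
    by (rule norm_K_le) simp
  also have "\<dots> \<le> 1 * exp (- (b * (\<bar>t\<bar> powr \<gamma> * D z)))" using b_pos by (intro mult_right_mono) auto
  finally show ?thesis using t by simp
qed

definition Ip :: "real \<Rightarrow> nat \<Rightarrow> real" where
  "Ip c m = (LBINT t:{0<..}. t ^ m * exp (- (c * t powr \<gamma>)))"

lemma Ip_nonneg: "Ip c m \<ge> 0"
  unfolding Ip_def set_lebesgue_integral_def by (intro Bochner_Integration.integral_nonneg) (auto simp: indicator_def)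

lemma Ip_scale:
  assumes "y > 0"
  shows "(LBINT t:{0<..}. t ^ m * exp (- (c * (t * y) powr \<gamma>))) = Ip c m / y ^ Suc m"
proof -
  have "Ip c m = y *\<^sub>R (LBINT t:{0<..}. (y * t) ^ m * exp (- (c * (y * t) powr \<gamma>)))"
    unfolding Ip_def by (rule LBINT_scale[OF assms])
  also have "\<dots> = y ^ Suc m * (LBINT t:{0<..}. t ^ m * exp (- (c * (t * y) powr \<gamma>)))"
    unfolding power_mult_distrib mult.assoc set_integral_mult_right by (simp add: mult.commute[of y])
  finally show ?thesis using assms by (simp add: field_simps)
qed

lemma Ip_scale_integrable:
  assumes "y > 0" "c > 0"
  shows "set_integrable lborel {0<..} (\<lambda>t. t ^ m * exp (- (c * (t * y) powr \<gamma>)))"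
proof -
  have "(\<lambda>t. t ^ m * exp (- (c * (t * y) powr \<gamma>))) = (\<lambda>t. t ^ m * exp (- ((c * y powr \<gamma>) * t powr \<gamma>)))"
    by (simp add: powr_mult mult_ac)
  then show ?thesis using integrable_exp_powr[of "c * y powr \<gamma>" m] assms by simp
qed

text \<open>After a quarter turn the path of integration runs through the vertical line on which
  \<open>u = 0\<close>, with \<open>z\<close> as parameter.\<close>

lemma Gf_rotate:
  assumes t: "t > 0" and m: "m \<ge> 1"
  shows "Gf n xs m t \<sigma> = (- \<i>) ^ m * of_real (t ^ m) * (LBINT z:{..<\<sigma>}. (\<sigma> - z) ^ (m - 1) *\<^sub>R K n xs 0 t z)"
proof -
  interpret r: rapid "kk n xs t" by (rule rapid_kk)
  obtain k where k: "m = Suc k" using m by (cases m) auto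
  let ?w = "1 + \<i> * of_real (t * \<sigma>) :: complex"
  have "Gf n xs m t \<sigma> = r.T (- \<i>) m ?w"
    unfolding Gf_eq_T k by (rule r.T_rotate) simp
  also have "\<dots> = (- \<i>) ^ m * (LBINT s:{0<..}. s ^ k *\<^sub>R kk n xs t (?w + - \<i> * of_real s))"
    by (simp add: r.T_def k)
  also have "(LBINT s:{0<..}. s ^ k *\<^sub>R kk n xs t (?w + - \<i> * of_real s))
     = t *\<^sub>R (LBINT s:{0<..}. (t * s) ^ k *\<^sub>R kk n xs t (?w + - \<i> * of_real (t * s)))"
    by (rule LBINT_scale[OF t])
  also have "(\<lambda>s. (t * s) ^ k *\<^sub>R kk n xs t (?w + - \<i> * of_real (t * s))) = (\<lambda>s. t ^ k *\<^sub>R (s ^ k *\<^sub>R K n xs 0 t (\<sigma> - s)))"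
    by (simp add: K_kk fun_eq_iff power_mult_distrib algebra_simps)
  also have "(LBINT s:{0<..}. t ^ k *\<^sub>R (s ^ k *\<^sub>R K n xs 0 t (\<sigma> - s))) = t ^ k *\<^sub>R (LBINT s:{0<..}. s ^ k *\<^sub>R K n xs 0 t (\<sigma> - s))"
    by (rule set_integral_scaleR_right)
  also have "(LBINT s:{0<..}. s ^ k *\<^sub>R K n xs 0 t (\<sigma> - s)) = (LBINT z:{..<\<sigma>}. (\<sigma> - z) ^ k *\<^sub>R K n xs 0 t z)"
    using LBINT_reflect[of "\<lambda>z. (\<sigma> - z) ^ k *\<^sub>R K n xs 0 t z" \<sigma>] by simp
  finally show ?thesis by (simp add: k scaleR_conv_of_real mult_ac)
qed

lemma LBINT_lessThan_atMost:
  fixes f :: "real \<Rightarrow> 'b::{banach,second_countable_topology}"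
  assumes [measurable]: "f \<in> borel_measurable borel"
  shows "(LBINT z:{..<a}. f z) = (LBINT z:{..a}. f z)"
  unfolding set_lebesgue_integral_def
proof (rule integral_cong_AE)
  show "AE z in lborel. indicator {..<a} z *\<^sub>R f z = indicator {..a} z *\<^sub>R f z"
    using AE_lborel_singleton[of a] by eventually_elim (auto simp: indicator_def)
qed auto

lemma measurable_wt [measurable]: "wt n xs \<in> borel_measurable borel"
  unfolding wt_def set_lebesgue_integral_def by measurable

section \<open>Decay in \<open>z\<close>, with a constant \<open>c\<close> as provided by
  \<open>D_lower\<close>\<close>

context
  fixes c :: real
  assumes c: "c > 0" "\<And>z. D z \<ge> c * (1 + \<bar>z\<bar>) powr \<gamma>"
begin

lemma norm_K0_decay:
  assumes "t > 0"
  shows "norm (K n xs 0 t z) \<le> exp (- (b * c * (t * (1 + \<bar>z\<bar>)) powr \<gamma>))"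
proof -
  have "b * c * (t * (1 + \<bar>z\<bar>)) powr \<gamma> = b * (t powr \<gamma> * (c * (1 + \<bar>z\<bar>) powr \<gamma>))"
    by (simp add: powr_mult mult_ac)
  also have "\<dots> \<le> b * (t powr \<gamma> * D z)" using b_pos c(2)[of z] by (intro mult_left_mono) auto
  finally show ?thesis using norm_K0_le[OF assms, of n xs z] by (smt (verit) exp_le_cancel_iff)
qed

lemma K0_integrable: "set_integrable lborel {0<..} (\<lambda>t. t ^ m *\<^sub>R K n xs 0 t z)"
proof (rule set_integrable_bound_le)
  show "set_integrable lborel {0<..} (\<lambda>t. t ^ m * exp (- (b * c * (t * (1 + \<bar>z\<bar>)) powr \<gamma>)))"
    using b_pos c by (intro Ip_scale_integrable) auto
  fix t :: real assume "t \<in> {0<..}"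
  then show "norm (t ^ m *\<^sub>R K n xs 0 t z) \<le> t ^ m * exp (- (b * c * (t * (1 + \<bar>z\<bar>)) powr \<gamma>))"
    using norm_K0_decay[of t n xs z] by (simp add: mult_left_mono)
qed measurable

text \<open>The majorant depends on \<open>t\<close> only through
  \<open>t * (1 + \<bar>z\<bar>)\<close>, so rescaling \<open>t\<close> yields one inverse power of
  \<open>1 + \<bar>z\<bar>\<close> for every power of \<open>t\<close> and one for the
  measure.\<close>

lemma K0_norm_integral:
  "(LBINT t:{0<..}. norm (t ^ m *\<^sub>R K n xs 0 t z)) \<le> Ip (b * c) m / (1 + \<bar>z\<bar>) ^ Suc m"
proof -
  have "(LBINT t:{0<..}. norm (t ^ m *\<^sub>R K n xs 0 t z)) \<le> (LBINT t:{0<..}. t ^ m * exp (- (b * c * (t * (1 + \<bar>z\<bar>)) powr \<gamma>)))"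
  proof (rule set_integral_mono)
    show "set_integrable lborel {0<..} (\<lambda>t. norm (t ^ m *\<^sub>R K n xs 0 t z))"
      using set_integrable_norm[OF K0_integrable] .
    show "set_integrable lborel {0<..} (\<lambda>t. t ^ m * exp (- (b * c * (t * (1 + \<bar>z\<bar>)) powr \<gamma>)))"
      using b_pos c by (intro Ip_scale_integrable) auto
    fix t :: real assume "t \<in> {0<..}"
    then show "norm (t ^ m *\<^sub>R K n xs 0 t z) \<le> t ^ m * exp (- (b * c * (t * (1 + \<bar>z\<bar>)) powr \<gamma>))"
      using norm_K0_decay[of t n xs z] by (simp add: mult_left_mono)
  qed
  also have "\<dots> = Ip (b * c) m / (1 + \<bar>z\<bar>) ^ Suc m" by (rule Ip_scale) simp
  finally show ?thesis .
qed

lemma wt_eq: "wt n xs z = Re ((- \<i>) ^ (n - 1) * (LBINT t:{0<..}. t ^ (n - 1) *\<^sub>R K n xs 0 t z))"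
proof -
  have int: "integrable lborel (\<lambda>t. (- \<i>) ^ (n - 1) * (indicator {0<..} t *\<^sub>R (t ^ (n - 1) *\<^sub>R K n xs 0 t z)))"
    using K0_integrable[of "n - 1" n xs z] by (intro integrable_mult_right) (simp add: set_integrable_def)
  have "Re ((- \<i>) ^ (n - 1) * (LBINT t:{0<..}. t ^ (n - 1) *\<^sub>R K n xs 0 t z))
     = Re (\<integral>t. (- \<i>) ^ (n - 1) * (indicator {0<..} t *\<^sub>R (t ^ (n - 1) *\<^sub>R K n xs 0 t z)) \<partial>lborel)"
    unfolding set_lebesgue_integral_def integral_mult_right_zero ..
  also have "\<dots> = (\<integral>t. Re ((- \<i>) ^ (n - 1) * (indicator {0<..} t *\<^sub>R (t ^ (n - 1) *\<^sub>R K n xs 0 t z))) \<partial>lborel)"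
    using integral_Re[OF int] by simp
  also have "\<dots> = wt n xs z"
    unfolding wt_def set_lebesgue_integral_def
    by (intro Bochner_Integration.integral_cong refl) (simp only: Re_mult_scaleR real_scaleR_def)
  finally show ?thesis ..
qed

lemma abs_wt_le:
  assumes "n \<ge> 1"
  shows "\<bar>wt n xs z\<bar> \<le> Ip (b * c) (n - 1) / (1 + \<bar>z\<bar>) ^ n"
proof -
  have "\<bar>wt n xs z\<bar> \<le> norm ((- \<i>) ^ (n - 1) * (LBINT t:{0<..}. t ^ (n - 1) *\<^sub>R K n xs 0 t z))"
    unfolding wt_eq by (rule abs_Re_le_cmod)
  also have "\<dots> = norm (LBINT t:{0<..}. t ^ (n - 1) *\<^sub>R K n xs 0 t z)" by (simp add: norm_mult norm_power)
  also have "\<dots> \<le> (LBINT t:{0<..}. norm (t ^ (n - 1) *\<^sub>R K n xs 0 t z))"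
    by (rule set_integral_norm_bound[OF K0_integrable])
  also have "\<dots> \<le> Ip (b * c) (n - 1) / (1 + \<bar>z\<bar>) ^ Suc (n - 1)" by (rule K0_norm_integral)
  finally show ?thesis using assms by simp
qed

lemma power_diff_le:
  fixes z \<sigma> :: real
  assumes "z \<le> \<sigma>" shows "(\<sigma> - z) ^ m \<le> (1 + \<bar>\<sigma>\<bar>) ^ m * (1 + \<bar>z\<bar>) ^ m"
proof -
  have "\<sigma> - z \<le> (1 + \<bar>\<sigma>\<bar>) * (1 + \<bar>z\<bar>)"
    using mult_nonneg_nonneg[OF abs_ge_zero[of \<sigma>] abs_ge_zero[of z]]
    by (simp only: distrib_left distrib_right mult_1 mult_1_right)
  then show ?thesis unfolding power_mult_distrib[symmetric] using assms by (intro power_mono) auto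
qed

text \<open>\<open>Gf_rotate\<close> with \<open>m = n - 1\<close> replaces the integral over
  \<open>u\<close> by one over \<open>z\<close>; what remains is to exchange it with the integral
  over \<open>t\<close>. For this the crude bound is enough:
  \<open>(1 + \<bar>z\<bar>) ^ (n - 2)\<close> against \<open>(1 + \<bar>z\<bar>) ^ n\<close> in the
  denominator leaves an integrable square.\<close>

lemma Re_Gd_double:
  assumes n: "n \<ge> 2"
  shows "(LBINT t:{0<..}. Re (Gd n xs t \<sigma>)) = real (n - 1) * (LBINT z:{..\<sigma>}. (\<sigma> - z) ^ (n - 2) * wt n xs z)"
proof -
  define J where "J = (\<lambda>(z, t). indicator {..\<sigma>} z *\<^sub>R indicator {0<..} t *\<^sub>R (\<sigma> - z) ^ (n - 2) *\<^sub>R t ^ (n - 1) *\<^sub>R K n xs 0 t z)"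
  have [measurable]: "J \<in> borel_measurable (lborel \<Otimes>\<^sub>M lborel)"
    unfolding J_def by measurable
  have n2: "Suc (n - 2) = n - 1" "Suc (n - 1) = n" using n by auto
  have inner: "integrable lborel (\<lambda>t. J (z, t))" for z
  proof -
    have "integrable lborel (\<lambda>t. (indicator {..\<sigma>} z * (\<sigma> - z) ^ (n - 2)) *\<^sub>R (indicator {0<..} t *\<^sub>R t ^ (n - 1) *\<^sub>R K n xs 0 t z))"
      using K0_integrable[of "n - 1" n xs z] by (intro integrable_scaleR_right) (simp add: set_integrable_def)
    also have "(\<lambda>t. (indicator {..\<sigma>} z * (\<sigma> - z) ^ (n - 2)) *\<^sub>R (indicator {0<..} t *\<^sub>R t ^ (n - 1) *\<^sub>R K n xs 0 t z)) = (\<lambda>t. J (z, t))"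
      by (auto simp: J_def fun_eq_iff)
    finally show ?thesis .
  qed
  have nJ: "(\<integral>t. norm (J (z, t)) \<partial>lborel) = indicator {..\<sigma>} z * (\<sigma> - z) ^ (n - 2) * (LBINT t:{0<..}. norm (t ^ (n - 1) *\<^sub>R K n xs 0 t z))" for z
  proof -
    have "(\<integral>t. norm (J (z, t)) \<partial>lborel) = (\<integral>t. (indicator {..\<sigma>} z * (\<sigma> - z) ^ (n - 2)) * (indicator {0<..} t * norm (t ^ (n - 1) *\<^sub>R K n xs 0 t z)) \<partial>lborel)"
      by (intro Bochner_Integration.integral_cong refl) (auto simp: J_def indicator_def abs_mult)
    then show ?thesis by (simp add: set_lebesgue_integral_def)
  qed
  define C where "C = (1 + \<bar>\<sigma>\<bar>) ^ (n - 2) * Ip (b * c) (n - 1)"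
  have int: "integrable (lborel \<Otimes>\<^sub>M lborel) J"
  proof (rule lborel_pair.Fubini_integrable)
    show "AE z in lborel. integrable lborel (\<lambda>t. J (z, t))" using inner by simp
    show "integrable lborel (\<lambda>z. \<integral>t. norm (J (z, t)) \<partial>lborel)"
    proof (rule integrable_deriv_bound)
      show "integrable lborel (\<lambda>z::real. C * inverse (1 + z\<^sup>2))"
        by (intro integrable_mult_right integrable_inverse_one_plus_square)
      show "(\<lambda>z. \<integral>t. norm (J (z, t)) \<partial>lborel) \<in> borel_measurable lborel" by measurable
      fix z :: real
      have C: "C \<ge> 0" unfolding C_def using Ip_nonneg by auto
      show "norm (\<integral>t. norm (J (z, t)) \<partial>lborel) \<le> C * inverse (1 + z\<^sup>2)"
      proof (cases "z \<le> \<sigma>")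
        case True
        have y: "1 + \<bar>z\<bar> > 0" by simp
        have "(\<integral>t. norm (J (z, t)) \<partial>lborel) = (\<sigma> - z) ^ (n - 2) * (LBINT t:{0<..}. norm (t ^ (n - 1) *\<^sub>R K n xs 0 t z))"
          unfolding nJ using True by simp
        also have "\<dots> \<le> ((1 + \<bar>\<sigma>\<bar>) ^ (n - 2) * (1 + \<bar>z\<bar>) ^ (n - 2)) * (Ip (b * c) (n - 1) / (1 + \<bar>z\<bar>) ^ Suc (n - 1))"
          using True Ip_nonneg
          by (intro mult_mono power_diff_le K0_norm_integral) (auto simp: set_lebesgue_integral_def intro!: Bochner_Integration.integral_nonneg)
        also have "\<dots> = C / (1 + \<bar>z\<bar>)\<^sup>2"
        proof -
          have "(1 + \<bar>z\<bar>) ^ n = (1 + \<bar>z\<bar>) ^ (n - 2) * (1 + \<bar>z\<bar>)\<^sup>2"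
            using n by (metis le_add_diff_inverse2 power_add)
          then show ?thesis using y n by (simp add: C_def)
        qed
        also have "\<dots> \<le> C * inverse (1 + z\<^sup>2)"
        proof -
          have "1 + z\<^sup>2 \<le> (1 + \<bar>z\<bar>)\<^sup>2" by (simp add: power2_sum)
          then show ?thesis unfolding divide_inverse using C
            by (intro mult_left_mono le_imp_inverse_le) (auto intro: add_pos_nonneg)
        qed
        finally show ?thesis by simp
      qed (use C in \<open>simp add: nJ\<close>)
    qed
  qed measurable
  have "(LBINT t:{0<..}. Re (Gd n xs t \<sigma>)) = (\<integral>t. real (n - 1) * Re ((- \<i>) ^ (n - 1) * (\<integral>z. J (z, t) \<partial>lborel)) \<partial>lborel)"
    unfolding set_lebesgue_integral_def
  proof (intro Bochner_Integration.integral_cong refl)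
    fix t :: real
    show "indicator {0<..} t *\<^sub>R Re (Gd n xs t \<sigma>) = real (n - 1) * Re ((- \<i>) ^ (n - 1) * (\<integral>z. J (z, t) \<partial>lborel))"
    proof (cases "t > 0")
      case True
      have "(LBINT z:{..<\<sigma>}. (\<sigma> - z) ^ (n - 2) *\<^sub>R K n xs 0 t z) = (LBINT z:{..\<sigma>}. (\<sigma> - z) ^ (n - 2) *\<^sub>R K n xs 0 t z)"
        by (rule LBINT_lessThan_atMost) measurable
      then have G: "Gf n xs (n - 1) t \<sigma> = (- \<i>) ^ (n - 1) * of_real (t ^ (n - 1)) * (LBINT z:{..\<sigma>}. (\<sigma> - z) ^ (n - 2) *\<^sub>R K n xs 0 t z)"
        using Gf_rotate[OF True, of "n - 1" n xs \<sigma>] n by (simp add: numeral_2_eq_2)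
      have "(\<integral>z. J (z, t) \<partial>lborel) = (\<integral>z. of_real (t ^ (n - 1)) * (indicator {..\<sigma>} z *\<^sub>R (\<sigma> - z) ^ (n - 2) *\<^sub>R K n xs 0 t z) \<partial>lborel)"
        using True by (intro Bochner_Integration.integral_cong refl) (auto simp: J_def scaleR_conv_of_real indicator_def)
      also have "\<dots> = of_real (t ^ (n - 1)) * (LBINT z:{..\<sigma>}. (\<sigma> - z) ^ (n - 2) *\<^sub>R K n xs 0 t z)"
        unfolding set_lebesgue_integral_def by (rule integral_mult_right_zero)
      finally have "(- \<i>) ^ (n - 1) * (\<integral>z. J (z, t) \<partial>lborel) = Gf n xs (n - 1) t \<sigma>" unfolding G by simp
      then show ?thesis using True n by (simp add: Gd_def)
    qed (simp add: J_def)
  qed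
  also have "\<dots> = real (n - 1) * (\<integral>t. Re ((- \<i>) ^ (n - 1) * (\<integral>z. J (z, t) \<partial>lborel)) \<partial>lborel)" by simp
  also have "(\<integral>t. Re ((- \<i>) ^ (n - 1) * (\<integral>z. J (z, t) \<partial>lborel)) \<partial>lborel) = Re ((- \<i>) ^ (n - 1) * (\<integral>t. (\<integral>z. J (z, t) \<partial>lborel) \<partial>lborel))"
  proof -
    have "integrable lborel (\<lambda>t. \<integral>z. J (z, t) \<partial>lborel)"
      using lborel_pair.integrable_snd[of "\<lambda>z t. J (z, t)"] int by simp
    then have "integrable lborel (\<lambda>t. (- \<i>) ^ (n - 1) * (\<integral>z. J (z, t) \<partial>lborel))" by simp
    from integral_Re[OF this] show ?thesis by simp
  qed
  also have "(\<integral>t. (\<integral>z. J (z, t) \<partial>lborel) \<partial>lborel) = (\<integral>z. (\<integral>t. J (z, t) \<partial>lborel) \<partial>lborel)"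
    using lborel_pair.Fubini_integral[of "\<lambda>z t. J (z, t)"] int by simp
  also have "Re ((- \<i>) ^ (n - 1) * (\<integral>z. (\<integral>t. J (z, t) \<partial>lborel) \<partial>lborel)) = (\<integral>z. Re ((- \<i>) ^ (n - 1) * (\<integral>t. J (z, t) \<partial>lborel)) \<partial>lborel)"
  proof -
    have "integrable lborel (\<lambda>z. \<integral>t. J (z, t) \<partial>lborel)"
      using lborel_pair.integrable_fst[of "\<lambda>z t. J (z, t)"] int by simp
    then have "integrable lborel (\<lambda>z. (- \<i>) ^ (n - 1) * (\<integral>t. J (z, t) \<partial>lborel))" by simp
    from integral_Re[OF this] show ?thesis by simp
  qed
  also have "\<dots> = (LBINT z:{..\<sigma>}. (\<sigma> - z) ^ (n - 2) * wt n xs z)"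
    unfolding set_lebesgue_integral_def
  proof (intro Bochner_Integration.integral_cong refl)
    fix z :: real
    have "(\<integral>t. J (z, t) \<partial>lborel) = (\<integral>t. of_real (indicator {..\<sigma>} z * (\<sigma> - z) ^ (n - 2)) * (indicator {0<..} t *\<^sub>R t ^ (n - 1) *\<^sub>R K n xs 0 t z) \<partial>lborel)"
      by (intro Bochner_Integration.integral_cong refl) (auto simp: J_def scaleR_conv_of_real indicator_def)
    also have "\<dots> = of_real (indicator {..\<sigma>} z * (\<sigma> - z) ^ (n - 2)) * (LBINT t:{0<..}. t ^ (n - 1) *\<^sub>R K n xs 0 t z)"
      unfolding set_lebesgue_integral_def by (rule integral_mult_right_zero)
    finally have "(- \<i>) ^ (n - 1) * (\<integral>t. J (z, t) \<partial>lborel) = of_real (indicator {..\<sigma>} z * (\<sigma> - z) ^ (n - 2)) *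
       ((- \<i>) ^ (n - 1) * (LBINT t:{0<..}. t ^ (n - 1) *\<^sub>R K n xs 0 t z))" by simp
    also have "Re \<dots> = indicator {..\<sigma>} z * (\<sigma> - z) ^ (n - 2) * wt n xs z"
      unfolding wt_eq by (simp del: of_real_mult)
    finally show "Re ((- \<i>) ^ (n - 1) * (\<integral>t. J (z, t) \<partial>lborel)) = indicator {..\<sigma>} z *\<^sub>R ((\<sigma> - z) ^ (n - 2) * wt n xs z)"
      by simp
  qed
  finally show ?thesis .
qed

text \<open>For large \<open>- z\<close> the crude bound of \<open>wt\<close> is not integrable against \<open>(\<sigma> - z) ^ (n - 1)\<close>.
  A factor \<open>\<bar>z\<bar> powr (- \<gamma>)\<close> is gained by subtracting the kernel of \<open>g = 0\<close>, whose contribution vanishes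
  because its rotated integral is real.\<close>

lemma wt_zero_part:
  assumes n: "n \<ge> 1"
  shows "(LBINT s:{0<..}. s ^ (n - 1) * Re ((- \<i>) ^ (n - 1) * kk n xs 0 (1 - \<i> * of_real s))) = 0"
proof -
  interpret r: rapid "kk n xs 0" by (rule rapid_kk)
  obtain m where m: "n = Suc m" using n by (cases n) auto
  let ?Y = "LBINT s:{0<..}. s ^ (n - 1) *\<^sub>R kk n xs 0 (1 + - \<i> * of_real s)"
  have int: "integrable lborel (\<lambda>s. (- \<i>) ^ (n - 1) * (indicator {0<..} s *\<^sub>R s ^ (n - 1) *\<^sub>R kk n xs 0 (1 + - \<i> * of_real s)))"
    using r.T_integrable[of "- \<i>" 1 "n - 1"] by (intro integrable_mult_right) (simp add: set_integrable_def)
  have "Gf n xs n 0 0 = r.T 1 (Suc m) 1" by (simp add: Gf_eq_T m)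
  also have "\<dots> = r.T (- \<i>) (Suc m) 1" by (rule r.T_rotate) simp
  also have "\<dots> = (- \<i>) ^ Suc m * (LBINT s:{0<..}. s ^ m *\<^sub>R kk n xs 0 (1 + - \<i> * of_real s))"
    by (simp only: r.T_def diff_Suc_1)
  also have "\<dots> = - \<i> * ((- \<i>) ^ (n - 1) * ?Y)"
    using m by (simp only: power_Suc mult.assoc diff_Suc_1)
  finally have "Im (- \<i> * ((- \<i>) ^ (n - 1) * ?Y)) = Im (Gf n xs n 0 0)" by simp
  also have "\<dots> = 0" using abs_Im_Gf_le[of n xs n 0 0] by simp
  finally have "Re ((- \<i>) ^ (n - 1) * ?Y) = 0" by simp
  moreover have "Re ((- \<i>) ^ (n - 1) * ?Y) = (\<integral>s. Re ((- \<i>) ^ (n - 1) * (indicator {0<..} s *\<^sub>R s ^ (n - 1) *\<^sub>R kk n xs 0 (1 + - \<i> * of_real s))) \<partial>lborel)"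
    unfolding integral_Re[OF int] set_lebesgue_integral_def integral_mult_right_zero ..
  moreover have "\<dots> = (LBINT s:{0<..}. s ^ (n - 1) * Re ((- \<i>) ^ (n - 1) * kk n xs 0 (1 - \<i> * of_real s)))"
    unfolding set_lebesgue_integral_def
    by (intro Bochner_Integration.integral_cong refl) (simp only: Re_mult_scaleR real_scaleR_def mult_minus_left diff_conv_add_uminus)
  ultimately show ?thesis by (simp only:)
qed

text \<open>The rate of decay in \<open>s powr \<gamma>\<close> shared by the two kernels compared
  in \<open>K_minus_kk\<close>: the constant \<open>c\<close> belongs to the kernel of
  \<open>g\<close>, the constant \<open>1\<close> to that of the zero function.\<close>

definition c' :: real where "c' = \<beta> * cg * min c 1"

lemma c'_pos: "c' > 0" using beta cg_pos c by (simp add: c'_def)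

text \<open>At \<open>z = - y\<close> and \<open>t = s / y\<close> the argument of the kernel is
  \<open>1 - \<i> * s - \<i> * (s / y) * g\<close>. As \<open>y\<close> grows, \<open>g\<close>
  disappears from it, and the rate of this convergence is the Hoelder order
  \<open>(s / y) powr \<gamma>\<close>.\<close>

lemma K_minus_kk:
  assumes y: "y \<ge> 1" and s: "s > 0"
  shows "norm (K n xs 0 (s / y) (- y) - kk n xs 0 (1 - \<i> * of_real s)) \<le> exp (- (c' * s powr \<gamma>)) * ((s / y) powr \<gamma> * cst n xs 0)"
proof -
  let ?w = "1 + of_real 0 + \<i> * of_real ((s / y) * (- y)) :: complex"
  have w: "1 - \<i> * of_real s = ?w" using y by simp
  let ?f = "arg_fun (s / y) ?w" and ?h = "arg_fun 0 ?w"
  have d: "norm (?f x - ?h x) powr \<gamma> = (s / y) powr \<gamma> * \<bar>g x - 0\<bar> powr \<gamma>" for x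
  proof -
    have "?f x - ?h x = - \<i> * of_real ((s / y) * g x)" by (simp add: arg_fun_def)
    then have "norm (?f x - ?h x) = \<bar>(s / y) * g x\<bar>" by (simp only: norm_mult norm_minus_cancel norm_ii norm_of_real mult_1)
    also have "\<dots> = (s / y) * \<bar>g x\<bar>" using y s by (simp add: abs_mult)
    finally show ?thesis by (simp only: powr_mult diff_zero)
  qed
  have "norm (ker n xs ?f - ker n xs ?h) \<le> exp (- (\<beta> * cg * (min c 1 * s powr \<gamma>))) *
     (4 * \<beta> * (\<integral>x. norm (?f x - ?h x) powr \<gamma> \<partial>P0) + 3 * (\<Sum>i<n. norm (?f (xs i) - ?h (xs i)) powr \<gamma>))"
  proof (rule ker_diff_le[OF gint_arg_fun _ gint_arg_fun])
    have "(s / y) * y = s" using y by simp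
    then have "min c 1 * s powr \<gamma> \<le> c * ((s / y) * y) powr \<gamma>" by (simp add: mult_right_mono)
    also have "\<dots> = \<bar>s / y\<bar> powr \<gamma> * (c * y powr \<gamma>)" using y s by (simp only: powr_mult) simp
    also have "\<dots> \<le> \<bar>s / y\<bar> powr \<gamma> * D (- y)"
    proof (rule mult_left_mono)
      have "c * y powr \<gamma> \<le> c * (1 + \<bar>- y\<bar>) powr \<gamma>" using c y gam by (intro mult_left_mono powr_mono2) auto
      then show "c * y powr \<gamma> \<le> D (- y)" using c(2)[of "- y"] by linarith
    qed simp
    also have "\<dots> \<le> (\<integral>x. norm (?f x) powr \<gamma> \<partial>P0)" by (rule arg_fun_integral_ge(2)) simp
    finally show "min c 1 * s powr \<gamma> \<le> (\<integral>x. norm (?f x) powr \<gamma> \<partial>P0)" .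
    have h: "?h x = 1 - \<i> * of_real s" for x unfolding w by (simp add: arg_fun_def)
    have "s \<le> norm (1 - \<i> * of_real s :: complex)" using abs_Im_le_cmod[of "1 - \<i> * of_real s"] s by simp
    then have "s powr \<gamma> \<le> norm (1 - \<i> * of_real s :: complex) powr \<gamma>" using s gam by (intro powr_mono2) auto
    moreover have "min c 1 * s powr \<gamma> \<le> 1 * s powr \<gamma>" by (intro mult_right_mono) auto
    ultimately show "min c 1 * s powr \<gamma> \<le> (\<integral>x. norm (?h x) powr \<gamma> \<partial>P0)" unfolding h by simp
  qed auto
  also have "4 * \<beta> * (\<integral>x. norm (?f x - ?h x) powr \<gamma> \<partial>P0) + 3 * (\<Sum>i<n. norm (?f (xs i) - ?h (xs i)) powr \<gamma>) = (s / y) powr \<gamma> * cst n xs 0"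
    unfolding d cst_def D_def by (simp add: sum_distrib_left algebra_simps)
  finally show ?thesis unfolding K_def kk_def w c'_def by (simp add: mult.assoc)
qed

text \<open>After the substitution \<open>t = s / y\<close>, \<open>wt_zero_part\<close> allows the
  kernel of the zero function to be subtracted for free. By \<open>K_minus_kk\<close> the difference
  brings the additional factor \<open>y powr (- \<gamma>)\<close>.\<close>

lemma abs_wt_le':
  assumes n: "n \<ge> 1" and y: "y \<ge> 1"
  shows "\<bar>wt n xs (- y)\<bar> \<le> cst n xs 0 * (Ip c' (n - 1) + Ip c' n) * (y powr (- \<gamma>) / y ^ n)"
proof -
  have y0: "y > 0" using y by simp
  let ?\<phi> = "\<lambda>t. Re ((- \<i>) ^ (n - 1) * K n xs 0 t (- y))"
  let ?\<psi> = "\<lambda>s. Re ((- \<i>) ^ (n - 1) * kk n xs 0 (1 - \<i> * of_real s))"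
  interpret r: rapid "kk n xs 0" by (rule rapid_kk)
  have i1: "set_integrable lborel {0<..} (\<lambda>s. s ^ (n - 1) * ?\<phi> (s / y))"
  proof -
    have "integrable lborel (\<lambda>t. Re ((- \<i>) ^ (n - 1) * (indicator {0<..} t *\<^sub>R t ^ (n - 1) *\<^sub>R K n xs 0 t (- y))))"
      using K0_integrable[of "n - 1" n xs "- y"] by (intro integrable_Re integrable_mult_right) (simp add: set_integrable_def)
    from lborel_integrable_real_affine[OF this, of "1 / y" 0]
    have "integrable lborel (\<lambda>s. y ^ (n - 1) * Re ((- \<i>) ^ (n - 1) * (indicator {0<..} (s / y) *\<^sub>R (s / y) ^ (n - 1) *\<^sub>R K n xs 0 (s / y) (- y))))"
      using y by (intro integrable_mult_right) simp
    also have "(\<lambda>s. y ^ (n - 1) * Re ((- \<i>) ^ (n - 1) * (indicator {0<..} (s / y) *\<^sub>R (s / y) ^ (n - 1) *\<^sub>R K n xs 0 (s / y) (- y))))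
      = (\<lambda>s. indicator {0<..} s *\<^sub>R (s ^ (n - 1) * ?\<phi> (s / y)))"
      using y by (auto simp: fun_eq_iff indicator_def Re_mult_scaleR power_divide zero_less_divide_iff simp del: times_complex.sel)
    finally show ?thesis by (simp add: set_integrable_def)
  qed
  have i2: "set_integrable lborel {0<..} (\<lambda>s. s ^ (n - 1) * ?\<psi> s)"
  proof -
    have "integrable lborel (\<lambda>s. Re ((- \<i>) ^ (n - 1) * (indicator {0<..} s *\<^sub>R s ^ (n - 1) *\<^sub>R kk n xs 0 (1 + - \<i> * of_real s))))"
      using r.T_integrable[of "- \<i>" 1 "n - 1"] by (intro integrable_Re integrable_mult_right) (simp add: set_integrable_def)
    also have "(\<lambda>s. Re ((- \<i>) ^ (n - 1) * (indicator {0<..} s *\<^sub>R s ^ (n - 1) *\<^sub>R kk n xs 0 (1 + - \<i> * of_real s))))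
       = (\<lambda>s. indicator {0<..} s *\<^sub>R (s ^ (n - 1) * ?\<psi> s))"
      by (simp only: fun_eq_iff Re_mult_scaleR real_scaleR_def mult_minus_left diff_conv_add_uminus) simp
    finally show ?thesis by (simp add: set_integrable_def)
  qed
  have "wt n xs (- y) = (1 / y) *\<^sub>R (LBINT s:{0<..}. ((1 / y) * s) ^ (n - 1) * ?\<phi> ((1 / y) * s))"
    unfolding wt_def by (rule LBINT_scale) (use y in simp)
  also have "\<dots> = (1 / y) * (1 / y) ^ (n - 1) * (LBINT s:{0<..}. s ^ (n - 1) * ?\<phi> (s / y))"
    unfolding power_mult_distrib mult.assoc set_integral_mult_right by simp
  also have "(1 / y) * (1 / y) ^ (n - 1) = 1 / y ^ n" using n by (cases n) (auto simp: power_divide)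
  also have "(LBINT s:{0<..}. s ^ (n - 1) * ?\<phi> (s / y)) = (LBINT s:{0<..}. s ^ (n - 1) * ?\<phi> (s / y)) - (LBINT s:{0<..}. s ^ (n - 1) * ?\<psi> s)"
    using wt_zero_part[OF n, of xs] by simp
  also have "\<dots> = (LBINT s:{0<..}. s ^ (n - 1) * ?\<phi> (s / y) - s ^ (n - 1) * ?\<psi> s)"
    by (rule set_integral_diff(2)[OF i1 i2, symmetric])
  finally have w: "wt n xs (- y) = 1 / y ^ n * (LBINT s:{0<..}. s ^ (n - 1) * ?\<phi> (s / y) - s ^ (n - 1) * ?\<psi> s)" .
  let ?B = "cst n xs 0 * y powr (- \<gamma>)"
  have B0: "?B \<ge> 0" using cst_nonneg by simp
  have J: "set_integrable lborel {0<..} (\<lambda>s. ?B * (s ^ (n - 1) * exp (- (c' * s powr \<gamma>)) + s ^ n * exp (- (c' * s powr \<gamma>))))"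
    using integrable_exp_powr[OF c'_pos] by (intro set_integrable_mult_right impI set_integral_add(1)) auto
  have "norm (LBINT s:{0<..}. s ^ (n - 1) * ?\<phi> (s / y) - s ^ (n - 1) * ?\<psi> s) \<le>
      (LBINT s:{0<..}. ?B * (s ^ (n - 1) * exp (- (c' * s powr \<gamma>)) + s ^ n * exp (- (c' * s powr \<gamma>))))"
    unfolding set_lebesgue_integral_def
  proof (rule norm_integral_le_integral)
    show "integrable lborel (\<lambda>s. indicator {0<..} s *\<^sub>R (s ^ (n - 1) * ?\<phi> (s / y) - s ^ (n - 1) * ?\<psi> s))"
      using set_integral_diff(1)[OF i1 i2] by (simp add: set_integrable_def)
    show "integrable lborel (\<lambda>s. indicator {0<..} s *\<^sub>R (?B * (s ^ (n - 1) * exp (- (c' * s powr \<gamma>)) + s ^ n * exp (- (c' * s powr \<gamma>)))))"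
      using J by (simp add: set_integrable_def)
    fix s :: real
    show "norm (indicator {0<..} s *\<^sub>R (s ^ (n - 1) * ?\<phi> (s / y) - s ^ (n - 1) * ?\<psi> s)) \<le>
        indicator {0<..} s *\<^sub>R (?B * (s ^ (n - 1) * exp (- (c' * s powr \<gamma>)) + s ^ n * exp (- (c' * s powr \<gamma>))))"
    proof (cases "s > 0")
      case s: True
      have "?\<phi> (s / y) - ?\<psi> s = Re ((- \<i>) ^ (n - 1) * (K n xs 0 (s / y) (- y) - kk n xs 0 (1 - \<i> * of_real s)))"
        by (simp only: right_diff_distrib minus_complex.sel)
      also have "\<bar>\<dots>\<bar> \<le> norm ((- \<i>) ^ (n - 1) * (K n xs 0 (s / y) (- y) - kk n xs 0 (1 - \<i> * of_real s)))"
        by (rule abs_Re_le_cmod)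
      also have "\<dots> = norm (K n xs 0 (s / y) (- y) - kk n xs 0 (1 - \<i> * of_real s))"
        by (simp add: norm_mult norm_power)
      also have "\<dots> \<le> exp (- (c' * s powr \<gamma>)) * ((s / y) powr \<gamma> * cst n xs 0)" by (rule K_minus_kk[OF y s])
      also have "(s / y) powr \<gamma> = y powr (- \<gamma>) * s powr \<gamma>" using y s by (simp add: powr_divide powr_minus_divide)
      also have "exp (- (c' * s powr \<gamma>)) * (y powr (- \<gamma>) * s powr \<gamma> * cst n xs 0) = ?B * (s powr \<gamma> * exp (- (c' * s powr \<gamma>)))"
        by (simp add: mult_ac)
      \<comment> \<open>The fractional power of \<open>s\<close> is replaced by
        \<open>1 + s\<close>, which accounts for the two neighbouring moments
        \<open>Ip c' (n - 1)\<close> and \<open>Ip c' n\<close>.\<close>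
      also have "\<dots> \<le> ?B * ((1 + s) * exp (- (c' * s powr \<gamma>)))"
      proof -
        have "s powr \<gamma> \<le> (1 + s) powr \<gamma>" using s gam by (intro powr_mono2) auto
        also have "\<dots> \<le> (1 + s) powr 1" using s gam by (intro powr_mono) auto
        finally show ?thesis using B0 s by (intro mult_left_mono mult_right_mono) auto
      qed
      finally have "s ^ (n - 1) * \<bar>?\<phi> (s / y) - ?\<psi> s\<bar> \<le> s ^ (n - 1) * (?B * ((1 + s) * exp (- (c' * s powr \<gamma>))))"
        using s by (intro mult_left_mono) auto
      also have "\<dots> = ?B * (s ^ (n - 1) * exp (- (c' * s powr \<gamma>)) + s ^ n * exp (- (c' * s powr \<gamma>)))"
        using n by (cases n) (auto simp: algebra_simps)
      finally have "\<bar>s ^ (n - 1) * (?\<phi> (s / y) - ?\<psi> s)\<bar> \<le> \<dots>" using s by (simp only: abs_mult power_abs) simp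
      then show ?thesis using s by (simp add: right_diff_distrib)
    qed simp
  qed
  also have "\<dots> = ?B * (Ip c' (n - 1) + Ip c' n)"
    unfolding set_integral_mult_right set_integral_add(2)[OF integrable_exp_powr[OF c'_pos] integrable_exp_powr[OF c'_pos]] Ip_def ..
  finally have "\<bar>LBINT s:{0<..}. s ^ (n - 1) * ?\<phi> (s / y) - s ^ (n - 1) * ?\<psi> s\<bar> / y ^ n \<le> ?B * (Ip c' (n - 1) + Ip c' n) / y ^ n"
    using y by (intro divide_right_mono) auto
  moreover have "\<bar>1 / y ^ n * L\<bar> = \<bar>L\<bar> / y ^ n" for L using y by (simp add: abs_mult)
  moreover have "?B * I / y ^ n = cst n xs 0 * I * (y powr (- \<gamma>) / y ^ n)" for I by simp
  ultimately show ?thesis unfolding w by (simp only:)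
qed

text \<open>For \<open>z < - 1\<close> the refined bound gives the integrable order
  \<open>(- z) powr (- \<gamma> - 1)\<close>; the crude one would only give
  \<open>1 / \<bar>z\<bar>\<close>. On the bounded rest the crude bound suffices.\<close>

lemma wt_integrable:
  assumes n: "n \<ge> 1"
  shows "set_integrable lborel {..\<sigma>} (\<lambda>z. (\<sigma> - z) ^ (n - 1) * wt n xs z)"
proof -
  define C1 where "C1 = (1 + \<bar>\<sigma>\<bar>) ^ (n - 1) * (cst n xs 0 * (Ip c' (n - 1) + Ip c' n))"
  define C2 where "C2 = (1 + \<bar>\<sigma>\<bar>) ^ (n - 1) * Ip (b * c) (n - 1)"
  have C: "C1 \<ge> 0" "C2 \<ge> 0" unfolding C1_def C2_def using cst_nonneg Ip_nonneg by (auto intro!: mult_nonneg_nonneg add_nonneg_nonneg)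
  have t: "integrable lborel (\<lambda>z. indicator {1<..} (- z) * (- z) powr (- \<gamma> - 1))"
    using lborel_integrable_real_affine[OF set_integrable_powr_tail[OF gam(1), unfolded set_integrable_def], of "- 1" 0] by simp
  have u: "integrable lborel (\<lambda>z. indicator {- 1..\<bar>\<sigma>\<bar> + 1} z :: real)" by simp
  show ?thesis
    unfolding set_integrable_def
  proof (rule integrable_deriv_bound)
    show "integrable lborel (\<lambda>z. C1 * (indicator {1<..} (- z) * (- z) powr (- \<gamma> - 1)) + C2 * indicator {- 1..\<bar>\<sigma>\<bar> + 1} z)"
      by (intro Bochner_Integration.integrable_add integrable_mult_right t u)
    fix z :: real
    show "norm (indicator {..\<sigma>} z *\<^sub>R ((\<sigma> - z) ^ (n - 1) * wt n xs z)) \<le> C1 * (indicator {1<..} (- z) * (- z) powr (- \<gamma> - 1)) + C2 * indicator {- 1..\<bar>\<sigma>\<bar> + 1} z"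
    proof (cases "z \<le> \<sigma>")
      case z: True
      show ?thesis
      proof (cases "z < - 1")
        case True
        define y where "y = - z"
        have y: "y > 1" "z = - y" using True by (auto simp: y_def)
        have "\<sigma> - z \<le> (1 + \<bar>\<sigma>\<bar>) * y" using y mult_left_mono[of 1 y "\<bar>\<sigma>\<bar>"] by (simp add: distrib_right)
        then have "(\<sigma> - z) ^ (n - 1) \<le> ((1 + \<bar>\<sigma>\<bar>) * y) ^ (n - 1)" using z by (intro power_mono) auto
        also have "\<dots> = (1 + \<bar>\<sigma>\<bar>) ^ (n - 1) * y ^ (n - 1)" by (rule power_mult_distrib)
        finally have "(\<sigma> - z) ^ (n - 1) * \<bar>wt n xs z\<bar> \<le> ((1 + \<bar>\<sigma>\<bar>) ^ (n - 1) * y ^ (n - 1)) *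
            (cst n xs 0 * (Ip c' (n - 1) + Ip c' n) * (y powr (- \<gamma>) / y ^ n))"
          using abs_wt_le'[OF n, of y xs] y z by (intro mult_mono) auto
        also have "\<dots> = C1 * (y ^ (n - 1) * y powr (- \<gamma>) / y ^ n)" by (simp add: C1_def)
        also have "y ^ (n - 1) * y powr (- \<gamma>) / y ^ n = y powr (- \<gamma> - 1)"
          using n y by (cases n) (auto simp: powr_diff)
        finally show ?thesis using z True C y by (simp add: abs_mult)
      next
        case False
        have "(\<sigma> - z) ^ (n - 1) * \<bar>wt n xs z\<bar> \<le> ((1 + \<bar>\<sigma>\<bar>) ^ (n - 1) * (1 + \<bar>z\<bar>) ^ (n - 1)) * (Ip (b * c) (n - 1) / (1 + \<bar>z\<bar>) ^ n)"
          using z abs_wt_le[OF n] by (intro mult_mono power_diff_le) auto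
        also have "\<dots> = C2 * (1 / (1 + \<bar>z\<bar>))" using n by (cases n) (auto simp: C2_def)
        also have "\<dots> \<le> C2 * 1" using C by (intro mult_left_mono) auto
        finally show ?thesis using z False C by (simp add: abs_mult)
      qed
    qed (use C in \<open>auto intro!: add_nonneg_nonneg\<close>)
  qed measurable
qed

text \<open>Writing \<open>(\<sigma> - z) ^ (n - 1)\<close> as the integral of its derivative over
  \<open>y\<close> between \<open>z\<close> and \<open>\<sigma>\<close> and exchanging the integrals
  shows that the double integral with exponent \<open>n - 1\<close> accumulates the one with
  exponent \<open>n - 2\<close>: a distribution function and its density.\<close>

lemma wt_cumulative:
  assumes n: "n \<ge> 2"
  shows "(LBINT z:{..\<sigma>}. (\<sigma> - z) ^ (n - 1) * wt n xs z) =
    (LBINT y:{..\<sigma>}. real (n - 1) * (LBINT z:{..y}. (y - z) ^ (n - 2) * wt n xs z))"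
proof -
  define F where "F = (\<lambda>(z, y). (real (n - 1) * (y - z) ^ (n - 2) * indicator {z..\<sigma>} y) * (indicator {..\<sigma>} z * wt n xs z))"
  have [measurable]: "F \<in> borel_measurable (lborel \<Otimes>\<^sub>M lborel)"
  proof -
    have "F = (\<lambda>(z, y). (real (n - 1) * (y - z) ^ (n - 2) * (if z \<le> y \<and> y \<le> \<sigma> then 1 else 0)) * (indicator {..\<sigma>} z * wt n xs z))"
      by (auto simp: F_def fun_eq_iff indicator_def)
    then show ?thesis by simp
  qed
  have n1: "n \<ge> 1" using n by simp
  have hb: "has_bochner_integral lborel (\<lambda>y. F (z, y)) ((\<sigma> - z) ^ (n - 1) * (indicator {..\<sigma>} z * wt n xs z))" for z
  proof (cases "z \<le> \<sigma>")
    case True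
    show ?thesis unfolding F_def prod.case
      by (intro has_bochner_integral_mult_left integral_power_diff[OF n True])
  next
    case False
    then show ?thesis unfolding F_def by (auto simp: has_bochner_integral_zero)
  qed
  have hbn: "has_bochner_integral lborel (\<lambda>y. norm (F (z, y))) (norm ((\<sigma> - z) ^ (n - 1) * (indicator {..\<sigma>} z * wt n xs z)))" for z
  proof (cases "z \<le> \<sigma>")
    case True
    have "has_bochner_integral lborel (\<lambda>y. (real (n - 1) * (y - z) ^ (n - 2) * indicator {z..\<sigma>} y) * \<bar>indicator {..\<sigma>} z * wt n xs z\<bar>) ((\<sigma> - z) ^ (n - 1) * \<bar>indicator {..\<sigma>} z * wt n xs z\<bar>)"
      by (intro has_bochner_integral_mult_left integral_power_diff[OF n True])
    moreover have "(\<lambda>y. (real (n - 1) * (y - z) ^ (n - 2) * indicator {z..\<sigma>} y) * \<bar>indicator {..\<sigma>} z * wt n xs z\<bar>) = (\<lambda>y. norm (F (z, y)))"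
      by (auto simp: F_def fun_eq_iff indicator_def abs_mult)
    moreover have "(\<sigma> - z) ^ (n - 1) * \<bar>indicator {..\<sigma>} z * wt n xs z\<bar> = norm ((\<sigma> - z) ^ (n - 1) * (indicator {..\<sigma>} z * wt n xs z))"
      using True by (simp add: abs_mult)
    ultimately show ?thesis by simp
  next
    case False
    then show ?thesis unfolding F_def by (auto simp: has_bochner_integral_zero)
  qed
  have int: "integrable (lborel \<Otimes>\<^sub>M lborel) F"
  proof (rule lborel_pair.Fubini_integrable)
    show "AE z in lborel. integrable lborel (\<lambda>y. F (z, y))" using hb has_bochner_integral_iff by blast
    have "integrable lborel (\<lambda>z. norm (indicator {..\<sigma>} z *\<^sub>R ((\<sigma> - z) ^ (n - 1) * wt n xs z)))"
      using wt_integrable[OF n1] by (intro integrable_norm) (simp add: set_integrable_def)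
    then show "integrable lborel (\<lambda>z. \<integral>y. norm (F (z, y)) \<partial>lborel)"
      using hbn by (simp add: has_bochner_integral_iff mult_ac)
  qed measurable
  have "(LBINT z:{..\<sigma>}. (\<sigma> - z) ^ (n - 1) * wt n xs z) = (\<integral>z. (\<integral>y. F (z, y) \<partial>lborel) \<partial>lborel)"
    unfolding set_lebesgue_integral_def using hb
    by (intro Bochner_Integration.integral_cong refl) (auto simp: has_bochner_integral_iff)
  also have "\<dots> = (\<integral>y. (\<integral>z. F (z, y) \<partial>lborel) \<partial>lborel)"
    using lborel_pair.Fubini_integral[of "\<lambda>z y. F (z, y)"] int by simp
  also have "\<dots> = (LBINT y:{..\<sigma>}. real (n - 1) * (LBINT z:{..y}. (y - z) ^ (n - 2) * wt n xs z))"
    unfolding set_lebesgue_integral_def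
  proof (intro Bochner_Integration.integral_cong refl)
    fix y :: real
    have "(\<integral>z. F (z, y) \<partial>lborel) = (\<integral>z. (indicator {..\<sigma>} y * real (n - 1)) * (indicator {..y} z * ((y - z) ^ (n - 2) * wt n xs z)) \<partial>lborel)"
      by (intro Bochner_Integration.integral_cong refl) (auto simp: F_def indicator_def)
    then show "(\<integral>z. F (z, y) \<partial>lborel) = indicator {..\<sigma>} y *\<^sub>R (real (n - 1) * (\<integral>z. indicator {..y} z *\<^sub>R ((y - z) ^ (n - 2) * wt n xs z) \<partial>lborel))"
      by simp
  qed
  finally show ?thesis .
qed

end

end

section \<open>Conditional characteristic functions\<close>

context gg_base
begin

text \<open>The weights of the copies are at most one. Dropping them gives an upper bound that needs
  no integrability of \<open>F\<close>, as opposed to \<open>urn_step_integral\<close>.\<close>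

lemma urn_step_nn_integral_le:
  fixes F :: "(nat \<Rightarrow> 'x) \<Rightarrow> ennreal"
  assumes L: "sets L = sets (seqs n)" "finite_measure L"
    and F [measurable]: "F \<in> borel_measurable (seqs (Suc n))"
  shows "(\<integral>\<^sup>+xs. F xs \<partial>urn_step n L) \<le>
    (\<integral>\<^sup>+xs. (\<Sum>j<n. F (xs(n := xs j))) + ennreal (\<beta> * \<gamma>) * (\<integral>\<^sup>+x. F (xs(n := x)) \<partial>P0) \<partial>L)"
proof -
  note [measurable_cong] = L(1)
  interpret L: finite_measure L by fact
  interpret C: finite_measure "count_space {..n}" by (rule finite_measure_count_space) simp
  interpret PCf: finite_measure "P0 \<Otimes>\<^sub>M count_space {..n}"
    by (rule finite_measure_pair_measure) unfold_locales
  let ?N = "L \<Otimes>\<^sub>M (P0 \<Otimes>\<^sub>M count_space {..n})"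
  have meas [measurable]: "(\<lambda>p. ennreal (urn_weight n p) * F (urn_map n p)) \<in> borel_measurable ?N" by measurable
  have "(\<integral>\<^sup>+xs. F xs \<partial>urn_step n L) = (\<integral>\<^sup>+p. ennreal (urn_weight n p) * F (urn_map n p) \<partial>?N)"
    unfolding urn_step_def by (simp add: nn_integral_distr nn_integral_density)
  also have "\<dots> = (\<integral>\<^sup>+xs. (\<integral>\<^sup>+q. ennreal (urn_weight n (xs, q)) * F (urn_map n (xs, q)) \<partial>(P0 \<Otimes>\<^sub>M count_space {..n})) \<partial>L)"
    by (rule PCf.nn_integral_fst[symmetric]) measurable
  also have "\<dots> \<le> (\<integral>\<^sup>+xs. (\<Sum>j<n. F (xs(n := xs j))) + ennreal (\<beta> * \<gamma>) * (\<integral>\<^sup>+x. F (xs(n := x)) \<partial>P0) \<partial>L)"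
  proof (rule nn_integral_mono)
    fix xs assume xs: "xs \<in> space L"
    have xs': "xs \<in> space (seqs n)" using xs sets_eq_imp_space_eq[OF L(1)] by simp
    have "(\<lambda>x. xs(n := x)) \<in> borel \<rightarrow>\<^sub>M seqs (Suc n)"
      unfolding lessThan_Suc using xs' by (intro measurable_fun_upd[where J = "{..<n}"]) auto
    from measurable_compose[OF this F] have m [measurable]: "(\<lambda>x. F (xs(n := x))) \<in> borel_measurable P0"
      by (simp add: borel_P0)
    have "(\<integral>\<^sup>+q. ennreal (urn_weight n (xs, q)) * F (urn_map n (xs, q)) \<partial>(P0 \<Otimes>\<^sub>M count_space {..n}))
       = (\<integral>\<^sup>+x. (\<integral>\<^sup>+j. ennreal (urn_weight n (xs, x, j)) * F (urn_map n (xs, x, j)) \<partial>count_space {..n}) \<partial>P0)"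
      using measurable_compose[OF measurable_Pair1'[OF xs] meas]
      by (intro C.nn_integral_fst[symmetric]) (simp add: comp_def)
    also have "\<dots> = (\<integral>\<^sup>+x. (\<Sum>j<n. ennreal (1 - \<gamma> / real (frequency n xs (xs j))) * F (xs(n := xs j))) + ennreal (\<beta> * \<gamma>) * F (xs(n := x)) \<partial>P0)"
      by (intro nn_integral_cong)
         (simp add: nn_integral_count_space_finite lessThan_Suc_atMost[symmetric] urn_weight_def urn_map_def)
    also have "\<dots> \<le> (\<integral>\<^sup>+x. (\<Sum>j<n. F (xs(n := xs j))) + ennreal (\<beta> * \<gamma>) * F (xs(n := x)) \<partial>P0)"
    proof (intro nn_integral_mono add_mono sum_mono order_refl)
      fix j assume "j \<in> {..<n}"
      have "ennreal (1 - \<gamma> / real (frequency n xs (xs j))) \<le> 1"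
        using gam by (simp add: divide_nonneg_nonneg)
      then show "ennreal (1 - \<gamma> / real (frequency n xs (xs j))) * F (xs(n := xs j)) \<le> F (xs(n := xs j))"
        using mult_right_mono[of _ 1 "F (xs(n := xs j))"] by simp
    qed
    also have "\<dots> = (\<Sum>j<n. F (xs(n := xs j))) + ennreal (\<beta> * \<gamma>) * (\<integral>\<^sup>+x. F (xs(n := x)) \<partial>P0)"
      using emeasure_space_1 by (simp add: nn_integral_add nn_integral_cmult)
    finally show "(\<integral>\<^sup>+q. ennreal (urn_weight n (xs, q)) * F (urn_map n (xs, q)) \<partial>(P0 \<Otimes>\<^sub>M count_space {..n}))
       \<le> (\<Sum>j<n. F (xs(n := xs j))) + ennreal (\<beta> * \<gamma>) * (\<integral>\<^sup>+x. F (xs(n := x)) \<partial>P0)" .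
  qed
  finally show ?thesis .
qed

text \<open>Every coordinate is a fresh draw from \<open>P0\<close> or a copy of an earlier one, so
  each marginal is dominated by a multiple of \<open>P0\<close>. This carries the moment of
  \<open>g\<close> from \<open>P0\<close> over to the sample points.\<close>

lemma urn_marginal:
  fixes \<phi> :: "'x \<Rightarrow> ennreal"
  assumes [measurable]: "\<phi> \<in> borel_measurable borel"
  shows "\<exists>C<\<infinity>. \<forall>i<n. (\<integral>\<^sup>+xs. \<phi> (xs i) \<partial>urn n) \<le> C * (\<integral>\<^sup>+x. \<phi> x \<partial>P0)"
proof (induction n)
  case (Suc n)
  then obtain C where C: "C < \<infinity>" "\<And>i. i < n \<Longrightarrow> (\<integral>\<^sup>+xs. \<phi> (xs i) \<partial>urn n) \<le> C * (\<integral>\<^sup>+x. \<phi> x \<partial>P0)" by blast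
  interpret pu: finite_measure "urn n" by (rule finite_urn)
  let ?I = "\<integral>\<^sup>+x. \<phi> x \<partial>P0" and ?m = "emeasure (urn n) (space (urn n))"
  \<comment> \<open>The constant serves both cases. The last coordinate copies one of
    \<open>n\<close> earlier ones or is fresh, giving \<open>n * C\<close> and
    \<open>\<beta> * \<gamma>\<close> times the total mass. An earlier coordinate is merely
    multiplied by the total weight \<open>n + \<beta> * \<gamma>\<close> of the step.\<close>
  define C' where "C' = (of_nat n + ennreal (\<beta> * \<gamma>)) * C + ennreal (\<beta> * \<gamma>) * ?m"
  have "C' < \<infinity>"
    unfolding C'_def using C(1) pu.emeasure_finite[of "space (urn n)"]
    by (simp add: ennreal_mult_less_top less_top[symmetric] ennreal_mult_eq_top_iff)
  moreover have "(\<integral>\<^sup>+xs. \<phi> (xs i) \<partial>urn (Suc n)) \<le> C' * ?I" if i: "i < Suc n" for i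
  proof -
    have m: "(\<lambda>xs. \<phi> (xs k)) \<in> borel_measurable (seqs n')" if "k < n'" for k n'
      using that by (intro measurable_compose[OF measurable_component_singleton]) auto
    have "(\<integral>\<^sup>+xs. \<phi> (xs i) \<partial>urn (Suc n)) \<le>
      (\<integral>\<^sup>+xs. (\<Sum>j<n. \<phi> ((xs(n := xs j)) i)) + ennreal (\<beta> * \<gamma>) * (\<integral>\<^sup>+x. \<phi> ((xs(n := x)) i) \<partial>P0) \<partial>urn n)"
      unfolding urn.simps by (rule urn_step_nn_integral_le[OF sets_urn finite_urn m[OF i]])
    also have "\<dots> \<le> C' * ?I"
    proof (cases "i = n")
      case True
      have [measurable]: "(\<lambda>xs. \<phi> (xs j)) \<in> borel_measurable (urn n)" if "j < n" for j
        using m[OF that] by (simp add: measurable_cong_sets[OF sets_urn refl])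
      have "(\<integral>\<^sup>+xs. (\<Sum>j<n. \<phi> ((xs(n := xs j)) i)) + ennreal (\<beta> * \<gamma>) * (\<integral>\<^sup>+x. \<phi> ((xs(n := x)) i) \<partial>P0) \<partial>urn n)
         = (\<integral>\<^sup>+xs. (\<Sum>j<n. \<phi> (xs j)) + ennreal (\<beta> * \<gamma>) * ?I \<partial>urn n)"
        using True by simp
      also have "\<dots> = (\<Sum>j<n. \<integral>\<^sup>+xs. \<phi> (xs j) \<partial>urn n) + ennreal (\<beta> * \<gamma>) * ?I * ?m"
        by (subst nn_integral_add) (auto simp: nn_integral_sum)
      also have "\<dots> \<le> (\<Sum>j<n. C * ?I) + ennreal (\<beta> * \<gamma>) * ?I * ?m"
        by (intro add_mono sum_mono C(2) order_refl) auto
      also have "\<dots> \<le> C' * ?I"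
      proof -
        have "C' * ?I = of_nat n * (C * ?I) + (ennreal (\<beta> * \<gamma>) * (C * ?I) + ennreal (\<beta> * \<gamma>) * ?I * ?m)"
          by (simp add: C'_def distrib_right distrib_left mult_ac add_ac)
        then show ?thesis by (simp add: add_left_mono add_increasing)
      qed
      finally show ?thesis .
    next
      case False
      with i have i': "i < n" by simp
      have [measurable]: "(\<lambda>xs. \<phi> (xs i)) \<in> borel_measurable (urn n)"
        using m[OF i'] by (simp add: measurable_cong_sets[OF sets_urn refl])
      have "(\<integral>\<^sup>+xs. (\<Sum>j<n. \<phi> ((xs(n := xs j)) i)) + ennreal (\<beta> * \<gamma>) * (\<integral>\<^sup>+x. \<phi> ((xs(n := x)) i) \<partial>P0) \<partial>urn n)
         = (\<integral>\<^sup>+xs. (of_nat n + ennreal (\<beta> * \<gamma>)) * \<phi> (xs i) \<partial>urn n)"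
        using False emeasure_space_1 by (simp add: distrib_right)
      also have "\<dots> = (of_nat n + ennreal (\<beta> * \<gamma>)) * (\<integral>\<^sup>+xs. \<phi> (xs i) \<partial>urn n)"
        by (rule nn_integral_cmult) measurable
      also have "\<dots> \<le> (of_nat n + ennreal (\<beta> * \<gamma>)) * (C * ?I)" by (intro mult_left_mono C(2) i') auto
      also have "\<dots> \<le> C' * ?I" unfolding C'_def by (simp add: distrib_right distrib_left mult_ac)
      finally show ?thesis .
    qed
    finally show ?thesis .
  qed
  ultimately show ?case by blast
qed (auto intro: exI[of _ 0])

end

context gg_fun
begin

lemma cst_integrable: "integrable (urn n) (\<lambda>xs. cst n xs z)"
proof -
  interpret pu: finite_measure "urn n" by (rule finite_urn)
  have "integrable (urn n) (\<lambda>xs. \<bar>g (xs i) - z\<bar> powr \<gamma>)" if i: "i < n" for i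
  proof -
    have [measurable]: "(\<lambda>xs. xs i) \<in> urn n \<rightarrow>\<^sub>M borel"
      unfolding measurable_cong_sets[OF sets_urn refl] using i by auto
    have "(\<lambda>x. ennreal (\<bar>g x - z\<bar> powr \<gamma>)) \<in> borel_measurable borel" by measurable
    from urn_marginal[OF this, of n] obtain C where C: "C < \<infinity>"
      "(\<integral>\<^sup>+xs. ennreal (\<bar>g (xs i) - z\<bar> powr \<gamma>) \<partial>urn n) \<le> C * (\<integral>\<^sup>+x. ennreal (\<bar>g x - z\<bar> powr \<gamma>) \<partial>P0)"
      using i by blast
    have "(\<integral>\<^sup>+x. ennreal (\<bar>g x - z\<bar> powr \<gamma>) \<partial>P0) = ennreal (D z)"
      unfolding D_def by (rule nn_integral_eq_integral[OF integrable_D]) simp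
    with C have "(\<integral>\<^sup>+xs. ennreal (\<bar>g (xs i) - z\<bar> powr \<gamma>) \<partial>urn n) < \<infinity>"
      by (auto simp: ennreal_mult_less_top intro: le_less_trans)
    then show ?thesis by (intro integrableI_nonneg) auto
  qed
  then show ?thesis unfolding cst_def by (intro Bochner_Integration.integrable_add integrable_mult_right Bochner_Integration.integrable_sum) auto
qed

lemma K_0_indep: "K n xs u 0 z = K n xs u 0 0"
  by (simp add: K_def arg_fun_def)

text \<open>The value of \<open>Gf\<close> at \<open>t = 0\<close>, which is real and the same for
  all \<open>z\<close> (\<open>Gf_0\<close>). Up to the constant \<open>k0 n\<close> it is the
  density of the law of the sample with respect to \<open>urn n\<close>, and therefore the
  denominator in every conditional quantity.\<close>

definition G0 :: "nat \<Rightarrow> (nat \<Rightarrow> 'x) \<Rightarrow> real" where "G0 n xs = Re (Gf n xs n 0 0)"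

lemma Gf_0: "Gf n xs n 0 z = of_real (G0 n xs)"
proof -
  have "Gf n xs n 0 z = Gf n xs n 0 0" unfolding Gf_def K_0_indep[of n xs _ z] ..
  moreover have "Im (Gf n xs n 0 0) = 0" using abs_Im_Gf_le[of n xs n 0 0] by simp
  ultimately show ?thesis by (simp add: G0_def complex_eq_iff)
qed

lemma G0_eq: "G0 n xs = (LBINT u:{0<..}. u ^ (n - 1) *
   (exp (- \<beta> * (1 + u) powr \<gamma>) * (\<Prod>y\<in>distinct_values n xs. (1 + u) powr (\<gamma> - real (frequency n xs y)))))"
  unfolding G0_def Re_Gf set_lebesgue_integral_def
proof (intro Bochner_Integration.integral_cong refl)
  fix u :: real
  show "indicator {0<..} u *\<^sub>R (u ^ (n - 1) * Re (K n xs u 0 0)) = indicator {0<..} u *\<^sub>R (u ^ (n - 1) *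
   (exp (- \<beta> * (1 + u) powr \<gamma>) * (\<Prod>y\<in>distinct_values n xs. (1 + u) powr (\<gamma> - real (frequency n xs y)))))"
    using K_0[of u n xs 0] by (cases "u > 0") (simp_all del: of_real_mult of_real_prod)
qed

lemma G0_pos: "G0 n xs > 0"
proof -
  let ?f = "\<lambda>u. indicator {0<..} u * (u ^ (n - 1) *
   (exp (- \<beta> * (1 + u) powr \<gamma>) * (\<Prod>y\<in>distinct_values n xs. (1 + u) powr (\<gamma> - real (frequency n xs y)))))"
  have eq: "?f u = indicator {0<..} u *\<^sub>R (u ^ (n - 1) * Re (K n xs u 0 0))" for u
    using K_0[of u n xs 0] by (cases "u > 0") (simp_all del: of_real_mult of_real_prod)
  have int: "integrable lborel ?f"
    unfolding eq using integrable_Re[OF K_integrable[of "n - 1" n xs 0 0, unfolded set_integrable_def]] by (simp add: mult.assoc)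
  have nn: "AE u in lborel. 0 \<le> ?f u" by (intro AE_I2) (auto simp: indicator_def intro!: mult_nonneg_nonneg prod_nonneg)
  have "(\<integral>u. ?f u \<partial>lborel) \<noteq> 0"
  proof
    assume "(\<integral>u. ?f u \<partial>lborel) = 0"
    then have "AE u in lborel. ?f u = 0" using integral_nonneg_eq_0_iff_AE[OF int nn] by simp
    then have "AE u in lborel. \<not> u > (0::real)"
    proof eventually_elim
      case (elim u)
      show ?case
      proof
        assume "u > 0"
        then have "?f u \<noteq> 0" by simp
        with elim show False by blast
      qed
    qed
    then have "AE u in lborel. u \<notin> {0<..<1::real}" by eventually_elim auto
    then have "{0<..<1::real} \<in> null_sets lborel" by (subst AE_iff_null_sets) auto
    then show False by (simp add: null_sets_def)
  qed
  moreover have "(\<integral>u. ?f u \<partial>lborel) \<ge> 0" using nn by (rule integral_nonneg_AE)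
  moreover have "G0 n xs = (\<integral>u. ?f u \<partial>lborel)" unfolding G0_eq by (simp add: set_lebesgue_integral_def)
  ultimately show ?thesis by simp
qed

definition cdfF :: "nat \<Rightarrow> (nat \<Rightarrow> 'x) \<Rightarrow> real \<Rightarrow> real" where
  "cdfF n xs z = 1 / 2 - H n xs z / (pi * G0 n xs)"

lemma measurable_H [measurable]: "(\<lambda>xs. H n xs z) \<in> borel_measurable (seqs n)"
  unfolding H_def set_lebesgue_integral_def by measurable

lemma measurable_G0 [measurable]: "(\<lambda>xs. G0 n xs) \<in> borel_measurable (seqs n)"
  unfolding G0_def by measurable

lemma measurable_cdfF [measurable]: "(\<lambda>xs. cdfF n xs z) \<in> borel_measurable (seqs n)"
  unfolding cdfF_def by measurable

lemma G0_le: "\<bar>G0 n xs\<bar> \<le> E0 n"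
proof -
  have "\<bar>G0 n xs\<bar> \<le> norm (Gf n xs n 0 0)" unfolding G0_def by (rule abs_Re_le_cmod)
  also have "\<dots> \<le> E0 n" using norm_Gf_le[of n xs n 0 0] by simp
  finally show ?thesis .
qed

end

section \<open>Integrals used for averaging over \<open>u\<close> and for inversion\<close>

lemma LBINT_power_exp:
  fixes s :: real
  assumes "s > 0"
  shows "set_integrable lborel {0<..} (\<lambda>u. u ^ k * (s ^ Suc k * exp (- (u * s))))"
    and "(LBINT u:{0<..}. u ^ k * (s ^ Suc k * exp (- (u * s)))) = fact k"
proof -
  have "(\<integral>\<^sup>+u. ennreal (indicator {0<..} u * (u ^ k * exp (- u))) \<partial>lborel) = (\<integral>\<^sup>+u. ennreal (u ^ k * exp (- u)) * indicator {0..} u \<partial>lborel)"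
  proof (rule nn_integral_cong_AE)
    show "AE u in lborel. ennreal (indicator {0<..} u * (u ^ k * exp (- u))) = ennreal (u ^ k * exp (- u)) * indicator {0..} (u::real)"
      using AE_lborel_singleton[of 0] by eventually_elim (auto simp: indicator_def)
  qed
  also have "\<dots> = ennreal (fact k)" using nn_intergal_power_times_exp_Ici[of k] by simp
  finally have "has_bochner_integral lborel (\<lambda>u::real. indicator {0<..} u * (u ^ k * exp (- u))) (fact k :: real)"
    by (intro has_bochner_integral_nn_integral) (auto simp: indicator_def)
  then have 1: "integrable lborel (\<lambda>u::real. indicator {0<..} u * (u ^ k * exp (- u)))"
    and 2: "(LBINT u:{0<..}. u ^ k * exp (- u)) = (fact k :: real)"
    by (auto simp: has_bochner_integral_iff set_lebesgue_integral_def)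
  have "integrable lborel (\<lambda>u. s * (indicator {0<..} (0 + s * u) * ((0 + s * u) ^ k * exp (- (0 + s * u)))))"
    using lborel_integrable_real_affine[OF 1, of s 0] assms by (intro integrable_mult_right) simp
  moreover have "(\<lambda>u. s * (indicator {0<..} (0 + s * u) * ((0 + s * u) ^ k * exp (- (0 + s * u))))) = (\<lambda>u. indicator {0<..} u *\<^sub>R (u ^ k * (s ^ Suc k * exp (- (u * s)))))"
    using assms by (auto simp: fun_eq_iff indicator_def zero_less_mult_iff power_mult_distrib mult_ac)
  ultimately show "set_integrable lborel {0<..} (\<lambda>u. u ^ k * (s ^ Suc k * exp (- (u * s))))"
    unfolding set_integrable_def by (simp only:)
  have "fact k = s *\<^sub>R (LBINT u:{0<..}. (s * u) ^ k * exp (- (s * u)))"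
    unfolding 2[symmetric] by (rule LBINT_scale[OF assms])
  also have "\<dots> = (LBINT u:{0<..}. s * ((s * u) ^ k * exp (- (s * u))))" by simp
  also have "\<dots> = (LBINT u:{0<..}. u ^ k * (s ^ Suc k * exp (- (u * s))))"
    by (simp add: power_mult_distrib mult_ac)
  finally show "(LBINT u:{0<..}. u ^ k * (s ^ Suc k * exp (- (u * s)))) = fact k" ..
qed

lemma Si_truncated:
  assumes "0 < a" "a \<le> T"
  shows "has_bochner_integral lborel (\<lambda>t. (inverse t * sin (t * y)) * indicator {a..T} t) (Si (T * y) - Si (a * y))"
proof (rule has_bochner_integral_FTC_Icc_real[OF assms(2)])
  fix t assume t: "a \<le> t" "t \<le> T"
  have "((\<lambda>t. Si (t * y)) has_real_derivative sinc (t * y) * y) (at t)"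
    by (rule DERIV_chain'[OF _ DERIV_Si, THEN DERIV_cong]) (auto intro!: derivative_eq_intros)
  then show "((\<lambda>t. Si (t * y)) has_real_derivative inverse t * sin (t * y)) (at t)"
    using t assms by (auto simp: field_simps split: if_splits)
  show "isCont (\<lambda>t. inverse t * sin (t * y)) t"
    using t assms by (intro continuous_intros) auto
qed

text \<open>As \<open>k\<close> tends to infinity these averages of the cosine converge boundedly to
  the indicator of \<open>y = 0\<close>; \<open>no_atom\<close> uses them to compute the mass of an
  atom from the characteristic function.\<close>

lemma cos_truncated:
  fixes k y :: real
  assumes "k > 0"
  shows "has_bochner_integral lborel (\<lambda>t. (cos (t * y) / k) * indicator {0..k} t) (if y = 0 then 1 else sin (k * y) / (k * y))"
proof -
  have "has_bochner_integral lborel (\<lambda>t. (cos (t * y) / k) * indicator {0..k} t)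
      ((if y = 0 then k / k else sin (k * y) / (k * y)) - (if y = 0 then 0 / k else sin (0 * y) / (k * y)))"
  proof (rule has_bochner_integral_FTC_Icc_real[where F = "\<lambda>t. if y = 0 then t / k else sin (t * y) / (k * y)" and a = 0 and b = k])
    show "((\<lambda>t. if y = 0 then t / k else sin (t * y) / (k * y)) has_real_derivative cos (t * y) / k) (at t)" for t
      using assms by (cases "y = 0") (auto intro!: derivative_eq_intros)
  qed (use assms in \<open>auto intro!: continuous_intros\<close>)
  moreover have "(if y = 0 then k / k else sin (k * y) / (k * y)) - (if y = 0 then 0 / k else sin (0 * y) / (k * y))
     = (if y = 0 then 1 else sin (k * y) / (k * y))" using assms by simp
  ultimately show ?thesis by simp
qed

lemma Si_seq_limit:
  "(\<lambda>k. Si (real (Suc k) * y) - Si (inverse (real (Suc k)) * y)) \<longlonglongrightarrow> pi / 2 * sgn y"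
proof -
  have "(\<lambda>k. inverse (real (Suc k)) * y) \<longlonglongrightarrow> 0 * y" by (intro tendsto_mult LIMSEQ_inverse_real_of_nat tendsto_const)
  then have 0: "(\<lambda>k. Si (inverse (real (Suc k)) * y)) \<longlonglongrightarrow> Si 0"
    using isCont_tendsto_compose[OF isCont_Si] by fastforce
  have Si0: "Si 0 = 0" using Si_neg[of 0] by simp
  have pos: "(\<lambda>k. Si (real (Suc k) * y)) \<longlonglongrightarrow> pi / 2" if "y > 0" for y
  proof (rule filterlim_compose[OF Si_at_top])
    show "filterlim (\<lambda>k. real (Suc k) * y) at_top sequentially"
      using that by (intro filterlim_at_top_mult_tendsto_pos[OF tendsto_const] filterlim_compose[OF filterlim_real_sequentially filterlim_Suc]) auto
  qed
  have "(\<lambda>k. Si (real (Suc k) * y)) \<longlonglongrightarrow> pi / 2 * sgn y"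
  proof (cases "y < 0")
    case True
    have "Si (real (Suc k) * y) = - Si (real (Suc k) * (- y))" for k
    proof -
      have "0 \<le> real (Suc k) * (- y)" using True by (intro mult_nonneg_nonneg) auto
      from Si_neg[OF this] show ?thesis by simp
    qed
    then show ?thesis using tendsto_minus[OF pos[of "- y"]] True by simp
  next
    case False
    then show ?thesis using pos[of y] by (cases "y = 0") (auto simp: Si0)
  qed
  from tendsto_diff[OF this 0] show ?thesis by (simp add: Si0)
qed

locale gg_all = gg_rand P0 \<gamma> \<beta> M S P + gg_fun P0 \<gamma> \<beta> g
  for P0 :: "'x::polish_space measure" and \<gamma> \<beta> and M :: "'w measure" and S P and g
begin

definition Y :: "real \<Rightarrow> 'w \<Rightarrow> real" where
  "Y z \<omega> = S \<omega> * (\<integral>x. g x - z \<partial>P \<omega>)"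

lemma Y_meas [measurable]: "Y z \<in> borel_measurable M"
  unfolding Y_def by measurable

text \<open>By conditional independence this is the conditional probability, given \<open>P\<close>,
  that the sample lies in the product of the sets \<open>A i\<close>.\<close>

definition W :: "nat \<Rightarrow> (nat \<Rightarrow> 'x set) \<Rightarrow> 'w \<Rightarrow> real" where
  "W n A \<omega> = (\<Prod>i<n. measure (P \<omega>) (A i))"

lemma W_meas [measurable]:
  assumes "\<And>i. i < n \<Longrightarrow> A i \<in> sets borel"
  shows "W n A \<in> borel_measurable M"
  unfolding W_def
proof (rule borel_measurable_prod)
  fix i assume "i \<in> {..<n}"
  with assms have "A i \<in> sets borel" by simp
  then show "(\<lambda>\<omega>. measure (P \<omega>) (A i)) \<in> borel_measurable M"
    by (rule measurable_compose[OF P_meas measurable_measure_subprob_algebra])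
qed

lemma W_bounds: "\<omega> \<in> space M \<Longrightarrow> 0 \<le> W n A \<omega>" "\<omega> \<in> space M \<Longrightarrow> W n A \<omega> \<le> 1"
  unfolding W_def using P_le_1 by (auto intro!: prod_nonneg prod_le_1)

lemma mass_prod_W: "mass_prod n A \<omega> = S \<omega> ^ n * W n A \<omega>"
  unfolding mass_prod_def W_def by (simp add: prod.distrib)

definition lin :: "real \<Rightarrow> real \<Rightarrow> real \<Rightarrow> 'x \<Rightarrow> complex" where
  "lin u t z x = of_real u - \<i> * of_real (t * (g x - z))"

lemma gint_lin: "gint (lin u t z)"
  and lin_arg: "1 + lin u t z x = arg_fun t (1 + of_real u + \<i> * of_real (t * z)) x"
  and lin_Re: "Re (lin u t z x) = u"
proof -
  have "lin u t z = arg_fun t (of_real u + \<i> * of_real (t * z))"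
    by (simp add: lin_def arg_fun_def fun_eq_iff algebra_simps)
  then show "gint (lin u t z)" using gint_arg_fun by simp
qed (simp_all add: lin_def arg_fun_def algebra_simps)

lemma X_lin: "AE \<omega> in M. X (lin u t z) \<omega> = of_real (u * S \<omega>) - \<i> * of_real (t * Y z \<omega>)"
proof -
  have gg: "gint (\<lambda>x. of_real (g x - z))"
    using gint_add[OF gint_g gint_const[of "- of_real z"]] by simp
  have "lin u t z = (\<lambda>x. of_real u + (- \<i> * of_real t) * of_real (g x - z))"
    by (simp add: lin_def fun_eq_iff mult.assoc)
  moreover have "AE \<omega> in M. X (\<lambda>x. of_real u + (- \<i> * of_real t) * of_real (g x - z)) \<omega> = X (\<lambda>_. of_real u) \<omega> + (- \<i> * of_real t) * X (\<lambda>x. of_real (g x - z)) \<omega>"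
    by (rule X_add[OF gint_const gg])
  ultimately have "AE \<omega> in M. X (lin u t z) \<omega> = X (\<lambda>_. of_real u) \<omega> + (- \<i> * of_real t) * X (\<lambda>x. of_real (g x - z)) \<omega>"
    by (simp only:)
  moreover have "X (\<lambda>x. of_real (g x - z)) \<omega> = of_real (Y z \<omega>)" for \<omega> unfolding X_of_real Y_def ..
  ultimately have "AE \<omega> in M. X (lin u t z) \<omega> = X (\<lambda>_. of_real u) \<omega> + (- \<i> * of_real t) * of_real (Y z \<omega>)"
    by (simp only:)
  then show ?thesis
    using X_const[of "of_real u"] by eventually_elim (simp add: mult_ac)
qed

lemma palm_K:
  assumes "u > 0" "\<And>i. i < n \<Longrightarrow> A i \<in> sets borel"
  shows "(\<integral>\<omega>. of_real (W n A \<omega> * (S \<omega> ^ n * exp (- (u * S \<omega>)))) * exp (\<i> * of_real (t * Y z \<omega>)) \<partial>M)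
    = exp (of_real \<beta>) * (\<integral>xs. of_real (box n A xs) * K n xs u t z \<partial>urn n)"
proof -
  note [measurable] = W_meas[OF assms(2)] mass_prod_measurable[OF assms(2)] X_meas[OF gint_measurable[OF gint_lin]]
  have "(\<integral>\<omega>. of_real (W n A \<omega> * (S \<omega> ^ n * exp (- (u * S \<omega>)))) * exp (\<i> * of_real (t * Y z \<omega>)) \<partial>M)
     = (\<integral>\<omega>. of_real (mass_prod n A \<omega>) * exp (- X (lin u t z) \<omega>) \<partial>M)"
  proof (rule integral_cong_AE)
    show "AE \<omega> in M. of_real (W n A \<omega> * (S \<omega> ^ n * exp (- (u * S \<omega>)))) * exp (\<i> * of_real (t * Y z \<omega>)) = of_real (mass_prod n A \<omega>) * exp (- X (lin u t z) \<omega>)"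
      using X_lin[of u t z]
    proof eventually_elim
      case (elim \<omega>)
      have "exp (- X (lin u t z) \<omega>) = of_real (exp (- (u * S \<omega>))) * exp (\<i> * of_real (t * Y z \<omega>))"
        unfolding elim exp_of_real[symmetric] exp_add[symmetric] by (simp add: algebra_simps)
      then show ?case by (simp add: mass_prod_W)
    qed
  qed measurable
  also have "\<dots> = palm_rhs n A (lin u t z)"
    by (rule palm[OF gint_lin assms(1) _ assms(2)]) (simp add: lin_Re)
  also have "\<dots> = exp (of_real \<beta>) * (\<integral>xs. of_real (box n A xs) * K n xs u t z \<partial>urn n)"
  proof -
    let ?a = "arg_fun t (1 + of_real u + \<i> * of_real (t * z))"
    let ?e = "exp (- of_real \<beta> * (\<integral>x. ?a x powr of_real \<gamma> \<partial>P0))"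
    have "(\<integral>xs. of_real (box n A xs) * K n xs u t z \<partial>urn n) = (\<integral>xs. ?e * (of_real (box n A xs) * wprod \<gamma> n xs ?a) \<partial>urn n)"
      unfolding K_def ker_def by (simp only: mult_ac)
    also have "\<dots> = ?e * (\<integral>xs. of_real (box n A xs) * wprod \<gamma> n xs ?a \<partial>urn n)"
      by (rule integral_mult_right_zero)
    finally show ?thesis by (simp only: palm_rhs_def lin_arg mult.assoc)
  qed
  finally show ?thesis .
qed

text \<open>The Palm formula is multiplied by \<open>u ^ (n - 1)\<close> and integrated over
  \<open>u\<close>, and Fubini's theorem is used on both sides. On the left the gamma integral turns
  \<open>S ^ n * exp (- u * S)\<close> into \<open>fact (n - 1)\<close>, so the absolute integral is
  bounded; on the right \<open>E0 n\<close> bounds it uniformly in the sample.\<close>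

lemma char_fun:
  assumes A: "\<And>i. i < n \<Longrightarrow> A i \<in> sets borel" and n: "n \<ge> 1"
  shows "fact (n - 1) * (\<integral>\<omega>. of_real (W n A \<omega>) * exp (\<i> * of_real (t * Y z \<omega>)) \<partial>M)
    = exp (of_real \<beta>) * (\<integral>xs. of_real (box n A xs) * Gf n xs n t z \<partial>urn n)"
proof -
  note [measurable] = W_meas[OF A]
  interpret pu: finite_measure "urn n" by (rule finite_urn)
  interpret MP: pair_sigma_finite M lborel ..
  interpret PP: pair_sigma_finite "urn n" lborel ..
  obtain k where k: "n = Suc k" using n by (cases n) auto
  have bx [measurable]: "box n A \<in> borel_measurable (urn n)"
    using box_measurable[OF A] by (simp add: measurable_cong_sets[OF sets_urn refl])
  define L where "L = (\<lambda>(\<omega>, u). indicator {0<..} u *\<^sub>R (of_real (W n A \<omega> * (u ^ k * (S \<omega> ^ Suc k * exp (- (u * S \<omega>))))) * exp (\<i> * of_real (t * Y z \<omega>))))"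
  define R where "R = (\<lambda>(xs, u). indicator {0<..} u *\<^sub>R (of_real (box n A xs) * (u ^ k *\<^sub>R K n xs u t z)))"
  have [measurable]: "L \<in> borel_measurable (M \<Otimes>\<^sub>M lborel)" unfolding L_def by measurable
  have [measurable]: "R \<in> borel_measurable (urn n \<Otimes>\<^sub>M lborel)"
  proof -
    have [measurable]: "(\<lambda>p. K n (fst p) (snd p) t z) \<in> borel_measurable (urn n \<Otimes>\<^sub>M lborel)"
      by (rule measurable_K) measurable
    show ?thesis unfolding R_def case_prod_beta by measurable
  qed
  have Lu: "integrable lborel (\<lambda>u. L (\<omega>, u))"
    "(\<integral>u. L (\<omega>, u) \<partial>lborel) = fact k * (of_real (W n A \<omega>) * exp (\<i> * of_real (t * Y z \<omega>)))"
    "(\<integral>u. norm (L (\<omega>, u)) \<partial>lborel) \<le> fact k" if S: "S \<omega> > 0" and w: "\<omega> \<in> space M" for \<omega>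
  proof -
    let ?c = "of_real (W n A \<omega>) * exp (\<i> * of_real (t * Y z \<omega>)) :: complex"
    have eq: "L (\<omega>, u) = of_real (indicator {0<..} u *\<^sub>R (u ^ k * (S \<omega> ^ Suc k * exp (- (u * S \<omega>))))) * ?c" for u
      by (auto simp: L_def indicator_def)
    note i = LBINT_power_exp[OF S, of k, unfolded set_integrable_def set_lebesgue_integral_def]
    show "integrable lborel (\<lambda>u. L (\<omega>, u))" unfolding eq by (intro integrable_mult_left integrable_of_real i(1))
    show "(\<integral>u. L (\<omega>, u) \<partial>lborel) = fact k * ?c"
      unfolding eq integral_mult_left_zero integral_complex_of_real i(2) by simp
    have "(\<integral>u. norm (L (\<omega>, u)) \<partial>lborel) = (\<integral>u. (indicator {0<..} u *\<^sub>R (u ^ k * (S \<omega> ^ Suc k * exp (- (u * S \<omega>))))) * norm ?c \<partial>lborel)"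
      unfolding eq norm_mult norm_of_real using S
      by (intro Bochner_Integration.integral_cong refl) (auto simp: indicator_def)
    also have "\<dots> = fact k * norm ?c" unfolding integral_mult_left_zero i(2) ..
    also have "\<dots> \<le> fact k * 1"
      using W_bounds[OF w, of n A] by (intro mult_left_mono) (auto simp: norm_mult)
    finally show "(\<integral>u. norm (L (\<omega>, u)) \<partial>lborel) \<le> fact k" by simp
  qed
  have intL: "integrable (M \<Otimes>\<^sub>M lborel) L"
  proof (rule MP.Fubini_integrable)
    show "AE \<omega> in M. integrable lborel (\<lambda>u. L (\<omega>, u))"
      using S_pos AE_space by eventually_elim (rule Lu(1))
    show "integrable M (\<lambda>\<omega>. \<integral>u. norm (L (\<omega>, u)) \<partial>lborel)"
    proof (rule M.integrable_const_bound[where B = "fact k"])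
      show "AE \<omega> in M. norm (\<integral>u. norm (L (\<omega>, u)) \<partial>lborel) \<le> fact k"
        using S_pos AE_space by eventually_elim (simp add: Lu(3))
    qed measurable
  qed measurable
  have Ru: "integrable lborel (\<lambda>u. R (xs, u))"
    "(\<integral>u. R (xs, u) \<partial>lborel) = of_real (box n A xs) * Gf n xs n t z"
    "(\<integral>u. norm (R (xs, u)) \<partial>lborel) \<le> E0 n" for xs
  proof -
    have eq: "R (xs, u) = of_real (box n A xs) * (indicator {0<..} u *\<^sub>R u ^ k *\<^sub>R K n xs u t z)" for u
      by (auto simp: R_def indicator_def)
    show "integrable lborel (\<lambda>u. R (xs, u))"
      unfolding eq using K_integrable[of k n xs t z] by (intro integrable_mult_right) (simp add: set_integrable_def)
    show "(\<integral>u. R (xs, u) \<partial>lborel) = of_real (box n A xs) * Gf n xs n t z"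
      unfolding eq integral_mult_right_zero by (simp add: Gf_def k set_lebesgue_integral_def)
    show "(\<integral>u. norm (R (xs, u)) \<partial>lborel) \<le> E0 n"
      unfolding E0_def set_lebesgue_integral_def
    proof (rule integral_mono)
      show "integrable lborel (\<lambda>u. norm (R (xs, u)))"
        unfolding eq using K_integrable[of k n xs t z] by (intro integrable_norm integrable_mult_right) (simp add: set_integrable_def)
      show "integrable lborel (\<lambda>u. indicator {0<..} u *\<^sub>R (u ^ (n - 1) * exp (- (b * (1 + u) powr \<gamma>))))"
        using E0_integrable by (simp add: set_integrable_def)
      fix u :: real
      show "norm (R (xs, u)) \<le> indicator {0<..} u *\<^sub>R (u ^ (n - 1) * exp (- (b * (1 + u) powr \<gamma>)))"
      proof (cases "u > 0")
        case True
        have "norm (K n xs u t z) \<le> exp (- (b * (1 + u) powr \<gamma>)) * exp (- (b * (\<bar>t\<bar> powr \<gamma> * D z)))"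
          using True by (intro norm_K_le) auto
        also have "\<dots> \<le> exp (- (b * (1 + u) powr \<gamma>)) * 1"
          using b_pos D_nonneg[of z] by (intro mult_left_mono) auto
        finally have K: "norm (K n xs u t z) \<le> exp (- (b * (1 + u) powr \<gamma>))" by simp
        have "norm (R (xs, u)) = box n A xs * (u ^ k * norm (K n xs u t z))"
          using True box_bounds[of n A xs] by (simp add: R_def norm_mult)
        also have "\<dots> \<le> 1 * (u ^ k * exp (- (b * (1 + u) powr \<gamma>)))"
          using box_bounds[of n A xs] True K by (intro mult_mono mult_left_mono) auto
        finally show ?thesis using True by (simp add: k)
      qed (simp add: R_def)
    qed
  qed
  have intR: "integrable (urn n \<Otimes>\<^sub>M lborel) R"
  proof (rule PP.Fubini_integrable)
    show "AE xs in urn n. integrable lborel (\<lambda>u. R (xs, u))" using Ru(1) by simp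
    show "integrable (urn n) (\<lambda>xs. \<integral>u. norm (R (xs, u)) \<partial>lborel)"
    proof (rule pu.integrable_const_bound[where B = "E0 n"])
      show "AE xs in urn n. norm (\<integral>u. norm (R (xs, u)) \<partial>lborel) \<le> E0 n"
        using Ru(3) by (intro AE_I2) simp
    qed measurable
  qed measurable
  have [measurable]: "(\<lambda>\<omega>. \<integral>u. L (\<omega>, u) \<partial>lborel) \<in> borel_measurable M" by measurable
  have "fact (n - 1) * (\<integral>\<omega>. of_real (W n A \<omega>) * exp (\<i> * of_real (t * Y z \<omega>)) \<partial>M)
      = (\<integral>\<omega>. fact k * (of_real (W n A \<omega>) * exp (\<i> * of_real (t * Y z \<omega>))) \<partial>M)"
    unfolding integral_mult_right_zero by (simp add: k)
  also have "\<dots> = (\<integral>\<omega>. (\<integral>u. L (\<omega>, u) \<partial>lborel) \<partial>M)"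
  proof (rule integral_cong_AE)
    show "AE \<omega> in M. fact k * (of_real (W n A \<omega>) * exp (\<i> * of_real (t * Y z \<omega>))) = (\<integral>u. L (\<omega>, u) \<partial>lborel)"
      using S_pos AE_space by eventually_elim (simp add: Lu(2))
  qed measurable
  also have "\<dots> = (\<integral>u. (\<integral>\<omega>. L (\<omega>, u) \<partial>M) \<partial>lborel)"
    using MP.Fubini_integral[of "\<lambda>\<omega> u. L (\<omega>, u)"] intL by simp
  also have "\<dots> = (\<integral>u. exp (of_real \<beta>) * (\<integral>xs. R (xs, u) \<partial>urn n) \<partial>lborel)"
  proof (intro Bochner_Integration.integral_cong refl)
    fix u :: real
    show "(\<integral>\<omega>. L (\<omega>, u) \<partial>M) = exp (of_real \<beta>) * (\<integral>xs. R (xs, u) \<partial>urn n)"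
    proof (cases "u > 0")
      case True
      have "(\<integral>\<omega>. L (\<omega>, u) \<partial>M) = (\<integral>\<omega>. of_real (u ^ k) * (of_real (W n A \<omega> * (S \<omega> ^ n * exp (- (u * S \<omega>)))) * exp (\<i> * of_real (t * Y z \<omega>))) \<partial>M)"
        using True by (intro Bochner_Integration.integral_cong refl) (simp add: L_def k)
      also have "\<dots> = of_real (u ^ k) * (exp (of_real \<beta>) * (\<integral>xs. of_real (box n A xs) * K n xs u t z \<partial>urn n))"
        by (subst integral_mult_right_zero, subst palm_K[OF True A]) simp_all
      also have "\<dots> = exp (of_real \<beta>) * (\<integral>xs. of_real (u ^ k) * (of_real (box n A xs) * K n xs u t z) \<partial>urn n)"
        unfolding integral_mult_right_zero by simp
      also have "\<dots> = exp (of_real \<beta>) * (\<integral>xs. R (xs, u) \<partial>urn n)"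
        using True by (intro arg_cong2[where f = "(*)"] Bochner_Integration.integral_cong refl) (simp add: R_def scaleR_conv_of_real mult_ac)
      finally show ?thesis .
    qed (simp add: L_def R_def)
  qed
  also have "\<dots> = exp (of_real \<beta>) * (\<integral>u. (\<integral>xs. R (xs, u) \<partial>urn n) \<partial>lborel)"
    by (rule integral_mult_right_zero)
  also have "(\<integral>u. (\<integral>xs. R (xs, u) \<partial>urn n) \<partial>lborel) = (\<integral>xs. (\<integral>u. R (xs, u) \<partial>lborel) \<partial>urn n)"
    using PP.Fubini_integral[of "\<lambda>xs u. R (xs, u)"] intR by simp
  also have "\<dots> = (\<integral>xs. of_real (box n A xs) * Gf n xs n t z \<partial>urn n)"
    by (simp only: Ru(2))
  finally show ?thesis .
qed

end

section \<open>Inversion of the characteristic function\<close>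

context gg_fun
begin

text \<open>The majorant is made affine in the constant \<open>c\<close>. With
  \<open>c = cst n xs z\<close> the dependence on the sample then separates from that on
  \<open>t\<close>, and each can be integrated by itself.\<close>

lemma Hbound_le:
  assumes "c \<ge> 0" "t > 0"
  shows "Hbound n c d t \<le> c * Hbound n 1 d t + Hbound n 0 d t"
  using assms E0_nonneg[of n] by (auto simp: Hbound_def intro!: add_increasing mult_nonneg_nonneg)

lemma H_integrand_integral_le:
  assumes D: "D z > 0"
  shows "(LBINT t:{0<..}. \<bar>inverse t * Im (Gf n xs n t z)\<bar>)
    \<le> cst n xs z * (LBINT t:{0<..}. Hbound n 1 (D z) t) + (LBINT t:{0<..}. Hbound n 0 (D z) t)"
proof -
  have i: "set_integrable lborel {0<..} (\<lambda>t. cst n xs z * Hbound n 1 (D z) t)"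
    by (intro set_integrable_mult_right impI Hbound_integrable D)
  have "(LBINT t:{0<..}. \<bar>inverse t * Im (Gf n xs n t z)\<bar>) \<le> (LBINT t:{0<..}. cst n xs z * Hbound n 1 (D z) t + Hbound n 0 (D z) t)"
  proof (rule set_integral_mono)
    show "set_integrable lborel {0<..} (\<lambda>t. \<bar>inverse t * Im (Gf n xs n t z)\<bar>)"
      by (rule set_integrable_abs[OF H_integrable[OF D]])
    show "set_integrable lborel {0<..} (\<lambda>t. cst n xs z * Hbound n 1 (D z) t + Hbound n 0 (D z) t)"
      by (rule set_integral_add(1)[OF i Hbound_integrable[OF D]])
    fix t :: real assume t: "t \<in> {0<..}"
    have "\<bar>inverse t * Im (Gf n xs n t z)\<bar> \<le> Hbound n (cst n xs z) (D z) t"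
      using t by (intro H_integrand_le) auto
    also have "\<dots> \<le> cst n xs z * Hbound n 1 (D z) t + Hbound n 0 (D z) t"
      using t cst_nonneg by (intro Hbound_le) auto
    finally show "\<bar>inverse t * Im (Gf n xs n t z)\<bar> \<le> cst n xs z * Hbound n 1 (D z) t + Hbound n 0 (D z) t" .
  qed
  also have "\<dots> = cst n xs z * (LBINT t:{0<..}. Hbound n 1 (D z) t) + (LBINT t:{0<..}. Hbound n 0 (D z) t)"
    unfolding set_integral_add(2)[OF i Hbound_integrable[OF D]] set_integral_mult_right ..
  finally show ?thesis .
qed

lemma abs_H_le:
  assumes D: "D z > 0"
  shows "\<bar>H n xs z\<bar> \<le> cst n xs z * (LBINT t:{0<..}. Hbound n 1 (D z) t) + (LBINT t:{0<..}. Hbound n 0 (D z) t)"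
  using order_trans[OF set_integral_norm_bound[OF H_integrable[OF D, of n xs], unfolded real_norm_def] H_integrand_integral_le[OF D]]
  by (simp add: H_def)

lemma H_pu_integrable:
  assumes D: "D z > 0"
  shows "integrable (urn n) (\<lambda>xs. H n xs z)"
proof -
  interpret pu: finite_measure "urn n" by (rule finite_urn)
  show ?thesis
  proof (rule integrable_deriv_bound)
    show "integrable (urn n) (\<lambda>xs. cst n xs z * (LBINT t:{0<..}. Hbound n 1 (D z) t) + (LBINT t:{0<..}. Hbound n 0 (D z) t))"
      using cst_integrable by simp
    show "(\<lambda>xs. H n xs z) \<in> borel_measurable (urn n)"
      by (simp add: measurable_cong_sets[OF sets_urn refl])
  qed (use abs_H_le[OF D] in simp)
qed

end

context gg_all
begin

lemma norm_char_le:
  "norm (\<integral>\<omega>. exp (\<i> * of_real (t * Y z \<omega>)) \<partial>M) \<le> exp \<beta> * exp (- (\<beta> * cg * (\<bar>t\<bar> powr \<gamma> * D z)))"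
proof -
  note [measurable] = X_meas[OF gint_measurable[OF gint_lin]]
  let ?w = "1 + of_real 0 + \<i> * of_real (t * z) :: complex"
  have "(\<integral>\<omega>. exp (\<i> * of_real (t * Y z \<omega>)) \<partial>M) = (\<integral>\<omega>. exp (- X (lin 0 t z) \<omega>) \<partial>M)"
  proof (rule integral_cong_AE)
    show "AE \<omega> in M. exp (\<i> * of_real (t * Y z \<omega>)) = exp (- X (lin 0 t z) \<omega>)"
      using X_lin[of 0 t z] by eventually_elim simp
  qed measurable
  also have "\<dots> = exp (- of_real \<beta> * ((\<integral>x. (1 + lin 0 t z x) powr of_real \<gamma> \<partial>P0) - 1))"
    using laplace_complex[OF gint_lin] lap_rhs_diff[OF gint_lin] by (simp add: lin_Re)
  also have "\<dots> = exp (of_real \<beta>) * exp (- of_real \<beta> * (\<integral>x. arg_fun t ?w x powr of_real \<gamma> \<partial>P0))"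
    unfolding lin_arg exp_add[symmetric] by (simp add: algebra_simps)
  finally have "norm (\<integral>\<omega>. exp (\<i> * of_real (t * Y z \<omega>)) \<partial>M) = exp \<beta> * exp (Re (- of_real \<beta> * (\<integral>x. arg_fun t ?w x powr of_real \<gamma> \<partial>P0)))"
    by (simp only: norm_mult norm_exp_eq_Re Re_complex_of_real)
  also have "\<dots> \<le> exp \<beta> * exp (- (\<beta> * cg * (\<integral>x. norm (arg_fun t ?w x) powr \<gamma> \<partial>P0)))"
    using Re_exponent_le[OF gint_arg_fun, of t ?w] by (intro mult_left_mono) (simp_all add: exp_le_cancel_iff)
  also have "\<dots> \<le> exp \<beta> * exp (- (\<beta> * cg * (\<bar>t\<bar> powr \<gamma> * D z)))"
  proof -
    have "\<beta> * cg * (\<bar>t\<bar> powr \<gamma> * D z) \<le> \<beta> * cg * (\<integral>x. norm (arg_fun t ?w x) powr \<gamma> \<partial>P0)"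
      using beta cg_pos arg_fun_integral_ge(2)[of 0 t z] by (intro mult_left_mono) auto
    then show ?thesis by (intro mult_left_mono) (simp_all only: exp_le_cancel_iff neg_le_iff_le exp_ge_zero)
  qed
  finally show ?thesis .
qed

text \<open>The average of the characteristic function over \<open>[0, k]\<close> tends to the mass
  of \<open>Y z\<close> at \<open>0\<close>. By \<open>norm_char_le\<close> the characteristic
  function is integrable if \<open>D z > 0\<close>, so these averages are at most
  \<open>C / k\<close>.\<close>

lemma no_atom:
  assumes D: "D z > 0"
  shows "AE \<omega> in M. Y z \<omega> \<noteq> 0"
proof -
  interpret MP: pair_sigma_finite M lborel ..
  define s where "s k y = (if y = 0 then 1 else sin (k * y) / (k * y))" for k y :: real
  have [measurable]: "(\<lambda>\<omega>. s k (Y z \<omega>)) \<in> borel_measurable M" for k unfolding s_def by measurable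
  have s1: "\<bar>s k y\<bar> \<le> 1" if "k > 0" for k y
    using abs_sin_x_le_abs_x[of "k * y"] that by (auto simp: s_def abs_mult divide_simps)
  define C where "C = (LBINT t:{0<..}. exp \<beta> * exp (- (\<beta> * cg * D z * t powr \<gamma>)))"
  have Ci: "set_integrable lborel {0<..} (\<lambda>t. exp \<beta> * exp (- (\<beta> * cg * D z * t powr \<gamma>)))"
    using integrable_exp_powr[of "\<beta> * cg * D z" 0] beta cg_pos D by (intro set_integrable_mult_right) simp
  have bd: "\<bar>\<integral>\<omega>. s k (Y z \<omega>) \<partial>M\<bar> \<le> C / k" if k: "k > 0" for k
  proof -
    define L where "L = (\<lambda>(\<omega>, t). (cos (t * Y z \<omega>) / k) * indicator {0..k} t)"
    have [measurable]: "L \<in> borel_measurable (M \<Otimes>\<^sub>M lborel)" unfolding L_def by measurable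
    have Lt: "has_bochner_integral lborel (\<lambda>t. L (\<omega>, t)) (s k (Y z \<omega>))" for \<omega>
      unfolding L_def s_def prod.case by (rule cos_truncated[OF k])
    have "integrable (M \<Otimes>\<^sub>M lborel) L"
    proof (rule MP.Fubini_integrable)
      show "AE \<omega> in M. integrable lborel (\<lambda>t. L (\<omega>, t))" using Lt by (auto simp: has_bochner_integral_iff)
      show "integrable M (\<lambda>\<omega>. \<integral>t. norm (L (\<omega>, t)) \<partial>lborel)"
      proof (rule M.integrable_const_bound[where B = 1], rule AE_I2)
        fix \<omega>
        have "(\<integral>t. norm (L (\<omega>, t)) \<partial>lborel) \<le> (\<integral>t. (1 / k) * indicator {0..k} t \<partial>lborel)"
        proof (rule integral_mono)
          show "integrable lborel (\<lambda>t. norm (L (\<omega>, t)))" using Lt[of \<omega>] by (auto simp: has_bochner_integral_iff)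
          show "norm (L (\<omega>, t)) \<le> (1 / k) * indicator {0..k} t" for t
            using k abs_cos_le_one[of "t * Y z \<omega>"] by (auto simp: L_def indicator_def divide_simps)
          show "integrable lborel (\<lambda>t. (1 / k) * indicator {0..k} t)"
            by (intro integrable_mult_right integrable_real_indicator) (auto simp: emeasure_lborel_Icc_eq)
        qed
        also have "\<dots> = 1" using k by simp
        finally show "norm (\<integral>t. norm (L (\<omega>, t)) \<partial>lborel) \<le> 1" by simp
      qed measurable
    qed measurable
    then have "(\<integral>t. (\<integral>\<omega>. L (\<omega>, t) \<partial>M) \<partial>lborel) = (\<integral>\<omega>. (\<integral>t. L (\<omega>, t) \<partial>lborel) \<partial>M)"
      and iL: "integrable lborel (\<lambda>t. \<integral>\<omega>. L (\<omega>, t) \<partial>M)"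
      using MP.Fubini_integral[of "\<lambda>\<omega> t. L (\<omega>, t)"] MP.integrable_snd[of "\<lambda>\<omega> t. L (\<omega>, t)"] by simp_all
    moreover have "(\<integral>t. L (\<omega>, t) \<partial>lborel) = s k (Y z \<omega>)" for \<omega> using Lt by (simp add: has_bochner_integral_iff)
    ultimately have "(\<integral>\<omega>. s k (Y z \<omega>) \<partial>M) = (\<integral>t. (\<integral>\<omega>. L (\<omega>, t) \<partial>M) \<partial>lborel)" by simp
    also have "\<bar>\<dots>\<bar> \<le> (\<integral>t. (1 / k) * (indicator {0<..} t *\<^sub>R (exp \<beta> * exp (- (\<beta> * cg * D z * t powr \<gamma>)))) \<partial>lborel)"
      unfolding real_norm_def[symmetric]
    proof (rule order_trans[OF integral_norm_bound], rule integral_mono_AE)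
      show "integrable lborel (\<lambda>t. norm (\<integral>\<omega>. L (\<omega>, t) \<partial>M))" using iL by simp
      show "integrable lborel (\<lambda>t. (1 / k) * (indicator {0<..} t *\<^sub>R (exp \<beta> * exp (- (\<beta> * cg * D z * t powr \<gamma>)))))"
        using Ci by (intro integrable_mult_right) (simp add: set_integrable_def)
      show "AE t in lborel. norm (\<integral>\<omega>. L (\<omega>, t) \<partial>M) \<le> (1 / k) * (indicator {0<..} t *\<^sub>R (exp \<beta> * exp (- (\<beta> * cg * D z * t powr \<gamma>))))"
        using AE_lborel_singleton[of 0]
      proof eventually_elim
        case (elim t)
        show ?case
        proof (cases "t \<in> {0..k}")
          case True
          have int: "integrable M (\<lambda>\<omega>. exp (\<i> * of_real (t * Y z \<omega>)))"
            by (rule M.integrable_const_bound[where B = 1]) auto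
          have "(\<integral>\<omega>. L (\<omega>, t) \<partial>M) = (1 / k) * (\<integral>\<omega>. Re (exp (\<i> * of_real (t * Y z \<omega>))) \<partial>M)"
            using True by (simp add: L_def Re_exp)
          also have "(\<integral>\<omega>. Re (exp (\<i> * of_real (t * Y z \<omega>))) \<partial>M) = Re (\<integral>\<omega>. exp (\<i> * of_real (t * Y z \<omega>)) \<partial>M)"
            by (rule integral_Re[OF int])
          finally have "norm (\<integral>\<omega>. L (\<omega>, t) \<partial>M) = (1 / k) * \<bar>Re (\<integral>\<omega>. exp (\<i> * of_real (t * Y z \<omega>)) \<partial>M)\<bar>"
            using k by (simp add: abs_mult)
          also have "\<dots> \<le> (1 / k) * (exp \<beta> * exp (- (\<beta> * cg * (\<bar>t\<bar> powr \<gamma> * D z))))"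
            using k by (intro mult_left_mono order_trans[OF abs_Re_le_cmod norm_char_le]) auto
          finally show ?thesis using True elim by (simp add: mult_ac)
        qed (use k in \<open>simp add: L_def\<close>)
      qed
    qed
    also have "\<dots> = C / k" unfolding C_def set_lebesgue_integral_def by (subst integral_mult_right_zero) simp
    finally show ?thesis .
  qed
  define p where "p = measure M {\<omega> \<in> space M. Y z \<omega> = 0}"
  have "(\<lambda>k. \<integral>\<omega>. s (real (Suc k)) (Y z \<omega>) \<partial>M) \<longlonglongrightarrow> (\<integral>\<omega>. indicator {\<omega> \<in> space M. Y z \<omega> = 0} \<omega> \<partial>M)"
  proof (rule integral_dominated_convergence[where w = "\<lambda>_. 1"])
    show "AE \<omega> in M. (\<lambda>k. s (real (Suc k)) (Y z \<omega>)) \<longlonglongrightarrow> indicator {\<omega> \<in> space M. Y z \<omega> = 0} \<omega>"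
    proof (rule AE_I2)
      fix \<omega> assume w: "\<omega> \<in> space M"
      show "(\<lambda>k. s (real (Suc k)) (Y z \<omega>)) \<longlonglongrightarrow> indicator {\<omega> \<in> space M. Y z \<omega> = 0} \<omega>"
      proof (cases "Y z \<omega> = 0")
        case False
        have "(\<lambda>k. s (real (Suc k)) (Y z \<omega>)) \<longlonglongrightarrow> 0"
        proof (rule Lim_null_comparison)
          show "\<forall>\<^sub>F k in sequentially. norm (s (real (Suc k)) (Y z \<omega>)) \<le> inverse (real (Suc k)) * inverse \<bar>Y z \<omega>\<bar>"
          proof (rule always_eventually, rule allI)
            fix k
            have "\<bar>sin (real (Suc k) * Y z \<omega>)\<bar> \<le> 1" by (rule abs_sin_le_one)
            then show "norm (s (real (Suc k)) (Y z \<omega>)) \<le> inverse (real (Suc k)) * inverse \<bar>Y z \<omega>\<bar>"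
              using False by (simp add: s_def abs_mult divide_simps)
          qed
          show "(\<lambda>k. inverse (real (Suc k)) * inverse \<bar>Y z \<omega>\<bar>) \<longlonglongrightarrow> 0"
            using tendsto_mult_left_zero[OF LIMSEQ_inverse_real_of_nat] .
        qed
        with False show ?thesis by simp
      qed (use w in \<open>simp add: s_def\<close>)
    qed
    show "AE \<omega> in M. norm (s (real (Suc k)) (Y z \<omega>)) \<le> 1" for k using s1[of "real (Suc k)"] by simp
  qed auto
  moreover have "(\<integral>\<omega>. indicator {\<omega> \<in> space M. Y z \<omega> = 0} \<omega> \<partial>M) = p" by (simp add: p_def)
  moreover have "(\<lambda>k. \<integral>\<omega>. s (real (Suc k)) (Y z \<omega>) \<partial>M) \<longlonglongrightarrow> 0"
  proof (rule Lim_null_comparison)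
    show "\<forall>\<^sub>F k in sequentially. norm (\<integral>\<omega>. s (real (Suc k)) (Y z \<omega>) \<partial>M) \<le> inverse (real (Suc k)) * C"
      using bd[of "real (Suc _)"] by (intro always_eventually allI) (simp add: divide_inverse mult.commute)
    show "(\<lambda>k. inverse (real (Suc k)) * C) \<longlonglongrightarrow> 0"
      using tendsto_mult_left_zero[OF LIMSEQ_inverse_real_of_nat] .
  qed
  ultimately have "p = 0" using LIMSEQ_unique by metis
  then have "{\<omega> \<in> space M. Y z \<omega> = 0} \<in> null_sets M"
    unfolding p_def by (intro null_setsI) (auto simp: M.emeasure_eq_measure)
  then show ?thesis by (rule AE_I') auto
qed

text \<open>The factor \<open>exp \<beta>\<close> stems from the summand \<open>- 1\<close> in the
  Laplace exponent \<open>(1 + f) powr \<gamma> - 1\<close>, and \<open>fact (n - 1)\<close> from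
  the gamma integral over \<open>u\<close>.\<close>

definition k0 :: "nat \<Rightarrow> real" where "k0 n = exp \<beta> / fact (n - 1)"

lemma k0_pos: "k0 n > 0" by (simp add: k0_def)

lemma W_exp_integrable:
  assumes A: "\<And>i. i < n \<Longrightarrow> A i \<in> sets borel"
  shows "integrable M (\<lambda>\<omega>. of_real (W n A \<omega>) * exp (\<i> * of_real (t * Y z \<omega>)))"
proof -
  note [measurable] = W_meas[OF A]
  show ?thesis
    by (rule M.integrable_const_bound[where B = 1]) (auto simp: norm_mult W_bounds intro!: AE_I2)
qed

lemma box_pu_meas:
  assumes A: "\<And>i. i < n \<Longrightarrow> A i \<in> sets borel"
  shows "box n A \<in> borel_measurable (urn n)"
  using box_measurable[OF A] by (simp add: measurable_cong_sets[OF sets_urn refl])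

lemma box_Gf_integrable:
  assumes A: "\<And>i. i < n \<Longrightarrow> A i \<in> sets borel"
  shows "integrable (urn n) (\<lambda>xs. of_real (box n A xs) * Gf n xs n t z)"
proof -
  interpret pu: finite_measure "urn n" by (rule finite_urn)
  note [measurable] = box_pu_meas[OF A]
  show ?thesis
  proof (rule pu.integrable_const_bound[where B = "1 * E0 n"], rule AE_I2)
    fix xs
    have "norm (Gf n xs n t z) \<le> E0 n * exp (- (b * (\<bar>t\<bar> powr \<gamma> * D z)))" by (rule norm_Gf_le)
    also have "\<dots> \<le> E0 n" using E0_nonneg b_pos D_nonneg by (intro mult_left_le) auto
    finally show "norm (of_real (box n A xs) * Gf n xs n t z) \<le> 1 * E0 n"
      unfolding norm_mult using box_bounds by (intro mult_mono) auto
  qed measurable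
qed

lemma W_sin:
  assumes A: "\<And>i. i < n \<Longrightarrow> A i \<in> sets borel" and n: "n \<ge> 1"
  shows "(\<integral>\<omega>. W n A \<omega> * sin (t * Y z \<omega>) \<partial>M) = k0 n * (\<integral>xs. box n A xs * Im (Gf n xs n t z) \<partial>urn n)"
proof -
  have "(\<integral>\<omega>. W n A \<omega> * sin (t * Y z \<omega>) \<partial>M) = (\<integral>\<omega>. Im (of_real (W n A \<omega>) * exp (\<i> * of_real (t * Y z \<omega>))) \<partial>M)"
    by (simp add: Im_exp)
  also have "\<dots> = Im (\<integral>\<omega>. of_real (W n A \<omega>) * exp (\<i> * of_real (t * Y z \<omega>)) \<partial>M)"
    by (rule integral_Im[OF W_exp_integrable[OF A]])
  also have "(\<integral>\<omega>. of_real (W n A \<omega>) * exp (\<i> * of_real (t * Y z \<omega>)) \<partial>M)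
      = of_real (k0 n) * (\<integral>xs. of_real (box n A xs) * Gf n xs n t z \<partial>urn n)"
  proof -
    have "fact (n - 1) * (\<integral>\<omega>. of_real (W n A \<omega>) * exp (\<i> * of_real (t * Y z \<omega>)) \<partial>M)
      = exp (of_real \<beta>) * (\<integral>xs. of_real (box n A xs) * Gf n xs n t z \<partial>urn n)"
      by (rule char_fun) (use A n in auto)
    then show ?thesis by (simp add: k0_def exp_of_real field_simps)
  qed
  also have "Im (of_real (k0 n) * (\<integral>xs. of_real (box n A xs) * Gf n xs n t z \<partial>urn n))
     = k0 n * (\<integral>xs. Im (of_real (box n A xs) * Gf n xs n t z) \<partial>urn n)"
  proof -
    have int: "integrable (urn n) (\<lambda>xs. of_real (box n A xs) * Gf n xs n t z)"
      by (rule box_Gf_integrable) (use A in auto)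
    show ?thesis unfolding integral_Im[OF int] by simp
  qed
  finally show ?thesis by simp
qed

lemma W_mean:
  assumes A: "\<And>i. i < n \<Longrightarrow> A i \<in> sets borel" and n: "n \<ge> 1"
  shows "(\<integral>\<omega>. W n A \<omega> \<partial>M) = k0 n * (\<integral>xs. box n A xs * G0 n xs \<partial>urn n)"
proof -
  have "complex_of_real (\<integral>\<omega>. W n A \<omega> \<partial>M) = (\<integral>\<omega>. of_real (W n A \<omega>) * exp (\<i> * of_real (0 * Y 0 \<omega>)) \<partial>M)"
    by simp
  also have "\<dots> = of_real (k0 n) * (\<integral>xs. of_real (box n A xs) * Gf n xs n 0 0 \<partial>urn n)"
  proof -
    have "fact (n - 1) * (\<integral>\<omega>. of_real (W n A \<omega>) * exp (\<i> * of_real (0 * Y 0 \<omega>)) \<partial>M)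
      = exp (of_real \<beta>) * (\<integral>xs. of_real (box n A xs) * Gf n xs n 0 0 \<partial>urn n)"
      by (rule char_fun) (use A n in auto)
    then show ?thesis by (simp add: k0_def exp_of_real field_simps)
  qed
  also have "\<dots> = of_real (k0 n * (\<integral>xs. box n A xs * G0 n xs \<partial>urn n))"
    unfolding Gf_0 of_real_mult[symmetric] integral_complex_of_real ..
  finally show ?thesis by (simp only: of_real_eq_iff)
qed

text \<open>The function \<open>sin (t * y) / t\<close> is not absolutely integrable over the
  half-line, so on the side of \<open>M\<close> the integrals can be exchanged only on truncated
  ranges, where the sine integral appears. On the side of the urn the bounds on
  \<open>Im (Gf n xs n t z)\<close> give absolute integrability over the whole half-line. Letting
  the truncation go to the limit on both sides identifies the two.\<close>

lemma W_sgn: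
  assumes A: "\<And>i. i < n \<Longrightarrow> A i \<in> sets borel" and n: "n \<ge> 1" and D: "D z > 0"
  shows "pi / 2 * (\<integral>\<omega>. W n A \<omega> * sgn (Y z \<omega>) \<partial>M) = k0 n * (\<integral>xs. box n A xs * H n xs z \<partial>urn n)"
proof -
  note [measurable] = W_meas[OF A] box_pu_meas[OF A]
  interpret pu: finite_measure "urn n" by (rule finite_urn)
  interpret MP: pair_sigma_finite M lborel ..
  interpret PP: pair_sigma_finite "urn n" lborel ..
  define \<phi> where "\<phi> t = inverse t * (\<integral>\<omega>. W n A \<omega> * sin (t * Y z \<omega>) \<partial>M)" for t
  define R where "R = (\<lambda>(xs, t). box n A xs * (indicator {0<..} t * (inverse t * Im (Gf n xs n t z))))"
  have [measurable]: "R \<in> borel_measurable (urn n \<Otimes>\<^sub>M lborel)"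
  proof -
    have [measurable]: "(\<lambda>p. Gf n (fst p) n (snd p) z) \<in> borel_measurable (urn n \<Otimes>\<^sub>M lborel)"
      by (rule measurable_Gf) measurable
    show ?thesis unfolding R_def case_prod_beta by measurable
  qed
  have Hi: "integrable lborel (\<lambda>t. indicator {0<..} t * (inverse t * Im (Gf n xs n t z)))" for xs
    using H_integrable[OF D, of n xs] by (simp add: set_integrable_def)
  have intR: "integrable (urn n \<Otimes>\<^sub>M lborel) R"
  proof (rule PP.Fubini_integrable)
    show "AE xs in urn n. integrable lborel (\<lambda>t. R (xs, t))"
      unfolding R_def using Hi by simp
    show "integrable (urn n) (\<lambda>xs. \<integral>t. norm (R (xs, t)) \<partial>lborel)"
    proof (rule integrable_deriv_bound)
      show "integrable (urn n) (\<lambda>xs. cst n xs z * (LBINT t:{0<..}. Hbound n 1 (D z) t) + (LBINT t:{0<..}. Hbound n 0 (D z) t))"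
        using cst_integrable by simp
      fix xs
      have "(\<integral>t. norm (R (xs, t)) \<partial>lborel) = box n A xs * (LBINT t:{0<..}. \<bar>inverse t * Im (Gf n xs n t z)\<bar>)"
        using box_bounds[of n A xs] unfolding set_lebesgue_integral_def R_def integral_mult_right_zero[symmetric]
        by (intro Bochner_Integration.integral_cong refl) (auto simp: abs_mult indicator_def)
      also have "\<dots> \<le> 1 * (cst n xs z * (LBINT t:{0<..}. Hbound n 1 (D z) t) + (LBINT t:{0<..}. Hbound n 0 (D z) t))"
        using box_bounds[of n A xs]
        by (intro mult_mono H_integrand_integral_le D) (auto simp: set_lebesgue_integral_def intro!: Bochner_Integration.integral_nonneg)
      finally show "norm (\<integral>t. norm (R (xs, t)) \<partial>lborel) \<le> cst n xs z * (LBINT t:{0<..}. Hbound n 1 (D z) t) + (LBINT t:{0<..}. Hbound n 0 (D z) t)"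
        by simp
    qed measurable
  qed measurable
  have \<phi>R: "indicator {0<..} t * \<phi> t = k0 n * (\<integral>xs. R (xs, t) \<partial>urn n)" for t
  proof (cases "t > 0")
    case True
    have "(\<integral>xs. R (xs, t) \<partial>urn n) = (\<integral>xs. inverse t * (box n A xs * Im (Gf n xs n t z)) \<partial>urn n)"
      using True by (intro Bochner_Integration.integral_cong refl) (simp add: R_def mult_ac)
    moreover have "(\<integral>\<omega>. W n A \<omega> * sin (t * Y z \<omega>) \<partial>M) = k0 n * (\<integral>xs. box n A xs * Im (Gf n xs n t z) \<partial>urn n)"
      by (rule W_sin) (use A n in auto)
    ultimately show ?thesis using True by (simp add: \<phi>_def)
  qed (simp add: R_def)
  have int\<phi>: "integrable lborel (\<lambda>t. indicator {0<..} t * \<phi> t)"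
    unfolding \<phi>R using PP.integrable_snd[of "\<lambda>xs t. R (xs, t)"] intR by (intro integrable_mult_right) simp
  have "(\<integral>t. indicator {0<..} t * \<phi> t \<partial>lborel) = k0 n * (\<integral>t. (\<integral>xs. R (xs, t) \<partial>urn n) \<partial>lborel)"
    unfolding \<phi>R by (rule integral_mult_right_zero)
  also have "(\<integral>t. (\<integral>xs. R (xs, t) \<partial>urn n) \<partial>lborel) = (\<integral>xs. (\<integral>t. R (xs, t) \<partial>lborel) \<partial>urn n)"
    using PP.Fubini_integral[of "\<lambda>xs t. R (xs, t)"] intR by simp
  also have "\<dots> = (\<integral>xs. box n A xs * H n xs z \<partial>urn n)"
    by (simp add: R_def H_def set_lebesgue_integral_def)
  finally have rhs: "(\<integral>t. indicator {0<..} t * \<phi> t \<partial>lborel) = k0 n * (\<integral>xs. box n A xs * H n xs z \<partial>urn n)" .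
  let ?Si = "\<lambda>k \<omega>. Si (real (Suc k) * Y z \<omega>) - Si (inverse (real (Suc k)) * Y z \<omega>)"
  let ?I = "\<lambda>k::nat. {inverse (real (Suc k))..real (Suc k)}"
  \<comment> \<open>On this range \<open>1 / t\<close> is at most \<open>Suc k\<close>, so Fubini's
    theorem needs nothing beyond boundedness of \<open>W\<close>.\<close>
  have trunc: "(\<integral>t. indicator (?I k) t * \<phi> t \<partial>lborel) = (\<integral>\<omega>. W n A \<omega> * ?Si k \<omega> \<partial>M)" for k
  proof -
    define L where "L = (\<lambda>(\<omega>, t). W n A \<omega> * ((inverse t * sin (t * Y z \<omega>)) * indicator (?I k) t))"
    have [measurable]: "L \<in> borel_measurable (M \<Otimes>\<^sub>M lborel)" unfolding L_def by measurable
    have le: "inverse (real (Suc k)) \<le> real (Suc k)"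
      by (simp add: inverse_le_1_iff order_trans[of _ 1])
    have Lt: "has_bochner_integral lborel (\<lambda>t. L (\<omega>, t)) (W n A \<omega> * ?Si k \<omega>)" for \<omega>
      unfolding L_def prod.case by (intro has_bochner_integral_mult_right Si_truncated le) auto
    have "integrable (M \<Otimes>\<^sub>M lborel) L"
    proof (rule MP.Fubini_integrable)
      show "AE \<omega> in M. integrable lborel (\<lambda>t. L (\<omega>, t))" using Lt by (auto simp: has_bochner_integral_iff)
      show "integrable M (\<lambda>\<omega>. \<integral>t. norm (L (\<omega>, t)) \<partial>lborel)"
      proof (rule M.integrable_const_bound[where B = "\<integral>t. real (Suc k) * indicator (?I k) t \<partial>lborel"], rule AE_I2)
        fix \<omega> assume w: "\<omega> \<in> space M"
        have "(\<integral>t. norm (L (\<omega>, t)) \<partial>lborel) \<le> (\<integral>t. real (Suc k) * indicator (?I k) t \<partial>lborel)"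
        proof (rule integral_mono)
          show "integrable lborel (\<lambda>t. norm (L (\<omega>, t)))" using Lt[of \<omega>] by (auto simp: has_bochner_integral_iff)
          fix t :: real
          show "norm (L (\<omega>, t)) \<le> real (Suc k) * indicator (?I k) t"
          proof (cases "t \<in> ?I k")
            case True
            then have t: "t > 0" by (auto intro: less_le_trans[of 0 "inverse (real (Suc k))"])
            have "inverse t \<le> inverse (inverse (real (Suc k)))" using True by (intro le_imp_inverse_le) auto
            then have "W n A \<omega> * (inverse t * \<bar>sin (t * Y z \<omega>)\<bar>) \<le> 1 * (real (Suc k) * 1)"
              using W_bounds[OF w, of n A] t by (intro mult_mono abs_sin_le_one) auto
            then show ?thesis using True t W_bounds[OF w, of n A] by (simp add: L_def abs_mult)
          qed (simp add: L_def)
          show "integrable lborel (\<lambda>t. real (Suc k) * indicator (?I k) t)"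
            by (intro integrable_mult_right integrable_real_indicator) (auto simp: emeasure_lborel_Icc_eq)
        qed
        then show "norm (\<integral>t. norm (L (\<omega>, t)) \<partial>lborel) \<le> (\<integral>t. real (Suc k) * indicator (?I k) t \<partial>lborel)" by simp
      qed measurable
    qed measurable
    then have "(\<integral>t. (\<integral>\<omega>. L (\<omega>, t) \<partial>M) \<partial>lborel) = (\<integral>\<omega>. (\<integral>t. L (\<omega>, t) \<partial>lborel) \<partial>M)"
      using MP.Fubini_integral[of "\<lambda>\<omega> t. L (\<omega>, t)"] by simp
    also have "\<dots> = (\<integral>\<omega>. W n A \<omega> * ?Si k \<omega> \<partial>M)"
      using Lt by (simp only: has_bochner_integral_iff)
    also have "(\<lambda>t. \<integral>\<omega>. L (\<omega>, t) \<partial>M) = (\<lambda>t. indicator (?I k) t * \<phi> t)"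
    proof
      fix t
      have "(\<integral>\<omega>. L (\<omega>, t) \<partial>M) = (\<integral>\<omega>. (indicator (?I k) t * inverse t) * (W n A \<omega> * sin (t * Y z \<omega>)) \<partial>M)"
        by (intro Bochner_Integration.integral_cong refl) (simp add: L_def mult_ac)
      then show "(\<integral>\<omega>. L (\<omega>, t) \<partial>M) = indicator (?I k) t * \<phi> t" by (simp add: \<phi>_def)
    qed
    finally show ?thesis .
  qed
  have "(\<lambda>k. \<integral>t. indicator (?I k) t * \<phi> t \<partial>lborel) \<longlonglongrightarrow> (\<integral>t. indicator {0<..} t * \<phi> t \<partial>lborel)"
  proof (rule integral_dominated_convergence[where w = "\<lambda>t. norm (indicator {0<..} t * \<phi> t)"])
    have [measurable]: "\<phi> \<in> borel_measurable borel" unfolding \<phi>_def by measurable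
    show "(\<lambda>t. indicator {0<..} t * \<phi> t) \<in> borel_measurable lborel"
      "(\<lambda>t. indicator (?I k) t * \<phi> t) \<in> borel_measurable lborel" for k by measurable
    show "integrable lborel (\<lambda>t. norm (indicator {0<..} t * \<phi> t))" by (rule integrable_norm[OF int\<phi>])
    show "AE t in lborel. (\<lambda>k. indicator (?I k) t * \<phi> t) \<longlonglongrightarrow> indicator {0<..} t * \<phi> t"
    proof (rule AE_I2)
      fix t :: real
      have "\<forall>\<^sub>F k in sequentially. indicator (?I k) t * \<phi> t = indicator {0<..} t * \<phi> t"
      proof (cases "t > 0")
        case True
        have "\<forall>\<^sub>F k in sequentially. inverse (real (Suc k)) < t"
          using order_tendstoD(2)[OF LIMSEQ_inverse_real_of_nat True] .
        moreover have "\<forall>\<^sub>F k in sequentially. t \<le> real (Suc k)"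
          using eventually_ge_at_top[of "nat \<lceil>t\<rceil>"] by eventually_elim linarith
        ultimately show ?thesis by eventually_elim (use True in auto)
      next
        case False
        have "t \<notin> ?I k" for k using False by (metis atLeastAtMost_iff inverse_positive_iff_positive less_le_trans of_nat_0_less_iff zero_less_Suc)
        then show ?thesis using False by simp
      qed
      then show "(\<lambda>k. indicator (?I k) t * \<phi> t) \<longlonglongrightarrow> indicator {0<..} t * \<phi> t" by (rule tendsto_eventually)
    qed
    show "AE t in lborel. norm (indicator (?I k) t * \<phi> t) \<le> norm (indicator {0<..} t * \<phi> t)" for k
    proof (rule AE_I2)
      fix t :: real
      have "t > 0" if "t \<in> ?I k" using that by (auto intro: less_le_trans[of 0 "inverse (real (Suc k))"])
      then show "norm (indicator (?I k) t * \<phi> t) \<le> norm (indicator {0<..} t * \<phi> t)" by (auto simp: indicator_def)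
    qed
  qed
  moreover have "(\<lambda>k. \<integral>t. indicator (?I k) t * \<phi> t \<partial>lborel) \<longlonglongrightarrow> (\<integral>\<omega>. W n A \<omega> * (pi / 2 * sgn (Y z \<omega>)) \<partial>M)"
    unfolding trunc
  proof -
    obtain B where B: "\<And>T. \<bar>Si T\<bar> \<le> B" using bounded_Si by blast
    show "(\<lambda>k. \<integral>\<omega>. W n A \<omega> * ?Si k \<omega> \<partial>M)
      \<longlonglongrightarrow> (\<integral>\<omega>. W n A \<omega> * (pi / 2 * sgn (Y z \<omega>)) \<partial>M)"
    proof (rule integral_dominated_convergence[where w = "\<lambda>_. 1 * (B + B)"])
      show "AE \<omega> in M. (\<lambda>k. W n A \<omega> * ?Si k \<omega>) \<longlonglongrightarrow> W n A \<omega> * (pi / 2 * sgn (Y z \<omega>))"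
        by (intro AE_I2 tendsto_mult_left Si_seq_limit)
      show "AE \<omega> in M. norm (W n A \<omega> * ?Si k \<omega>) \<le> 1 * (B + B)" for k
      proof (rule AE_I2)
        fix \<omega> assume w: "\<omega> \<in> space M"
        show "norm (W n A \<omega> * ?Si k \<omega>) \<le> 1 * (B + B)"
        proof -
          have "\<bar>Si x - Si y\<bar> \<le> B + B" for x y
            by (rule order_trans[OF abs_triangle_ineq4 add_mono[OF B B]])
          then show ?thesis
            unfolding real_norm_def abs_mult using W_bounds[OF w, of n A] by (intro mult_mono) auto
        qed
      qed
    qed measurable
  qed
  ultimately have "(\<integral>\<omega>. W n A \<omega> * (pi / 2 * sgn (Y z \<omega>)) \<partial>M) = k0 n * (\<integral>xs. box n A xs * H n xs z \<partial>urn n)"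
    unfolding rhs by (rule LIMSEQ_unique[rotated])
  moreover have "(\<integral>\<omega>. W n A \<omega> * (pi / 2 * sgn (Y z \<omega>)) \<partial>M) = (\<integral>\<omega>. pi / 2 * (W n A \<omega> * sgn (Y z \<omega>)) \<partial>M)"
    by (simp add: mult_ac)
  ultimately show ?thesis by simp
qed

text \<open>Outside the null event \<open>Y z = 0\<close> the indicator of
  \<open>Y z \<le> 0\<close> equals \<open>1/2 - sgn (Y z) / 2\<close>; the two terms are evaluated
  by \<open>W_mean\<close> and \<open>W_sgn\<close>. The factor \<open>k0 n * G0 n xs\<close> is
  split off because it is the density of the sample.\<close>

theorem cdf_identity:
  assumes A: "\<And>i. i < n \<Longrightarrow> A i \<in> sets borel" and n: "n \<ge> 1" and D: "D z > 0"
  shows "(\<integral>\<omega>. W n A \<omega> * indicator {..0} (Y z \<omega>) \<partial>M) = (\<integral>xs. box n A xs * (k0 n * G0 n xs * cdfF n xs z) \<partial>urn n)"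
proof -
  note [measurable] = W_meas[OF A] box_pu_meas[OF A]
  interpret pu: finite_measure "urn n" by (rule finite_urn)
  have iW: "integrable M (W n A)"
    by (rule M.integrable_const_bound[where B = 1]) (auto simp: W_bounds intro!: AE_I2)
  have iWs: "integrable M (\<lambda>\<omega>. W n A \<omega> * sgn (Y z \<omega>))"
    by (rule M.integrable_const_bound[where B = 1]) (auto simp: W_bounds abs_mult sgn_real_def intro!: AE_I2)
  have "(\<integral>\<omega>. W n A \<omega> * indicator {..0} (Y z \<omega>) \<partial>M) = (\<integral>\<omega>. W n A \<omega> / 2 - (W n A \<omega> * sgn (Y z \<omega>)) / 2 \<partial>M)"
  proof (rule integral_cong_AE)
    show "AE \<omega> in M. W n A \<omega> * indicator {..0} (Y z \<omega>) = W n A \<omega> / 2 - (W n A \<omega> * sgn (Y z \<omega>)) / 2"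
      using no_atom[OF D] by eventually_elim (auto simp: sgn_real_def)
  qed measurable
  also have "\<dots> = (\<integral>\<omega>. W n A \<omega> \<partial>M) / 2 - (\<integral>\<omega>. W n A \<omega> * sgn (Y z \<omega>) \<partial>M) / 2"
    using iW iWs by simp
  also have "(\<integral>\<omega>. W n A \<omega> * sgn (Y z \<omega>) \<partial>M) = k0 n * (\<integral>xs. box n A xs * H n xs z \<partial>urn n) * (2 / pi)"
  proof -
    have "pi / 2 * (\<integral>\<omega>. W n A \<omega> * sgn (Y z \<omega>) \<partial>M) = k0 n * (\<integral>xs. box n A xs * H n xs z \<partial>urn n)"
      by (rule W_sgn) (use A n D in auto)
    then show ?thesis by (simp add: field_simps)
  qed
  also have "(\<integral>\<omega>. W n A \<omega> \<partial>M) / 2 - k0 n * (\<integral>xs. box n A xs * H n xs z \<partial>urn n) * (2 / pi) / 2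
     = k0 n / 2 * (\<integral>xs. box n A xs * G0 n xs \<partial>urn n) - k0 n / pi * (\<integral>xs. box n A xs * H n xs z \<partial>urn n)"
  proof -
    have "(\<integral>\<omega>. W n A \<omega> \<partial>M) = k0 n * (\<integral>xs. box n A xs * G0 n xs \<partial>urn n)"
      by (rule W_mean) (use A n in auto)
    then show ?thesis by simp
  qed
  also have "\<dots> = (\<integral>xs. k0 n / 2 * (box n A xs * G0 n xs) - k0 n / pi * (box n A xs * H n xs z) \<partial>urn n)"
  proof (subst Bochner_Integration.integral_diff)
    have bG: "integrable (urn n) (\<lambda>xs. box n A xs * G0 n xs)"
    proof (rule pu.integrable_const_bound[where B = "1 * E0 n"])
      show "AE xs in urn n. norm (box n A xs * G0 n xs) \<le> 1 * E0 n"
        unfolding norm_mult using box_bounds G0_le by (intro AE_I2 mult_mono) auto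
      have [measurable]: "G0 n \<in> borel_measurable (urn n)" by (simp add: measurable_cong_sets[OF sets_urn refl])
      show "(\<lambda>xs. box n A xs * G0 n xs) \<in> borel_measurable (urn n)" by measurable
    qed
    then show "integrable (urn n) (\<lambda>xs. k0 n / 2 * (box n A xs * G0 n xs))" by simp
    have bH: "integrable (urn n) (\<lambda>xs. box n A xs * H n xs z)"
    proof (rule integrable_deriv_bound)
      show "integrable (urn n) (\<lambda>xs. norm (H n xs z))" using H_pu_integrable[OF D] by (rule integrable_norm)
      have [measurable]: "(\<lambda>xs. H n xs z) \<in> borel_measurable (urn n)" by (simp add: measurable_cong_sets[OF sets_urn refl])
      show "(\<lambda>xs. box n A xs * H n xs z) \<in> borel_measurable (urn n)" by measurable
      show "norm (box n A xs * H n xs z) \<le> norm (H n xs z)" for xs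
        using box_bounds[of n A xs] by (simp add: abs_mult mult_left_le_one_le)
    qed
    then show "integrable (urn n) (\<lambda>xs. k0 n / pi * (box n A xs * H n xs z))" by simp
  qed simp
  also have "\<dots> = (\<integral>xs. box n A xs * (k0 n * G0 n xs * cdfF n xs z) \<partial>urn n)"
    using less_imp_neq[OF G0_pos[of n]]
    by (intro Bochner_Integration.integral_cong refl) (simp add: cdfF_def field_simps)
  finally show ?thesis .
qed

end

section \<open>The posterior distribution\<close>

text \<open>A Dynkin argument for the signed set function
  \<open>C \<mapsto> E (1\<^sub>C(X) * h)\<close>: as \<open>h\<close> changes sign, uniqueness of
  measures on a generator is not directly applicable, and the complement and union steps are done
  with integrals.\<close>

lemma integral_zero_PiM:
  fixes h :: "'w \<Rightarrow> real"
  assumes "finite I" and X [measurable]: "X \<in> M \<rightarrow>\<^sub>M PiM I N" and h: "integrable M h"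
    and zero: "\<And>A. (\<And>i. i \<in> I \<Longrightarrow> A i \<in> sets (N i)) \<Longrightarrow> (\<integral>\<omega>. indicator (Pi\<^sub>E I A) (X \<omega>) * h \<omega> \<partial>M) = 0"
    and C: "C \<in> sets (PiM I N)"
  shows "(\<integral>\<omega>. indicator C (X \<omega>) * h \<omega> \<partial>M) = 0"
proof -
  have int: "integrable M (\<lambda>\<omega>. indicator C (X \<omega>) * h \<omega>)" if "C \<in> sets (PiM I N)" for C
  proof (rule Bochner_Integration.integrable_bound[OF h])
    show "(\<lambda>\<omega>. indicator C (X \<omega>) * h \<omega>) \<in> borel_measurable M" using that h by measurable
  qed (auto simp: indicator_def)
  have C': "C \<in> sigma_sets (\<Pi>\<^sub>E i\<in>I. space (N i)) (prod_algebra I N)"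
    using C by (simp add: sets_PiM)
  have sp: "(\<Pi>\<^sub>E i\<in>I. space (N i)) \<in> sets (PiM I N)" by (metis sets.top space_PiM)
  show ?thesis
    using Int_stable_prod_algebra prod_algebra_sets_into_space C'
  proof (induction rule: sigma_sets_induct_disjoint)
    case (basic A)
    then obtain E where E: "A = Pi\<^sub>E I E" "E \<in> (\<Pi> j\<in>I. sets (N j))"
      using prod_algebra_eq_finite[OF \<open>finite I\<close>, of N] by auto
    show ?case unfolding E(1) by (rule zero) (use E(2) in auto)
  next
    case empty then show ?case by simp
  next
    case (compl A)
    then have A: "A \<in> sets (PiM I N)" by (simp add: sets_PiM)
    have "(\<integral>\<omega>. indicator ((\<Pi>\<^sub>E i\<in>I. space (N i)) - A) (X \<omega>) * h \<omega> \<partial>M)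
       = (\<integral>\<omega>. indicator (\<Pi>\<^sub>E i\<in>I. space (N i)) (X \<omega>) * h \<omega> - indicator A (X \<omega>) * h \<omega> \<partial>M)"
      using sets.sets_into_space[OF A] by (intro Bochner_Integration.integral_cong refl) (auto simp: indicator_def space_PiM)
    also have "\<dots> = 0"
      using int[OF sp] int[OF A] zero[of "\<lambda>i. space (N i)"] compl by simp
    finally show ?case .
  next
    case (union A)
    then have A: "A i \<in> sets (PiM I N)" for i by (auto simp: sets_PiM)
    define B where "B i = X -` A i \<inter> space M" for i
    have B: "B i \<in> sets M" for i unfolding B_def using A by measurable
    have UB: "(\<Union>i. B i) = X -` (\<Union>i. A i) \<inter> space M" by (auto simp: B_def)
    have ind: "(\<integral>\<omega>. indicator C (X \<omega>) * h \<omega> \<partial>M) = (LINT \<omega>:X -` C \<inter> space M|M. h \<omega>)" for C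
      unfolding set_lebesgue_integral_def by (intro Bochner_Integration.integral_cong refl) (auto simp: indicator_def)
    have "set_integrable M (\<Union>i. B i) h"
      using int[of "\<Union>i. A i"] A unfolding UB set_integrable_def
      by (rule_tac Bochner_Integration.integrable_cong[THEN iffD1, rotated 2]) (auto simp: indicator_def)
    then have "(LINT \<omega>:(\<Union>i. B i)|M. h \<omega>) = (\<Sum>i. (LINT \<omega>:B i|M. h \<omega>))"
      using B union(1) by (intro lebesgue_integral_countable_add) (auto simp: B_def disjoint_family_on_def)
    also have "\<dots> = 0" using union unfolding B_def ind[symmetric] by simp
    finally show ?case unfolding ind UB[symmetric] .
  qed
qed

locale gg_sample = gg_all P0 \<gamma> \<beta> M S P g
  for P0 :: "'x::polish_space measure" and \<gamma> \<beta> and M :: "'w measure" and S P and g +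
  fixes n :: nat and Xs :: "nat \<Rightarrow> 'w \<Rightarrow> 'x"
  assumes n: "1 \<le> n" and sample: "cond_iid M n Xs P"
begin

definition XX :: "'w \<Rightarrow> nat \<Rightarrow> 'x" where "XX \<omega> = (\<lambda>i\<in>{..<n}. Xs i \<omega>)"

definition PG :: "'w \<Rightarrow> real" where "PG \<omega> = (\<integral>x. g x \<partial>P \<omega>)"

lemma Xs_meas: "i < n \<Longrightarrow> Xs i \<in> M \<rightarrow>\<^sub>M borel"
  using sample by (simp add: cond_iid_def)

lemma XX_meas [measurable]: "XX \<in> M \<rightarrow>\<^sub>M seqs n"
  unfolding XX_def by (intro measurable_restrict) (use Xs_meas in auto)

lemma PG_meas [measurable]: "PG \<in> borel_measurable M"
  unfolding PG_def by measurable

lemma box_XX: "indicator (Pi\<^sub>E {..<n} A) (XX \<omega>) = box n A (XX \<omega>)"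
  by (auto simp: box_def XX_def indicator_def PiE_iff prod_zero_iff)

text \<open>\<open>P(g)\<close> is a function of \<open>P\<close>, so the indicator of
  \<open>B\<close> is measurable with respect to the sigma-algebra generated by \<open>P\<close> and
  the sample indicator may be replaced by its conditional expectation \<open>W\<close>.\<close>

lemma sample_identity:
  assumes A: "\<And>i. i < n \<Longrightarrow> A i \<in> sets borel" and B: "B \<in> sets borel"
  shows "(\<integral>\<omega>. indicator (Pi\<^sub>E {..<n} A) (XX \<omega>) * indicator B (PG \<omega>) \<partial>M) = (\<integral>\<omega>. W n A \<omega> * indicator B (PG \<omega>) \<partial>M)"
proof -
  note [measurable] = W_meas[OF A] Xs_meas A B
  let ?F = "vimage_algebra (space M) P (subprob_algebra borel)"
  have sub: "subalgebra M ?F"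
  proof -
    have "P \<in> space M \<rightarrow> space (subprob_algebra borel)" using P_meas by (simp add: measurable_def)
    then show ?thesis
      unfolding subalgebra_def by (auto simp: sets_vimage_algebra2 intro: measurable_sets[OF P_meas])
  qed
  interpret F: finite_measure_subalgebra M ?F
    using sub by unfold_locales
  have PF: "P \<in> ?F \<rightarrow>\<^sub>M subprob_algebra borel"
    by (rule measurable_vimage_algebra1) (use P_meas in \<open>auto simp: measurable_def\<close>)
  have GF [measurable]: "(\<lambda>\<omega>. indicator B (PG \<omega>) :: real) \<in> borel_measurable ?F"
    unfolding PG_def
    by (rule measurable_compose[OF measurable_compose[OF PF integral_measurable_subprob_algebra[OF g_meas]]]) (use B in measurable)
  let ?I = "indicator {\<omega> \<in> space M. \<forall>i<n. Xs i \<omega> \<in> A i} :: 'w \<Rightarrow> real"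
  have I [measurable]: "?I \<in> borel_measurable M" by measurable
  have int: "integrable M (\<lambda>\<omega>. indicator B (PG \<omega>) * ?I \<omega>)"
    by (rule M.integrable_const_bound[where B = 1]) (auto simp: indicator_def)
  have ae: "AE \<omega> in M. real_cond_exp M ?F ?I \<omega> = W n A \<omega>"
    using sample A unfolding cond_iid_def W_def by auto
  have "(\<integral>\<omega>. indicator (Pi\<^sub>E {..<n} A) (XX \<omega>) * indicator B (PG \<omega>) \<partial>M) = (\<integral>\<omega>. indicator B (PG \<omega>) * ?I \<omega> \<partial>M)"
    by (intro Bochner_Integration.integral_cong refl) (auto simp: XX_def indicator_def PiE_iff)
  also have "\<dots> = (\<integral>\<omega>. indicator B (PG \<omega>) * real_cond_exp M ?F ?I \<omega> \<partial>M)"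
    by (rule F.real_cond_exp_intg(2)[OF int GF I, symmetric])
  also have "\<dots> = (\<integral>\<omega>. W n A \<omega> * indicator B (PG \<omega>) \<partial>M)"
    by (rule integral_cong_AE) (use ae in \<open>auto simp: borel_measurable_cond_exp2\<close>)
  finally show ?thesis .
qed

lemma PG_Y: "AE \<omega> in M. indicator {..z} (PG \<omega>) = (indicator {..0} (Y z \<omega>) :: real)"
proof -
  have "AE \<omega> in M. integrable (P \<omega>) (\<lambda>x. complex_of_real (g x))" by (rule X_integrable[OF gint_g])
  then show ?thesis using P_prob S_pos
  proof eventually_elim
    case (elim \<omega>)
    interpret p: prob_space "P \<omega>" by (rule elim(2))
    have "integrable (P \<omega>) g" using integrable_Re[OF elim(1)] by simp
    then have "(\<integral>x. g x - z \<partial>P \<omega>) = PG \<omega> - z" by (simp add: PG_def p.prob_space)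
    then show ?case using elim(3) by (simp add: Y_def indicator_def mult_le_0_iff not_less)
  qed
qed

text \<open>With \<open>B = UNIV\<close>, \<open>sample_identity\<close> and \<open>W_mean\<close>
  give the probability of every rectangle; rectangles determine the law. The integrability statement
  is needed separately because \<open>cdfF\<close> is not known to be bounded in the sample.\<close>

lemma law_XX:
  fixes \<phi> :: "(nat \<Rightarrow> 'x) \<Rightarrow> real"
  assumes [measurable]: "\<phi> \<in> borel_measurable (seqs n)"
  shows "integrable M (\<lambda>\<omega>. \<phi> (XX \<omega>)) \<longleftrightarrow> integrable (urn n) (\<lambda>xs. k0 n * G0 n xs * \<phi> xs)"
    and "(\<integral>\<omega>. \<phi> (XX \<omega>) \<partial>M) = (\<integral>xs. k0 n * G0 n xs * \<phi> xs \<partial>urn n)"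
proof -
  interpret pu: finite_measure "urn n" by (rule finite_urn)
  define w where "w xs = k0 n * G0 n xs" for xs
  have w0: "w xs \<ge> 0" for xs unfolding w_def using k0_pos[of n] G0_pos[of n xs] by simp
  have w_le: "w xs \<le> k0 n * E0 n" for xs
    unfolding w_def using k0_pos[of n] G0_le[of n xs] by (intro mult_left_mono) auto
  have [measurable]: "w \<in> borel_measurable (urn n)"
    unfolding w_def by (simp add: measurable_cong_sets[OF sets_urn refl])
  have eq: "distr M (seqs n) XX = density (urn n) (\<lambda>xs. ennreal (w xs))" (is "?P = ?Q")
  proof (rule measure_eqI_PiM_finite[where I = "{..<n}" and M = "\<lambda>_. borel" and A = "\<lambda>_. space (seqs n)"])
    fix A :: "nat \<Rightarrow> 'x set" assume A: "\<And>i. i \<in> {..<n} \<Longrightarrow> A i \<in> sets borel"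
    then have A': "\<And>i. i < n \<Longrightarrow> A i \<in> sets borel" by simp
    have PiA [measurable]: "Pi\<^sub>E {..<n} A \<in> sets (seqs n)" using A by (intro sets_PiM_I_finite) auto
    have "emeasure ?P (Pi\<^sub>E {..<n} A) = emeasure M (XX -` Pi\<^sub>E {..<n} A \<inter> space M)"
      by (rule emeasure_distr) measurable
    also have "\<dots> = ennreal (\<integral>\<omega>. indicator (XX -` Pi\<^sub>E {..<n} A \<inter> space M) \<omega> \<partial>M)"
      by (simp add: M.emeasure_eq_measure)
    also have "(\<integral>\<omega>. indicator (XX -` Pi\<^sub>E {..<n} A \<inter> space M) \<omega> \<partial>M) = (\<integral>\<omega>. indicator (Pi\<^sub>E {..<n} A) (XX \<omega>) * indicator UNIV (PG \<omega>) \<partial>M :: real)"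
      by (intro Bochner_Integration.integral_cong refl) (auto simp: indicator_def)
    also have "\<dots> = (\<integral>\<omega>. W n A \<omega> * indicator UNIV (PG \<omega>) \<partial>M)" by (rule sample_identity) (use A' in auto)
    also have "\<dots> = k0 n * (\<integral>xs. box n A xs * G0 n xs \<partial>urn n)"
      using W_mean[of n A, OF _ n] A' by simp
    also have "\<dots> = (\<integral>xs. w xs * box n A xs \<partial>urn n)"
      unfolding w_def mult.assoc integral_mult_right_zero by (simp add: mult.commute)
    also have "ennreal (\<integral>xs. w xs * box n A xs \<partial>urn n) = (\<integral>\<^sup>+xs. ennreal (w xs * box n A xs) \<partial>urn n)"
    proof (rule nn_integral_eq_integral[symmetric])
      have [measurable]: "box n A \<in> borel_measurable (urn n)" by (rule box_pu_meas) (use A' in auto)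
      show "integrable (urn n) (\<lambda>xs. w xs * box n A xs)"
      proof (rule pu.integrable_const_bound[where B = "k0 n * E0 n * 1"], rule AE_I2)
        fix xs
        have "w xs * box n A xs \<le> (k0 n * E0 n) * 1"
          using w_le w0[of xs] box_bounds[of n A xs] order_trans[OF w0 w_le] by (intro mult_mono) auto
        then show "norm (w xs * box n A xs) \<le> k0 n * E0 n * 1" using w0[of xs] box_bounds[of n A xs] by simp
      qed measurable
      show "AE xs in urn n. 0 \<le> w xs * box n A xs" using w0 box_bounds by (intro AE_I2) auto
    qed
    also have "\<dots> = (\<integral>\<^sup>+xs. ennreal (w xs) * indicator (Pi\<^sub>E {..<n} A) xs \<partial>urn n)"
    proof (rule nn_integral_cong)
      fix xs assume "xs \<in> space (urn n)"
      then have "xs \<in> space (seqs n)" using sets_eq_imp_space_eq[OF sets_urn] by simp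
      then have "box n A xs = indicator (Pi\<^sub>E {..<n} A) xs"
        by (auto simp: box_def indicator_def PiE_iff space_PiM prod_zero_iff)
      then show "ennreal (w xs * box n A xs) = ennreal (w xs) * indicator (Pi\<^sub>E {..<n} A) xs"
        by (auto simp: indicator_def)
    qed
    also have "\<dots> = emeasure ?Q (Pi\<^sub>E {..<n} A)"
      using PiA by (subst emeasure_density) (auto simp: sets_urn)
    finally show "emeasure ?P (Pi\<^sub>E {..<n} A) = emeasure ?Q (Pi\<^sub>E {..<n} A)" .
  next
    show "emeasure ?P (space (seqs n)) \<noteq> \<infinity>" for i :: nat
      by (simp add: emeasure_distr M.emeasure_finite)
    show "range (\<lambda>_. space (seqs n)) \<subseteq> prod_algebra {..<n} (\<lambda>_. borel)"
      by (auto simp: prod_algebra_eq_finite space_PiM intro!: exI[of _ "\<lambda>_. UNIV"])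
  qed (auto simp: sets_urn)
  have "integrable M (\<lambda>\<omega>. \<phi> (XX \<omega>)) \<longleftrightarrow> integrable ?P \<phi>"
    by (simp add: integrable_distr_eq)
  also have "\<dots> \<longleftrightarrow> integrable (urn n) (\<lambda>xs. w xs * \<phi> xs)"
    unfolding eq using w0 by (subst integrable_density) (auto simp: measurable_cong_sets[OF sets_urn refl])
  finally show "integrable M (\<lambda>\<omega>. \<phi> (XX \<omega>)) \<longleftrightarrow> integrable (urn n) (\<lambda>xs. k0 n * G0 n xs * \<phi> xs)"
    by (simp add: w_def)
  have "(\<integral>\<omega>. \<phi> (XX \<omega>) \<partial>M) = (\<integral>xs. \<phi> xs \<partial>?P)"
    by (simp add: integral_distr)
  also have "\<dots> = (\<integral>xs. w xs * \<phi> xs \<partial>urn n)"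
    unfolding eq using w0 by (subst integral_density) (auto simp: measurable_cong_sets[OF sets_urn refl])
  finally show "(\<integral>\<omega>. \<phi> (XX \<omega>) \<partial>M) = (\<integral>xs. k0 n * G0 n xs * \<phi> xs \<partial>urn n)"
    by (simp add: w_def)
qed

abbreviation "FX \<equiv> vimage_algebra (space M) XX (seqs n)"

lemma FX_subalgebra: "finite_measure_subalgebra M FX"
proof -
  have "subalgebra M FX"
  proof -
    have "XX \<in> space M \<rightarrow> space (seqs n)" using XX_meas by (simp add: measurable_def)
    then show ?thesis
      unfolding subalgebra_def by (auto simp: sets_vimage_algebra2 intro: measurable_sets[OF XX_meas])
  qed
  then show ?thesis by unfold_locales
qed

lemma XX_FX: "XX \<in> FX \<rightarrow>\<^sub>M seqs n"
  by (rule measurable_vimage_algebra1) (use XX_meas in \<open>auto simp: measurable_def\<close>)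

lemma cdfF_XX_integrable:
  assumes D: "D z > 0"
  shows "integrable M (\<lambda>\<omega>. cdfF n (XX \<omega>) z)"
proof -
  interpret pu: finite_measure "urn n" by (rule finite_urn)
  have [measurable]: "G0 n \<in> borel_measurable (urn n)" by (simp add: measurable_cong_sets[OF sets_urn refl])
  have "integrable (urn n) (G0 n)"
    by (rule pu.integrable_const_bound[where B = "E0 n"]) (use G0_le in auto)
  then have "integrable (urn n) (\<lambda>xs. k0 n / 2 * G0 n xs - k0 n / pi * H n xs z)"
    using H_pu_integrable[OF D, of n] by simp
  also have "(\<lambda>xs. k0 n / 2 * G0 n xs - k0 n / pi * H n xs z) = (\<lambda>xs. k0 n * G0 n xs * cdfF n xs z)"
    using less_imp_neq[OF G0_pos[of n]] by (simp add: fun_eq_iff cdfF_def field_simps)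
  finally show ?thesis by (subst law_XX(1)) measurable
qed

text \<open>By the averaging characterization of conditional expectation it suffices to test against
  events of the sample, and by \<open>integral_zero_PiM\<close> against rectangles, where
  \<open>cdf_identity\<close> applies.\<close>

lemma cond_cdf:
  assumes D: "D z > 0"
  shows "AE \<omega> in M. real_cond_exp M FX (indicator {\<omega> \<in> space M. PG \<omega> \<in> {..z}}) \<omega> = cdfF n (XX \<omega>) z"
proof -
  interpret F: finite_measure_subalgebra M FX by (rule FX_subalgebra)
  define h where "h \<omega> = indicator {..z} (PG \<omega>) - cdfF n (XX \<omega>) z" for \<omega>
  have i1: "integrable M (\<lambda>\<omega>. indicator {..z} (PG \<omega>) :: real)"
    by (rule M.integrable_const_bound[where B = 1]) (auto simp: indicator_def)
  note i2 = cdfF_XX_integrable[OF D]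
  have ih: "integrable M h" unfolding h_def using i1 i2 by simp
  have bd: "integrable M (\<lambda>\<omega>. indicator C (XX \<omega>) * f \<omega>)" if "integrable M f" "C \<in> sets (seqs n)" for f :: "'w \<Rightarrow> real" and C
  proof (rule Bochner_Integration.integrable_bound[OF that(1)])
    show "(\<lambda>\<omega>. indicator C (XX \<omega>) * f \<omega>) \<in> borel_measurable M" using that by measurable
  qed (auto simp: indicator_def)
  have zero: "(\<integral>\<omega>. indicator C (XX \<omega>) * h \<omega> \<partial>M) = 0" if C: "C \<in> sets (seqs n)" for C
  proof (rule integral_zero_PiM[OF _ XX_meas ih _ C])
    fix A :: "nat \<Rightarrow> 'x set" assume "\<And>i. i \<in> {..<n} \<Longrightarrow> A i \<in> sets borel"
    then have A: "\<And>i. i < n \<Longrightarrow> A i \<in> sets borel" by simp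
    then have PiA: "Pi\<^sub>E {..<n} A \<in> sets (seqs n)" by (intro sets_PiM_I_finite) auto
    have [measurable]: "W n A \<in> borel_measurable M" by (rule W_meas) (use A in auto)
    have "(\<integral>\<omega>. indicator (Pi\<^sub>E {..<n} A) (XX \<omega>) * indicator {..z} (PG \<omega>) \<partial>M) = (\<integral>\<omega>. W n A \<omega> * indicator {..z} (PG \<omega>) \<partial>M)"
      by (rule sample_identity) (use A in auto)
    also have "\<dots> = (\<integral>\<omega>. W n A \<omega> * indicator {..0} (Y z \<omega>) \<partial>M)"
      by (rule integral_cong_AE) (use PG_Y[of z] in auto)
    also have "\<dots> = (\<integral>xs. box n A xs * (k0 n * G0 n xs * cdfF n xs z) \<partial>urn n)"
      by (rule cdf_identity) (use A n D in auto)
    also have "\<dots> = (\<integral>xs. k0 n * G0 n xs * (box n A xs * cdfF n xs z) \<partial>urn n)"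
      by (simp add: mult_ac)
    also have "\<dots> = (\<integral>\<omega>. box n A (XX \<omega>) * cdfF n (XX \<omega>) z \<partial>M)"
    proof (rule law_XX(2)[symmetric])
      have [measurable]: "box n A \<in> borel_measurable (seqs n)" by (rule box_measurable) (use A in auto)
      show "(\<lambda>xs. box n A xs * cdfF n xs z) \<in> borel_measurable (seqs n)" by measurable
    qed
    finally show "(\<integral>\<omega>. indicator (Pi\<^sub>E {..<n} A) (XX \<omega>) * h \<omega> \<partial>M) = 0"
      unfolding h_def right_diff_distrib using bd[OF i1 PiA] bd[OF i2 PiA] by (simp add: box_XX)
  qed simp
  show ?thesis
  proof (rule F.real_cond_exp_charact)
    fix C' assume "C' \<in> sets FX"
    then obtain C where C: "C \<in> sets (seqs n)" "C' = XX -` C \<inter> space M"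
      using XX_meas by (auto simp: sets_vimage_algebra2 measurable_space)
    have "(\<integral>\<omega>. indicator C (XX \<omega>) * indicator {..z} (PG \<omega>) \<partial>M) = (\<integral>\<omega>. indicator C (XX \<omega>) * cdfF n (XX \<omega>) z \<partial>M)"
      using zero[OF C(1)] bd[OF i1 C(1)] bd[OF i2 C(1)] unfolding h_def right_diff_distrib by simp
    moreover have "(LINT \<omega>:C'|M. indicator {\<omega> \<in> space M. PG \<omega> \<in> {..z}} \<omega>) = (\<integral>\<omega>. indicator C (XX \<omega>) * indicator {..z} (PG \<omega>) \<partial>M :: real)"
      unfolding set_lebesgue_integral_def by (intro Bochner_Integration.integral_cong refl) (auto simp: C(2) indicator_def)
    moreover have "(LINT \<omega>:C'|M. cdfF n (XX \<omega>) z) = (\<integral>\<omega>. indicator C (XX \<omega>) * cdfF n (XX \<omega>) z \<partial>M)"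
      unfolding set_lebesgue_integral_def by (intro Bochner_Integration.integral_cong refl) (auto simp: C(2) indicator_def)
    ultimately show "(LINT \<omega>:C'|M. indicator {\<omega> \<in> space M. PG \<omega> \<in> {..z}} \<omega>) = (LINT \<omega>:C'|M. cdfF n (XX \<omega>) z)" by simp
  next
    show "integrable M (indicator {\<omega> \<in> space M. PG \<omega> \<in> {..z}} :: 'w \<Rightarrow> real)"
      by (rule M.integrable_const_bound[where B = 1]) (auto simp: indicator_def)
    show "integrable M (\<lambda>\<omega>. cdfF n (XX \<omega>) z)" by (rule i2)
    show "(\<lambda>\<omega>. cdfF n (XX \<omega>) z) \<in> borel_measurable FX"
      by (rule measurable_compose[OF XX_FX measurable_cdfF])
  qed
qed

lemma D_pos_iff: "D z > 0 \<longleftrightarrow> \<not> (AE x in P0. g x = z)"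
proof
  assume "D z > 0"
  show "\<not> (AE x in P0. g x = z)"
  proof
    assume "AE x in P0. g x = z"
    then have "AE x in P0. \<bar>g x - z\<bar> powr \<gamma> = 0" by eventually_elim simp
    then have "D z = 0" unfolding D_def by (intro integral_eq_zero_AE)
    with \<open>D z > 0\<close> show False by simp
  qed
qed (rule D_pos)

lemma cdfF_isCont: "D z > 0 \<Longrightarrow> isCont (cdfF n xs) z"
  unfolding cdfF_def using DERIV_isCont[OF H_deriv[OF n, of z xs]]
  by (intro continuous_intros) (use G0_pos[of n xs] in auto)

text \<open>The conditional identity holds for each argument outside a null set of its own. It is
  collected over the rationals and then extended to every real argument with \<open>D z > 0\<close>,
  using right continuity of a distribution function on one side and continuity of
  \<open>cdfF\<close> on the other.\<close>

theorem kernel_unique: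
  assumes \<kappa>: "regular_cond_distr M XX (seqs n) PG borel \<kappa>"
  shows "AE \<omega> in M. \<forall>z. D z > 0 \<longrightarrow> cdf (\<kappa> (XX \<omega>)) z = cdfF n (XX \<omega>) z"
proof -
  have \<kappa>m: "\<kappa> \<in> seqs n \<rightarrow>\<^sub>M prob_algebra borel" using \<kappa> by (simp add: regular_cond_distr_def)
  have "AE \<omega> in M. \<forall>q\<in>\<rat>. D q > 0 \<longrightarrow> cdf (\<kappa> (XX \<omega>)) q = cdfF n (XX \<omega>) q"
  proof (rule AE_ball_countable')
    fix q :: real
    have "AE \<omega> in M. real_cond_exp M FX (indicator {\<omega> \<in> space M. PG \<omega> \<in> {..q}}) \<omega> = measure (\<kappa> (XX \<omega>)) {..q}"
    proof -
      have "\<forall>B\<in>sets borel. AE \<omega> in M. real_cond_exp M FX (indicator {\<omega> \<in> space M. PG \<omega> \<in> B}) \<omega> = measure (\<kappa> (XX \<omega>)) B"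
        using \<kappa> unfolding regular_cond_distr_def by blast
      from bspec[OF this, of "{..q}"] show ?thesis by simp
    qed
    moreover have "AE \<omega> in M. D q > 0 \<longrightarrow> real_cond_exp M FX (indicator {\<omega> \<in> space M. PG \<omega> \<in> {..q}}) \<omega> = cdfF n (XX \<omega>) q"
      using cond_cdf[of q] by (cases "D q > 0") auto
    ultimately show "AE \<omega> in M. D q > 0 \<longrightarrow> cdf (\<kappa> (XX \<omega>)) q = cdfF n (XX \<omega>) q"
      by eventually_elim (simp add: cdf_def)
  qed (simp add: countable_rat)
  then show ?thesis
    using AE_space
  proof eventually_elim
    case (elim \<omega>)
    have "\<kappa> (XX \<omega>) \<in> space (prob_algebra borel)"
      using measurable_space[OF \<kappa>m measurable_space[OF XX_meas elim(2)]] .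
    then have pk: "prob_space (\<kappa> (XX \<omega>))" and sk: "sets (\<kappa> (XX \<omega>)) = sets borel"
      by (auto simp: space_prob_algebra)
    interpret k: finite_borel_measure "\<kappa> (XX \<omega>)"
      unfolding finite_borel_measure_def finite_borel_measure_axioms_def
      using pk sk by (simp add: prob_space.finite_measure)
    show ?case
    proof (intro allI impI)
      fix z assume D: "D z > 0"
      \<comment> \<open>The rational arguments approaching \<open>z\<close> must themselves satisfy
        the positivity condition; continuity of \<open>D\<close> guarantees it within distance
        \<open>r\<close>.\<close>
      obtain r where r: "r > 0" "\<And>y. y \<in> ball z r \<Longrightarrow> D y \<ge> D z / 2" using D_pos_near[OF D] by blast
      have "\<exists>q\<in>\<rat>. z < q \<and> q < z + min r (inverse (real (Suc k)))" for k
        using Rats_dense_in_real[of z "z + min r (inverse (real (Suc k)))"] r by auto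
      then obtain q where q: "\<And>k. q k \<in> \<rat>" "\<And>k. z < q k" "\<And>k. q k < z + min r (inverse (real (Suc k)))" by metis
      have qz: "q \<longlonglongrightarrow> z"
      proof (rule tendsto_sandwich[where f = "\<lambda>_. z" and h = "\<lambda>k. z + inverse (real (Suc k))"])
        show "(\<lambda>k. z + inverse (real (Suc k))) \<longlonglongrightarrow> z"
          using tendsto_add[OF tendsto_const LIMSEQ_inverse_real_of_nat, of z] by simp
        show "\<forall>\<^sub>F k in sequentially. z \<le> q k" using q(2) by (simp add: less_imp_le)
        have "q k \<le> z + inverse (real (Suc k))" for k using q(3)[of k] by simp
        then show "\<forall>\<^sub>F k in sequentially. q k \<le> z + inverse (real (Suc k))" by simp
      qed simp
      have Dq: "D (q k) > 0" for k
      proof -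
        have "q k - z < r" using q(3)[of k] by linarith
        then have "q k \<in> ball z r" using q(2)[of k] by (simp add: dist_real_def)
        from r(2)[OF this] D show ?thesis by linarith
      qed
      have eq: "cdf (\<kappa> (XX \<omega>)) (q k) = cdfF n (XX \<omega>) (q k)" for k using elim(1) q(1) Dq by auto
      have "(\<lambda>k. cdf (\<kappa> (XX \<omega>)) (q k)) \<longlonglongrightarrow> cdf (\<kappa> (XX \<omega>)) z"
      proof -
        have "(cdf (\<kappa> (XX \<omega>)) \<longlongrightarrow> cdf (\<kappa> (XX \<omega>)) z) (at_right z)"
          using k.cdf_is_right_cont[of z] by (simp add: continuous_within)
        moreover have "filterlim q (at_right z) sequentially"
          using qz q(2) less_imp_neq[OF q(2)] by (auto simp: filterlim_at intro!: always_eventually)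
        ultimately show ?thesis by (rule filterlim_compose)
      qed
      moreover have "(\<lambda>k. cdf (\<kappa> (XX \<omega>)) (q k)) \<longlonglongrightarrow> cdfF n (XX \<omega>) z"
        unfolding eq by (rule isCont_tendsto_compose[OF cdfF_isCont[OF D] qz])
      ultimately show "cdf (\<kappa> (XX \<omega>)) z = cdfF n (XX \<omega>) z" by (rule LIMSEQ_unique)
    qed
  qed
qed

text \<open>For a fixed event \<open>C\<close> of the sample both sides, integrated over
  \<open>C\<close>, are finite measures in \<open>B\<close>: the image under \<open>PG\<close> of
  \<open>M\<close> restricted to \<open>C\<close>, and the mixture of the kernel over
  \<open>C\<close>. Agreement on the closed half-lines, a generator stable under intersection, makes
  them equal.\<close>

lemma regular_cond_distrI:
  assumes \<kappa>: "\<kappa> \<in> seqs n \<rightarrow>\<^sub>M prob_algebra borel"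
    and half: "\<And>q. AE \<omega> in M. real_cond_exp M FX (indicator {\<omega> \<in> space M. PG \<omega> \<in> {..q}}) \<omega> = measure (\<kappa> (XX \<omega>)) {..q}"
  shows "regular_cond_distr M XX (seqs n) PG borel \<kappa>"
proof -
  interpret F: finite_measure_subalgebra M FX by (rule FX_subalgebra)
  have \<kappa>s: "\<kappa> \<in> seqs n \<rightarrow>\<^sub>M subprob_algebra borel" using \<kappa> by (rule measurable_prob_algebraD)
  have \<kappa>X [measurable]: "(\<lambda>\<omega>. \<kappa> (XX \<omega>)) \<in> M \<rightarrow>\<^sub>M subprob_algebra borel"
    by (rule measurable_compose[OF XX_meas \<kappa>s])
  have \<kappa>F: "(\<lambda>\<omega>. measure (\<kappa> (XX \<omega>)) B) \<in> borel_measurable FX" if "B \<in> sets borel" for B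
    by (rule measurable_compose[OF measurable_compose[OF XX_FX \<kappa>s] measurable_measure_subprob_algebra[OF that]])
  have \<kappa>p: "prob_space (\<kappa> (XX \<omega>))" if "\<omega> \<in> space M" for \<omega>
    using measurable_space[OF \<kappa> measurable_space[OF XX_meas that]] by (simp add: space_prob_algebra)
  have i\<kappa>: "integrable M (\<lambda>\<omega>. measure (\<kappa> (XX \<omega>)) B)" if [measurable]: "B \<in> sets borel" for B
    by (rule M.integrable_const_bound[where B = 1])
       (use \<kappa>p in \<open>auto intro!: AE_I2 simp: prob_space.prob_le_1\<close>)
  have iP: "integrable M (indicator {\<omega> \<in> space M. PG \<omega> \<in> B} :: 'w \<Rightarrow> real)" if [measurable]: "B \<in> sets borel" for B
    by (rule M.integrable_const_bound[where B = 1]) (auto simp: indicator_def)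
  show ?thesis
    unfolding regular_cond_distr_def
  proof (intro conjI ballI \<kappa>)
    fix B :: "real set" assume B: "B \<in> sets borel"
    show "AE \<omega> in M. real_cond_exp M FX (indicator {\<omega> \<in> space M. PG \<omega> \<in> B}) \<omega> = measure (\<kappa> (XX \<omega>)) B"
    proof (rule F.real_cond_exp_charact[OF _ iP[OF B] i\<kappa>[OF B] \<kappa>F[OF B]])
      fix C assume C: "C \<in> sets FX"
      then have CM: "C \<in> sets M" using F.subalg by (auto simp: subalgebra_def)
      let ?N = "density M (indicator C)"
      have m1: "emeasure (distr ?N borel PG) B = ennreal (LINT \<omega>:C|M. indicator {\<omega> \<in> space M. PG \<omega> \<in> B} \<omega>)" if [measurable]: "B \<in> sets borel" for B
      proof -
        have "emeasure (distr ?N borel PG) B = emeasure ?N (PG -` B \<inter> space M)"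
          by (subst emeasure_distr) auto
        also have "\<dots> = emeasure M (C \<inter> (PG -` B \<inter> space M))"
          using CM by (subst emeasure_density) (auto simp: nn_integral_indicator[symmetric] indicator_inter_arith simp del: nn_integral_indicator)
        also have "\<dots> = ennreal (LINT \<omega>:C|M. indicator {\<omega> \<in> space M. PG \<omega> \<in> B} \<omega>)"
        proof -
          have "(LINT \<omega>:C|M. indicator {\<omega> \<in> space M. PG \<omega> \<in> B} \<omega>) = (\<integral>\<omega>. indicator (C \<inter> (PG -` B \<inter> space M)) \<omega> \<partial>M :: real)"
            unfolding set_lebesgue_integral_def by (intro Bochner_Integration.integral_cong refl) (auto simp: indicator_def)
          also have "\<dots> = measure M (C \<inter> (PG -` B \<inter> space M))"
            using sets.sets_into_space[OF CM] by (simp add: Int_absorb2 le_infI1)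
          finally show ?thesis by (simp add: M.emeasure_eq_measure)
        qed
        finally show ?thesis .
      qed
      have m2: "emeasure (?N \<bind> (\<lambda>\<omega>. \<kappa> (XX \<omega>))) B = ennreal (LINT \<omega>:C|M. measure (\<kappa> (XX \<omega>)) B)" if [measurable]: "B \<in> sets borel" for B
      proof -
        have "emeasure (?N \<bind> (\<lambda>\<omega>. \<kappa> (XX \<omega>))) B = (\<integral>\<^sup>+\<omega>. emeasure (\<kappa> (XX \<omega>)) B \<partial>?N)"
          by (rule emeasure_bind[where N = borel]) (auto simp: M.not_empty)
        also have "\<dots> = (\<integral>\<^sup>+\<omega>. indicator C \<omega> * emeasure (\<kappa> (XX \<omega>)) B \<partial>M)"
          using CM by (subst nn_integral_density) auto
        also have "\<dots> = (\<integral>\<^sup>+\<omega>. ennreal (indicator C \<omega> *\<^sub>R measure (\<kappa> (XX \<omega>)) B) \<partial>M)"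
        proof (rule nn_integral_cong)
          fix \<omega> assume "\<omega> \<in> space M"
          then interpret k: prob_space "\<kappa> (XX \<omega>)" by (rule \<kappa>p)
          show "indicator C \<omega> * emeasure (\<kappa> (XX \<omega>)) B = ennreal (indicator C \<omega> *\<^sub>R measure (\<kappa> (XX \<omega>)) B)"
            by (auto simp: indicator_def k.emeasure_eq_measure)
        qed
        also have "\<dots> = ennreal (LINT \<omega>:C|M. measure (\<kappa> (XX \<omega>)) B)"
          unfolding set_lebesgue_integral_def
          by (rule nn_integral_eq_integral[OF integrable_mult_indicator[OF CM i\<kappa>[OF that]]]) auto
        finally show ?thesis .
      qed
      have "distr ?N borel PG = ?N \<bind> (\<lambda>\<omega>. \<kappa> (XX \<omega>))"
      proof (rule measure_eqI_generator_eq[where E = "range atMost" and \<Omega> = UNIV and A = "\<lambda>i::nat. {..real i}"])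
        show "Int_stable (range atMost :: real set set)" by (auto simp: Int_stable_def)
        show "sets (distr ?N borel PG) = sigma_sets UNIV (range atMost)"
          by (simp add: borel_eq_atMost)
        have "sets (?N \<bind> (\<lambda>\<omega>. \<kappa> (XX \<omega>))) = sets borel"
          by (rule sets_bind[OF sets_kernel[OF \<kappa>X]]) (auto simp: M.not_empty)
        then show "sets (?N \<bind> (\<lambda>\<omega>. \<kappa> (XX \<omega>))) = sigma_sets UNIV (range atMost)"
          by (simp add: borel_eq_atMost)
        show "(\<Union>i::nat. {..real i}) = UNIV" by (auto intro: real_arch_simple)
        show "emeasure (distr ?N borel PG) {..real i} \<noteq> \<infinity>" for i by (simp add: m1)
        fix X :: "real set" assume "X \<in> range atMost"
        then obtain q where X: "X = {..q}" by auto
        have "(LINT \<omega>:C|M. indicator {\<omega> \<in> space M. PG \<omega> \<in> {..q}} \<omega>) = (LINT \<omega>:C|M. real_cond_exp M FX (indicator {\<omega> \<in> space M. PG \<omega> \<in> {..q}}) \<omega>)"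
          by (rule F.real_cond_exp_intA[OF iP C]) simp
        also have "\<dots> = (LINT \<omega>:C|M. measure (\<kappa> (XX \<omega>)) {..q})"
          unfolding set_lebesgue_integral_def
          by (rule integral_cong_AE) (use half[of q] CM in \<open>auto simp: borel_measurable_cond_exp2\<close>)
        finally show "emeasure (distr ?N borel PG) X = emeasure (?N \<bind> (\<lambda>\<omega>. \<kappa> (XX \<omega>))) X"
          unfolding X by (simp add: m1 m2)
      qed auto
      then have "ennreal (LINT \<omega>:C|M. indicator {\<omega> \<in> space M. PG \<omega> \<in> B} \<omega>) = ennreal (LINT \<omega>:C|M. measure (\<kappa> (XX \<omega>)) B)"
        using m1[OF B] m2[OF B] by simp
      moreover have "(LINT \<omega>:C|M. indicator {\<omega> \<in> space M. PG \<omega> \<in> B} \<omega>) \<ge> (0::real)" "(LINT \<omega>:C|M. measure (\<kappa> (XX \<omega>)) B) \<ge> 0"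
        unfolding set_lebesgue_integral_def by (auto intro!: Bochner_Integration.integral_nonneg)
      ultimately show "(LINT \<omega>:C|M. indicator {\<omega> \<in> space M. PG \<omega> \<in> B} \<omega>) = (LINT \<omega>:C|M. measure (\<kappa> (XX \<omega>)) B)"
        by simp
    qed
  qed
qed

text \<open>Only countably many arguments of \<open>cdfF n xs\<close> are tested, which keeps the predicate measurable.\<close>

definition good :: "(nat \<Rightarrow> 'x) \<Rightarrow> bool" where
  "good xs \<longleftrightarrow> (\<forall>p\<in>\<rat>. \<forall>q\<in>\<rat>. p \<le> q \<longrightarrow> cdfF n xs p \<le> cdfF n xs q) \<and>
     (\<forall>q\<in>\<rat>. 0 \<le> cdfF n xs q \<and> cdfF n xs q \<le> 1) \<and>
     (\<forall>k::nat. \<exists>m::nat. cdfF n xs (- real m) \<le> inverse (real (Suc k))) \<and>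
     (\<forall>k::nat. \<exists>m::nat. cdfF n xs (real m) \<ge> 1 - inverse (real (Suc k)))"

lemma good_measurable [measurable]: "Measurable.pred (seqs n) good"
proof -
  have R: "(\<forall>p\<in>\<rat>. Q p) \<longleftrightarrow> (\<forall>p::rat. Q (of_rat p))" for Q :: "real \<Rightarrow> bool"
    by (auto simp: Rats_def)
  have le: "Measurable.pred (seqs n) (\<lambda>xs. cdfF n xs p \<le> cdfF n xs q)"
      "Measurable.pred (seqs n) (\<lambda>xs. cdfF n xs p \<le> c)" "Measurable.pred (seqs n) (\<lambda>xs. c \<le> cdfF n xs p)" for p q c
    by (simp_all add: pred_def borel_measurable_le[OF measurable_cdfF measurable_cdfF]
        borel_measurable_le[OF measurable_cdfF borel_measurable_const] borel_measurable_le[OF borel_measurable_const measurable_cdfF])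
  show ?thesis
    unfolding good_def R by (intro pred_intros_countable pred_intros_logic pred_intros_imp' le)
qed

context
  assumes nonconst: "\<And>z. D z > 0"
begin

lemma cdfF_cont: "isCont (cdfF n xs) z"
  by (rule cdfF_isCont[OF nonconst])

lemma good_AE: "AE \<omega> in M. good (XX \<omega>)"
proof -
  interpret F: finite_measure_subalgebra M FX by (rule FX_subalgebra)
  let ?I = "\<lambda>z. indicator {\<omega> \<in> space M. PG \<omega> \<in> {..z}} :: 'w \<Rightarrow> real"
  have iI: "integrable M (?I z)" for z
    by (rule M.integrable_const_bound[where B = 1]) (auto simp: indicator_def)
  note cc = cond_cdf[OF nonconst]
  have mono: "AE \<omega> in M. cdfF n (XX \<omega>) p \<le> cdfF n (XX \<omega>) q" if "p \<le> q" for p q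
  proof -
    have "AE \<omega> in M. real_cond_exp M FX (?I p) \<omega> \<le> real_cond_exp M FX (?I q) \<omega>"
      using that by (intro F.real_cond_exp_mono iI AE_I2) (auto simp: indicator_def)
    then show ?thesis using cc[of p] cc[of q] by eventually_elim simp
  qed
  have bd: "AE \<omega> in M. 0 \<le> cdfF n (XX \<omega>) q \<and> cdfF n (XX \<omega>) q \<le> 1" for q
  proof -
    have "AE \<omega> in M. real_cond_exp M FX (?I q) \<omega> \<ge> 0"
      by (intro F.real_cond_exp_ge_c iI) auto
    moreover have "AE \<omega> in M. real_cond_exp M FX (?I q) \<omega> \<le> 1"
      by (intro F.real_cond_exp_le_c iI) (auto simp: indicator_def)
    ultimately show ?thesis using cc[of q] by eventually_elim simp
  qed
  have M1: "AE \<omega> in M. \<forall>p\<in>\<rat>. \<forall>q\<in>\<rat>. p \<le> q \<longrightarrow> cdfF n (XX \<omega>) p \<le> cdfF n (XX \<omega>) q"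
  proof (intro AE_ball_countable' countable_rat)
    fix p q :: real
    show "AE \<omega> in M. p \<le> q \<longrightarrow> cdfF n (XX \<omega>) p \<le> cdfF n (XX \<omega>) q" using mono[of p q] by (cases "p \<le> q") auto
  qed
  have M2: "AE \<omega> in M. \<forall>q\<in>\<rat>. 0 \<le> cdfF n (XX \<omega>) q \<and> cdfF n (XX \<omega>) q \<le> 1"
    by (intro AE_ball_countable' countable_rat bd)
  interpret G: real_distribution "distr M borel PG" by (rule M.real_distribution_distr) simp
  \<comment> \<open>The mean of the conditional distribution function is that of
    \<open>P(g)\<close>, so its limits at both infinities are known in the mean.\<close>
  have Ecdf: "(\<integral>\<omega>. cdfF n (XX \<omega>) z \<partial>M) = cdf (distr M borel PG) z" for z
  proof -
    have "(\<integral>\<omega>. cdfF n (XX \<omega>) z \<partial>M) = (\<integral>\<omega>. real_cond_exp M FX (?I z) \<omega> \<partial>M)"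
      using cc[of z] cdfF_XX_integrable[OF nonconst] by (intro integral_cong_AE) auto
    also have "\<dots> = (\<integral>\<omega>. ?I z \<omega> \<partial>M)" by (rule F.real_cond_exp_int(2)[OF iI])
    also have "\<dots> = measure M (PG -` {..z} \<inter> space M)"
      by (simp add: vimage_def Int_def conj_commute)
    also have "\<dots> = cdf (distr M borel PG) z" by (simp add: cdf_def measure_distr)
    finally show ?thesis .
  qed
  \<comment> \<open>Markov's inequality bounds the probability that every \<open>Z m\<close> exceeds
    a given level by a multiple of each mean, hence by zero. It is applied to both tails.\<close>
  have key: "AE \<omega> in M. \<forall>k::nat. \<exists>m::nat. Z m \<omega> \<le> inverse (real (Suc k))"
    if Z: "\<And>m. AE \<omega> in M. 0 \<le> Z m \<omega>" "\<And>m. AE \<omega> in M. Z (Suc m) \<omega> \<le> Z m \<omega>"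
      "\<And>m. integrable M (Z m)" "(\<lambda>m. \<integral>\<omega>. Z m \<omega> \<partial>M) \<longlonglongrightarrow> 0" for Z :: "nat \<Rightarrow> 'w \<Rightarrow> real"
  proof (subst AE_all_countable, rule allI)
    fix k :: nat
    let ?c = "inverse (real (Suc k))"
    have [measurable]: "Z m \<in> borel_measurable M" for m using Z(3) by auto
    let ?B = "{\<omega> \<in> space M. \<forall>m. Z m \<omega> > ?c}"
    have B [measurable]: "?B \<in> sets M" by measurable
    have le: "measure M ?B * ?c \<le> (\<integral>\<omega>. Z m \<omega> \<partial>M)" for m
    proof -
      have "measure M ?B * ?c = (\<integral>\<omega>. indicator ?B \<omega> * ?c \<partial>M)" by simp
      also have "\<dots> \<le> (\<integral>\<omega>. Z m \<omega> \<partial>M)"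
      proof (rule integral_mono_AE)
        show "integrable M (\<lambda>\<omega>. indicator ?B \<omega> * ?c)"
          using B by (intro integrable_mult_left integrable_real_indicator) (auto simp: M.emeasure_finite less_top[symmetric])
        show "AE \<omega> in M. indicator ?B \<omega> * ?c \<le> Z m \<omega>"
          using Z(1)[of m] by eventually_elim (auto simp: indicator_def intro: less_imp_le)
      qed (rule Z(3))
      finally show ?thesis .
    qed
    have "measure M ?B * ?c \<le> 0"
      by (rule LIMSEQ_le_const[OF Z(4)]) (use le in auto)
    then have "measure M ?B \<le> 0" by (simp add: mult_le_0_iff)
    then have "measure M ?B = 0" using measure_nonneg[of M ?B] by (rule order_antisym)
    then have "?B \<in> null_sets M" using B by (intro null_setsI) (auto simp: M.emeasure_eq_measure)
    then show "AE \<omega> in M. \<exists>m. Z m \<omega> \<le> ?c" by (rule AE_I') (auto simp: not_le)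
  qed
  have M3: "AE \<omega> in M. \<forall>k::nat. \<exists>m::nat. cdfF n (XX \<omega>) (- real m) \<le> inverse (real (Suc k))"
  proof (rule key)
    show "(\<lambda>m. \<integral>\<omega>. cdfF n (XX \<omega>) (- real m) \<partial>M) \<longlonglongrightarrow> 0"
      unfolding Ecdf by (rule G.cdf_lim_neg_infty)
    show "AE \<omega> in M. 0 \<le> cdfF n (XX \<omega>) (- real m)" for m using bd[of "- real m"] by auto
    show "AE \<omega> in M. cdfF n (XX \<omega>) (- real (Suc m)) \<le> cdfF n (XX \<omega>) (- real m)" for m by (rule mono) simp
  qed (rule cdfF_XX_integrable[OF nonconst])
  have M4: "AE \<omega> in M. \<forall>k::nat. \<exists>m::nat. 1 - cdfF n (XX \<omega>) (real m) \<le> inverse (real (Suc k))"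
  proof (rule key)
    have "(\<integral>\<omega>. 1 - cdfF n (XX \<omega>) (real m) \<partial>M) = 1 - cdf (distr M borel PG) (real m)" for m
      using cdfF_XX_integrable[OF nonconst] M.prob_space by (simp add: Ecdf)
    moreover have "(\<lambda>m. 1 - cdf (distr M borel PG) (real m)) \<longlonglongrightarrow> 1 - 1"
      by (intro tendsto_diff tendsto_const G.cdf_lim_infty_prob)
    ultimately show "(\<lambda>m. \<integral>\<omega>. 1 - cdfF n (XX \<omega>) (real m) \<partial>M) \<longlonglongrightarrow> 0" by simp
    show "AE \<omega> in M. 0 \<le> 1 - cdfF n (XX \<omega>) (real m)" for m using bd[of "real m"] by auto
    show "AE \<omega> in M. 1 - cdfF n (XX \<omega>) (real (Suc m)) \<le> 1 - cdfF n (XX \<omega>) (real m)" for m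
      using mono[of "real m" "real (Suc m)"] by auto
    show "integrable M (\<lambda>\<omega>. 1 - cdfF n (XX \<omega>) (real m))" for m
      using cdfF_XX_integrable[OF nonconst] by simp
  qed
  show ?thesis
    using M1 M2 M3 M4
  proof eventually_elim
    case (elim \<omega>)
    have "\<forall>k::nat. \<exists>m::nat. cdfF n (XX \<omega>) (real m) \<ge> 1 - inverse (real (Suc k))"
      using elim(4) by (simp add: algebra_simps)
    with elim show ?case unfolding good_def by blast
  qed
qed

text \<open>Monotonicity and the bounds pass from rational to real arguments because
  \<open>cdfF\<close> is continuous; the limits are tested along integers and follow by
  monotonicity.\<close>

lemma good_distribution:
  assumes "good xs"
  shows "real_distribution (interval_measure (cdfF n xs))" "cdf (interval_measure (cdfF n xs)) = cdfF n xs"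
proof -
  let ?F = "cdfF n xs"
  have seq: "\<exists>q. (\<forall>k. q k \<in> \<rat> \<and> x < q k) \<and> q \<longlonglongrightarrow> x" for x :: real
  proof -
    have "\<exists>q\<in>\<rat>. x < q \<and> q < x + inverse (real (Suc k))" for k
      using Rats_dense_in_real[of x "x + inverse (real (Suc k))"] by auto
    then obtain q where q: "\<And>k. q k \<in> \<rat>" "\<And>k. x < q k" "\<And>k. q k < x + inverse (real (Suc k))" by metis
    have "q \<longlonglongrightarrow> x"
    proof (rule tendsto_sandwich[where f = "\<lambda>_. x" and h = "\<lambda>k. x + inverse (real (Suc k))"])
      show "(\<lambda>k. x + inverse (real (Suc k))) \<longlonglongrightarrow> x"
        using tendsto_add[OF tendsto_const LIMSEQ_inverse_real_of_nat, of x] by simp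
      show "\<forall>\<^sub>F k in sequentially. x \<le> q k" "\<forall>\<^sub>F k in sequentially. q k \<le> x + inverse (real (Suc k))"
        using q(2,3) by (simp_all add: less_imp_le)
    qed simp
    with q show ?thesis by blast
  qed
  have mono: "?F x \<le> ?F y" if "x \<le> y" for x y
  proof (cases "x = y")
    case False
    with that have "x < y" by simp
    obtain p q where p: "\<And>k. p k \<in> \<rat>" "\<And>k. x < p k" "p \<longlonglongrightarrow> x" and q: "\<And>k. q k \<in> \<rat>" "\<And>k. y < q k" "q \<longlonglongrightarrow> y"
      using seq[of x] seq[of y] by blast
    have ev: "\<forall>\<^sub>F k in sequentially. p k < y" using order_tendstoD(2)[OF p(3) \<open>x < y\<close>] .
    have "\<forall>\<^sub>F k in sequentially. ?F (p k) \<le> ?F (q k)"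
      using ev
    proof eventually_elim
      case (elim k)
      then have "p k \<le> q k" using q(2)[of k] by linarith
      then show ?case using assms p(1) q(1) unfolding good_def by blast
    qed
    then show ?thesis
      using isCont_tendsto_compose[OF cdfF_cont p(3)] isCont_tendsto_compose[OF cdfF_cont q(3)]
      by (intro tendsto_le[OF sequentially_bot])
  qed simp
  have right: "continuous (at_right a) ?F" for a
    using cdfF_cont[where xs = xs and z = a] by (rule continuous_at_imp_continuous_within)
  have nn: "0 \<le> ?F x" "?F x \<le> 1" for x
  proof -
    obtain q where q: "\<And>k. q k \<in> \<rat>" "q \<longlonglongrightarrow> x" using seq[of x] by blast
    have "0 \<le> ?F (q k) \<and> ?F (q k) \<le> 1" for k using assms q(1) unfolding good_def by blast
    moreover have "(\<lambda>k. ?F (q k)) \<longlonglongrightarrow> ?F x" by (rule isCont_tendsto_compose[OF cdfF_cont q(2)])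
    ultimately show "0 \<le> ?F x" "?F x \<le> 1"
      using LIMSEQ_le_const[of "\<lambda>k. ?F (q k)" "?F x" 0] LIMSEQ_le_const2[of "\<lambda>k. ?F (q k)" "?F x" 1] by blast+
  qed
  have bot: "(?F \<longlongrightarrow> 0) at_bot"
  proof (rule tendstoI)
    fix e :: real assume "e > 0"
    then obtain k where k: "inverse (real (Suc k)) < e" using reals_Archimedean by blast
    obtain m :: nat where m: "?F (- real m) \<le> inverse (real (Suc k))" using assms unfolding good_def by blast
    show "\<forall>\<^sub>F x in at_bot. dist (?F x) 0 < e"
      using eventually_le_at_bot[of "- real m"]
    proof eventually_elim
      case (elim x)
      then have "?F x \<le> ?F (- real m)" by (rule mono)
      then show ?case using m k nn[of x] by simp
    qed
  qed
  have top: "(?F \<longlongrightarrow> 1) at_top"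
  proof (rule tendstoI)
    fix e :: real assume "e > 0"
    then obtain k where k: "inverse (real (Suc k)) < e" using reals_Archimedean by blast
    obtain m :: nat where m: "?F (real m) \<ge> 1 - inverse (real (Suc k))" using assms unfolding good_def by blast
    show "\<forall>\<^sub>F x in at_top. dist (?F x) 1 < e"
      using eventually_ge_at_top[of "real m"]
    proof eventually_elim
      case (elim x)
      then have "?F (real m) \<le> ?F x" by (rule mono)
      then show ?case using m k nn[of x] by (simp add: dist_real_def)
    qed
  qed
  show "real_distribution (interval_measure ?F)" by (rule real_distribution_interval_measure[OF mono right bot top])
  show "cdf (interval_measure ?F) = ?F" by (rule cdf_interval_measure[OF mono right bot])
qed

lemma kernel_exists_nonconst: "\<exists>\<kappa>. regular_cond_distr M XX (seqs n) PG borel \<kappa>"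
proof -
  \<comment> \<open>A kernel has to be a probability measure at every sample. The point mass at
    \<open>0\<close> is an arbitrary default on samples that are not \<open>good\<close>, which
    occur with probability zero.\<close>
  define \<kappa> where "\<kappa> xs = (if good xs then interval_measure (cdfF n xs) else return borel 0)" for xs
  have \<kappa>: "prob_space (\<kappa> xs)" "sets (\<kappa> xs) = sets borel" for xs
    using good_distribution(1)[of xs] by (auto simp: \<kappa>_def real_distribution_def prob_space_return)
  have em: "emeasure (\<kappa> xs) {..q} = ennreal (if good xs then cdfF n xs q else indicator {..q} 0)" for xs q
  proof (cases "good xs")
    case True
    interpret k: prob_space "interval_measure (cdfF n xs)"
      using good_distribution(1)[OF True] by (simp add: real_distribution_def)
    show ?thesis using True fun_cong[OF good_distribution(2)[OF True], of q]
      by (simp add: \<kappa>_def k.emeasure_eq_measure cdf_def)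
  qed (simp add: \<kappa>_def indicator_def)
  have "regular_cond_distr M XX (seqs n) PG borel \<kappa>"
  proof (rule regular_cond_distrI)
    show "\<kappa> \<in> seqs n \<rightarrow>\<^sub>M prob_algebra borel"
    proof (rule measurable_prob_algebra_generated[where \<Omega> = UNIV and G = "range atMost"])
      show "sets borel = sigma_sets UNIV (range (atMost :: real \<Rightarrow> real set))" by (simp add: borel_eq_atMost)
      show "Int_stable (range (atMost :: real \<Rightarrow> real set))" by (auto simp: Int_stable_def)
      fix A :: "real set" assume "A \<in> range atMost"
      then obtain q where "A = {..q}" by auto
      then show "(\<lambda>xs. emeasure (\<kappa> xs) A) \<in> borel_measurable (seqs n)" by (simp add: em)
    qed (auto simp: \<kappa>)
    fix q
    show "AE \<omega> in M. real_cond_exp M FX (indicator {\<omega> \<in> space M. PG \<omega> \<in> {..q}}) \<omega> = measure (\<kappa> (XX \<omega>)) {..q}"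
      using cond_cdf[OF nonconst, of q] good_AE
    proof eventually_elim
      case (elim \<omega>)
      then show ?case using fun_cong[OF good_distribution(2)[OF elim(2)], of q] by (simp add: \<kappa>_def cdf_def)
    qed
  qed
  then show ?thesis by blast
qed

end

text \<open>The inversion formula is of no use here, but the Laplace functional of
  \<open>\<bar>g - c\<bar>\<close> equals \<open>1\<close>, so
  \<open>S * P(\<bar>g - c\<bar>)\<close> vanishes almost surely. Hence \<open>P(g) = c\<close>
  almost surely, and the point mass at \<open>c\<close> is a version.\<close>

lemma kernel_exists_const:
  assumes c: "AE x in P0. g x = c"
  shows "\<exists>\<kappa>. regular_cond_distr M XX (seqs n) PG borel \<kappa>"
proof -
  interpret F: finite_measure_subalgebra M FX by (rule FX_subalgebra)
  let ?f = "\<lambda>x. \<bar>g x - c\<bar>"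
  have z: "AE x in P0. ?f x powr \<gamma> = 0" using c by eventually_elim simp
  have int: "integrable P0 (\<lambda>x. ?f x powr \<gamma>)" using integrable_D by simp
  have "(\<integral>x. (1 + ?f x) powr \<gamma> - 1 \<partial>P0) = (\<integral>x. 0 \<partial>P0)"
    using c by (intro integral_cong_AE) (auto simp: borel_P0)
  then have E1: "(\<integral>\<omega>. exp (- (S \<omega> * (\<integral>x. ?f x \<partial>P \<omega>))) \<partial>M) = 1"
    using real_laplace[of ?f, OF _ _ int] by simp
  have nn: "0 \<le> S \<omega> * (\<integral>x. ?f x \<partial>P \<omega>)" for \<omega>
    using S_nonneg by (intro mult_nonneg_nonneg Bochner_Integration.integral_nonneg) auto
  have ie: "integrable M (\<lambda>\<omega>. exp (- (S \<omega> * (\<integral>x. ?f x \<partial>P \<omega>))))"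
    by (rule M.integrable_const_bound[where B = 1]) (use nn in auto)
  have "(\<integral>\<omega>. 1 - exp (- (S \<omega> * (\<integral>x. ?f x \<partial>P \<omega>))) \<partial>M) = 0"
    using ie E1 M.prob_space by simp
  moreover have "integrable M (\<lambda>\<omega>. 1 - exp (- (S \<omega> * (\<integral>x. ?f x \<partial>P \<omega>))))" using ie by simp
  ultimately have "AE \<omega> in M. 1 - exp (- (S \<omega> * (\<integral>x. ?f x \<partial>P \<omega>))) = 0"
    using nn by (subst (asm) integral_nonneg_eq_0_iff_AE) auto
  then have PGc: "AE \<omega> in M. PG \<omega> = c"
    using S_pos P_prob X_integrable[OF gint_g]
  proof eventually_elim
    case (elim \<omega>)
    interpret p: prob_space "P \<omega>" by (rule elim(3))
    have g: "integrable (P \<omega>) g" using integrable_Re[OF elim(4)] by simp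
    have f0: "(\<integral>x. ?f x \<partial>P \<omega>) = 0" using elim(1,2) by simp
    have "(\<integral>x. g x - c \<partial>P \<omega>) = PG \<omega> - c" using g by (simp add: PG_def p.prob_space)
    moreover have "\<bar>\<integral>x. g x - c \<partial>P \<omega>\<bar> \<le> (\<integral>x. ?f x \<partial>P \<omega>)" by (rule integral_abs_bound)
    ultimately show ?case using f0 by simp
  qed
  have "regular_cond_distr M XX (seqs n) PG borel (\<lambda>_. return borel c)"
  proof (rule regular_cond_distrI)
    show "(\<lambda>_. return borel c) \<in> seqs n \<rightarrow>\<^sub>M prob_algebra borel"
      by (intro measurable_const) (simp add: space_prob_algebra prob_space_return)
    fix q
    let ?I = "indicator {\<omega> \<in> space M. PG \<omega> \<in> {..q}} :: 'w \<Rightarrow> real"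
    have "AE \<omega> in M. real_cond_exp M FX ?I \<omega> = indicator {..q} c"
    proof (rule F.real_cond_exp_charact)
      show "integrable M ?I" by (rule M.integrable_const_bound[where B = 1]) (auto simp: indicator_def)
      fix C assume "C \<in> sets FX"
      then have CM: "C \<in> sets M" using F.subalg by (auto simp: subalgebra_def)
      show "(LINT \<omega>:C|M. ?I \<omega>) = (LINT \<omega>:C|M. indicator {..q} c)"
        unfolding set_lebesgue_integral_def
      proof (rule integral_cong_AE)
        show "AE \<omega> in M. indicator C \<omega> *\<^sub>R ?I \<omega> = indicator C \<omega> *\<^sub>R indicator {..q} c"
          using PGc AE_space by eventually_elim (auto simp: indicator_def)
      qed (use CM in auto)
    qed auto
    then show "AE \<omega> in M. real_cond_exp M FX ?I \<omega> = measure (return borel c) {..q}"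
      by (simp add: measure_return)
  qed
  then show ?thesis by blast
qed

theorem kernel_exists: "\<exists>\<kappa>. regular_cond_distr M XX (seqs n) PG borel \<kappa>"
proof (cases "\<exists>c. AE x in P0. g x = c")
  case True
  then show ?thesis using kernel_exists_const by blast
next
  case False
  then have "D z > 0" for z using D_pos by blast
  then show ?thesis by (rule kernel_exists_nonconst)
qed

end

section \<open>The closed form of the normalizing constant\<close>

lemma sum_frequency: "(\<Sum>y\<in>distinct_values n xs. frequency n xs y) = n"
proof -
  have "(\<Sum>i<n. 1::nat) = (\<Sum>y\<in>xs ` {..<n}. \<Sum>i\<in>{i\<in>{..<n}. xs i = y}. 1)"
    by (rule sum.image_gen) simp
  then show ?thesis by (simp add: distinct_values_def frequency_def lessThan_def)
qed

lemma prod_powr_frequency: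
  fixes y :: real
  assumes "y > 0"
  shows "(\<Prod>v\<in>distinct_values n xs. y powr (\<gamma> - real (frequency n xs v))) = y powr (real (n_distinct n xs) * \<gamma> - real n)"
proof -
  have "(\<Prod>v\<in>distinct_values n xs. y powr (\<gamma> - real (frequency n xs v)))
     = y powr (\<Sum>v\<in>distinct_values n xs. \<gamma> - real (frequency n xs v))"
    using assms by (subst powr_sum) (auto simp: distinct_values_def)
  also have "(\<Sum>v\<in>distinct_values n xs. \<gamma> - real (frequency n xs v)) = real (n_distinct n xs) * \<gamma> - real n"
    by (simp add: sum_subtractf n_distinct_def sum_frequency flip: of_nat_sum)
  finally show ?thesis .
qed

context gg_fun
begin

text \<open>One half of the exponent absorbs the power of \<open>1 + u\<close>, whatever
  \<open>s\<close> is, and the other half remains as an integrable majorant.\<close>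

lemma integrable_powr_exp:
  "set_integrable lborel {0<..} (\<lambda>u. (1 + u) powr s * exp (- (\<beta> * (1 + u) powr \<gamma>)))"
proof -
  define N where "N = nat \<lceil>s\<rceil>"
  obtain B where B: "B > 0" "\<And>x. x \<ge> 0 \<Longrightarrow> exp (- (\<beta> / 2 * x powr \<gamma>)) * (1 + x) ^ N \<le> B"
    using exp_powr_rapid[of "\<beta> / 2" N] beta by auto
  have "set_integrable lborel {0<..} (\<lambda>u. B * (u ^ 0 * exp (- (\<beta> / 2 * u powr \<gamma>))))"
    using beta by (intro set_integrable_mult_right impI integrable_exp_powr) simp
  then show ?thesis
  proof (rule set_integrable_bound_le)
    fix u :: real assume "u \<in> {0<..}"
    then have u: "u > 0" by simp
    have "(1 + u) powr s \<le> (1 + u) powr real N"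
      using u unfolding N_def by (intro powr_mono) linarith+
    also have "\<dots> = (1 + u) ^ N" using u by (simp add: powr_realpow)
    also have "\<dots> \<le> (1 + (1 + u)) ^ N" using u by (intro power_mono) auto
    finally have "exp (- (\<beta> / 2 * (1 + u) powr \<gamma>)) * (1 + u) powr s \<le> B"
      using B(2)[of "1 + u"] u by (meson dual_order.trans exp_ge_zero mult_left_mono add_nonneg_nonneg less_imp_le zero_le_one)
    moreover have "exp (- (\<beta> / 2 * (1 + u) powr \<gamma>)) \<le> exp (- (\<beta> / 2 * u powr \<gamma>))"
      using u gam beta by (auto intro!: mult_left_mono powr_mono2)
    ultimately have "(exp (- (\<beta> / 2 * (1 + u) powr \<gamma>)) * (1 + u) powr s) * exp (- (\<beta> / 2 * (1 + u) powr \<gamma>))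
        \<le> B * exp (- (\<beta> / 2 * u powr \<gamma>))"
      using B(1) by (intro mult_mono) auto
    also have "(exp (- (\<beta> / 2 * (1 + u) powr \<gamma>)) * (1 + u) powr s) * exp (- (\<beta> / 2 * (1 + u) powr \<gamma>))
       = (1 + u) powr s * exp (- (\<beta> / 2 * (1 + u) powr \<gamma>) + - (\<beta> / 2 * (1 + u) powr \<gamma>))"
      unfolding exp_add by (simp only: mult_ac)
    finally show "norm ((1 + u) powr s * exp (- (\<beta> * (1 + u) powr \<gamma>))) \<le> B * (u ^ 0 * exp (- (\<beta> / 2 * u powr \<gamma>)))"
      by simp
  qed measurable
qed

text \<open>The substitution \<open>w = \<beta> * (1 + u) powr \<gamma>\<close> maps
  \<open>u > 0\<close> onto \<open>w > \<beta>\<close>, which explains why incomplete gamma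
  functions at \<open>\<beta>\<close> enter the normalizing constant.\<close>

lemma upper_Gamma_subst:
  "upper_Gamma c \<beta> = \<gamma> * \<beta> powr c * (LBINT u:{0<..}. (1 + u) powr (\<gamma> * c - 1) * exp (- (\<beta> * (1 + u) powr \<gamma>)))"
proof -
  define f where "f w = w powr (c - 1) * exp (- w)" for w :: real
  define h where "h u = \<beta> * (1 + u) powr \<gamma>" for u
  define h' where "h' u = \<beta> * (\<gamma> * (1 + u) powr (\<gamma> - 1))" for u
  have fh: "f (h u) * h' u = (\<gamma> * \<beta> powr c) * ((1 + u) powr (\<gamma> * c - 1) * exp (- (\<beta> * (1 + u) powr \<gamma>)))" if "u > 0" for u
  proof -
    have "(\<beta> * (1 + u) powr \<gamma>) powr (c - 1) = \<beta> powr (c - 1) * (1 + u) powr (\<gamma> * (c - 1))"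
      using that beta by (simp add: powr_mult powr_powr)
    moreover have "\<beta> powr (c - 1) * \<beta> = \<beta> powr c" using beta by (simp add: powr_diff)
    moreover have "(1 + u) powr (\<gamma> * (c - 1)) * (1 + u) powr (\<gamma> - 1) = (1 + u) powr (\<gamma> * c - 1)"
      by (simp add: powr_add[symmetric] algebra_simps)
    ultimately show ?thesis unfolding f_def h_def h'_def by (simp add: mult_ac)
  qed
  have e0: "einterval 0 \<infinity> = {0<..}" and eb: "einterval (ereal \<beta>) \<infinity> = {\<beta><..}" by (auto simp: einterval_def)
  have int: "set_integrable lborel {0<..} (\<lambda>u. f (h u) * h' u)"
    by (subst set_integrable_cong[OF refl refl fh]) (auto intro: integrable_powr_exp)
  have "(LBINT w=ereal \<beta>..\<infinity>. f w) = (LBINT u=0..\<infinity>. f (h u) * h' u)"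
  proof (rule interval_integral_substitution_nonneg(2))
    fix u assume "0 < ereal u"
    then have u: "u > 0" by simp
    show "DERIV h u :> h' u" unfolding h_def h'_def using u by (auto intro!: derivative_eq_intros)
    have "h u > 0" using u beta by (simp add: h_def)
    then show "isCont f (h u)" unfolding f_def by (auto intro!: continuous_intros)
    show "isCont h' u" unfolding h'_def using u by (auto intro!: continuous_intros)
  next
    show "0 \<le> f w" for w by (simp add: f_def)
    show "0 \<le> h' u" for u using beta gam by (simp add: h'_def)
    have "(h \<longlongrightarrow> \<beta>) (at_right 0)"
    proof -
      have "isCont h 0" unfolding h_def by (auto intro!: continuous_intros)
      then have "(h \<longlongrightarrow> h 0) (at_right 0)" by (simp add: isCont_def filterlim_at_split)
      then show ?thesis by (simp add: h_def)
    qed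
    then show "((ereal \<circ> h \<circ> real_of_ereal) \<longlongrightarrow> ereal \<beta>) (at_right 0)"
      by (simp add: zero_ereal_def ereal_tendsto_simps)
    have "filterlim h at_top at_top"
      unfolding h_def using beta gam by real_asymp
    then show "((ereal \<circ> h \<circ> real_of_ereal) \<longlongrightarrow> \<infinity>) (at_left \<infinity>)"
      by (simp add: ereal_tendsto_simps)
    show "set_integrable lborel (einterval 0 \<infinity>) (\<lambda>u. f (h u) * h' u)" using int by (simp add: e0)
  qed auto
  then have "upper_Gamma c \<beta> = (LBINT u:{0<..}. f (h u) * h' u)"
    by (simp add: upper_Gamma_def f_def interval_lebesgue_integral_def e0 eb)
  also have "\<dots> = (LBINT u:{0<..}. (\<gamma> * \<beta> powr c) * ((1 + u) powr (\<gamma> * c - 1) * exp (- (\<beta> * (1 + u) powr \<gamma>))))"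
    by (rule set_lebesgue_integral_cong) (auto simp: fh)
  finally show ?thesis by simp
qed

text \<open>At \<open>t = 0\<close> the product over the distinct values collapses to a single power
  of \<open>1 + u\<close>, as the multiplicities sum to \<open>n\<close>. Expanding
  \<open>u ^ (n - 1)\<close> in powers of \<open>1 + u\<close> then leaves integrals of the form in
  \<open>upper_Gamma_subst\<close>; this is the origin of the alternating binomial sum.\<close>

lemma G0_eq_norm_sum:
  assumes n: "n \<ge> 1"
  shows "G0 n xs = gg_norm_sum \<gamma> \<beta> n (n_distinct n xs) / (\<gamma> * \<beta> ^ n_distinct n xs)"
proof -
  define k where "k = n_distinct n xs"
  define f where "f j u = (1 + u) powr (real k * \<gamma> - real j - 1) * exp (- (\<beta> * (1 + u) powr \<gamma>))" for j and u :: real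
  define a where "a j = real ((n - 1) choose j) * (- 1) ^ j" for j
  have trm: "(LBINT u:{0<..}. f j u) = \<beta> powr (real j / \<gamma>) * upper_Gamma (real k - real j / \<gamma>) \<beta> / (\<gamma> * \<beta> ^ k)" for j
  proof -
    have "\<gamma> * (real k - real j / \<gamma>) - 1 = real k * \<gamma> - real j - 1" using gam by (simp add: field_simps)
    then have "upper_Gamma (real k - real j / \<gamma>) \<beta> = \<gamma> * \<beta> powr (real k - real j / \<gamma>) * (LBINT u:{0<..}. f j u)"
      unfolding f_def upper_Gamma_subst by simp
    also have "\<beta> powr (real k - real j / \<gamma>) = \<beta> ^ k / \<beta> powr (real j / \<gamma>)"
      using beta by (simp add: powr_diff powr_realpow)
    finally show ?thesis using beta gam by (simp add: field_simps)
  qed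
  have fint: "set_integrable lborel {0<..} (f j)" for j unfolding f_def by (rule integrable_powr_exp)
  have "G0 n xs = (LBINT u:{0<..}. \<Sum>j\<le>n - 1. a j * f j u)"
    unfolding G0_eq
  proof (rule set_lebesgue_integral_cong)
    show "\<forall>u. u \<in> {0<..} \<longrightarrow> u ^ (n - 1) * (exp (- \<beta> * (1 + u) powr \<gamma>) *
        (\<Prod>y\<in>distinct_values n xs. (1 + u) powr (\<gamma> - real (frequency n xs y)))) = (\<Sum>j\<le>n - 1. a j * f j u)"
    proof (intro allI impI)
      fix u :: real assume "u \<in> {0<..}"
      then have u: "1 + u > 0" by simp
      have "u ^ (n - 1) = (- 1 + (1 + u)) ^ (n - 1)" by simp
      also have "\<dots> = (\<Sum>j\<le>n - 1. a j * (1 + u) ^ (n - 1 - j))"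
        unfolding binomial_ring a_def by simp
      finally have "u ^ (n - 1) * (1 + u) powr (real k * \<gamma> - real n) =
          (\<Sum>j\<le>n - 1. a j * ((1 + u) ^ (n - 1 - j) * (1 + u) powr (real k * \<gamma> - real n)))"
        by (simp add: sum_distrib_right mult.assoc)
      also have "\<dots> = (\<Sum>j\<le>n - 1. a j * (1 + u) powr (real k * \<gamma> - real j - 1))"
      proof (rule sum.cong[OF refl])
        fix j assume "j \<in> {..n - 1}"
        then have "real (n - 1 - j) = real n - 1 - real j" using n by (simp add: of_nat_diff)
        then have "(1 + u) ^ (n - 1 - j) = (1 + u) powr (real n - 1 - real j)" using u powr_realpow[OF u, of "n - 1 - j"] by simp
        then show "a j * ((1 + u) ^ (n - 1 - j) * (1 + u) powr (real k * \<gamma> - real n)) = a j * (1 + u) powr (real k * \<gamma> - real j - 1)"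
          by (simp add: powr_add[symmetric] algebra_simps)
      qed
      finally have "u ^ (n - 1) * (1 + u) powr (real k * \<gamma> - real n) * exp (- (\<beta> * (1 + u) powr \<gamma>)) = (\<Sum>j\<le>n - 1. a j * f j u)"
        by (simp add: sum_distrib_right f_def mult.assoc)
      then show "u ^ (n - 1) * (exp (- \<beta> * (1 + u) powr \<gamma>) *
        (\<Prod>y\<in>distinct_values n xs. (1 + u) powr (\<gamma> - real (frequency n xs y)))) = (\<Sum>j\<le>n - 1. a j * f j u)"
        unfolding prod_powr_frequency[OF u] k_def by (simp add: mult_ac)
    qed
  qed simp
  also have "\<dots> = (\<Sum>j\<le>n - 1. a j * (LBINT u:{0<..}. f j u))"
    using fint unfolding set_lebesgue_integral_def set_integrable_def real_scaleR_def sum_distrib_left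
    by (subst Bochner_Integration.integral_sum) (auto simp: mult.left_commute)
  also have "\<dots> = gg_norm_sum \<gamma> \<beta> n k / (\<gamma> * \<beta> ^ k)"
    unfolding trm gg_norm_sum_def a_def sum_divide_distrib atLeast0AtMost by (simp add: mult.assoc)
  finally show ?thesis by (simp add: k_def)
qed

lemma gg_chi_eq:
  assumes n: "n \<ge> 1"
  shows "gg_chi \<gamma> \<beta> P0 g n xs t z = of_real (1 / (pi * G0 n xs)) * K n xs 0 t z"
proof -
  define q where "q = \<gamma> * \<beta> ^ n_distinct n xs"
  have "q \<noteq> 0" using gam beta by (simp add: q_def)
  moreover have "G0 n xs = gg_norm_sum \<gamma> \<beta> n (n_distinct n xs) / q"
    unfolding q_def by (rule G0_eq_norm_sum[OF n])
  then have "gg_norm_sum \<gamma> \<beta> n (n_distinct n xs) = q * G0 n xs" using \<open>q \<noteq> 0\<close> by simp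
  ultimately show ?thesis
    unfolding gg_chi_def gg_kernel_eq q_def[symmetric] by (simp add: divide_inverse)
qed

lemma gg_post_cdf_eq:
  assumes n: "n \<ge> 1"
  shows "gg_post_cdf \<gamma> \<beta> P0 g n xs z = cdfF n xs z"
proof -
  have "(LBINT u:{0<..}. inverse t * u ^ (n - 1) * Im (gg_kernel \<gamma> \<beta> P0 g n xs u t z)) = inverse t * Im (Gf n xs n t z)" for t
    unfolding gg_kernel_eq Im_Gf mult.assoc by (rule set_integral_mult_right)
  then have "(LBINT t:{0<..}. LBINT u:{0<..}. inverse t * u ^ (n - 1) * Im (gg_kernel \<gamma> \<beta> P0 g n xs u t z)) = H n xs z"
    by (simp add: H_def)
  moreover have "pi * inverse (\<gamma> * \<beta> ^ n_distinct n xs) * gg_norm_sum \<gamma> \<beta> n (n_distinct n xs) = pi * G0 n xs"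
    by (simp add: G0_eq_norm_sum[OF n] divide_inverse)
  ultimately show ?thesis unfolding gg_post_cdf_def cdfF_def by simp
qed

definition rho :: "nat \<Rightarrow> (nat \<Rightarrow> 'x) \<Rightarrow> real \<Rightarrow> real" where
  "rho n xs z = (LBINT t:{0<..}. Re (Gd n xs t z)) / (pi * G0 n xs)"

lemma rho_measurable: "rho n xs \<in> borel_measurable borel"
proof -
  have [measurable]: "(\<lambda>p. indicator {0<..} (snd p) *\<^sub>R Re (Gd n xs (snd p) (fst p)) :: real) \<in> borel_measurable (borel \<Otimes>\<^sub>M lborel)"
    by measurable
  show ?thesis unfolding rho_def set_lebesgue_integral_def by measurable
qed

lemma cdfF_deriv:
  assumes "n \<ge> 1" "D z > 0"
  shows "(cdfF n xs has_real_derivative rho n xs z) (at z)"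
  unfolding cdfF_def[abs_def] rho_def using H_deriv[OF assms, of xs]
  using G0_pos[of n xs] by (auto intro!: derivative_eq_intros simp: less_imp_neq[symmetric])

context
  fixes c :: real
  assumes c: "c > 0" "\<And>z. D z \<ge> c * (1 + \<bar>z\<bar>) powr \<gamma>"
begin

lemma gg_chi_inner:
  assumes n: "n \<ge> 1"
  shows "even n \<Longrightarrow> (- 1) ^ (n div 2 + 1) * (LBINT t:{0<..}. t ^ (n - 1) * Im (gg_chi \<gamma> \<beta> P0 g n xs t z)) = wt n xs z / (pi * G0 n xs)"
    and "odd n \<Longrightarrow> (- 1) ^ (n div 2) * (LBINT t:{0<..}. t ^ (n - 1) * Re (gg_chi \<gamma> \<beta> P0 g n xs t z)) = wt n xs z / (pi * G0 n xs)"
proof -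
  have Im_mult: "Im (of_real r * x) = r * Im x" for r x by simp
  show "even n \<Longrightarrow> (- 1) ^ (n div 2 + 1) * (LBINT t:{0<..}. t ^ (n - 1) * Im (gg_chi \<gamma> \<beta> P0 g n xs t z)) = wt n xs z / (pi * G0 n xs)"
    "odd n \<Longrightarrow> (- 1) ^ (n div 2) * (LBINT t:{0<..}. t ^ (n - 1) * Re (gg_chi \<gamma> \<beta> P0 g n xs t z)) = wt n xs z / (pi * G0 n xs)"
    unfolding gg_chi_eq[OF n] wt_def Re_neg_i_power[OF n] Re_mult_real_of Im_mult set_integral_divide_zero[symmetric]
      set_integral_mult_right[symmetric]
    by (simp_all only: if_True if_False) (simp_all add: mult_ac divide_inverse)
qed

lemma gg_double_integral_eq:
  assumes n: "n \<ge> 1"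
  shows "gg_double_integral \<gamma> \<beta> P0 g n xs z = (LBINT y:{..z}. (z - y) ^ (n - 1) * wt n xs y) / (pi * G0 n xs)"
proof -
  have *: "s * (LBINT y:{..z}. LBINT t:{0<..}. ((z - y) * t) ^ (n - 1) * f t y) = (LBINT y:{..z}. (z - y) ^ (n - 1) * wt n xs y) / (pi * G0 n xs)"
    if f: "\<And>y. s * (LBINT t:{0<..}. t ^ (n - 1) * f t y) = wt n xs y / (pi * G0 n xs)" for s :: real and f :: "real \<Rightarrow> real \<Rightarrow> real"
  proof -
    have eq: "s * (LBINT t:{0<..}. ((z - y) * t) ^ (n - 1) * f t y) = (z - y) ^ (n - 1) * wt n xs y / (pi * G0 n xs)" for y
    proof -
      have "s * (LBINT t:{0<..}. ((z - y) * t) ^ (n - 1) * f t y) = (z - y) ^ (n - 1) * (s * (LBINT t:{0<..}. t ^ (n - 1) * f t y))"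
        unfolding power_mult_distrib mult.assoc set_integral_mult_right by (simp add: mult.left_commute)
      then show ?thesis unfolding f by simp
    qed
    have "s * (LBINT y:{..z}. LBINT t:{0<..}. ((z - y) * t) ^ (n - 1) * f t y)
       = (LBINT y:{..z}. s * (LBINT t:{0<..}. ((z - y) * t) ^ (n - 1) * f t y))"
      by (rule set_integral_mult_right[symmetric])
    then show ?thesis unfolding eq set_integral_divide_zero .
  qed
  show ?thesis
  proof (cases "even n")
    case True
    then show ?thesis
      unfolding gg_double_integral_def Let_def by (simp only: if_True) (rule *[OF gg_chi_inner(1)[OF n True]])
  next
    case False
    then show ?thesis
      unfolding gg_double_integral_def Let_def by (simp only: if_False) (rule *[OF gg_chi_inner(2)[OF n False]])
  qed
qed

lemma rho_double:
  assumes n: "n \<ge> 2"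
  shows "rho n xs z = (LBINT y:{..z}. real (n - 1) * (z - y) ^ (n - 2) * wt n xs y) / (pi * G0 n xs)"
  unfolding rho_def Re_Gd_double[OF c n] mult.assoc set_integral_mult_right ..

lemma gg_post_density_eq:
  assumes n: "n \<ge> 1"
  shows "gg_post_density \<gamma> \<beta> P0 g n xs z = rho n xs z"
proof (cases "n = 1")
  case True
  then show ?thesis
    unfolding gg_post_density_def Let_def rho_def Gd_def gg_chi_eq[OF n] Re_mult_real_of by simp
next
  case False
  with n have n2: "n \<ge> 2" by simp
  have *: "s * (LBINT y:{..z}. LBINT t:{0<..}. real (n - 1) * (z - y) ^ (n - 2) * t ^ (n - 1) * f t y) = rho n xs z"
    if f: "\<And>y. s * (LBINT t:{0<..}. t ^ (n - 1) * f t y) = wt n xs y / (pi * G0 n xs)" for s :: real and f :: "real \<Rightarrow> real \<Rightarrow> real"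
  proof -
    have eq: "s * (LBINT t:{0<..}. real (n - 1) * (z - y) ^ (n - 2) * t ^ (n - 1) * f t y)
        = real (n - 1) * (z - y) ^ (n - 2) * wt n xs y / (pi * G0 n xs)" for y
    proof -
      have "s * (LBINT t:{0<..}. real (n - 1) * (z - y) ^ (n - 2) * t ^ (n - 1) * f t y)
          = real (n - 1) * (z - y) ^ (n - 2) * (s * (LBINT t:{0<..}. t ^ (n - 1) * f t y))"
        unfolding mult.assoc set_integral_mult_right by (simp add: mult.left_commute)
      then show ?thesis unfolding f by simp
    qed
    have "s * (LBINT y:{..z}. LBINT t:{0<..}. real (n - 1) * (z - y) ^ (n - 2) * t ^ (n - 1) * f t y)
       = (LBINT y:{..z}. s * (LBINT t:{0<..}. real (n - 1) * (z - y) ^ (n - 2) * t ^ (n - 1) * f t y))"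
      by (rule set_integral_mult_right[symmetric])
    then show ?thesis unfolding eq rho_double[OF n2] set_integral_divide_zero .
  qed
  show ?thesis
  proof (cases "even n")
    case True
    with False show ?thesis
      unfolding gg_post_density_def Let_def by (simp only: if_True if_False) (rule *[OF gg_chi_inner(1)[OF n True]])
  next
    case odd: False
    with False show ?thesis
      unfolding gg_post_density_def Let_def by (simp only: if_False) (rule *[OF gg_chi_inner(2)[OF n odd]])
  qed
qed

lemma gg_double_integral_rho:
  assumes n: "n \<ge> 2"
  shows "gg_double_integral \<gamma> \<beta> P0 g n xs z = (LBINT y:{..z}. rho n xs y)"
proof -
  have n1: "n \<ge> 1" using n by simp
  show ?thesis
    unfolding gg_double_integral_eq[OF n1] wt_cumulative[OF c n] rho_double[OF n] set_integral_divide_zero mult.assoc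
      set_integral_mult_right ..
qed

end

end

text \<open>Monotonicity makes the derivative nonnegative, so the fundamental theorem for
  nonnegative integrands applies without a prior integrability check. It is used on the tails, where
  the limit of the distribution function at infinity supplies the boundary value.\<close>

lemma density_eq_of_cdf_deriv:
  assumes "real_distribution \<kappa>" and f: "f \<in> borel_measurable borel"
    and deriv: "\<And>x. (cdf \<kappa> has_real_derivative f x) (at x)"
  shows "(\<forall>x. 0 \<le> f x) \<and> \<kappa> = density lborel (\<lambda>x. ennreal (f x)) \<and> (\<forall>x. cdf \<kappa> x = (LBINT y:{..x}. f y))"
proof -
  interpret \<kappa>: real_distribution \<kappa> by fact
  have mono: "mono (cdf \<kappa>)" by (auto intro!: monoI \<kappa>.cdf_nondecreasing)
  have nn: "0 \<le> f x" for x
    using mono_on_imp_deriv_nonneg[of UNIV "cdf \<kappa>" "f x" x] mono deriv by (auto simp: mono_on_def mono_def)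
  have eq: "\<kappa> = density lborel (\<lambda>x. ennreal (f x))"
  proof (rule measure_eqI_lessThan)
    fix x :: real
    show "emeasure \<kappa> {x<..} < \<infinity>" by (simp add: \<kappa>.emeasure_eq_measure)
    have "emeasure (density lborel (\<lambda>x. ennreal (f x))) {x<..} = (\<integral>\<^sup>+y. ennreal (f y) * indicator {x<..} y \<partial>lborel)"
      using f by (subst emeasure_density) auto
    also have "\<dots> = (\<integral>\<^sup>+y. ennreal (f y) * indicator {x..} y \<partial>lborel)"
      by (rule nn_integral_cong_AE) (use AE_lborel_singleton[of x] in \<open>eventually_elim, auto simp: indicator_def\<close>)
    also have "\<dots> = ennreal (1 - cdf \<kappa> x)"
      by (rule nn_integral_FTC_atLeast[OF f]) (use deriv nn \<kappa>.cdf_lim_at_top_prob in auto)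
    also have "1 - cdf \<kappa> x = measure \<kappa> {x<..}"
      using \<kappa>.prob_compl[of "{..x}"] by (simp add: cdf_def Compl_eq_Diff_UNIV[symmetric])
    finally show "emeasure \<kappa> {x<..} = emeasure (density lborel (\<lambda>x. ennreal (f x))) {x<..}"
      by (simp add: \<kappa>.emeasure_eq_measure)
  qed auto
  have "cdf \<kappa> x = (LBINT y:{..x}. f y)" for x
  proof -
    have "cdf \<kappa> x = enn2real (\<integral>\<^sup>+y. ennreal (f y) * indicator {..x} y \<partial>lborel)"
      unfolding cdf_def measure_def by (subst eq, subst emeasure_density) (use f in auto)
    also have "\<dots> = enn2real (\<integral>\<^sup>+y. ennreal (indicator {..x} y *\<^sub>R f y) \<partial>lborel)"
      by (intro arg_cong[where f = enn2real] nn_integral_cong) (auto simp: indicator_def)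
    also have "\<dots> = (LBINT y:{..x}. f y)"
      unfolding set_lebesgue_integral_def by (rule integral_eq_nn_integral[symmetric]) (use f nn in auto)
    finally show ?thesis .
  qed
  with nn eq show ?thesis by blast
qed

context gg_sample
begin

theorem posterior:
  assumes \<kappa>: "regular_cond_distr M XX (seqs n) PG borel \<kappa>"
  shows "AE \<omega> in M.
     ((\<forall>c. \<not> (AE x in P0. g x = c)) \<longrightarrow>
        gg_post_density \<gamma> \<beta> P0 g n (XX \<omega>) \<in> borel_measurable borel \<and>
        (\<forall>z. 0 \<le> gg_post_density \<gamma> \<beta> P0 g n (XX \<omega>) z) \<and>
        \<kappa> (XX \<omega>) = density lborel (\<lambda>z. ennreal (gg_post_density \<gamma> \<beta> P0 g n (XX \<omega>) z)) \<and>
        (2 \<le> n \<longrightarrow> (\<forall>z. gg_double_integral \<gamma> \<beta> P0 g n (XX \<omega>) z = cdf (\<kappa> (XX \<omega>)) z))) \<and>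
     (\<forall>z. \<not> (AE x in P0. g x = z) \<longrightarrow> cdf (\<kappa> (XX \<omega>)) z = gg_post_cdf \<gamma> \<beta> P0 g n (XX \<omega>) z)"
  using kernel_unique[OF \<kappa>] AE_space
proof eventually_elim
  case (elim \<omega>)
  have "\<kappa> \<in> seqs n \<rightarrow>\<^sub>M prob_algebra borel" using \<kappa> by (simp add: regular_cond_distr_def)
  from measurable_space[OF this measurable_space[OF XX_meas elim(2)]]
  have dist: "real_distribution (\<kappa> (XX \<omega>))"
    by (simp add: space_prob_algebra real_distribution_def real_distribution_axioms_def)
  have cdf: "cdf (\<kappa> (XX \<omega>)) z = cdfF n (XX \<omega>) z" if "\<not> (AE x in P0. g x = z)" for z
    using elim(1) that by (simp add: D_pos_iff)
  have "gg_post_density \<gamma> \<beta> P0 g n (XX \<omega>) \<in> borel_measurable borel \<and>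
        (\<forall>z. 0 \<le> gg_post_density \<gamma> \<beta> P0 g n (XX \<omega>) z) \<and>
        \<kappa> (XX \<omega>) = density lborel (\<lambda>z. ennreal (gg_post_density \<gamma> \<beta> P0 g n (XX \<omega>) z)) \<and>
        (2 \<le> n \<longrightarrow> (\<forall>z. gg_double_integral \<gamma> \<beta> P0 g n (XX \<omega>) z = cdf (\<kappa> (XX \<omega>)) z))"
    if nonconst: "\<forall>c. \<not> (AE x in P0. g x = c)"
  proof -
    obtain c where c: "c > 0" "\<And>z. D z \<ge> c * (1 + \<bar>z\<bar>) powr \<gamma>" using D_lower nonconst by blast
    have rho: "gg_post_density \<gamma> \<beta> P0 g n (XX \<omega>) = rho n (XX \<omega>)"
      using gg_post_density_eq[OF c n] by (simp add: fun_eq_iff)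
    have F: "cdf (\<kappa> (XX \<omega>)) = cdfF n (XX \<omega>)" using cdf nonconst by (simp add: fun_eq_iff)
    have "(cdf (\<kappa> (XX \<omega>)) has_real_derivative rho n (XX \<omega>) z) (at z)" for z
      unfolding F by (rule cdfF_deriv[OF n]) (use nonconst D_pos_iff in blast)
    note density_eq_of_cdf_deriv[OF dist rho_measurable this]
    moreover have "gg_double_integral \<gamma> \<beta> P0 g n (XX \<omega>) z = (LBINT y:{..z}. rho n (XX \<omega>) y)" if n2: "2 \<le> n" for z
      using gg_double_integral_rho[OF c n2] .
    ultimately show ?thesis
      unfolding rho using rho_measurable[of n "XX \<omega>"] by (metis (no_types, lifting))
  qed
  then show ?case unfolding gg_post_cdf_eq[OF n] using cdf by blast
qed

end

section \<open>The generalized gamma measure\<close>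

lemma nn_integral_powr_exp:
  assumes "\<gamma> < 1" "s > 0"
  shows "(\<integral>\<^sup>+v. ennreal (indicator {0<..} v * (v powr (- \<gamma>) * exp (- (s * v)))) \<partial>lborel) = ennreal (Gamma (1 - \<gamma>) * s powr (\<gamma> - 1))"
proof -
  have e: "ennreal (indicator {0..} (0 + s * v) * (0 + s * v) powr (1 - \<gamma> - 1) / exp (0 + s * v))
     = ennreal (s powr (- \<gamma>)) * ennreal (indicator {0<..} v * (v powr (- \<gamma>) * exp (- (s * v))))" for v
    using assms(2) by (cases "v > 0"; cases "v = 0")
      (auto simp: indicator_def zero_le_mult_iff powr_mult exp_minus divide_inverse ennreal_mult'[symmetric] mult_ac)
  have "ennreal (Gamma (1 - \<gamma>)) = (\<integral>\<^sup>+t. ennreal (indicator {0..} t * t powr (1 - \<gamma> - 1) / exp t) \<partial>lborel)"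
    using assms by (intro Gamma_conv_nn_integral_real) simp
  also have "\<dots> = ennreal \<bar>s\<bar> * (\<integral>\<^sup>+v. ennreal (indicator {0..} (0 + s * v) * (0 + s * v) powr (1 - \<gamma> - 1) / exp (0 + s * v)) \<partial>lborel)"
    using assms by (intro nn_integral_real_affine) auto
  also have "\<dots> = ennreal (s powr (1 - \<gamma>)) * (\<integral>\<^sup>+v. ennreal (indicator {0<..} v * (v powr (- \<gamma>) * exp (- (s * v)))) \<partial>lborel)"
    unfolding e using assms
    by (subst nn_integral_cmult) (auto simp: mult.assoc[symmetric] ennreal_mult'[symmetric] powr_diff powr_minus divide_inverse)
  finally have "ennreal (s powr (\<gamma> - 1)) * ennreal (Gamma (1 - \<gamma>)) = ennreal (s powr (\<gamma> - 1)) * ennreal (s powr (1 - \<gamma>)) *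
      (\<integral>\<^sup>+v. ennreal (indicator {0<..} v * (v powr (- \<gamma>) * exp (- (s * v)))) \<partial>lborel)"
    by (simp add: mult.assoc)
  moreover have "ennreal (s powr (\<gamma> - 1)) * ennreal (s powr (1 - \<gamma>)) = 1"
    using assms by (simp add: ennreal_mult'[symmetric] powr_add[symmetric])
  ultimately show ?thesis by (simp add: ennreal_mult'' mult.commute)
qed

lemma one_minus_exp_nn_integral:
  fixes v l :: real
  assumes "v \<ge> 0" "l \<ge> 0"
  shows "(\<integral>\<^sup>+s. ennreal (v * exp (- (v * s))) * indicator {0..l} s \<partial>lborel) = ennreal (1 - exp (- (v * l)))"
proof -
  have "(\<integral>\<^sup>+s. ennreal (v * exp (- (v * s))) * indicator {0..l} s \<partial>lborel) = ennreal (- exp (- (v * l)) - - exp (- (v * 0)))"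
    by (rule nn_integral_FTC_Icc) (use assms in \<open>auto intro!: derivative_eq_intros\<close>)
  then show ?thesis by simp
qed

lemma powr_diff_nn_integral:
  fixes l :: real
  assumes "0 < \<gamma>" "0 < \<tau>" "l \<ge> 0"
  shows "(\<integral>\<^sup>+s. ennreal (\<gamma> * (\<tau> + s) powr (\<gamma> - 1)) * indicator {0..l} s \<partial>lborel) = ennreal ((\<tau> + l) powr \<gamma> - \<tau> powr \<gamma>)"
proof -
  have "(\<integral>\<^sup>+s. ennreal (\<gamma> * (\<tau> + s) powr (\<gamma> - 1)) * indicator {0..l} s \<partial>lborel) = ennreal ((\<tau> + l) powr \<gamma> - (\<tau> + 0) powr \<gamma>)"
    by (rule nn_integral_FTC_Icc) (use assms in \<open>auto intro!: derivative_eq_intros\<close>)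
  then show ?thesis by simp
qed

text \<open>Writing \<open>1 - exp (- v * l)\<close> as the integral of
  \<open>v * exp (- v * s)\<close> over \<open>s\<close> in \<open>[0, l]\<close> removes the
  singularity of the intensity at \<open>v = 0\<close>. By Tonelli's theorem the integral over
  \<open>v\<close> becomes a gamma integral, and the one over \<open>s\<close> is
  elementary.\<close>

lemma gg_levy_exponent:
  assumes g: "0 < \<gamma>" "\<gamma> < 1" "0 < \<tau>" and l: "l \<ge> 0"
  shows "(\<integral>\<^sup>+v. (if 0 < v then ennreal (\<gamma> / Gamma (1 - \<gamma>) * (exp (- \<tau> * v) / v powr (1 + \<gamma>))) else 0) * ennreal (1 - exp (- (v * l))) \<partial>lborel)
    = ennreal ((\<tau> + l) powr \<gamma> - \<tau> powr \<gamma>)"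
proof -
  define C where "C = \<gamma> / Gamma (1 - \<gamma>)"
  have G: "Gamma (1 - \<gamma>) > 0" using g by (intro Gamma_real_pos) simp
  have C: "C > 0" using G g by (simp add: C_def)
  let ?h = "\<lambda>v s :: real. ennreal C * (ennreal (indicator {0<..} v * (v powr (- \<gamma>) * exp (- ((\<tau> + s) * v)))) * indicator {0..l} s)"
  have "(\<integral>\<^sup>+v. (if 0 < v then ennreal (\<gamma> / Gamma (1 - \<gamma>) * (exp (- \<tau> * v) / v powr (1 + \<gamma>))) else 0) * ennreal (1 - exp (- (v * l))) \<partial>lborel)
    = (\<integral>\<^sup>+v. (\<integral>\<^sup>+s. ?h v s \<partial>lborel) \<partial>lborel)"
  proof (rule nn_integral_cong)
    fix v :: real
    show "(if 0 < v then ennreal (\<gamma> / Gamma (1 - \<gamma>) * (exp (- \<tau> * v) / v powr (1 + \<gamma>))) else 0) * ennreal (1 - exp (- (v * l)))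
      = (\<integral>\<^sup>+s. ?h v s \<partial>lborel)"
    proof (cases "v > 0")
      case v: True
      have "(if 0 < v then ennreal (\<gamma> / Gamma (1 - \<gamma>) * (exp (- \<tau> * v) / v powr (1 + \<gamma>))) else 0) * ennreal (1 - exp (- (v * l)))
        = (\<integral>\<^sup>+s. ennreal (C * (exp (- \<tau> * v) / v powr (1 + \<gamma>))) * (ennreal (v * exp (- (v * s))) * indicator {0..l} s) \<partial>lborel)"
        using v l by (subst nn_integral_cmult) (auto simp: one_minus_exp_nn_integral C_def)
      also have "\<dots> = (\<integral>\<^sup>+s. ?h v s \<partial>lborel)"
      proof (rule nn_integral_cong)
        fix s :: real
        have "v powr (1 + \<gamma>) = v * v powr \<gamma>" using v by (simp add: powr_add)
        have "C * (exp (- \<tau> * v) / v powr (1 + \<gamma>)) * (v * exp (- (v * s))) = C * (v powr (- \<gamma>) * exp (- ((\<tau> + s) * v)))"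
        proof -
          have "exp (- ((\<tau> + s) * v)) = exp (- \<tau> * v) * exp (- (v * s))"
            by (simp add: exp_add[symmetric] algebra_simps)
          then show ?thesis using v \<open>v powr (1 + \<gamma>) = v * v powr \<gamma>\<close> by (simp add: powr_minus field_simps)
        qed
        then have "ennreal (C * (exp (- \<tau> * v) / v powr (1 + \<gamma>))) * ennreal (v * exp (- (v * s)))
           = ennreal C * ennreal (v powr (- \<gamma>) * exp (- ((\<tau> + s) * v)))"
          using v C by (simp add: ennreal_mult'[symmetric])
        then show "ennreal (C * (exp (- \<tau> * v) / v powr (1 + \<gamma>))) * (ennreal (v * exp (- (v * s))) * indicator {0..l} s) = ?h v s"
          using v by (simp add: mult.assoc[symmetric])
      qed
      finally show ?thesis .
    qed simp
  qed
  also have "\<dots> = (\<integral>\<^sup>+s. (\<integral>\<^sup>+v. ?h v s \<partial>lborel) \<partial>lborel)"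
    by (rule lborel_pair.Fubini') measurable
  also have "\<dots> = (\<integral>\<^sup>+s. ennreal (\<gamma> * (\<tau> + s) powr (\<gamma> - 1)) * indicator {0..l} s \<partial>lborel)"
  proof (rule nn_integral_cong)
    fix s :: real
    show "(\<integral>\<^sup>+v. ?h v s \<partial>lborel) = ennreal (\<gamma> * (\<tau> + s) powr (\<gamma> - 1)) * indicator {0..l} s"
    proof (cases "s \<in> {0..l}")
      case True
      then have "(\<integral>\<^sup>+v. ?h v s \<partial>lborel) = ennreal C * ennreal (Gamma (1 - \<gamma>) * (\<tau> + s) powr (\<gamma> - 1))"
        using g by (subst nn_integral_cmult) (auto simp: nn_integral_powr_exp)
      also have "\<dots> = ennreal (\<gamma> * (\<tau> + s) powr (\<gamma> - 1))"
        using C G by (simp add: ennreal_mult'[symmetric] C_def)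
      finally show ?thesis using True by simp
    qed simp
  qed
  also have "\<dots> = ennreal ((\<tau> + l) powr \<gamma> - \<tau> powr \<gamma>)" by (rule powr_diff_nn_integral) (use g l in auto)
  finally show ?thesis .
qed

lemma laplace_exponent_gg:
  assumes g: "0 < \<gamma>" "\<gamma> < 1" "0 < \<tau>" and \<alpha>: "finite_measure \<alpha>" "sets \<alpha> = sets (borel :: 'x::topological_space measure)"
    and f [measurable]: "f \<in> borel_measurable borel" and f0: "\<And>x. 0 \<le> f x"
  shows "laplace_exponent (gg_intensity \<gamma> \<tau> \<alpha>) f = (\<integral>\<^sup>+x. ennreal ((\<tau> + f x) powr \<gamma> - \<tau> powr \<gamma>) \<partial>\<alpha>)"
proof -
  interpret \<alpha>: finite_measure \<alpha> by fact
  interpret pair_sigma_finite lborel \<alpha> ..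
  note [measurable_cong] = \<alpha>(2)
  have meas: "(\<lambda>(v, x). (if 0 < v then ennreal (\<gamma> / Gamma (1 - \<gamma>) * (exp (- \<tau> * v) / v powr (1 + \<gamma>))) else 0) *
      ennreal (1 - exp (- (v * f x)))) \<in> borel_measurable (lborel \<Otimes>\<^sub>M \<alpha>)"
    by measurable
  have "laplace_exponent (gg_intensity \<gamma> \<tau> \<alpha>) f = (\<integral>\<^sup>+p. (case p of (v, x) \<Rightarrow>
      (if 0 < v then ennreal (\<gamma> / Gamma (1 - \<gamma>) * (exp (- \<tau> * v) / v powr (1 + \<gamma>))) else 0)) *
      (case p of (v, x) \<Rightarrow> ennreal (1 - exp (- (v * f x)))) \<partial>(lborel \<Otimes>\<^sub>M \<alpha>))"
    unfolding laplace_exponent_def gg_intensity_def by (rule nn_integral_density) measurable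
  also have "\<dots> = (\<integral>\<^sup>+p. (\<lambda>(v, x). (if 0 < v then ennreal (\<gamma> / Gamma (1 - \<gamma>) * (exp (- \<tau> * v) / v powr (1 + \<gamma>))) else 0) *
      ennreal (1 - exp (- (v * f x)))) p \<partial>(lborel \<Otimes>\<^sub>M \<alpha>))"
    by (rule nn_integral_cong) auto
  also have "\<dots> = (\<integral>\<^sup>+x. (\<integral>\<^sup>+v. (if 0 < v then ennreal (\<gamma> / Gamma (1 - \<gamma>) * (exp (- \<tau> * v) / v powr (1 + \<gamma>))) else 0) *
      ennreal (1 - exp (- (v * f x))) \<partial>lborel) \<partial>\<alpha>)"
    by (subst nn_integral_snd[OF meas, symmetric]) simp
  also have "\<dots> = (\<integral>\<^sup>+x. ennreal ((\<tau> + f x) powr \<gamma> - \<tau> powr \<gamma>) \<partial>\<alpha>)"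
    by (intro nn_integral_cong gg_levy_exponent g f0)
  finally show ?thesis .
qed

text \<open>A random measure may have infinite mass at some points, so it need not be a kernel into
  subprobability measures. Measurability of integrals is therefore derived from that of the masses
  of sets by the usual induction on the integrand.\<close>

lemma nn_integral_random_measure_measurable:
  assumes \<mu>: "random_measure M \<mu>" and f: "f \<in> borel_measurable borel"
  shows "(\<lambda>\<omega>. \<integral>\<^sup>+x. f x \<partial>\<mu> \<omega>) \<in> borel_measurable M"
proof -
  have sets: "\<omega> \<in> space M \<Longrightarrow> sets (\<mu> \<omega>) = sets borel" for \<omega> using \<mu> by (simp add: random_measure_def)
  have bm: "\<omega> \<in> space M \<Longrightarrow> h \<in> borel_measurable (\<mu> \<omega>) \<longleftrightarrow> h \<in> borel_measurable borel" for \<omega> and h :: "'b \<Rightarrow> ennreal"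
    by (simp add: measurable_cong_sets[OF sets refl])
  have mc: "k \<in> borel_measurable M"
    if "h \<in> borel_measurable M" "\<And>\<omega>. \<omega> \<in> space M \<Longrightarrow> k \<omega> = h \<omega>" for h k :: "'a \<Rightarrow> ennreal"
    by (subst measurable_cong[OF that(2)]) (use that(1) in auto)
  show ?thesis
    using f
  proof (induct rule: borel_measurable_induct)
    case (cong f h) then show ?case by simp
  next
    case (set A)
    show ?case
    proof (rule mc)
      show "(\<lambda>\<omega>. emeasure (\<mu> \<omega>) A) \<in> borel_measurable M" using \<mu> set by (simp add: random_measure_def)
    qed (use set in \<open>simp add: sets\<close>)
  next
    case (mult u c)
    show ?case
      by (rule mc[of "\<lambda>\<omega>. c * (\<integral>\<^sup>+x. u x \<partial>\<mu> \<omega>)"]) (use mult in \<open>auto simp: nn_integral_cmult bm\<close>)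
  next
    case (add u v)
    show ?case
      by (rule mc[of "\<lambda>\<omega>. (\<integral>\<^sup>+x. v x \<partial>\<mu> \<omega>) + (\<integral>\<^sup>+x. u x \<partial>\<mu> \<omega>)"]) (use add in \<open>auto simp: nn_integral_add bm\<close>)
  next
    case (seq U)
    show ?case
    proof (rule mc)
      show "(\<lambda>\<omega>. SUP i. \<integral>\<^sup>+x. U i x \<partial>\<mu> \<omega>) \<in> borel_measurable M"
        using seq by (intro borel_measurable_SUP) auto
      fix \<omega> assume "\<omega> \<in> space M"
      then show "(\<integral>\<^sup>+x. (SUP i. U i) x \<partial>\<mu> \<omega>) = (SUP i. \<integral>\<^sup>+x. U i x \<partial>\<mu> \<omega>)"
        unfolding SUP_apply using seq bm by (intro nn_integral_monotone_convergence_SUP) auto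
    qed
  qed
qed

lemma exp_neg_measurable [measurable]: "exp_neg \<in> borel_measurable borel"
  unfolding exp_neg_def[abs_def] by measurable

lemma exp_neg_bounds: "0 \<le> exp_neg y" "exp_neg y \<le> 1"
  by (auto simp: exp_neg_def)

lemma exp_neg_ennreal: "0 \<le> r \<Longrightarrow> exp_neg (ennreal r) = exp (- r)"
  by (simp add: exp_neg_def)

lemma ennreal_inverse_mult_self:
  fixes x :: ennreal
  assumes "x \<noteq> 0" "x < \<infinity>"
  shows "inverse x * x = 1"
proof -
  obtain t where "x = ennreal t" "t > 0" using assms by (auto simp: less_top_ennreal ennreal_eq_0_iff)
  then show ?thesis by (simp add: inverse_ennreal ennreal_mult'[symmetric])
qed

section \<open>From the completely random measure to the rescaled Laplace identities\<close>

locale gg_crm = M: prob_space M + \<alpha>: finite_measure \<alpha>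
  for M :: "'w measure" and \<alpha> :: "'x::polish_space measure" +
  fixes \<gamma> \<tau> :: real and \<mu> :: "'w \<Rightarrow> 'x measure"
  assumes gam: "0 < \<gamma>" "\<gamma> < 1" and tau: "0 < \<tau>"
    and sets_\<alpha> [measurable_cong, simp]: "sets \<alpha> = sets borel"
    and mass: "0 < measure \<alpha> (space \<alpha>)"
    and nonatomic: "\<And>x. emeasure \<alpha> {x} = 0"
    and crm: "completely_random_measure M \<mu> (gg_intensity \<gamma> \<tau> \<alpha>)"
begin

abbreviation "P0 \<equiv> normalize_measure \<alpha>"
abbreviation "\<beta> \<equiv> measure \<alpha> (space \<alpha>) * \<tau> powr \<gamma>"
abbreviation "P \<equiv> nrmi \<mu>"

definition T :: "'w \<Rightarrow> ennreal" where "T \<omega> = emeasure (\<mu> \<omega>) UNIV"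

text \<open>The factor \<open>\<tau>\<close> turns the exponent
  \<open>(\<tau> + \<tau> * f) powr \<gamma> - \<tau> powr \<gamma>\<close> into
  \<open>\<tau> powr \<gamma> * ((1 + f) powr \<gamma> - 1)\<close>. On the null event of infinite
  mass the value is \<open>0\<close>.\<close>

definition S :: "'w \<Rightarrow> real" where "S \<omega> = \<tau> * enn2real (T \<omega>)"

lemma random: "random_measure M \<mu>"
  using crm by (simp add: completely_random_measure_def)

lemma sets_\<mu>: "\<omega> \<in> space M \<Longrightarrow> sets (\<mu> \<omega>) = sets borel"
  using random by (simp add: random_measure_def)

lemma space_\<mu>: "\<omega> \<in> space M \<Longrightarrow> space (\<mu> \<omega>) = UNIV"
  using sets_eq_imp_space_eq[OF sets_\<mu>, of \<omega>] by simp

lemma T_meas [measurable]: "T \<in> borel_measurable M"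
  using random unfolding random_measure_def T_def by auto

lemma S_meas: "S \<in> borel_measurable M"
  unfolding S_def by measurable

lemma emeasure_P: "\<omega> \<in> space M \<Longrightarrow> emeasure (P \<omega>) A = inverse (T \<omega>) * emeasure (\<mu> \<omega>) A"
  by (simp add: nrmi_def normalize_measure_def T_def space_\<mu>)

lemma sets_P: "\<omega> \<in> space M \<Longrightarrow> sets (P \<omega>) = sets borel"
  by (simp add: nrmi_def normalize_measure_def sets_\<mu>)

lemma P_meas: "P \<in> M \<rightarrow>\<^sub>M subprob_algebra borel"
proof (rule measurable_subprob_algebra)
  fix \<omega> assume \<omega>: "\<omega> \<in> space M"
  \<comment> \<open>The product is \<open>1\<close> for positive finite mass and \<open>0\<close> in
    the two degenerate cases, so \<open>P \<omega>\<close> is a subprobability measure at every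
    point.\<close>
  have "inverse (T \<omega>) * T \<omega> \<le> 1"
    by (cases "T \<omega> = 0"; cases "T \<omega> = \<infinity>") (auto simp: ennreal_inverse_mult_self less_top)
  then show "subprob_space (P \<omega>)"
    using sets_eq_imp_space_eq[OF sets_P[OF \<omega>]] emeasure_P[OF \<omega>, of UNIV] by (intro subprob_spaceI) (auto simp: T_def)
next
  fix A :: "'x set" assume "A \<in> sets borel"
  then have [measurable]: "(\<lambda>\<omega>. emeasure (\<mu> \<omega>) A) \<in> borel_measurable M"
    using random by (simp add: random_measure_def)
  show "(\<lambda>\<omega>. emeasure (P \<omega>) A) \<in> borel_measurable M"
    by (subst measurable_cong[OF emeasure_P]) measurable
qed (rule sets_P)

lemma P0_density: "P0 = density \<alpha> (\<lambda>_. ennreal (inverse (measure \<alpha> (space \<alpha>))))"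
  using mass by (intro measure_eqI)
    (auto simp: normalize_measure_def emeasure_density_const \<alpha>.emeasure_eq_measure inverse_ennreal)

lemma integrable_P0:
  fixes f :: "'x \<Rightarrow> real"
  assumes [measurable]: "f \<in> borel_measurable borel"
  shows "integrable P0 f \<longleftrightarrow> integrable \<alpha> f"
  unfolding P0_density using mass by (subst integrable_density) auto

lemma integral_P0:
  fixes f :: "'x \<Rightarrow> real"
  assumes [measurable]: "f \<in> borel_measurable borel"
  shows "(\<integral>x. f x \<partial>\<alpha>) = measure \<alpha> (space \<alpha>) * (\<integral>x. f x \<partial>P0)"
  unfolding P0_density using mass by (subst integral_density) auto

lemma AE_P0: "(AE x in P0. Q x) \<longleftrightarrow> (AE x in \<alpha>. Q x)"
  unfolding P0_density using mass by (subst AE_density) auto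

lemma prob_P0: "prob_space P0"
proof (rule prob_spaceI)
  have "emeasure P0 (space P0) = ennreal (inverse (measure \<alpha> (space \<alpha>))) * emeasure \<alpha> (space \<alpha>)"
    unfolding P0_density space_density by (rule emeasure_density_const) (rule sets.top)
  then show "emeasure P0 (space P0) = 1"
    using mass by (simp add: \<alpha>.emeasure_eq_measure ennreal_mult'[symmetric])
qed

definition \<psi> :: "('x \<Rightarrow> real) \<Rightarrow> real" where "\<psi> f = (\<integral>x. (1 + f x) powr \<gamma> - 1 \<partial>P0)"

context
  fixes f :: "'x \<Rightarrow> real"
  assumes f [measurable]: "f \<in> borel_measurable borel" and f0: "\<And>x. 0 \<le> f x"
    and int: "integrable P0 (\<lambda>x. f x powr \<gamma>)"
begin

lemma psi_integrand_bounds: "0 \<le> (1 + f x) powr \<gamma> - 1" "(1 + f x) powr \<gamma> - 1 \<le> 2 + 2 * f x powr \<gamma>"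
proof -
  show "0 \<le> (1 + f x) powr \<gamma> - 1" using f0[of x] gam by (simp add: ge_one_powr_ge_zero)
  have "(1 + f x) powr \<gamma> \<le> 2 * (1 powr \<gamma> + f x powr \<gamma>)" using f0 gam by (intro powr_add_le) auto
  then show "(1 + f x) powr \<gamma> - 1 \<le> 2 + 2 * f x powr \<gamma>" by simp
qed

lemma psi_integrable: "integrable \<alpha> (\<lambda>x. (1 + f x) powr \<gamma> - 1)"
proof (rule Bochner_Integration.integrable_bound)
  have "integrable \<alpha> (\<lambda>x. f x powr \<gamma>)" using int by (simp add: integrable_P0)
  then show "integrable \<alpha> (\<lambda>x. 2 + 2 * f x powr \<gamma>)" by simp
  show "AE x in \<alpha>. norm ((1 + f x) powr \<gamma> - 1) \<le> norm (2 + 2 * f x powr \<gamma>)"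
    using psi_integrand_bounds by (intro AE_I2) (simp add: abs_of_nonneg add_nonneg_nonneg)
qed measurable

lemma laplace_scaled: "(\<integral>\<omega>. exp_neg (\<integral>\<^sup>+x. ennreal (\<tau> * f x) \<partial>\<mu> \<omega>) \<partial>M) = exp (- \<beta> * \<psi> f)"
proof -
  have "laplace_exponent (gg_intensity \<gamma> \<tau> \<alpha>) (\<lambda>x. \<tau> * f x) = (\<integral>\<^sup>+x. ennreal ((\<tau> + \<tau> * f x) powr \<gamma> - \<tau> powr \<gamma>) \<partial>\<alpha>)"
    by (rule laplace_exponent_gg) (use gam tau f0 \<alpha>.finite_measure_axioms in auto)
  also have "\<dots> = (\<integral>\<^sup>+x. ennreal (\<tau> powr \<gamma> * ((1 + f x) powr \<gamma> - 1)) \<partial>\<alpha>)"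
  proof (rule nn_integral_cong)
    fix x
    have "(\<tau> + \<tau> * f x) powr \<gamma> = (\<tau> * (1 + f x)) powr \<gamma>" by (simp add: algebra_simps)
    also have "\<dots> = \<tau> powr \<gamma> * (1 + f x) powr \<gamma>" using tau f0[of x] by (intro powr_mult)
    finally show "ennreal ((\<tau> + \<tau> * f x) powr \<gamma> - \<tau> powr \<gamma>) = ennreal (\<tau> powr \<gamma> * ((1 + f x) powr \<gamma> - 1))"
      by (simp add: algebra_simps)
  qed
  also have "\<dots> = ennreal (\<integral>x. \<tau> powr \<gamma> * ((1 + f x) powr \<gamma> - 1) \<partial>\<alpha>)"
    using psi_integrable psi_integrand_bounds(1) by (intro nn_integral_eq_integral) auto
  also have "(\<integral>x. \<tau> powr \<gamma> * ((1 + f x) powr \<gamma> - 1) \<partial>\<alpha>) = \<tau> powr \<gamma> * (\<integral>x. (1 + f x) powr \<gamma> - 1 \<partial>\<alpha>)"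
    by (rule integral_mult_right_zero)
  also have "\<dots> = \<beta> * \<psi> f"
    unfolding \<psi>_def by (subst integral_P0) (auto simp: mult_ac)
  finally have e: "laplace_exponent (gg_intensity \<gamma> \<tau> \<alpha>) (\<lambda>x. \<tau> * f x) = ennreal (\<beta> * \<psi> f)" .
  have "0 \<le> \<psi> f" unfolding \<psi>_def using psi_integrand_bounds(1) by (intro Bochner_Integration.integral_nonneg)
  then have nn: "0 \<le> \<beta> * \<psi> f" using mass by simp
  have "(\<lambda>x. \<tau> * f x) \<in> borel_measurable borel" "\<forall>x. 0 \<le> \<tau> * f x" using f0 tau by auto
  then have "(\<integral>\<omega>. exp_neg (\<integral>\<^sup>+x. ennreal (\<tau> * f x) \<partial>\<mu> \<omega>) \<partial>M) = exp_neg (laplace_exponent (gg_intensity \<gamma> \<tau> \<alpha>) (\<lambda>x. \<tau> * f x))"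
    using crm e unfolding completely_random_measure_def by auto
  then show ?thesis unfolding e exp_neg_ennreal[OF nn] by simp
qed

end

lemma mass_laplace:
  assumes "k \<ge> 0"
  shows "(\<integral>\<omega>. exp_neg (ennreal (\<tau> * k) * T \<omega>) \<partial>M) = exp (- \<beta> * ((1 + k) powr \<gamma> - 1))"
proof -
  interpret P0: prob_space P0 by (rule prob_P0)
  have "(\<integral>\<omega>. exp_neg (ennreal (\<tau> * k) * T \<omega>) \<partial>M) = (\<integral>\<omega>. exp_neg (\<integral>\<^sup>+x. ennreal (\<tau> * k) \<partial>\<mu> \<omega>) \<partial>M)"
    by (intro Bochner_Integration.integral_cong refl) (simp add: space_\<mu> T_def)
  also have "\<dots> = exp (- \<beta> * \<psi> (\<lambda>_. k))" by (rule laplace_scaled) (use assms in auto)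
  also have "\<psi> (\<lambda>_. k) = (1 + k) powr \<gamma> - 1" by (simp add: \<psi>_def P0.prob_space)
  finally show ?thesis .
qed

text \<open>For every \<open>k\<close> the Laplace functional at \<open>f / Suc k\<close> is a lower
  bound of the probability that the integral of \<open>f\<close> is finite, because
  \<open>exp_neg\<close> vanishes at infinity. As \<open>k\<close> grows the Laplace exponent tends
  to zero, so this probability is one.\<close>

lemma nn_integral_finite:
  fixes f :: "'x \<Rightarrow> real"
  assumes f [measurable]: "f \<in> borel_measurable borel" and f0: "\<And>x. 0 \<le> f x"
    and int: "integrable P0 (\<lambda>x. f x powr \<gamma>)"
  shows "AE \<omega> in M. (\<integral>\<^sup>+x. ennreal (f x) \<partial>\<mu> \<omega>) < \<infinity>"
proof -
  interpret P0: prob_space P0 by (rule prob_P0)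
  define N where "N \<omega> = (\<integral>\<^sup>+x. ennreal (f x) \<partial>\<mu> \<omega>)" for \<omega>
  have [measurable]: "N \<in> borel_measurable M"
    unfolding N_def by (rule nn_integral_random_measure_measurable[OF random]) simp
  let ?A = "{\<omega> \<in> space M. N \<omega> < \<infinity>}"
  have A: "?A \<in> sets M" by measurable
  define fk where "fk k x = f x / real (Suc k)" for k x
  have fk: "fk k \<in> borel_measurable borel" "0 \<le> fk k x" "fk k x \<le> f x" for k x
    unfolding fk_def using f0[of x] by (auto simp: divide_le_eq algebra_simps)
  have fki: "integrable P0 (\<lambda>x. fk k x powr \<gamma>)" for k
    by (rule Bochner_Integration.integrable_bound[OF int])
       (use fk gam in \<open>auto simp: P0_density intro!: AE_I2 powr_mono2\<close>)
  have le: "exp (- \<beta> * \<psi> (fk k)) \<le> measure M ?A" for k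
  proof -
    have "exp (- \<beta> * \<psi> (fk k)) = (\<integral>\<omega>. exp_neg (\<integral>\<^sup>+x. ennreal (\<tau> * fk k x) \<partial>\<mu> \<omega>) \<partial>M)"
      by (rule laplace_scaled[symmetric]) (use fk fki in auto)
    also have "\<dots> = (\<integral>\<omega>. exp_neg (ennreal (\<tau> / real (Suc k)) * N \<omega>) \<partial>M)"
    proof (intro Bochner_Integration.integral_cong refl)
      fix \<omega> assume \<omega>: "\<omega> \<in> space M"
      have "ennreal (\<tau> * fk k x) = ennreal (\<tau> / real (Suc k)) * ennreal (f x)" for x
        using tau f0[of x] by (simp add: fk_def ennreal_mult'[symmetric])
      then show "exp_neg (\<integral>\<^sup>+x. ennreal (\<tau> * fk k x) \<partial>\<mu> \<omega>) = exp_neg (ennreal (\<tau> / real (Suc k)) * N \<omega>)"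
        unfolding N_def using f by (subst nn_integral_cmult[symmetric]) (simp_all add: measurable_cong_sets[OF sets_\<mu>[OF \<omega>] refl])
    qed
    also have "\<dots> \<le> (\<integral>\<omega>. indicator ?A \<omega> \<partial>M)"
    proof (rule integral_mono)
      show "integrable M (\<lambda>\<omega>. exp_neg (ennreal (\<tau> / real (Suc k)) * N \<omega>))"
        by (rule M.integrable_const_bound[where B = 1]) (auto simp: exp_neg_bounds)
      show "integrable M (indicator ?A :: 'w \<Rightarrow> real)"
        using A by (intro integrable_real_indicator) (auto simp: M.emeasure_finite less_top[symmetric])
      fix \<omega> assume \<omega>: "\<omega> \<in> space M"
      show "exp_neg (ennreal (\<tau> / real (Suc k)) * N \<omega>) \<le> indicator ?A \<omega>"
      proof (cases "N \<omega> = \<infinity>")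
        case True
        have "ennreal (\<tau> / real (Suc k)) \<noteq> 0" using tau by (simp add: ennreal_eq_0_iff divide_le_0_iff)
        then have "ennreal (\<tau> / real (Suc k)) * N \<omega> = \<infinity>" using True by (simp add: ennreal_mult_top)
        then show ?thesis by (simp add: exp_neg_def)
      qed (use \<omega> exp_neg_bounds in \<open>simp add: less_top\<close>)
    qed
    also have "\<dots> = measure M ?A" using A by simp
    finally show ?thesis .
  qed
  have "(\<lambda>k. \<psi> (fk k)) \<longlonglongrightarrow> (\<integral>x. 0 \<partial>P0)"
    unfolding \<psi>_def
  proof (rule integral_dominated_convergence[where w = "\<lambda>x. 2 + 2 * f x powr \<gamma>"])
    show "integrable P0 (\<lambda>x. 2 + 2 * f x powr \<gamma>)" using int by simp
    show "AE x in P0. norm ((1 + fk k x) powr \<gamma> - 1) \<le> 2 + 2 * f x powr \<gamma>" for k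
    proof (rule AE_I2)
      fix x
      have "(1 + fk k x) powr \<gamma> - 1 \<le> (1 + f x) powr \<gamma> - 1" using fk(2,3)[of k x] gam by (simp add: powr_mono2)
      then show "norm ((1 + fk k x) powr \<gamma> - 1) \<le> 2 + 2 * f x powr \<gamma>"
        using psi_integrand_bounds(1)[OF fk(1,2) fki, of k x] psi_integrand_bounds(2)[OF f f0 int, of x] by simp
    qed
    show "AE x in P0. (\<lambda>k. (1 + fk k x) powr \<gamma> - 1) \<longlonglongrightarrow> 0"
    proof (rule AE_I2)
      fix x
      have "(\<lambda>k. f x * inverse (real (Suc k))) \<longlonglongrightarrow> f x * 0"
        by (intro tendsto_mult tendsto_const LIMSEQ_inverse_real_of_nat)
      then have "(\<lambda>k. fk k x) \<longlonglongrightarrow> 0" by (simp add: fk_def divide_inverse)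
      then have "(\<lambda>k. (1 + fk k x) powr \<gamma> - 1) \<longlonglongrightarrow> (1 + 0) powr \<gamma> - 1"
        by (intro tendsto_diff tendsto_powr tendsto_add tendsto_const) auto
      then show "(\<lambda>k. (1 + fk k x) powr \<gamma> - 1) \<longlonglongrightarrow> 0" by simp
    qed
    show "(\<lambda>x. (1 + fk k x) powr \<gamma> - 1) \<in> borel_measurable P0" for k
      using fk(1)[of k] by (simp add: P0_density)
  qed simp
  then have "(\<lambda>k. exp (- \<beta> * \<psi> (fk k))) \<longlonglongrightarrow> exp (- \<beta> * 0)" by (intro tendsto_intros) simp
  then have "1 \<le> measure M ?A" using LIMSEQ_le_const2[of "\<lambda>k. exp (- \<beta> * \<psi> (fk k))" 1 "measure M ?A"] le by auto
  then have "measure M ?A = 1" by (simp add: order_antisym)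
  then have "AE \<omega> in M. \<omega> \<in> ?A" by (subst M.prob_eq_1[symmetric]) (use A in auto)
  then show ?thesis by eventually_elim (simp add: N_def)
qed

lemma T_finite: "AE \<omega> in M. T \<omega> < \<infinity>"
proof -
  interpret P0: prob_space P0 by (rule prob_P0)
  have "AE \<omega> in M. (\<integral>\<^sup>+x. ennreal 1 \<partial>\<mu> \<omega>) < \<infinity>" by (rule nn_integral_finite) auto
  then show ?thesis using AE_space by eventually_elim (simp add: T_def space_\<mu>)
qed

text \<open>The Laplace transform of the total mass is an upper bound of the probability that the
  mass is zero, and it tends to zero because the exponent is unbounded: the intensity has infinitely
  many small jumps.\<close>

lemma T_pos: "AE \<omega> in M. T \<omega> > 0"
proof -
  let ?A = "{\<omega> \<in> space M. T \<omega> = 0}"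
  have A: "?A \<in> sets M" by measurable
  have le: "measure M ?A \<le> exp (- \<beta> * ((1 + real k) powr \<gamma> - 1))" for k
  proof -
    have "measure M ?A = (\<integral>\<omega>. indicator ?A \<omega> \<partial>M)" using A by simp
    also have "\<dots> \<le> (\<integral>\<omega>. exp_neg (ennreal (\<tau> * real k) * T \<omega>) \<partial>M)"
    proof (rule integral_mono)
      show "integrable M (\<lambda>\<omega>. exp_neg (ennreal (\<tau> * real k) * T \<omega>))"
        by (rule M.integrable_const_bound[where B = 1]) (auto simp: exp_neg_bounds)
      show "integrable M (indicator ?A :: 'w \<Rightarrow> real)"
        using A by (intro integrable_real_indicator) (auto simp: M.emeasure_finite less_top[symmetric])
      fix \<omega> assume "\<omega> \<in> space M"
      then show "indicator ?A \<omega> \<le> exp_neg (ennreal (\<tau> * real k) * T \<omega>)"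
        using exp_neg_bounds by (cases "T \<omega> = 0") (auto simp: exp_neg_def)
    qed
    also have "\<dots> = exp (- \<beta> * ((1 + real k) powr \<gamma> - 1))" by (rule mass_laplace) simp
    finally show ?thesis .
  qed
  have b: "\<beta> > 0" using mass tau by simp
  have "(\<lambda>k. exp (- \<beta> * ((1 + real k) powr \<gamma> - 1))) \<longlonglongrightarrow> 0"
  proof -
    have "(\<lambda>k::nat. exp (- b * ((1 + real k) powr \<gamma> - 1))) \<longlonglongrightarrow> 0" if "b > 0" for b :: real
      using that gam by real_asymp
    then show ?thesis using b by blast
  qed
  then have "measure M ?A \<le> 0" by (rule LIMSEQ_le_const) (use le in auto)
  then have "measure M ?A = 0" by (simp add: measure_le_0_iff)
  then have "AE \<omega> in M. \<omega> \<notin> ?A" using A by (subst (asm) M.prob_eq_0) auto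
  then show ?thesis using AE_space by eventually_elim (auto simp: zero_less_iff_neq_zero)
qed

lemma nn_integral_P: "\<omega> \<in> space M \<Longrightarrow> f \<in> borel_measurable borel \<Longrightarrow> (\<integral>\<^sup>+x. f x \<partial>P \<omega>) = inverse (T \<omega>) * (\<integral>\<^sup>+x. f x \<partial>\<mu> \<omega>)"
  unfolding nrmi_def normalize_measure_def
  by (subst nn_integral_scale_measure) (simp_all add: measurable_cong_sets[OF sets_\<mu> refl] T_def space_\<mu>)

lemma integral_P:
  fixes f :: "'x \<Rightarrow> real"
  assumes f [measurable]: "f \<in> borel_measurable borel" and f0: "\<And>x. 0 \<le> f x"
    and int: "integrable P0 (\<lambda>x. f x powr \<gamma>)"
  shows "AE \<omega> in M. integrable (P \<omega>) f \<and> (\<integral>\<^sup>+x. ennreal (\<tau> * f x) \<partial>\<mu> \<omega>) = ennreal (S \<omega> * (\<integral>x. f x \<partial>P \<omega>))"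
  using nn_integral_finite[OF assms] T_finite T_pos AE_space
proof eventually_elim
  case (elim \<omega>)
  define N where "N = (\<integral>\<^sup>+x. ennreal (f x) \<partial>\<mu> \<omega>)"
  obtain m where m: "N = ennreal m" "m \<ge> 0" using elim(1) unfolding N_def by (auto simp: less_top_ennreal)
  obtain t where t: "T \<omega> = ennreal t" "t > 0" using elim(2,3) by (auto simp: less_top_ennreal)
  have nn: "(\<integral>\<^sup>+x. ennreal (f x) \<partial>P \<omega>) = ennreal (m / t)"
    using t m by (subst nn_integral_P[OF elim(4)]) (auto simp: N_def[symmetric] inverse_ennreal ennreal_mult'[symmetric] divide_inverse mult.commute)
  have [measurable]: "f \<in> borel_measurable (P \<omega>)" using f by (simp add: measurable_cong_sets[OF sets_P[OF elim(4)] refl])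
  have i: "integrable (P \<omega>) f" by (rule integrableI_nonneg) (use nn f0 in auto)
  have "(\<integral>x. f x \<partial>P \<omega>) = m / t"
    using nn m t by (subst integral_eq_nn_integral) (use f0 in auto)
  moreover have "(\<integral>\<^sup>+x. ennreal (\<tau> * f x) \<partial>\<mu> \<omega>) = ennreal (\<tau> * m)"
  proof -
    have "(\<integral>\<^sup>+x. ennreal (\<tau> * f x) \<partial>\<mu> \<omega>) = (\<integral>\<^sup>+x. ennreal \<tau> * ennreal (f x) \<partial>\<mu> \<omega>)"
      using tau by (simp add: ennreal_mult')
    also have "\<dots> = ennreal \<tau> * N"
      unfolding N_def using f by (intro nn_integral_cmult) (simp add: measurable_cong_sets[OF sets_\<mu>[OF elim(4)] refl])
    finally show ?thesis using m tau by (simp add: ennreal_mult')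
  qed
  ultimately show ?case using i t by (simp add: S_def)
qed

theorem gg_rand_P: "gg_rand P0 \<gamma> \<beta> M S P"
proof (intro gg_rand.intro gg_base.intro gg_base_axioms.intro gg_rand_axioms.intro)
  show "prob_space P0" by (rule prob_P0)
  show "prob_space M" by (rule M.prob_space_axioms)
  show "sets P0 = sets borel" by (simp add: P0_density)
  show "0 < \<gamma>" "\<gamma> < 1" by (rule gam)+
  show "0 < \<beta>" using mass tau by simp
  show "emeasure P0 {x} = 0" for x using nonatomic[of x] by (simp add: P0_density emeasure_density_const)
  show "S \<in> borel_measurable M" by (rule S_meas)
  show "0 \<le> S \<omega>" for \<omega> using tau by (simp add: S_def)
  show "AE \<omega> in M. 0 < S \<omega>"
    using T_finite T_pos by eventually_elim (use tau in \<open>auto simp: S_def enn2real_positive_iff\<close>)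
  show "P \<in> M \<rightarrow>\<^sub>M subprob_algebra borel" by (rule P_meas)
  show "AE \<omega> in M. prob_space (P \<omega>)"
    using T_finite T_pos AE_space
  proof eventually_elim
    case (elim \<omega>)
    have "emeasure (P \<omega>) (space (P \<omega>)) = inverse (T \<omega>) * T \<omega>"
      using emeasure_P[OF elim(3)] sets_eq_imp_space_eq[OF sets_P[OF elim(3)]] by (simp add: T_def)
    also have "\<dots> = 1" using elim(1,2) by (intro ennreal_inverse_mult_self) auto
    finally show ?case by (rule prob_spaceI)
  qed
  fix f :: "'x \<Rightarrow> real"
  assume f: "f \<in> borel_measurable borel" "\<And>x. 0 \<le> f x" "integrable P0 (\<lambda>x. f x powr \<gamma>)"
  show "AE \<omega> in M. integrable (P \<omega>) f" using integral_P[OF f] by eventually_elim simp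
  have "(\<integral>\<omega>. exp (- (S \<omega> * (\<integral>x. f x \<partial>P \<omega>))) \<partial>M) = (\<integral>\<omega>. exp_neg (\<integral>\<^sup>+x. ennreal (\<tau> * f x) \<partial>\<mu> \<omega>) \<partial>M)"
  proof (rule integral_cong_AE)
    note [measurable] = S_meas f(1) measurable_compose[OF P_meas integral_measurable_subprob_algebra[OF f(1)]]
    show "(\<lambda>\<omega>. exp (- (S \<omega> * (\<integral>x. f x \<partial>P \<omega>)))) \<in> borel_measurable M" by measurable
    have "(\<lambda>\<omega>. \<integral>\<^sup>+x. ennreal (\<tau> * f x) \<partial>\<mu> \<omega>) \<in> borel_measurable M"
      by (rule nn_integral_random_measure_measurable[OF random]) measurable
    then show "(\<lambda>\<omega>. exp_neg (\<integral>\<^sup>+x. ennreal (\<tau> * f x) \<partial>\<mu> \<omega>)) \<in> borel_measurable M" by measurable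
    show "AE \<omega> in M. exp (- (S \<omega> * (\<integral>x. f x \<partial>P \<omega>))) = exp_neg (\<integral>\<^sup>+x. ennreal (\<tau> * f x) \<partial>\<mu> \<omega>)"
      using integral_P[OF f]
    proof eventually_elim
      case (elim \<omega>)
      have "0 \<le> S \<omega> * (\<integral>x. f x \<partial>P \<omega>)"
        using tau f(2) by (auto simp: S_def intro!: mult_nonneg_nonneg Bochner_Integration.integral_nonneg)
      with elim show ?case by (simp add: exp_neg_ennreal)
    qed
  qed
  also have "\<dots> = exp (- \<beta> * (\<integral>x. (1 + f x) powr \<gamma> - 1 \<partial>P0))"
    using laplace_scaled[OF f] by (simp add: \<psi>_def)
  finally show "(\<integral>\<omega>. exp (- (S \<omega> * (\<integral>x. f x \<partial>P \<omega>))) \<partial>M) = exp (- \<beta> * (\<integral>x. (1 + f x) powr \<gamma> - 1 \<partial>P0))" .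
qed

end

theorem proposition4p4:
  fixes M :: "'w measure"
    and \<alpha> :: "'x::polish_space measure"
    and \<gamma> \<tau> :: real
    and \<mu> :: "'w \<Rightarrow> 'x measure"
    and g :: "'x \<Rightarrow> real"
    and n :: nat
    and X :: "nat \<Rightarrow> 'w \<Rightarrow> 'x"
  defines "P0 \<equiv> normalize_measure \<alpha>"
    and "\<beta> \<equiv> measure \<alpha> (space \<alpha>) * \<tau> powr \<gamma>"
    and "P \<equiv> nrmi \<mu>"
    and "\<X> \<equiv> (\<lambda>\<omega>. \<lambda>i\<in>{..<n}. X i \<omega>)"
  assumes "prob_space M"
    and "0 < \<gamma>" "\<gamma> < 1" "0 < \<tau>"
    and "sets \<alpha> = sets borel" "finite_measure \<alpha>" "0 < measure \<alpha> (space \<alpha>)"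
    and nonatomic: "\<And>x. emeasure \<alpha> {x} = 0"
    and "completely_random_measure M \<mu> (gg_intensity \<gamma> \<tau> \<alpha>)"
    and "g \<in> borel_measurable borel"
    and "\<And>t. 0 < t \<Longrightarrow> (\<integral>\<^sup>+x. ennreal ((\<tau> + t * \<bar>g x\<bar>) powr \<gamma>) \<partial>\<alpha>) < \<infinity>"
    and "1 \<le> n"
    and "cond_iid M n X P"
  shows "(\<exists>\<kappa>. regular_cond_distr M \<X> (\<Pi>\<^sub>M i\<in>{..<n}. borel) (\<lambda>\<omega>. \<integral>x. g x \<partial>P \<omega>) borel \<kappa>) \<and>
    (\<forall>\<kappa>. regular_cond_distr M \<X> (\<Pi>\<^sub>M i\<in>{..<n}. borel) (\<lambda>\<omega>. \<integral>x. g x \<partial>P \<omega>) borel \<kappa> \<longrightarrow>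
      (AE \<omega> in M.
        ((\<forall>c. \<not> (AE x in \<alpha>. g x = c)) \<longrightarrow>
           gg_post_density \<gamma> \<beta> P0 g n (\<X> \<omega>) \<in> borel_measurable borel \<and>
           (\<forall>\<sigma>. 0 \<le> gg_post_density \<gamma> \<beta> P0 g n (\<X> \<omega>) \<sigma>) \<and>
           \<kappa> (\<X> \<omega>) = density lborel (\<lambda>\<sigma>. ennreal (gg_post_density \<gamma> \<beta> P0 g n (\<X> \<omega>) \<sigma>)) \<and>
           (2 \<le> n \<longrightarrow> (\<forall>\<sigma>. gg_double_integral \<gamma> \<beta> P0 g n (\<X> \<omega>) \<sigma> = cdf (\<kappa> (\<X> \<omega>)) \<sigma>))) \<and>
        (\<forall>\<sigma>. \<not> (AE x in \<alpha>. g x = \<sigma>) \<longrightarrow>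
           cdf (\<kappa> (\<X> \<omega>)) \<sigma> = gg_post_cdf \<gamma> \<beta> P0 g n (\<X> \<omega>) \<sigma>)))"
proof -
  interpret crm: gg_crm M \<alpha> \<gamma> \<tau> \<mu>
    using assms(5-13) by (intro gg_crm.intro gg_crm_axioms.intro) auto
  have g: "g \<in> borel_measurable borel" by fact
  \<comment> \<open>The instance \<open>t = 1\<close> of the condition dominates
    \<open>\<bar>g\<bar> powr \<gamma>\<close>, which is the form in which integrability of
    \<open>g\<close> enters \<open>gg_fun\<close>.\<close>
  have "integrable \<alpha> (\<lambda>x. (\<tau> + 1 * \<bar>g x\<bar>) powr \<gamma>)"
    using assms(15)[of 1] g by (intro integrableI_nonneg) auto
  then have "integrable \<alpha> (\<lambda>x. \<bar>g x\<bar> powr \<gamma>)"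
    by (rule Bochner_Integration.integrable_bound) (use g crm.gam crm.tau in \<open>auto intro!: AE_I2 powr_mono2\<close>)
  then have "integrable P0 (\<lambda>x. \<bar>g x\<bar> powr \<gamma>)" using g by (simp add: P0_def crm.integrable_P0)
  then have gf: "gg_fun_axioms P0 \<gamma> g" using g by (simp add: gg_fun_axioms_def)
  have gr: "gg_rand P0 \<gamma> \<beta> M crm.S P"
    using crm.gg_rand_P by (simp add: P0_def \<beta>_def P_def)
  interpret gg_sample P0 \<gamma> \<beta> M crm.S P g n X
    using gr gf assms(16,17) by (auto intro!: gg_sample.intro gg_all.intro gg_fun.intro gg_sample_axioms.intro simp: gg_rand_def)
  have XX: "XX = \<X>" by (simp add: XX_def fun_eq_iff \<X>_def)
  have PG: "PG = (\<lambda>\<omega>. \<integral>x. g x \<partial>P \<omega>)" by (simp add: PG_def fun_eq_iff)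
  have ae: "(AE x in P0. Q x) \<longleftrightarrow> (AE x in \<alpha>. Q x)" for Q
    unfolding P0_def by (rule crm.AE_P0)
  show ?thesis
    using kernel_exists posterior unfolding XX PG ae by blast
qed

end
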